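(* We have $$\lim_{V \to 0}\tau(\Sigma_V) = \infty .$$ More precisely, there are constants $C_3, C_4 > 0$ such that $$C_3 V^{-1} \le \tau(\Sigma_V)\le \theta(\Sigma_V) \le C_4 V^{-1}$$ for all sufficiently small $V > 0$.
   Context: Let $\alpha = \frac{\sqrt{5}-1}{2}$. For $V>0$ and $\omega \in \mathbb{T} = \mathbb{R}/\mathbb{Z}$, the Fibonacci Hamiltonian is the bounded self-adjoint operator on $\ell^2(\mathbb{Z})$ given by $$[H_{V,\omega} \psi](n) = \psi(n+1) + \psi(n-1) + V \chi_{[1-\alpha,1)}(n\alpha + \omega \bmod 1)\, \psi(n).$$ Its spectrum does not depend on $\omega$; $\Sigma_V$ denotes the common spectrum, $\Sigma_V = \sigma(H_{V,\omega})$ for every $\omega \in \mathbb{T}$. It is known that $\Sigma_V$ is a Cantor set of zero Lebesgue measure. The limit $V\to 0$ is taken over $V>0$. Thickness and denseness. Let $C \subset \mathbb{R}$ be a Cantor set with convex hull $I$. A gap of $C$ is a connected component of $I\setminus C$. A presentation of $C$ is an ordering $\mathcal{U} = \{U_n\}_{n\ge 1}$ of the gaps of $C$. If $u\in C$ is a boundary point of a gap $U$ of $C$, let $K$ be the connected component of $I \setminus (U_1\cup U_2 \cup \cdots \cup U_n)$ (with $n$ chosen so that $U_n = U$) that contains $u$, and put $\tau(C,\mathcal{U},u) = |K|/|U|$, where $|\cdot|$ denotes length. The thickness $\tau(C)$ and the denseness $\theta(C)$ are $$\tau(C) = \sup_{\mathcal{U}} \inf_{u} \tau(C,\mathcal{U},u),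 \qquad \theta(C) = \inf_{\mathcal{U}} \sup_u \tau(C,\mathcal{U},u),$$ where $\mathcal{U}$ ranges over all presentations of $C$ and $u$ over all boundary points of gaps of $C$. *)

theory Defs
  imports "HOL-Analysis.Analysis"
begin

subsection \<open>Bounded operators on the Hilbert space of square-summable two-sided sequences\<close>

definition l2 :: "(int \<Rightarrow> complex) set" where
  "l2 = {\<psi>. (\<lambda>n. (cmod (\<psi> n))\<^sup>2) summable_on UNIV}"

definition l2_norm :: "(int \<Rightarrow> complex) \<Rightarrow> real" where
  "l2_norm \<psi> = sqrt (\<Sum>\<^sub>\<infinity>n. (cmod (\<psi> n))\<^sup>2)"

definition bounded_operator_l2 :: "((int \<Rightarrow> complex) \<Rightarrow> (int \<Rightarrow> complex)) \<Rightarrow> bool" where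
  "bounded_operator_l2 T \<longleftrightarrow>
     (\<forall>\<psi>\<in>l2. T \<psi> \<in> l2) \<and>
     (\<forall>\<psi>\<in>l2. \<forall>\<phi>\<in>l2. T (\<lambda>n. \<psi> n + \<phi> n) = (\<lambda>n. T \<psi> n + T \<phi> n)) \<and>
     (\<forall>c. \<forall>\<psi>\<in>l2. T (\<lambda>n. c * \<psi> n) = (\<lambda>n. c * T \<psi> n)) \<and>
     (\<exists>B. \<forall>\<psi>\<in>l2. l2_norm (T \<psi>) \<le> B * l2_norm \<psi>)"

text \<open>A number \<open>z\<close> lies outside the spectrum of \<open>T\<close> iff \<open>T - z\<close> has a bounded two-sided inverse
  \<open>S\<close> on \<open>l2\<close>. Operators are functions on all sequences, but only their values on \<open>l2\<close> matter.\<close>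

definition spectrum_l2 :: "((int \<Rightarrow> complex) \<Rightarrow> (int \<Rightarrow> complex)) \<Rightarrow> complex set" where
  "spectrum_l2 T = {z. \<not> (\<exists>S. bounded_operator_l2 S \<and>
     (\<forall>\<psi>\<in>l2. S (\<lambda>n. T \<psi> n - z * \<psi> n) = \<psi> \<and> (\<lambda>n. T (S \<psi>) n - z * S \<psi> n) = \<psi>))}"


subsection \<open>The Fibonacci Hamiltonian\<close>

definition golden_alpha :: real where
  "golden_alpha = (sqrt 5 - 1) / 2"

text \<open>Points of the circle are given by real representatives \<open>\<omega>\<close>; the operator depends only on
  \<open>\<omega>\<close> modulo 1.\<close>

definition fibonacci_hamiltonian ::
    "real \<Rightarrow> real \<Rightarrow> (int \<Rightarrow> complex) \<Rightarrow> (int \<Rightarrow> complex)" where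
  "fibonacci_hamiltonian V \<omega> \<psi> = (\<lambda>n. \<psi> (n + 1) + \<psi> (n - 1) +
     of_real (V * indicator {1 - golden_alpha..<1} (frac (of_int n * golden_alpha + \<omega>))) * \<psi> n)"

text \<open>The operator is self-adjoint, so its spectrum is real and no spectral points are lost by
  regarding it as a subset of the real line.\<close>

definition fibonacci_spectrum :: "real \<Rightarrow> real \<Rightarrow> real set" where
  "fibonacci_spectrum V \<omega> = {E. complex_of_real E \<in> spectrum_l2 (fibonacci_hamiltonian V \<omega>)}"


subsection \<open>Thickness and denseness\<close>

definition gaps :: "real set \<Rightarrow> real set set" where
  "gaps C = components (convex hull C - C)"

definition presentations :: "real set \<Rightarrow> (nat \<Rightarrow> real set) set" where
  "presentations C = {U. bij_betw U {1..} (gaps C)}"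

text \<open>Boundary points are recorded together with the index of the gap they bound. In a Cantor
  set, which has no isolated points, this index is determined by the point.\<close>

definition gap_boundary_points :: "real set \<Rightarrow> (nat \<Rightarrow> real set) \<Rightarrow> (nat \<times> real) set" where
  "gap_boundary_points C U = {(n, u). 1 \<le> n \<and> u \<in> C \<and> u \<in> frontier (U n)}"

definition bridge :: "real set \<Rightarrow> (nat \<Rightarrow> real set) \<Rightarrow> nat \<Rightarrow> real \<Rightarrow> real set" where
  "bridge C U n u = connected_component_set (convex hull C - (\<Union>i\<in>{1..n}. U i)) u"

definition local_thickness :: "real set \<Rightarrow> (nat \<Rightarrow> real set) \<Rightarrow> nat \<Rightarrow> real \<Rightarrow> real" where
  "local_thickness C U n u = measure lborel (bridge C U n u) / measure lborel (U n)"

text \<open>The values are extended reals: suprema and infima are then unconditional, and an infinite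
  denseness is not collapsed to a junk real number.\<close>

definition thickness :: "real set \<Rightarrow> ereal" where
  "thickness C = (SUP U\<in>presentations C. INF (n, u)\<in>gap_boundary_points C U.
     ereal (local_thickness C U n u))"

definition denseness :: "real set \<Rightarrow> ereal" where
  "denseness C = (INF U\<in>presentations C. SUP (n, u)\<in>gap_boundary_points C U.
     ereal (local_thickness C U n u))"

end

theory Submission
  imports Defs "HOL-Complex_Analysis.Complex_Analysis" "HOL-Number_Theory.Fib"
    "HOL-Computational_Algebra.Fundamental_Theorem_Algebra"
begin

text \<open>The traces of the Fibonacci transfer matrices, seen as polynomials in the energy, satisfy
  \<open>X (n + 3) = X (n + 2) * X (n + 1) - X n\<close>, and the spectrum is the set of energies at which no two
  consecutive traces exceed 2 in modulus. At an energy in a gap that escapes at step \<open>m\<close>, the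
  quantity \<open>ln \<bar>X n\<bar>\<close> is of order \<open>sqrt V * fib (n - m)\<close>, whereas the number of zeros of \<open>X n\<close>
  between this gap and an older one is at least of order \<open>fib (n - m) / sqrt V\<close>, because its Fibonacci
  recursion already holds about \<open>log (1 / V)\<close> steps earlier. So the growth in a gap is at most \<open>V\<close>
  times the mass of zeros between it and an older gap. Comparing \<open>ln \<bar>X n\<bar>\<close> with the positive harmonic
  function \<open>Im (arccos (X n / 2))\<close> on the upper half plane turns this into lengths: a gap is at most of
  order \<open>V\<close> times its distance to any older gap, which bounds the thickness from below.

  Conversely, if all gaps meeting an interval of length \<open>R\<close> were much shorter than \<open>V R\<close>, harmonic
  majorants would force \<open>ln \<bar>X n\<bar>\<close> to be much smaller than \<open>V\<close> times the number of zeros in the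
  interval. But following the elliptic branch of the trace map from a pair of neighbouring zeros
  of the first \<open>X l\<close> with two zeros there leads to an energy that escapes \<open>log (1 / V)\<close> steps later and has
  growth of order \<open>V\<close> times that number. Hence every interval contains a gap of comparable length
  up to a factor \<open>V\<close>, and ordering the gaps by decreasing length bounds the denseness.\<close>

text \<open>The scale \<open>sqrt V\<close> comes from the invariant of the trace map. At the first
  escape the traces lie within a multiple of \<open>V\<close> of 2, and \<open>2 * cosh t\<close> is
  about \<open>2 + t^2\<close>, so a distance of order \<open>V\<close> is a rate of order
  \<open>sqrt V\<close>. In the same way the angles just before the escape have order
  \<open>sqrt V\<close>; they add like Fibonacci numbers backwards in time and become of order 1
  only when \<open>fib\<close> has reached \<open>1 / sqrt V\<close>. The quotient of these two
  scales is \<open>V\<close>. An error in the recursion for the numbers of zeros would be amplified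
  as fast as the numbers themselves. Interlacing arguments give these numbers only up to one, so the
  recursion has to be made exact by a parity argument, which needs the signs of three consecutive
  traces. The function \<open>ln \<bar>X n\<bar>\<close> has poles at the zeros and is not positive.
  The imaginary part of the arccos is positive, hence obeys Harnack inequalities, and both are
  compared only up to bounded errors; letting \<open>n\<close> grow removes these errors. The
  description of the spectrum is proved from both sides: periodic closures give a bounded inverse
  off the trapped set, and repetitions of the word exclude one on it.\<close>

lemma discriminant_of_roots:
  fixes x y z w c :: real
  assumes "z + w = x * y" "z * w = x^2 + y^2 - 4 - c"
  shows "(z - w)^2 = (x^2 - 4) * (y^2 - 4) + 4 * c"
proof -
  have "(z - w)^2 = (z + w)^2 - 4 * (z * w)"
    by (simp add: power2_eq_square algebra_simps)
  then show ?thesis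
    unfolding assms by (simp add: power2_eq_square algebra_simps)
qed

lemma sinh_ge_self:
  fixes t :: real
  assumes "0 \<le> t"
  shows "t \<le> sinh t"
proof -
  have "sinh 0 - 0 \<le> sinh t - t"
  proof (rule DERIV_nonneg_imp_nondecreasing[OF assms])
    fix s :: real
    have "((\<lambda>s. sinh s - s) has_real_derivative (cosh s - 1)) (at s)"
      by (auto intro!: derivative_eq_intros)
    then show "\<exists>y. ((\<lambda>s. sinh s - s) has_real_derivative y) (at s) \<and> 0 \<le> y"
      using cosh_real_ge_1[of s] by force
  qed
  then show ?thesis by simp
qed

lemma cosh_ge_quadratic:
  fixes t :: real
  assumes "0 \<le> t"
  shows "1 + t^2 / 2 \<le> cosh t"
proof -
  have "(t / 2)^2 \<le> (sinh (t / 2))^2"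
    using sinh_ge_self[of "t / 2"] assms by (intro power_mono) auto
  moreover have "cosh t = 1 + 2 * (sinh (t / 2))^2"
    using cosh_double_cosh[of "t / 2"] by (simp add: cosh_square_eq)
  ultimately show ?thesis by (simp add: power_divide)
qed

lemma cosh_le_quadratic:
  fixes t :: real
  assumes "0 \<le> t" "t \<le> 1"
  shows "cosh t \<le> 1 + t^2"
proof -
  have "exp t \<le> 1 + t + t^2" by (rule exp_bound) (use assms in auto)
  moreover have "exp (- t) \<le> 1 - t + t^2"
  proof -
    have "1 \<le> (1 - t + t^2) * (1 + t)"
      using assms by (simp add: algebra_simps power2_eq_square)
    also have "\<dots> \<le> (1 - t + t^2) * exp t"
      using assms by (intro mult_left_mono) auto
    finally show ?thesis
      by (simp add: exp_minus inverse_eq_divide divide_le_eq)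
  qed
  ultimately show ?thesis by (simp add: cosh_def)
qed

text \<open>An error \<open>v\<close> in a trace \<open>2 * cosh t\<close> thus costs at most
  \<open>sqrt v\<close> in \<open>t\<close>, uniformly in \<open>t\<close>. The critical region is
  \<open>t\<close> near 0, where cosh is only quadratic.\<close>

lemma cosh_add_sqrt_ge:
  fixes t v :: real
  assumes "0 \<le> t" "0 \<le> v"
  shows "2 * cosh t + v \<le> 2 * cosh (t + sqrt v)"
proof -
  have "cosh t + v / 2 \<le> cosh t * (1 + v / 2)"
    using assms cosh_real_ge_1[of t] mult_right_mono[of 1 "cosh t" "v / 2"]
    by (simp add: algebra_simps)
  also have "\<dots> \<le> cosh t * cosh (sqrt v)"
    using cosh_ge_quadratic[of "sqrt v"] assms by (intro mult_left_mono) auto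
  also have "\<dots> \<le> cosh (t + sqrt v)"
    using assms by (simp add: cosh_add)
  finally show ?thesis by simp
qed

subsection \<open>Orbits of the trace map\<close>

text \<open>These are the sign changes that map orbits of the trace recursion to orbits. Two
  consecutive signs can be prescribed freely, so two consecutive nonzero traces can be made positive
  simultaneously.\<close>

definition sign_seq :: "(nat \<Rightarrow> real) \<Rightarrow> bool" where
  "sign_seq s \<longleftrightarrow> (\<forall>n. s (n + 2) = s (n + 1) * s n) \<and> (\<forall>n. s n = 1 \<or> s n = -1)"

lemma sign_seq_square: "sign_seq s \<Longrightarrow> s n * s n = 1"
  unfolding sign_seq_def by (metis mult_minus1_right mult_1_right minus_minus)

lemma sign_seq_abs: "sign_seq s \<Longrightarrow> \<bar>s n * t\<bar> = \<bar>t\<bar>"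
  unfolding sign_seq_def by (auto simp: abs_mult) (metis abs_minus_cancel abs_one mult_1)

lemma sign_seq_exists:
  assumes "a = 1 \<or> a = -1" "b = 1 \<or> b = -1"
  shows "\<exists>s. sign_seq s \<and> s m = a \<and> s (Suc m) = b"
  using assms
proof (induction m arbitrary: a b)
  case 0
  define s :: "nat \<Rightarrow> real" where "s = (\<lambda>n. if n mod 3 = 0 then a else if n mod 3 = 1 then b else a * b)"
  have "sign_seq s"
    unfolding sign_seq_def
  proof (intro conjI allI)
    fix n :: nat
    have "n mod 3 = 0 \<and> (n + 1) mod 3 = 1 \<and> (n + 2) mod 3 = 2 \<or> n mod 3 = 1 \<and> (n + 1) mod 3 = 2 \<and> (n + 2) mod 3 = 0
        \<or> n mod 3 = 2 \<and> (n + 1) mod 3 = 0 \<and> (n + 2) mod 3 = 1"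
      by presburger
    then show "s (n + 2) = s (n + 1) * s n"
      using 0 unfolding s_def by (elim disjE conjE) simp_all
    show "s n = 1 \<or> s n = -1"
      using 0 unfolding s_def by auto
  qed
  then show ?case by (intro exI[of _ s]) (simp add: s_def)
next
  case (Suc m)
  obtain s where s: "sign_seq s" "s m = b * a" "s (Suc m) = a"
    using Suc.IH[of "b * a" a] Suc.prems by auto
  then have "s (Suc (Suc m)) = a * (b * a)"
    unfolding sign_seq_def by (metis add_2_eq_Suc' Suc_eq_plus1)
  then show ?case using s Suc.prems by (intro exI[of _ s]) auto
qed

text \<open>The quantity in \<open>invariant_0\<close> is the Fricke-Vogt invariant of the Fibonacci
  trace map. The energy is left out on purpose: orbits with changed signs, which are not traces of
  transfer matrices, are also instances.\<close>

locale trace_orbit =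
  fixes V :: real and x :: "nat \<Rightarrow> real"
  assumes V_pos: "0 < V" and V_small: "V \<le> 1/1000"
    and rec: "x (n + 3) = x (n + 2) * x (n + 1) - x n"
    and invariant_0: "(x 2)^2 + (x 1)^2 + (x 0)^2 - x 2 * x 1 * x 0 = 4 + V^2"
begin

lemma invariant: "(x (n + 2))^2 + (x (n + 1))^2 + (x n)^2 - x (n + 2) * x (n + 1) * x n = 4 + V^2"
proof (induction n)
  case 0
  then show ?case using invariant_0 by (simp add: numeral_2_eq_2)
next
  case (Suc n)
  have "(a * b - c)^2 + a^2 + b^2 - (a * b - c) * a * b = a^2 + b^2 + c^2 - a * b * c" for a b c :: real
    by (simp add: power2_eq_square algebra_simps)
  from this[of "x (n + 2)" "x (n + 1)" "x n"] show ?case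
    using Suc rec[of n] by (simp add: numeral_eq_Suc)
qed

lemma roots_sum: "x (n + 3) + x n = x (n + 1) * x (n + 2)"
  using rec[of n] by simp

lemma roots_prod: "x (n + 3) * x n = (x (n + 1))^2 + (x (n + 2))^2 - 4 - V^2"
  using invariant[of n] unfolding rec[of n] power2_eq_square left_diff_distrib by (simp add: mult_ac)

text \<open>By the invariant, \<open>x n\<close> and \<open>x (n + 3)\<close> are the two roots of
  one quadratic with coefficients in the middle traces. If the middle traces lie both in the band
  from -2 to 2 or both outside it, the roots differ by at least \<open>2 * V\<close>. This
  separation drives every escape, and it prevents the two roots from changing order along a path of
  energies.\<close>

lemma discriminant: "(x (n + 3) - x n)^2 = ((x (n + 1))^2 - 4) * ((x (n + 2))^2 - 4) + 4 * V^2"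
  by (rule discriminant_of_roots) (simp_all add: roots_sum roots_prod)

text \<open>A rearrangement of the invariant. If \<open>x (n + 1)\<close> and
  \<open>x (n + 2)\<close> exceed 2 and \<open>x n\<close> lies between -2 and 2, both summands are
  nonnegative, so that \<open>2 - x n\<close> and the difference of the large traces are each at
  most \<open>V\<close>.\<close>

lemma three_term: "(x (n + 2) - x (n + 1))^2 + (2 - x n) * (x (n + 2) * x (n + 1) - 2 - x n) = V^2"
  using invariant[of n] by (simp add: power2_eq_square algebra_simps)

lemma three_term': "(x (n + 2) - x n)^2 + (2 - x (n + 1)) * (x (n + 2) * x n - 2 - x (n + 1)) = V^2"
  using invariant[of n] by (simp add: power2_eq_square algebra_simps)

lemma twist:
  assumes "sign_seq s"
  shows "trace_orbit V (\<lambda>n. s n * x n)"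
proof
  fix n
  have s2: "s (n + 2) = s (n + 1) * s n" and s3: "s (n + 3) = s (n + 2) * s (n + 1)"
    using assms unfolding sign_seq_def by (auto simp: numeral_eq_Suc)
  have s3': "s (n + 3) = s n"
    unfolding s3 s2 using sign_seq_square[OF assms, of "n + 1"] by (simp add: algebra_simps)
  show "s (n + 3) * x (n + 3) = s (n + 2) * x (n + 2) * (s (n + 1) * x (n + 1)) - s n * x n"
  proof -
    have "s (n + 3) * (x (n + 2) * x (n + 1)) = s (n + 2) * x (n + 2) * (s (n + 1) * x (n + 1))"
      by (subst s3) (simp only: mult_ac)
    then show ?thesis
      using s3' by (simp only: rec[of n] right_diff_distrib)
  qed
  have "s 2 = s 1 * s 0"
    using assms unfolding sign_seq_def by (metis Suc_1 add_2_eq_Suc' Suc_eq_plus1 add_0)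
  then have "s 2 * s 1 * s 0 = 1"
    using sign_seq_square[OF assms, of 2] by (simp add: mult.assoc)
  then have "s 2 * x 2 * (s 1 * x 1) * (s 0 * x 0) = x 2 * x 1 * x 0"
    by (metis (no_types, lifting) mult.assoc mult.left_commute mult_1)
  moreover have "(s m * t)^2 = t^2" for m t
    using sign_seq_square[OF assms, of m] by (simp add: power2_eq_square)
  ultimately show "(s 2 * x 2)^2 + (s 1 * x 1)^2 + (s 0 * x 0)^2 - s 2 * x 2 * (s 1 * x 1) * (s 0 * x 0) = 4 + V^2"
    using invariant_0 by (simp only:)
qed (use V_pos V_small in auto)

text \<open>For traces \<open>2 * cosh t\<close> and \<open>2 * cosh t'\<close> the discriminant is
  \<open>(4 * sinh t * sinh t')^2 + (2 * V)^2\<close>. The larger root therefore exceeds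
  \<open>2 * cosh (t + t')\<close> by at most \<open>V\<close>: the arcosh values obey a perturbed
  Fibonacci recursion. The last conclusion renews the hypothesis on the order of the roots.\<close>

lemma growth_step:
  assumes "2 \<le> x (n + 1)" "2 \<le> x (n + 2)" "x n \<le> x (n + 3)"
  shows "2 + V \<le> x (n + 3)"
    and "2 * cosh (arcosh (x (n + 1) / 2) + arcosh (x (n + 2) / 2)) \<le> x (n + 3)"
    and "x (n + 3) \<le> 2 * cosh (arcosh (x (n + 1) / 2) + arcosh (x (n + 2) / 2)) + V"
    and "x (n + 1) \<le> x (n + 4)"
proof -
  define t where "t = arcosh (x (n + 1) / 2)"
  define t' where "t' = arcosh (x (n + 2) / 2)"
  have t: "x (n + 1) = 2 * cosh t" "0 \<le> t" and t': "x (n + 2) = 2 * cosh t'" "0 \<le> t'"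
    using assms by (auto simp: t_def t'_def)
  have d: "0 \<le> x (n + 3) - x n" using assms by simp
  have D: "(x (n + 3) - x n)^2 = (4 * sinh t * sinh t')^2 + (2 * V)^2"
    unfolding discriminant t t' by (simp add: power_mult_distrib cosh_square_eq algebra_simps)
  have st: "0 \<le> 4 * sinh t * sinh t'" using t t' by simp
  have "4 * sinh t * sinh t' \<le> x (n + 3) - x n"
    by (rule power2_le_imp_le[OF _ d]) (simp add: D)
  then show "2 * cosh (t + t') \<le> x (n + 3)"
    using roots_sum[of n] unfolding t t' by (simp add: cosh_add)
  have "x (n + 3) - x n \<le> 4 * sinh t * sinh t' + 2 * V"
    by (rule power2_le_imp_le) (use st V_pos D in \<open>auto simp: power2_sum\<close>)
  then show "x (n + 3) \<le> 2 * cosh (t + t') + V"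
    using roots_sum[of n] unfolding t t' by (simp add: cosh_add)
  have "2 * V \<le> x (n + 3) - x n"
    by (rule power2_le_imp_le[OF _ d]) (simp add: D)
  moreover have "2 * 2 \<le> x (n + 1) * x (n + 2)"
    using assms by (intro mult_mono) auto
  ultimately show *: "2 + V \<le> x (n + 3)" using roots_sum[of n] by simp
  have "2 * x (n + 1) \<le> x (n + 2) * x (n + 1)"
    using assms by (intro mult_right_mono) auto
  then have a: "x (n + 1) \<le> x (n + 3)"
    using roots_sum[of n] assms(3) mult.commute[of "x (n + 2)" "x (n + 1)"] by linarith
  have "x (n + 3) * 2 \<le> x (n + 3) * x (n + 2)"
    using assms * V_pos by (intro mult_left_mono) auto
  then have "2 * x (n + 3) - x (n + 1) \<le> x (n + 4)"
    using rec[of "n + 1"] by (simp add: numeral_eq_Suc)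
  then show "x (n + 1) \<le> x (n + 4)" using a by simp
qed

lemma growth_forever:
  assumes "2 \<le> x (n + 1)" "2 \<le> x (n + 2)" "x n \<le> x (n + 3)"
  shows "2 \<le> x (n + 1 + k) \<and> 2 \<le> x (n + 2 + k) \<and> x (n + k) \<le> x (n + 3 + k)"
proof (induction k)
  case 0
  then show ?case using assms by simp
next
  case (Suc k)
  then have "2 \<le> x (n + k + 1)" "2 \<le> x (n + k + 2)" "x (n + k) \<le> x (n + k + 3)"
    by (auto simp: algebra_simps)
  from growth_step(1,4)[OF this] show ?case
    using Suc V_pos by (auto simp: numeral_eq_Suc)
qed

text \<open>The root separation makes the third trace at least \<open>2 + V\<close>, and
  \<open>cosh t \<le> 1 + t^2\<close> turns this into the seed \<open>sqrt (V / 2)\<close>. From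
  then on the rates are superadditive.\<close>

lemma growth_lower:
  assumes "2 \<le> x (n + 1)" "2 \<le> x (n + 2)" "x n \<le> x (n + 3)"
  shows "sqrt (V / 2) * fib (k + 1) \<le> arcosh (x (n + 3 + k) / 2)"
proof -
  define t where "t = (\<lambda>k. arcosh (x (n + 1 + k) / 2))"
  have ge2: "2 \<le> x (n + 1 + k)" for k
    using growth_forever[OF assms, of k] by auto
  have t0: "0 \<le> t k" for k
    using ge2[of k] by (simp add: t_def)
  have step: "t k + t (k + 1) \<le> t (k + 2)" for k
  proof -
    have "2 * cosh (t k + t (k + 1)) \<le> x (n + k + 3)"
      using growth_step(2)[of "n + k"] growth_forever[OF assms, of k]
      by (simp add: t_def algebra_simps)
    also have "\<dots> = 2 * cosh (t (k + 2))"
      using ge2[of "k + 2"] by (simp add: t_def algebra_simps numeral_eq_Suc)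
    finally show ?thesis
      using t0 by (simp add: cosh_real_nonneg_le_iff)
  qed
  have t2: "sqrt (V / 2) \<le> t 2"
  proof -
    have "cosh (sqrt (V / 2)) \<le> 1 + (sqrt (V / 2))^2"
      by (rule cosh_le_quadratic) (use V_pos V_small in auto)
    also have "\<dots> \<le> cosh (t 2)"
      using growth_step(1)[OF assms] ge2[of 2] V_pos by (simp add: t_def algebra_simps numeral_eq_Suc)
    finally show ?thesis
      using t0 V_pos by (simp add: cosh_real_nonneg_le_iff)
  qed
  have t3: "sqrt (V / 2) \<le> t 3"
    using step[of 1] t2 t0[of 1] by (simp add: numeral_eq_Suc)
  have "sqrt (V / 2) * fib (k + 1) \<le> t (k + 2) \<and> sqrt (V / 2) * fib (k + 2) \<le> t (k + 3)"
  proof (induction k)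
    case 0
    then show ?case using t2 t3 by (simp add: numeral_eq_Suc)
  next
    case (Suc k)
    have "fib (Suc k + 2) = fib (k + 2) + fib (k + 1)" by (simp add: numeral_eq_Suc)
    then have "sqrt (V / 2) * fib (Suc k + 2) = sqrt (V / 2) * fib (k + 2) + sqrt (V / 2) * fib (k + 1)"
      by (simp add: algebra_simps)
    also have "\<dots> \<le> t (Suc k + 3)"
      using Suc step[of "k + 2"] by (simp add: numeral_eq_Suc)
    finally show ?case using Suc by (simp add: numeral_eq_Suc)
  qed
  then show ?thesis by (simp add: t_def algebra_simps numeral_eq_Suc)
qed

text \<open>Each step adds an error \<open>V\<close> to a trace, hence at most \<open>sqrt V\<close>
  to its rate. After adding \<open>sqrt V\<close> to every rate the sequence is subadditive and is
  dominated by a multiple of the Fibonacci numbers.\<close>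

lemma growth_upper:
  assumes "2 \<le> x (n + 1)" "2 \<le> x (n + 2)" "x n \<le> x (n + 3)"
    and D: "arcosh (x (n + 1) / 2) \<le> D" "arcosh (x (n + 2) / 2) \<le> D"
  shows "arcosh (x (n + 1 + k) / 2) \<le> (D + sqrt V) * fib (k + 2)"
proof -
  define t where "t = (\<lambda>k. arcosh (x (n + 1 + k) / 2) + sqrt V)"
  have ge2: "2 \<le> x (n + 1 + k)" for k
    using growth_forever[OF assms(1-3), of k] by auto
  have t0: "0 \<le> t k - sqrt V" for k
    using ge2[of k] by (simp add: t_def)
  have sq: "0 \<le> sqrt V" using V_pos by simp
  have step: "t (k + 2) \<le> t k + t (k + 1)" for k
  proof -
    have "2 * cosh (t (k + 2) - sqrt V) = x (n + k + 3)"
      using ge2[of "k + 2"] by (simp add: t_def algebra_simps numeral_eq_Suc)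
    also have "\<dots> \<le> 2 * cosh ((t k - sqrt V) + (t (k + 1) - sqrt V)) + V"
      using growth_step(3)[of "n + k"] growth_forever[OF assms(1-3), of k]
      by (simp add: t_def algebra_simps)
    also have "\<dots> \<le> 2 * cosh ((t k - sqrt V) + (t (k + 1) - sqrt V) + sqrt V)"
      using t0[of k] t0[of "k + 1"] V_pos by (intro cosh_add_sqrt_ge) auto
    finally have "cosh (t (k + 2) - sqrt V) \<le> cosh ((t k - sqrt V) + (t (k + 1) - sqrt V) + sqrt V)"
      by simp
    then have "t (k + 2) - sqrt V \<le> (t k - sqrt V) + (t (k + 1) - sqrt V) + sqrt V"
      by (rule cosh_real_nonneg_le_iff[THEN iffD1, rotated 2])
        (use t0[of k] t0[of "k + 1"] t0[of "k + 2"] sq in linarith)+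
    then show ?thesis by simp
  qed
  have "t k \<le> (D + sqrt V) * fib (k + 2) \<and> t (k + 1) \<le> (D + sqrt V) * fib (k + 3)"
  proof (induction k)
    case 0
    have "0 \<le> D" using D(1) t0[of 0] by (simp add: t_def)
    then have "D + sqrt V \<le> (D + sqrt V) * 2" using sq by simp
    then show ?case using D sq unfolding t_def by (simp add: numeral_eq_Suc)
  next
    case (Suc k)
    have "fib (Suc k + 3) = fib (k + 3) + fib (k + 2)" by (simp add: numeral_eq_Suc)
    then have "(D + sqrt V) * fib (Suc k + 3) = (D + sqrt V) * fib (k + 3) + (D + sqrt V) * fib (k + 2)"
      by (simp add: algebra_simps)
    then show ?case using Suc step[of k] by (simp add: numeral_eq_Suc)
  qed
  then have "t k \<le> (D + sqrt V) * fib (k + 2)" by blast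
  then show ?thesis using sq unfolding t_def by linarith
qed

end

section \<open>The orbit before its first escape\<close>

context trace_orbit
begin

text \<open>By \<open>three_term\<close>, \<open>x (n + 2)\<close> is nearly 2 and the escaping
  traces nearly agree. The recursion run backwards then makes \<open>x (n + 1)\<close>, and likewise
  \<open>x n\<close>, nearly equal to them; as one of these two is at most 2 in modulus, the
  escaping traces can exceed 2 only by a multiple of \<open>V\<close>.\<close>

lemma first_escape:
  assumes esc: "2 < x (n + 3)" "2 < x (n + 4)" and y: "\<bar>x (n + 2)\<bar> \<le> 2"
    and w: "\<bar>x (n + 1)\<bar> \<le> 2 \<or> \<bar>x n\<bar> \<le> 2"
  shows "2 - V \<le> x (n + 2)" "x (n + 3) \<le> 2 + 11 * V" "x (n + 4) \<le> 2 + 11 * V"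
proof -
  define X Z y w where "X = x (n + 3)" and "Z = x (n + 4)" and "y = x (n + 2)" and "w = x (n + 1)"
  note defs = X_def Z_def y_def w_def
  have XZ: "2 < X" "2 < Z" using esc by (auto simp: defs)
  have y2: "y \<le> 2" "-2 \<le> y" using y by (auto simp: defs)
  have tt: "(Z - X)^2 + (2 - y) * (Z * X - 2 - y) = V^2"
    using three_term[of "n + 2"] by (simp add: defs numeral_eq_Suc)
  have "2 * 2 < Z * X"
    using XZ by (intro mult_strict_mono) auto
  then have "(2 - y) * (2 - y) \<le> (2 - y) * (Z * X - 2 - y)"
    using y2 by (intro mult_left_mono) auto
  then have "(2 - y)^2 \<le> V^2" "(Z - X)^2 \<le> V^2"
    using tt zero_le_power2[of "Z - X"] zero_le_power2[of "2 - y"] unfolding power2_eq_square by linarith+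
  then have yV: "2 - V \<le> y" and ZX: "\<bar>Z - X\<bar> \<le> V"
    using V_pos y2 by (auto simp: power2_le_iff_abs_le abs_le_iff dest!: power2_le_imp_le)
  then show "2 - V \<le> x (n + 2)" by (simp add: defs)
  have w: "w = y * X - Z"
    using rec[of "n + 1"] by (simp add: defs numeral_eq_Suc mult.commute)
  have u: "x n = w * y - X"
    using rec[of n] by (simp add: defs mult.commute)
  have yX: "(2 - V) * X \<le> y * X"
    using yV XZ by (intro mult_right_mono) auto
  have "X \<le> 2 + 10 * V"
  proof (cases "\<bar>w\<bar> \<le> 2")
    case True
    then have "(2 - V) * X \<le> 2 + X + V" using w yX ZX by linarith
    then have "X * (1 - V) \<le> 2 + V" by (simp add: algebra_simps)
    also have "\<dots> \<le> (2 + 10 * V) * (1 - V)"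
    proof -
      have "10 * V * V \<le> 10 * V * (1/1000)" using V_pos V_small by (intro mult_left_mono) auto
      then show ?thesis using V_pos by (simp add: algebra_simps)
    qed
    finally show ?thesis using V_small by simp
  next
    case False
    then have "\<bar>x n\<bar> \<le> 2" using assms(4) by (simp add: defs)
    then have a: "w * y \<le> 2 + X" using u by linarith
    have b: "(1 - V) * X - V \<le> w" using w yX ZX by (simp add: algebra_simps abs_le_iff)
    have c: "0 \<le> (1 - V) * X - V"
    proof -
      have "(1 - V) * 2 \<le> (1 - V) * X" using XZ V_small by (intro mult_left_mono) auto
      then show ?thesis using V_small by (simp add: algebra_simps)
    qed
    have "((1 - V) * X - V) * (2 - V) \<le> w * y"
      using b c yV V_small by (intro mult_mono) auto
    with a have d: "((1 - V) * X - V) * (2 - V) \<le> 2 + X" by linarith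
    have e: "((1 - V) * X - V) * (2 - V) = 2 * X - 3 * (V * X) + V * V * X - 2 * V + V * V"
      by (simp add: algebra_simps)
    have "0 \<le> V * V * X" "0 \<le> V * V" using XZ V_pos by auto
    then have "X - 3 * (V * X) \<le> 2 + 2 * V" using d e by linarith
    then have "X * (1 - 3 * V) \<le> 2 + 2 * V" by (simp add: algebra_simps)
    also have "\<dots> \<le> (2 + 10 * V) * (1 - 3 * V)"
    proof -
      have "30 * V * V \<le> 30 * V * (1/1000)" using V_pos V_small by (intro mult_left_mono) auto
      then show ?thesis using V_pos by (simp add: algebra_simps)
    qed
    finally show ?thesis using V_small by simp
  qed
  then show "x (n + 3) \<le> 2 + 11 * V" "x (n + 4) \<le> 2 + 11 * V"
    using ZX V_pos by (auto simp: defs)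
qed

text \<open>The number \<open>2 - p^2\<close> is a lower substitute for \<open>2 * cos p\<close>, so
  \<open>p\<close> and \<open>q\<close> play the part of angles, and angles add when the orbit is
  run backwards. If one of the traces slightly exceeds 2, the product in the discriminant is at most
  0 and only the splitting by \<open>2 * V\<close> remains.\<close>

lemma backward_lower:
  assumes "0 \<le> x (k + 1)" "0 \<le> x (k + 2)" "\<not> (2 < x (k + 1) \<and> 2 < x (k + 2))"
    and p: "0 \<le> p" "2 - p^2 \<le> x (k + 1)" and q: "0 \<le> q" "2 - q^2 \<le> x (k + 2)"
  shows "2 - (p + q)^2 - V \<le> x k"
proof -
  define X Y d where "X = x (k + 1)" and "Y = x (k + 2)" and "d = x (k + 3) - x k"
  have d2: "d^2 = (X^2 - 4) * (Y^2 - 4) + 4 * V^2"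
    unfolding d_def X_def Y_def by (rule discriminant)
  have xk: "2 * x k = X * Y - d"
    using roots_sum[of k] by (simp add: d_def X_def Y_def)
  have XY0: "0 \<le> X" "0 \<le> Y" using assms by (auto simp: X_def Y_def)
  have pq: "p^2 + q^2 + 2 * (p * q) = (p + q)^2" "0 \<le> p * q" "0 \<le> p^2" "0 \<le> q^2"
    using p q by (auto simp: power2_sum)
  consider "X \<le> 2" "Y \<le> 2" | "2 < X" "Y \<le> 2" | "X \<le> 2" "2 < Y"
    using assms by (fastforce simp: X_def Y_def)
  then show ?thesis
  proof cases
    case 1
    have "4 - X^2 \<le> 4 * p^2" "4 - Y^2 \<le> 4 * q^2" "0 \<le> 4 - X^2" "0 \<le> 4 - Y^2"
    proof -
      have sq: "4 - u^2 \<le> 4 * r \<and> 0 \<le> 4 - u^2" if "0 \<le> u" "u \<le> 2" "2 - r \<le> u" for u r :: real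
      proof -
        have "4 - u^2 = (2 - u) * (2 + u)" by (simp add: power2_eq_square algebra_simps)
        moreover have "(2 - u) * (2 + u) \<le> (2 - u) * 4" using that by (intro mult_left_mono) auto
        moreover have "0 \<le> (2 - u) * (2 + u)" using that by auto
        ultimately show ?thesis using that by argo
      qed
      show "4 - X^2 \<le> 4 * p^2" "4 - Y^2 \<le> 4 * q^2" "0 \<le> 4 - X^2" "0 \<le> 4 - Y^2"
        using sq[of X "p^2"] sq[of Y "q^2"] 1 XY0 p q by (auto simp: X_def Y_def)
    qed
    then have "(4 - X^2) * (4 - Y^2) \<le> (4 * p^2) * (4 * q^2)"
      by (intro mult_mono) auto
    then have "d^2 \<le> (4 * (p * q))^2 + (2 * V)^2"
      unfolding d2 by (simp add: power_mult_distrib algebra_simps)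
    also have "\<dots> \<le> (4 * (p * q) + 2 * V)^2"
      using pq V_pos by (simp add: power2_sum)
    finally have "d \<le> 4 * (p * q) + 2 * V"
      by (rule power2_le_imp_le) (use pq V_pos in auto)
    moreover have "0 \<le> (2 - X) * (2 - Y)" using 1 by simp
    then have "2 * X + 2 * Y - 4 \<le> X * Y" by (simp add: algebra_simps)
    ultimately show ?thesis using xk p(2) q(2) pq unfolding X_def[symmetric] Y_def[symmetric] by linarith
  next
    case 2
    have "(X^2 - 4) * (Y^2 - 4) \<le> 0"
      using 2 XY0 power_mono[of 2 X 2] power_mono[of Y 2 2] by (intro mult_nonneg_nonpos) auto
    then have "d^2 \<le> (2 * V)^2" using d2 by (simp add: power_mult_distrib)
    then have "d \<le> 2 * V" by (rule power2_le_imp_le) (use V_pos in auto)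
    moreover have "2 * Y \<le> X * Y" using 2 XY0 by (intro mult_right_mono) auto
    ultimately show ?thesis using xk p(2) q(2) pq unfolding X_def[symmetric] Y_def[symmetric] by linarith
  next
    case 3
    have "(X^2 - 4) * (Y^2 - 4) \<le> 0"
      using 3 XY0 power_mono[of 2 Y 2] power_mono[of X 2 2] by (intro mult_nonpos_nonneg) auto
    then have "d^2 \<le> (2 * V)^2" using d2 by (simp add: power_mult_distrib)
    then have "d \<le> 2 * V" by (rule power2_le_imp_le) (use V_pos in auto)
    moreover have "X * 2 \<le> X * Y" using 3 XY0 by (intro mult_left_mono) auto
    ultimately show ?thesis using xk p(2) q(2) pq unfolding X_def[symmetric] Y_def[symmetric] by linarith
  qed
qed

text \<open>By the arithmetic-geometric mean inequality the root of
  \<open>(4 - X^2) * (4 - Y^2)\<close> plus \<open>X * Y\<close> is at most 4, the analogue of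
  \<open>cos (a - b) \<le> 1\<close>. The term \<open>4 * V^2\<close> of the discriminant adds at
  most \<open>V\<close> to \<open>x k\<close>.\<close>

lemma backward_upper:
  assumes "0 \<le> x (k + 1)" "0 \<le> x (k + 2)" "x (k + 1) \<le> 2" "x (k + 2) \<le> 2"
  shows "x k \<le> 2 + V"
proof -
  define X Y d where "X = x (k + 1)" and "Y = x (k + 2)" and "d = x k - x (k + 3)"
  have d2: "d^2 = (4 - X^2) * (4 - Y^2) + (2 * V)^2"
    using discriminant[of k] unfolding d_def X_def Y_def
    by (simp add: power2_commute algebra_simps power_mult_distrib)
  define r where "r = (8 - X^2 - Y^2) / 2"
  have XY: "X^2 \<le> 4" "Y^2 \<le> 4"
    using assms power_mono[of X 2 2] power_mono[of Y 2 2] by (auto simp: X_def Y_def)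
  have "r^2 - (4 - X^2) * (4 - Y^2) = ((X^2 - Y^2) / 2)^2"
    unfolding r_def by (simp add: power2_eq_square field_simps)
  then have "(4 - X^2) * (4 - Y^2) \<le> r^2"
    using zero_le_power2[of "(X^2 - Y^2) / 2"] by linarith
  moreover have "0 \<le> r" using XY by (simp add: r_def)
  ultimately have "d^2 \<le> (r + 2 * V)^2"
  proof -
    have "(r + 2 * V)^2 = r^2 + 4 * (r * V) + (2 * V)^2" by (simp add: power2_sum)
    moreover have "0 \<le> r * V" using \<open>0 \<le> r\<close> V_pos by simp
    ultimately show ?thesis using \<open>(4 - X^2) * (4 - Y^2) \<le> r^2\<close> unfolding d2 by linarith
  qed
  then have "d \<le> r + 2 * V" by (rule power2_le_imp_le) (use \<open>0 \<le> r\<close> V_pos in auto)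
  moreover have "2 * (X * Y) \<le> X^2 + Y^2" by (rule sum_squares_bound[of X Y, unfolded mult.assoc])
  moreover have "2 * x k = X * Y + d"
    using roots_sum[of k] by (simp add: d_def X_def Y_def)
  ultimately show ?thesis by (simp add: r_def field_simps)
qed

text \<open>This is the pattern large, small, large. The argument is that of
  \<open>three_term\<close> with the middle trace as the small one; one further step of the
  recursion bounds the large traces from above.\<close>

lemma backward_upper_alternating:
  assumes "2 < x k" "0 \<le> x (k + 1)" "x (k + 1) \<le> 2" "2 < x (k + 2)"
  shows "\<bar>x (k + 2) - x k\<bar> \<le> V" and "x (k + 3) \<le> 2 \<Longrightarrow> x k \<le> 2 + 5 * V"
proof -
  define z c y where "z = x k" and "c = x (k + 1)" and "y = x (k + 2)"
  note defs = z_def c_def y_def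
  have tt: "(y - z)^2 + (2 - c) * (y * z - 2 - c) = V^2"
    using three_term'[of k] by (simp add: defs)
  have "2 * 2 < y * z" using assms by (intro mult_strict_mono) (auto simp: defs)
  then have "(2 - c) * (2 - c) \<le> (2 - c) * (y * z - 2 - c)"
    using assms by (intro mult_left_mono) (auto simp: defs)
  then have "(2 - c)^2 \<le> V^2" "(y - z)^2 \<le> V^2"
    using tt zero_le_power2[of "y - z"] zero_le_power2[of "2 - c"] unfolding power2_eq_square by linarith+
  then have cV: "2 - V \<le> c" and yz: "\<bar>y - z\<bar> \<le> V"
    using V_pos assms by (auto simp: power2_le_iff_abs_le abs_le_iff defs dest!: power2_le_imp_le)
  then show "\<bar>x (k + 2) - x k\<bar> \<le> V" by (simp add: defs)
  assume "x (k + 3) \<le> 2"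
  then have "y * c \<le> 2 + z" using rec[of k] by (simp add: defs)
  moreover have "y * (2 - V) \<le> y * c" using cV assms by (intro mult_left_mono) (auto simp: defs)
  ultimately have "y * (1 - V) \<le> 2 + V" using yz by (simp add: algebra_simps)
  also have "\<dots> \<le> (2 + 4 * V) * (1 - V)"
  proof -
    have "4 * V * V \<le> 4 * V * (1/1000)" using V_pos V_small by (intro mult_left_mono) auto
    then show ?thesis using V_pos by (simp add: algebra_simps)
  qed
  finally have "y \<le> 2 + 4 * V" using V_small by simp
  then show "x k \<le> 2 + 5 * V" using yz by (simp add: defs)
qed

text \<open>Backwards from the first escape the angles start at \<open>sqrt V\<close> at most and
  add up like Fibonacci numbers. As long as their sum is at most 1 the traces cannot fall below 1,
  so their signs are known.\<close>

lemma backward_window: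
  assumes esc: "2 < x m" "2 < x (m + 1)" and m: "3 \<le> m"
    and first: "\<And>j. j < m \<Longrightarrow> \<not> (2 < \<bar>x j\<bar> \<and> 2 < \<bar>x (j + 1)\<bar>)"
    and i: "i \<le> m" "2 * sqrt V * fib (i + 1) \<le> 1"
  shows "1 \<le> x (m - i)"
proof -
  \<comment> \<open>The solution of \<open>b (i + 2) = b i + b (i + 1) + sqrt V\<close> with
    \<open>b 0 = b 1 = sqrt V\<close>. The surplus \<open>sqrt V\<close> in each step absorbs the
    error \<open>V\<close> of \<open>backward_lower\<close>.\<close>
  define b where "b = (\<lambda>i. 2 * sqrt V * fib (i + 1) - sqrt V)"
  have sV: "0 < sqrt V" "(sqrt V)^2 = V" using V_pos by auto
  have fib1: "1 \<le> real (fib (i + 1))" for i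
    using fib_neq_0_nat[of "i + 1"] by linarith
  have b0: "0 \<le> b i" for i
  proof -
    have "2 * sqrt V * 1 \<le> 2 * sqrt V * fib (i + 1)" using sV fib1 by (intro mult_left_mono) auto
    then show ?thesis using sV by (simp add: b_def)
  qed
  have bstep: "b (i + 2) = b i + b (i + 1) + sqrt V" for i
    by (simp add: b_def algebra_simps)
  obtain n where n: "m = n + 3" using m by (metis add.commute le_Suc_ex)
  have fe: "2 - V \<le> x (n + 2)" "x (n + 3) \<le> 2 + 11 * V" "x (n + 4) \<le> 2 + 11 * V"
  proof -
    have c: "\<bar>x (n + 2)\<bar> \<le> 2"
      using first[of "n + 2"] esc by (auto simp: n numeral_eq_Suc)
    have d: "\<bar>x (n + 1)\<bar> \<le> 2 \<or> \<bar>x n\<bar> \<le> 2"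
      using first[of n] by (auto simp: n)
    show "2 - V \<le> x (n + 2)" "x (n + 3) \<le> 2 + 11 * V" "x (n + 4) \<le> 2 + 11 * V"
      using first_escape[OF _ _ c d] esc by (auto simp: n numeral_eq_Suc)
  qed
  define Q where "Q = (\<lambda>i. 1 \<le> x (m - i) \<and> x (m - i) \<le> 2 + 12 * V \<and> 2 - (b i)^2 \<le> x (m - i))"
  have ok: "1 \<le> t" if "2 - (b i)^2 \<le> t" "2 * sqrt V * fib (i + 1) \<le> 1" for i t
  proof -
    have "b i \<le> 1" using that sV unfolding b_def by linarith
    then have "(b i)^2 \<le> 1" using b0[of i] by (simp add: power_le_one)
    then show ?thesis using that by linarith
  qed
  have "i \<le> m \<longrightarrow> 2 * sqrt V * fib (i + 1) \<le> 1 \<longrightarrow> Q i" for i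
  proof (induction i rule: less_induct)
    case (less i)
    show ?case
    proof (intro impI)
      assume im: "i \<le> m" and fi: "2 * sqrt V * fib (i + 1) \<le> 1"
      consider "i = 0" | "i = 1" | j where "i = j + 2"
        by (metis One_nat_def Suc_eq_plus1 add_2_eq_Suc' not0_implies_Suc)
      then show "Q i"
      proof cases
        case 1
        then show ?thesis using fe esc sV order_trans[of "2 - (b 0)^2" 2 "x (n + 3)"] V_pos unfolding Q_def by (auto simp: n)
      next
        case 2
        have "(b 1)^2 = V" using sV by (simp add: b_def)
        moreover have "x (n + 2) \<le> 2" using first[of "n + 2"] esc by (auto simp: n numeral_eq_Suc)
        ultimately show ?thesis using fe V_pos V_small unfolding Q_def 2 by (auto simp: n)
      next
        case 3
        have mono: "real (fib (j + 2)) \<le> fib (i + 1)" "real (fib (j + 1)) \<le> fib (i + 1)"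
          using fib_mono[of "j + 2" "i + 1"] fib_mono[of "j + 1" "i + 1"] 3 by auto
        have f1: "2 * sqrt V * fib (j + 2) \<le> 1" "2 * sqrt V * fib (j + 1) \<le> 1"
          using order_trans[OF mult_left_mono[OF mono(1), of "2 * sqrt V"] fi]
            order_trans[OF mult_left_mono[OF mono(2), of "2 * sqrt V"] fi] sV by auto
        define k where "k = m - i"
        have k: "m - (j + 1) = k + 1" "m - j = k + 2" "k < m" using im 3 by (auto simp: k_def)
        have Q1: "Q (j + 1)" "Q j"
          using less.IH[of "j + 1"] less.IH[of j] f1 im 3 by auto
        have q: "1 \<le> x (k + 1)" "x (k + 1) \<le> 2 + 12 * V" "2 - (b (j + 1))^2 \<le> x (k + 1)"
                "1 \<le> x (k + 2)" "x (k + 2) \<le> 2 + 12 * V" "2 - (b j)^2 \<le> x (k + 2)"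
          using Q1 unfolding Q_def k by auto
        have nb: "\<not> (2 < x (k + 1) \<and> 2 < x (k + 2))"
        proof -
          have "k + 1 < m" using im 3 by (simp add: k_def)
          then show ?thesis using first[of "k + 1"] q by (auto simp: numeral_eq_Suc)
        qed
        have "2 - (b (j + 1) + b j)^2 - V \<le> x k"
          by (rule backward_lower) (use q nb b0 in auto)
        moreover have "(b (j + 1) + b j)^2 + V \<le> (b (j + 2))^2"
          using b0[of j] b0[of "j + 1"] sV unfolding bstep by (simp add: power2_sum algebra_simps)
        ultimately have low: "2 - (b i)^2 \<le> x k" using 3 by simp
        have up: "x k \<le> 2 + 12 * V"
        proof (cases "x k \<le> 2")
          case True
          then show ?thesis using V_pos by simp
        next
          case False
          then have c1: "x (k + 1) \<le> 2"
            using first[of k] k(3) q(1) by auto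
          show ?thesis
          proof (cases "x (k + 2) \<le> 2")
            case True
            then show ?thesis using backward_upper[of k] c1 q V_pos by auto
          next
            case c2: False
            have b: "\<bar>x (k + 2) - x k\<bar> \<le> V" "x (k + 3) \<le> 2 \<Longrightarrow> x k \<le> 2 + 5 * V"
              using backward_upper_alternating[of k] c1 c2 False q by auto
            show ?thesis
            proof (cases "k + 2 = m")
              case True
              then have "x (k + 2) \<le> 2 + 11 * V" using fe(2) by (simp only: n)
              then show ?thesis using b(1) by linarith
            next
              case False
              then have "k + 2 < m" using im 3 by (auto simp: k_def)
              then have "x (k + 3) \<le> 2"
                using first[of "k + 2"] c2 by (auto simp: numeral_eq_Suc)
              from b(2)[OF this] show ?thesis using V_pos by linarith
            qed
          qed
        qed
        show ?thesis using low up ok[OF low fi] unfolding Q_def by (simp add: k_def)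
      qed
    qed
  qed
  then show ?thesis using i unfolding Q_def by blast
qed

text \<open>On the branch where \<open>x k\<close> is the smaller root, the discriminant gives
  \<open>x k \<le> 2 * cos (a + b)\<close>. Read forwards, the angles decrease at least as fast as
  reciprocals of Fibonacci numbers, which brings the traces close to 2.\<close>

lemma branch_angle:
  assumes "0 \<le> x (k + 1)" "x (k + 1) \<le> 2" "0 \<le> x (k + 2)" "x (k + 2) \<le> 2"
    and "x k \<le> x (k + 3)" "0 \<le> x k"
  shows "arccos (x (k + 1) / 2) + arccos (x (k + 2) / 2) \<le> arccos (x k / 2)"
proof -
  define a b where "a = arccos (x (k + 1) / 2)" and "b = arccos (x (k + 2) / 2)"
  have c: "x (k + 1) = 2 * cos a" "x (k + 2) = 2 * cos b"
    using assms by (auto simp: a_def b_def cos_arccos)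
  have ab: "0 \<le> a" "a \<le> pi / 2" "0 \<le> b" "b \<le> pi / 2"
    using assms arccos_le_pi2[of "x (k + 1) / 2"] arccos_le_pi2[of "x (k + 2) / 2"] by (auto simp: a_def b_def arccos_lbound)
  have s: "0 \<le> sin a" "0 \<le> sin b"
    using ab by (auto intro!: sin_ge_zero)
  define d where "d = x (k + 3) - x k"
  have d2: "d^2 = (4 * (sin a * sin b))^2 + 4 * V^2"
    unfolding d_def discriminant c by (simp add: power_mult_distrib sin_squared_eq algebra_simps)
  have "4 * (sin a * sin b) \<le> d"
    by (rule power2_le_imp_le) (use d2 assms in \<open>auto simp: d_def\<close>)
  moreover have "2 * x k = 4 * (cos a * cos b) - d"
    using roots_sum[of k] unfolding c by (simp add: d_def)
  ultimately have "x k \<le> 2 * cos (a + b)"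
    by (simp add: cos_add)
  moreover from this have "x k \<le> 2" using cos_le_one[of "a + b"] by linarith
  ultimately have "arccos (cos (a + b)) \<le> arccos (x k / 2)"
    using assms(6) by (intro arccos_le_mono[THEN iffD2]) auto
  then show ?thesis
    using ab by (simp add: arccos_cos a_def b_def)
qed

end

subsection \<open>Transfer matrices\<close>

type_synonym 'a mat2 = "'a \<times> 'a \<times> 'a \<times> 'a"

fun mat2_mul :: "'a::comm_ring_1 mat2 \<Rightarrow> 'a mat2 \<Rightarrow> 'a mat2" where
  "mat2_mul (a, b, c, d) (e, f, g, h) = (a * e + b * g, a * f + b * h, c * e + d * g, c * f + d * h)"

fun mat2_add :: "'a::comm_ring_1 mat2 \<Rightarrow> 'a mat2 \<Rightarrow> 'a mat2" where
  "mat2_add (a, b, c, d) (e, f, g, h) = (a + e, b + f, c + g, d + h)"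

fun mat2_app :: "'a::comm_ring_1 mat2 \<Rightarrow> 'a \<times> 'a \<Rightarrow> 'a \<times> 'a" where
  "mat2_app (a, b, c, d) (u, v) = (a * u + b * v, c * u + d * v)"

fun mat2_det :: "'a::comm_ring_1 mat2 \<Rightarrow> 'a" where
  "mat2_det (a, b, c, d) = a * d - b * c"

fun mat2_tr :: "'a::comm_ring_1 mat2 \<Rightarrow> 'a" where
  "mat2_tr (a, b, c, d) = a + d"

fun mat2_low :: "'a::comm_ring_1 mat2 \<Rightarrow> 'a" where
  "mat2_low (a, b, c, d) = c"

lemma mat2_app_mul: "mat2_app (mat2_mul A B) v = mat2_app A (mat2_app B v)"
  by (cases A; cases B; cases v) (simp add: algebra_simps)

lemma mat2_det_mul: "mat2_det (mat2_mul A B) = mat2_det A * mat2_det B"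
  by (cases A; cases B) (simp add: algebra_simps)

text \<open>Cayley-Hamilton in the form \<open>A * A = tr A * A - 1\<close>, together with the
  cyclicity of the trace. This is the source of the trace recursion.\<close>

lemma mat2_tr_conj:
  assumes "mat2_det A = 1"
  shows "mat2_tr (mat2_mul A (mat2_mul B A)) = mat2_tr (mat2_mul B A) * mat2_tr A - mat2_tr B"
proof -
  obtain a b c d e f g h where AB: "A = (a, b, c, d)" "B = (e, f, g, h)"
    by (cases A; cases B) auto
  have "mat2_tr (mat2_mul B A) * mat2_tr A - mat2_tr B - mat2_tr (mat2_mul A (mat2_mul B A))
      = (e + h) * (mat2_det A - 1)"
    unfolding AB by (simp add: algebra_simps)
  then show ?thesis using assms by simp
qed

lemma mat2_det_add_scalar: "mat2_det (mat2_add N (t, 0, 0, t)) = mat2_det N + t * mat2_tr N + t * t"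
  by (cases N) (simp add: algebra_simps)

text \<open>The indices are shifted so that for \<open>k \<ge> 2\<close> the matrix \<open>transfer V E k\<close> is the product of the
  one-step matrices over the first \<open>fib k\<close> sites (see \<open>transfer_word\<close>); index 0 is an auxiliary start
  of the recursion.\<close>

fun trace_seq :: "real \<Rightarrow> 'a::real_normed_field \<Rightarrow> nat \<Rightarrow> 'a" where
  "trace_seq V E 0 = 2"
| "trace_seq V E (Suc 0) = E"
| "trace_seq V E (Suc (Suc 0)) = E - of_real V"
| "trace_seq V E (Suc (Suc (Suc n))) = trace_seq V E (Suc (Suc n)) * trace_seq V E (Suc n) - trace_seq V E n"

fun transfer :: "real \<Rightarrow> 'a::real_normed_field \<Rightarrow> nat \<Rightarrow> 'a mat2" where
  "transfer V E 0 = (1, - of_real V, 0, 1)"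
| "transfer V E (Suc 0) = (E, -1, 1, 0)"
| "transfer V E (Suc (Suc n)) = mat2_mul (transfer V E n) (transfer V E (Suc n))"

lemma transfer_det: "mat2_det (transfer V E n) = 1"
  by (induction V E n rule: transfer.induct) (simp_all add: mat2_det_mul)

lemma transfer_tr: "mat2_tr (transfer V E n) = trace_seq V E n"
proof (induction V E n rule: trace_seq.induct)
  case (4 V E n)
  have "transfer V E (Suc (Suc (Suc n))) = mat2_mul (transfer V E (Suc n)) (mat2_mul (transfer V E n) (transfer V E (Suc n)))"
    by simp
  then show ?case
    using mat2_tr_conj[OF transfer_det, of V E "Suc n" "transfer V E n"] 4 by simp
qed simp_all

lemma trace_seq_of_real: "trace_seq V (of_real E :: 'a::real_normed_field) n = of_real (trace_seq V E n)"
  by (induction V "of_real E :: 'a" n rule: trace_seq.induct) simp_all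

lemma trace_seq_cnj: "trace_seq V (cnj E) n = cnj (trace_seq V E n)"
  by (induction V E n rule: trace_seq.induct) simp_all

lemma trace_orbit_trace_seq:
  assumes "0 < V" "V \<le> 1/1000"
  shows "trace_orbit V (trace_seq V (E :: real))"
proof
  show "trace_seq V E (n + 3) = trace_seq V E (n + 2) * trace_seq V E (n + 1) - trace_seq V E n" for n
    by (simp add: numeral_eq_Suc)
  show "(trace_seq V E 2)^2 + (trace_seq V E 1)^2 + (trace_seq V E 0)^2 - trace_seq V E 2 * trace_seq V E 1 * trace_seq V E 0 = 4 + V^2"
    by (simp add: numeral_2_eq_2) (simp add: power2_eq_square algebra_simps)
qed (use assms in auto)

lemma continuous_on_trace_seq [continuous_intros]:
  "continuous_on S (\<lambda>E :: 'a::real_normed_field. trace_seq V E n)"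
  by (induction V "0::'a" n rule: trace_seq.induct) (auto intro!: continuous_intros)

subsection \<open>Monotonicity in the energy\<close>

text \<open>The form \<open>Im (v\<^sub>1 * cnj v\<^sub>2)\<close> is invariant under real transfer matrices; its growth for
  \<open>Im E > 0\<close> is what keeps \<open>X n\<close> off \<open>{-2..2}\<close> away from the real line.\<close>

definition wronskian :: "complex \<times> complex \<Rightarrow> real" where
  "wronskian v = Im (fst v * cnj (snd v))"

text \<open>Both inequalities are needed: if the form does not grow, the first one annihilates the
  first component of the vector and the second one the second component of its image, and together
  they force the vector to vanish.\<close>

definition expanding :: "real \<Rightarrow> complex mat2 \<Rightarrow> bool" where
  "expanding y M \<longleftrightarrow> (\<forall>v. wronskian v + y * (cmod (fst v))^2 \<le> wronskian (mat2_app M v) \<and>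
     wronskian v + y * (cmod (snd (mat2_app M v)))^2 \<le> wronskian (mat2_app M v))"

text \<open>The one-step matrix increases the form by exactly
  \<open>Im E * (cmod (fst v))^2\<close>, and the shear at index 0 preserves it and the second
  component. For a product, the first inequality comes from the factor applied first and the second
  from the factor applied last.\<close>

lemma expanding_transfer:
  assumes "0 \<le> Im E" "1 \<le> n"
  shows "expanding (Im E) (transfer V E n)"
proof -
  have base: "wronskian (mat2_app (transfer V E (Suc 0)) v) = wronskian v + Im E * (cmod (fst v))^2" for v
    by (cases v) (simp add: wronskian_def cmod_power2, simp add: power2_eq_square algebra_simps)
  have base0: "wronskian (mat2_app (transfer V E 0) v) = wronskian v" for v
    by (cases v) (simp add: wronskian_def algebra_simps)
  have "expanding (Im E) (transfer V E (Suc n)) \<and> expanding (Im E) (transfer V E (Suc (Suc n)))" for n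
  proof (induction n)
    case 0
    have "expanding (Im E) (transfer V E (Suc 0))"
      unfolding expanding_def using base by (auto split: prod.splits)
    moreover have "snd (mat2_app (transfer V E 0) v) = snd v" for v
      by (cases v) simp
    ultimately show ?case
      unfolding expanding_def by (simp add: mat2_app_mul base0 del: transfer.simps(1,2))
  next
    case (Suc n)
    have "expanding (Im E) (mat2_mul A B)" if "expanding (Im E) A" "expanding (Im E) B" for A B
      unfolding expanding_def mat2_app_mul
    proof (intro allI conjI)
      fix v
      have "wronskian (mat2_app B v) \<le> wronskian (mat2_app A (mat2_app B v))"
        using that(1) assms(1) unfolding expanding_def
        by (meson add_increasing2 dual_order.trans mult_nonneg_nonneg order_refl zero_le_power2 le_add_same_cancel1)
      moreover have "wronskian v \<le> wronskian (mat2_app B v)"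
        using that(2) assms(1) unfolding expanding_def
        by (meson add_increasing2 dual_order.trans mult_nonneg_nonneg order_refl zero_le_power2 le_add_same_cancel1)
      ultimately show "wronskian v + Im E * (cmod (fst v))^2 \<le> wronskian (mat2_app A (mat2_app B v))"
        "wronskian v + Im E * (cmod (snd (mat2_app A (mat2_app B v))))^2 \<le> wronskian (mat2_app A (mat2_app B v))"
        using that unfolding expanding_def by (smt (verit))+
    qed
    then show ?case using Suc by simp
  qed
  then show ?thesis using assms(2) by (cases n) auto
qed

lemma mat2_kernel:
  fixes K :: "complex mat2"
  assumes "mat2_det K = 0"
  shows "\<exists>v. v \<noteq> (0, 0) \<and> mat2_app K v = (0, 0)"
proof -
  obtain a b c d where K: "K = (a, b, c, d)" by (cases K)
  have det: "a * d = b * c" using assms by (simp add: K)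
  show ?thesis
  proof (cases "a = 0 \<and> b = 0")
    case True
    show ?thesis
    proof (cases "c = 0 \<and> d = 0")
      case T2: True
      then show ?thesis using True by (intro exI[of _ "(1, 0)"]) (simp add: K)
    next
      case False
      then show ?thesis using True by (intro exI[of _ "(d, - c)"]) (auto simp: K)
    qed
  next
    case False
    then show ?thesis using det by (intro exI[of _ "(b, - a)"]) (auto simp: K algebra_simps)
  qed
qed

text \<open>A trace between -2 and 2 and determinant 1 give an eigenvalue on the unit circle. The
  form takes the same value at an eigenvector and at its image, which contradicts its
  growth.\<close>

lemma trace_seq_not_in_band:
  assumes "Im E > 0" "1 \<le> n" "\<bar>t\<bar> \<le> 2"
  shows "trace_seq V E n \<noteq> of_real t"
proof
  assume t: "trace_seq V E n = of_real t"
  obtain a b c d where M: "transfer V E n = (a, b, c, d)" by (cases "transfer V E n")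
  have det: "a * d - b * c = 1" using transfer_det[of V E n] by (simp add: M)
  have tr: "a + d = of_real t" using transfer_tr[of V E n] t by (simp add: M)
  define \<theta> where "\<theta> = arccos (t / 2)"
  have ct: "t = 2 * cos \<theta>" using assms(3) by (simp add: \<theta>_def cos_arccos)
  define l where "l = cis \<theta>"
  have l1: "cmod l = 1" by (simp add: l_def)
  then have ll: "l * cnj l = 1" by (simp add: complex_norm_square[symmetric])
  have "of_real t = l + cnj l" by (simp add: l_def ct complex_eq_iff)
  then have l: "cmod l = 1" "l * l - of_real t * l + 1 = 0"
    using l1 ll by (simp_all add: algebra_simps)
  have "mat2_det (a - l, b, c, d - l) = 0"
  proof -
    have "(a - l) * (d - l) - b * c = (a * d - b * c) - l * (a + d) + l * l" by (simp add: algebra_simps)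
    then show ?thesis using l det tr by (simp add: algebra_simps)
  qed
  then obtain v where v: "v \<noteq> (0, 0)" "mat2_app (a - l, b, c, d - l) v = (0, 0)"
    using mat2_kernel by blast
  then have Mv: "mat2_app (transfer V E n) v = (l * fst v, l * snd v)"
    by (cases v) (simp add: M algebra_simps)
  have "l * fst v * cnj (l * snd v) = (l * cnj l) * (fst v * cnj (snd v))"
    by (simp only: complex_cnj_mult mult_ac)
  then have "wronskian (mat2_app (transfer V E n) v) = wronskian v"
    unfolding Mv wronskian_def fst_conv snd_conv by (simp only: ll mult_1)
  then have "Im E * (cmod (fst v))^2 \<le> 0" "Im E * (cmod (l * snd v))^2 \<le> 0"
    using expanding_transfer[of E n V] assms Mv unfolding expanding_def by (smt (verit) snd_conv)+
  then have "fst v = 0" "snd v = 0"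
    using assms(1) l by (auto simp: mult_le_0_iff norm_mult)
  then show False using v(1) by (simp add: prod_eq_iff)
qed

text \<open>The pieces \<open>A\<close> and \<open>B\<close> are joined into a closed system by a
  unitary scattering matrix with reflection amplitude \<open>\<i> * r\<close> and transmission
  amplitude \<open>s\<close>. Pure reflection would decouple them and give the condition
  \<open>tr A * tr B = 0\<close>; pure transmission gives \<open>tr (B A) = - 2 * e\<close>. The
  expression is, up to the sign \<open>e\<close>, the determinant of the mixed system. A solution
  would conserve the total form, against the growth in both pieces.\<close>

lemma expanding_interlacing:
  fixes A B :: "complex mat2" and r s :: real
  assumes A: "mat2_det A = 1" "expanding y A" and B: "mat2_det B = 1" "expanding y B" and y: "0 < y"
    and rs: "r^2 + s^2 = 1" "s \<noteq> 0" and e: "e = 1 \<or> e = -1"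
  shows "of_real (r^2) * (mat2_tr A * mat2_tr B) + of_real (s^2) * (mat2_tr (mat2_mul B A) + 2 * of_real e) \<noteq> 0"
proof
  assume z: "of_real (r^2) * (mat2_tr A * mat2_tr B) + of_real (s^2) * (mat2_tr (mat2_mul B A) + 2 * of_real e) = 0"
  obtain a b c d where Ae: "A = (a, b, c, d)" by (cases A)
  obtain e' f g h where Be: "B = (e', f, g, h)" by (cases B)
  define R S \<epsilon> where "R = \<i> * of_real r" and "S = complex_of_real s" and "\<epsilon> = complex_of_real e"
  have RS: "S * S - R * R = 1"
    using rs(1) unfolding R_def S_def by (simp add: complex_eq_iff power2_eq_square)
  have e2: "\<epsilon> * \<epsilon> = 1" using e by (auto simp: \<epsilon>_def)
  have dA: "a * d - b * c = 1" and dB: "e' * h - f * g = 1" using A B by (auto simp: Ae Be)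
  have z': "- (R * R) * ((a + d) * (e' + h)) + S * S * (e' * a + f * c + (g * b + h * d) + 2 * \<epsilon>) = 0"
  proof -
    have "- (R * R) = of_real (r^2)" "S * S = of_real (s^2)"
      by (simp_all add: R_def S_def complex_eq_iff power2_eq_square)
    then show ?thesis using z by (simp add: Ae Be \<epsilon>_def)
  qed
  \<comment> \<open>The system reads \<open>A v1 = p\<close> and \<open>B v2 = q\<close>, where
    \<open>v1 = R * p + S * q\<close> and \<open>v2 = - \<epsilon> * (S * p + R * q)\<close>.
    Eliminating \<open>q\<close> with the inverse matrices leaves the equation
    \<open>K p = 0\<close>.\<close>
  define K where "K = mat2_add (mat2_mul (h + \<epsilon> * R, - f, - g, e' + \<epsilon> * R) (d - R, - b, - c, a - R)) (\<epsilon> * S * S, 0, 0, \<epsilon> * S * S)"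
  define x y' z where "x = a + d" and "y' = e' + h" and "z = e' * a + f * c + (g * b + h * d)"
  have SS: "S * S = 1 + R * R" using RS by (simp add: algebra_simps)
  define N1 N2 where "N1 = (h + \<epsilon> * R, - f, - g, e' + \<epsilon> * R)" and "N2 = (d - R, - b, - c, a - R)"
  have N1: "mat2_det N1 = 1 + \<epsilon> * R * y' + R * R"
    using dB e2 by (simp add: N1_def y'_def algebra_simps)
  have N2: "mat2_det N2 = 1 - R * x + R * R"
    using dA by (simp add: N2_def x_def algebra_simps)
  have N12: "mat2_tr (mat2_mul N1 N2) = z - R * y' + \<epsilon> * R * x - 2 * \<epsilon> * (R * R)"
    by (simp add: N1_def N2_def x_def y'_def z_def algebra_simps)
  have "mat2_det K = mat2_det N1 * mat2_det N2 + \<epsilon> * S * S * mat2_tr (mat2_mul N1 N2) + \<epsilon> * S * S * (\<epsilon> * S * S)"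
    unfolding K_def N1_def[symmetric] N2_def[symmetric] mat2_det_add_scalar mat2_det_mul by (rule refl)
  also have "\<dots> = (1 + \<epsilon> * R * y' + R * R) * (1 - R * x + R * R)
      + \<epsilon> * (S * S) * (z - R * y' + \<epsilon> * R * x - 2 * \<epsilon> * (R * R)) + \<epsilon> * (S * S) * (\<epsilon> * (S * S))"
    unfolding N1 N2 N12 by (simp only: mult.assoc)
  also have "\<dots> = \<epsilon> * (- (R * R) * (x * y') + S * S * (z + 2 * \<epsilon>))"
    unfolding SS using e by (auto simp: \<epsilon>_def algebra_simps)
  finally have "mat2_det K = 0"
    using z' unfolding x_def y'_def z_def by simp
  then obtain p where p: "p \<noteq> (0, 0)" "mat2_app K p = (0, 0)"
    using mat2_kernel by blast
  obtain p1 p2 where pp: "p = (p1, p2)" by (cases p)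
  define q1 q2 where "q1 = ((d - R) * p1 - b * p2) / S" and "q2 = (- c * p1 + (a - R) * p2) / S"
  have S0: "S \<noteq> 0" using rs by (simp add: S_def)
  have Sq: "S * q1 = (d - R) * p1 - b * p2" "S * q2 = - c * p1 + (a - R) * p2"
    using S0 by (auto simp: q1_def q2_def)
  define v1 where "v1 = (R * p1 + S * q1, R * p2 + S * q2)"
  define v2 where "v2 = (- \<epsilon> * (S * p1 + R * q1), - \<epsilon> * (S * p2 + R * q2))"
  have Av1: "mat2_app A v1 = p"
  proof -
    have "a * (R * p1 + S * q1) + b * (R * p2 + S * q2) = (a * d - b * c) * p1"
      "c * (R * p1 + S * q1) + d * (R * p2 + S * q2) = (a * d - b * c) * p2"
      unfolding Sq by (simp_all add: algebra_simps)
    then show ?thesis using dA by (simp add: v1_def Ae pp)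
  qed
  have Bv2: "mat2_app B v2 = (q1, q2)"
  proof -
    have "(h + \<epsilon> * R) * (S * q1) - f * (S * q2) + \<epsilon> * S * S * p1 = 0"
      "- g * (S * q1) + (e' + \<epsilon> * R) * (S * q2) + \<epsilon> * S * S * p2 = 0"
      using p(2) unfolding pp K_def Sq by (simp_all add: algebra_simps)
    then have "S * ((h + \<epsilon> * R) * q1 - f * q2 + \<epsilon> * S * p1) = 0" "S * (- g * q1 + (e' + \<epsilon> * R) * q2 + \<epsilon> * S * p2) = 0"
      by (simp_all add: algebra_simps)
    then have "(h + \<epsilon> * R) * q1 - f * q2 + \<epsilon> * S * p1 = 0" "- g * q1 + (e' + \<epsilon> * R) * q2 + \<epsilon> * S * p2 = 0"
      using S0 by (simp_all only: mult_eq_0_iff simp_thms)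
    then have n: "h * q1 - f * q2 = - \<epsilon> * (S * p1 + R * q1)" "- g * q1 + e' * q2 = - \<epsilon> * (S * p2 + R * q2)"
      by (simp_all add: algebra_simps add_eq_0_iff)
    have "e' * (h * q1 - f * q2) + f * (- g * q1 + e' * q2) = (e' * h - f * g) * q1"
      "g * (h * q1 - f * q2) + h * (- g * q1 + e' * q2) = (e' * h - f * g) * q2"
      by (simp_all add: algebra_simps)
    then show ?thesis unfolding v2_def Be mat2_app.simps n[symmetric] dB by simp
  qed
  have W: "wronskian v1 + wronskian v2 = (r^2 + s^2) * (wronskian p + wronskian (q1, q2))"
    using e unfolding v1_def v2_def pp wronskian_def R_def S_def \<epsilon>_def
    by (auto simp: power2_eq_square algebra_simps)
  have "wronskian v1 + y * (cmod (fst v1))^2 \<le> wronskian p" "wronskian v1 \<le> wronskian p"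
    "wronskian v2 \<le> wronskian (q1, q2)" "wronskian v1 + y * (cmod p2)^2 \<le> wronskian p"
    "wronskian v2 + y * (cmod q2)^2 \<le> wronskian (q1, q2)"
  proof -
    have "0 \<le> y * (cmod t)^2" for t using y by simp
    moreover have "wronskian v1 + y * (cmod (fst v1))^2 \<le> wronskian p" "wronskian v1 + y * (cmod p2)^2 \<le> wronskian p"
      "wronskian v2 + y * (cmod (fst v2))^2 \<le> wronskian (q1, q2)" "wronskian v2 + y * (cmod q2)^2 \<le> wronskian (q1, q2)"
      using A(2) B(2) Av1 Bv2 unfolding expanding_def by (metis pp snd_conv)+
    ultimately show "wronskian v1 + y * (cmod (fst v1))^2 \<le> wronskian p" "wronskian v1 \<le> wronskian p"
      "wronskian v2 \<le> wronskian (q1, q2)" "wronskian v1 + y * (cmod p2)^2 \<le> wronskian p"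
      "wronskian v2 + y * (cmod q2)^2 \<le> wronskian (q1, q2)"
      by (smt (verit))+
  qed
  then have "y * (cmod (fst v1))^2 \<le> 0" "y * (cmod p2)^2 \<le> 0" "y * (cmod q2)^2 \<le> 0"
    using W rs(1) by auto
  then have "fst v1 = 0" "p2 = 0" "q2 = 0"
    using y by (auto simp: mult_le_0_iff)
  then have "v1 = (0, 0)" by (simp add: v1_def)
  then have "p = (0, 0)" using Av1 by (simp add: Ae)
  then show False using p(1) by simp
qed


section \<open>Derivatives in the energy and the orientation of neighbouring traces\<close>

fun transfer_deriv :: "real \<Rightarrow> real \<Rightarrow> nat \<Rightarrow> real mat2" where
  "transfer_deriv V E 0 = (0, 0, 0, 0)"
| "transfer_deriv V E (Suc 0) = (1, 0, 0, 0)"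
| "transfer_deriv V E (Suc (Suc n)) = mat2_add (mat2_mul (transfer_deriv V E n) (transfer V E (Suc n)))
     (mat2_mul (transfer V E n) (transfer_deriv V E (Suc n)))"

fun mat2_entry :: "nat \<Rightarrow> 'a mat2 \<Rightarrow> 'a" where
  "mat2_entry i (a, b, c, d) = (if i = 0 then a else if i = 1 then b else if i = 2 then c else d)"

lemma transfer_has_derivative:
  "((\<lambda>E. mat2_entry i (transfer V E n)) has_real_derivative mat2_entry i (transfer_deriv V E n)) (at E)"
proof (induction n arbitrary: i rule: less_induct)
  case (less n)
  consider "n = 0" | "n = 1" | k where "n = Suc (Suc k)"
    by (metis One_nat_def not0_implies_Suc)
  then show ?case
  proof cases
    case 3
    have entry: "mat2_entry i (mat2_mul A B) = (if i = 0 then mat2_entry 0 A * mat2_entry 0 B + mat2_entry 1 A * mat2_entry 2 B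
        else if i = 1 then mat2_entry 0 A * mat2_entry 1 B + mat2_entry 1 A * mat2_entry 3 B
        else if i = 2 then mat2_entry 2 A * mat2_entry 0 B + mat2_entry 3 A * mat2_entry 2 B
        else mat2_entry 2 A * mat2_entry 1 B + mat2_entry 3 A * mat2_entry 3 B)" for A B :: "real mat2"
      by (cases A; cases B) simp
    have add: "mat2_entry i (mat2_add A B) = mat2_entry i A + mat2_entry i B" for A B :: "real mat2"
      by (cases A; cases B) simp
    note d1 = less.IH[of k] less.IH[of "Suc k"]
    show ?thesis
      unfolding 3 transfer.simps transfer_deriv.simps entry add
      using 3 by (auto intro!: derivative_eq_intros d1 simp: algebra_simps)
  qed (auto intro!: derivative_eq_intros)
qed

definition trace_deriv :: "real \<Rightarrow> real \<Rightarrow> nat \<Rightarrow> real" where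
  "trace_deriv V E n = mat2_tr (transfer_deriv V E n)"

lemma trace_seq_has_derivative:
  "((\<lambda>E. trace_seq V E n) has_real_derivative trace_deriv V E n) (at E)"
proof -
  have t: "mat2_tr A = mat2_entry 0 A + mat2_entry 3 A" for A :: "real mat2"
    by (cases A) simp
  show ?thesis
    unfolding transfer_tr[symmetric] trace_deriv_def t
    by (intro DERIV_add transfer_has_derivative)
qed

definition wedge :: "real \<times> real \<Rightarrow> real \<times> real \<Rightarrow> real" where
  "wedge u v = fst u * snd v - snd u * fst v"

lemma wedge_mat2_app: "wedge (mat2_app A u) (mat2_app A v) = mat2_det A * wedge u v"
  by (cases A; cases u; cases v) (simp add: wedge_def algebra_simps)

text \<open>As the energy grows, the image of a fixed vector turns in one direction only. The
  one-step matrix contributes \<open>(fst v)^2\<close>, and matrices of determinant 1 preserve the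
  wedge product, so the contributions of the factors of a product add up.\<close>

lemma transfer_twist:
  "wedge (mat2_app (transfer_deriv V E n) v) (mat2_app (transfer V E n) v) \<ge> (if n = 0 then 0 else (fst v)^2)"
proof (induction V E n arbitrary: v rule: transfer_deriv.induct)
  case (3 V E n)
  define u where "u = mat2_app (transfer V E (Suc n)) v"
  define w where "w = mat2_app (transfer_deriv V E (Suc n)) v"
  have add: "mat2_app (mat2_add A B) v = (fst (mat2_app A v) + fst (mat2_app B v), snd (mat2_app A v) + snd (mat2_app B v))"
    for A B :: "real mat2" and v
    by (cases A; cases B; cases v) (simp add: algebra_simps)
  have "wedge (mat2_app (transfer_deriv V E (Suc (Suc n))) v) (mat2_app (transfer V E (Suc (Suc n))) v)
     = wedge (mat2_app (transfer_deriv V E n) u) (mat2_app (transfer V E n) u)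
       + wedge (mat2_app (transfer V E n) w) (mat2_app (transfer V E n) u)"
    unfolding transfer_deriv.simps transfer.simps add mat2_app_mul u_def[symmetric] w_def[symmetric]
    by (simp add: wedge_def algebra_simps)
  also have "\<dots> = wedge (mat2_app (transfer_deriv V E n) u) (mat2_app (transfer V E n) u) + wedge w u"
    by (simp add: wedge_mat2_app transfer_det)
  also have "\<dots> \<ge> (fst v)^2"
  proof -
    have "0 \<le> (if n = 0 then 0 else (fst u)^2)" by simp
    from order_trans[OF this 3(1)[of u]] show ?thesis
      using 3(2)[of v] unfolding u_def w_def by simp
  qed
  finally show ?case by simp
next
  case (1 V E)
  then show ?case by (cases v) (simp add: wedge_def)
next
  case (2 V E)
  then show ?case by (cases v) (simp add: wedge_def power2_eq_square)
qed

text \<open>In particular each trace is strictly monotone in the energy wherever its modulus is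
  below 2, in the direction given by the sense of rotation, that is, by the sign of the lower left
  entry.\<close>

lemma elliptic_twist:
  assumes "1 \<le> n" "\<bar>trace_seq V E n\<bar> < 2"
  shows "0 < mat2_low (transfer V E n) * trace_deriv V E n"
proof -
  obtain a b c d where M: "transfer V E n = (a, b, c, d)" by (cases "transfer V E n")
  obtain a' b' c' d' where D: "transfer_deriv V E n = (a', b', c', d')" by (cases "transfer_deriv V E n")
  have det: "a * d - b * c = 1" using transfer_det[of V E n] by (simp add: M)
  have tr: "a + d = trace_seq V E n" using transfer_tr[of V E n] by (simp add: M)
  have det': "a' * d + a * d' - b' * c - b * c' = 0"
  proof -
    have der: "((\<lambda>E. mat2_entry i (transfer V E n)) has_real_derivative mat2_entry i (a', b', c', d')) (at E)" for i
      using transfer_has_derivative[of i V n E] by (simp add: D)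
    have "((\<lambda>E. mat2_entry 0 (transfer V E n) * mat2_entry 3 (transfer V E n) - mat2_entry 1 (transfer V E n) * mat2_entry 2 (transfer V E n))
       has_real_derivative (a' * d + a * d' - b' * c - b * c')) (at E)"
      using M by (auto intro!: derivative_eq_intros der)
    moreover have "mat2_entry 0 A * mat2_entry 3 A - mat2_entry 1 A * mat2_entry 2 A = mat2_det A" for A :: "real mat2"
      by (cases A) simp
    ultimately have "((\<lambda>E. 1) has_real_derivative (a' * d + a * d' - b' * c - b * c')) (at E)"
      by (simp add: transfer_det)
    then show ?thesis using DERIV_unique[OF _ DERIV_const] by blast
  qed
  define F where "F = (\<lambda>u v. (a' * u + b' * v) * (c * u + d * v) - (c' * u + d' * v) * (a * u + b * v))"
  have F: "u^2 \<le> F u v" for u v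
    using transfer_twist[where v = "(u, v)", of n V E] assms(1) by (simp add: M D wedge_def F_def)
  \<comment> \<open>The vector \<open>(p, c)\<close> is the image of \<open>(1, 0)\<close> under the
    transfer matrix minus half its trace. With the determinant and its derivative inserted,
    \<open>c * (a' + d')\<close> becomes \<open>F p c + F 1 0 * (1 - (tr / 2)^2)\<close>, a sum of a
    nonnegative and a positive term.\<close>
  define p where "p = (a - d) / 2"
  have "F p c = c * (a' + d') + F 1 0 * (p^2 + b * c)"
  proof -
    have "4 * F p c - 4 * (c * (a' + d') + F 1 0 * (p^2 + b * c))
      = 4 * c * c * (b' * d - d' * b) + 2 * c * (a - d) * (a' * d + b' * c - c' * b - d' * a) - 4 * c * (a' + d') - 4 * (a' * c - c' * a) * (b * c)"
      unfolding F_def p_def by (simp add: power2_eq_square field_simps)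
    also have "\<dots> = 2 * c * ((a + d) * (a' * d + a * d' - b' * c - b * c') * (-1) + 2 * (a' + d') * (a * d - b * c) - 2 * (a' + d'))"
      by (simp add: algebra_simps)
    also have "\<dots> = 0" unfolding det det' by simp
    finally show ?thesis by simp
  qed
  moreover have "p^2 + b * c = ((a + d) / 2)^2 - (a * d - b * c)"
    unfolding p_def by (simp add: power2_eq_square field_simps)
  then have "p^2 + b * c = (trace_seq V E n / 2)^2 - 1" unfolding det tr .
  ultimately have "F p c = c * (a' + d') + F 1 0 * ((trace_seq V E n / 2)^2 - 1)"
    by (simp only:)
  then have "c * (a' + d') = F p c + F 1 0 * (1 - (trace_seq V E n / 2)^2)"
    by (simp add: right_diff_distrib)
  moreover have "(trace_seq V E n / 2)^2 < 1"
    using assms(2) by (simp add: abs_square_less_1)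
  moreover have "0 \<le> F p c" using F[of p c] zero_le_power2[of p] by linarith
  moreover have "0 < F 1 0 * (1 - (trace_seq V E n / 2)^2)"
    using F[of 1 0] \<open>(trace_seq V E n / 2)^2 < 1\<close> by (intro mult_pos_pos) auto
  ultimately show ?thesis by (simp add: M D trace_deriv_def)
qed

text \<open>Ellipticity means \<open>b * c < - (p^2)\<close> and \<open>f * g < - (q^2)\<close>;
  inserting this leaves minus twice a square. The geometric content is that rotations in the same
  sense add their angles and rotations in opposite senses subtract them.\<close>

lemma elliptic_pair_orientation:
  fixes A B :: "real mat2"
  assumes "mat2_det A = 1" "mat2_det B = 1" "\<bar>mat2_tr A\<bar> < 2" "\<bar>mat2_tr B\<bar> < 2"
  shows "(2 * mat2_tr (mat2_mul B A) - mat2_tr A * mat2_tr B) * (mat2_low A * mat2_low B) < 0"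
proof -
  obtain a b c d where A: "A = (a, b, c, d)" by (cases A)
  obtain e f g h where B: "B = (e, f, g, h)" by (cases B)
  define p q where "p = (a - d) / 2" and "q = (e - h) / 2"
  have "p^2 + b * c = (mat2_tr A / 2)^2 - mat2_det A" "q^2 + f * g = (mat2_tr B / 2)^2 - mat2_det B"
    unfolding p_def q_def A B by (simp_all add: power2_eq_square field_simps)
  moreover have "(mat2_tr A / 2)^2 < 1" "(mat2_tr B / 2)^2 < 1"
    using assms by (simp_all add: abs_square_less_1)
  ultimately have bc: "b * c < - (p^2)" "f * g < - (q^2)" using assms by auto
  have c0: "c \<noteq> 0" "g \<noteq> 0"
    using bc zero_le_power2[of p] zero_le_power2[of q] by auto
  have "(2 * mat2_tr (mat2_mul B A) - mat2_tr A * mat2_tr B) * (c * g)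
      = 4 * (p * q) * (c * g) + 2 * (f * g) * c^2 + 2 * (b * c) * g^2"
    unfolding p_def q_def A B by (simp add: power2_eq_square field_simps)
  also have "\<dots> < 4 * (p * q) * (c * g) + 2 * (- (q^2)) * c^2 + 2 * (- (p^2)) * g^2"
    using bc c0 by (intro add_strict_mono add_le_less_mono mult_strict_right_mono mult_strict_left_mono) auto
  also have "\<dots> = - 2 * (q * c - p * g)^2" by (simp add: power2_eq_square algebra_simps)
  also have "\<dots> \<le> 0" by simp
  finally show ?thesis by (simp add: A B)
qed

text \<open>The two candidates for \<open>X (n + 2)\<close> given \<open>X (n + 1)\<close> and \<open>X n\<close> are separated by
  \<open>X (n + 1) * X n / 2\<close>; the lemma tells which one occurs from the signs of the derivatives.\<close>

lemma trace_orientation: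
  assumes "1 \<le> n" "\<bar>trace_seq V E n\<bar> < 2" "\<bar>trace_seq V E (n + 1)\<bar> < 2"
  shows "(2 * trace_seq V E (n + 2) - trace_seq V E (n + 1) * trace_seq V E n) * (trace_deriv V E (n + 1) * trace_deriv V E n) < 0"
proof -
  define A B where "A = transfer V E (n + 1)" and "B = transfer V E n"
  define cA cB dA dB where "cA = mat2_low A" and "cB = mat2_low B"
    and "dA = trace_deriv V E (n + 1)" and "dB = trace_deriv V E n"
  have AB: "mat2_tr A = trace_seq V E (n + 1)" "mat2_tr B = trace_seq V E n" "mat2_tr (mat2_mul B A) = trace_seq V E (n + 2)"
    using transfer_tr[of V E "n + 2"] by (auto simp: A_def B_def transfer_tr)
  define r where "r = 2 * trace_seq V E (n + 2) - trace_seq V E (n + 1) * trace_seq V E n"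
  have 1: "r * (cA * cB) < 0"
    using elliptic_pair_orientation[of A B] assms AB unfolding r_def cA_def cB_def A_def B_def by (simp add: transfer_det)
  have 2: "0 < cA * dA" "0 < cB * dB"
    using elliptic_twist[of n V E] elliptic_twist[of "n + 1" V E] assms by (auto simp: cA_def cB_def A_def B_def dA_def dB_def)
  have "(r * (cA * cB)) * ((cA * dA) * (cB * dB)) < 0"
    by (rule mult_neg_pos[OF 1 mult_pos_pos[OF 2]])
  also have "(r * (cA * cB)) * ((cA * dA) * (cB * dB)) = (r * (dA * dB)) * ((cA * cB) * (cA * cB))"
    by (simp only: mult_ac)
  finally have "r * (dA * dB) < 0"
    by (metis mult_nonneg_nonneg not_less zero_le_square)
  then show ?thesis by (simp add: r_def dA_def dB_def)
qed

section \<open>Reality of the roots of the trace polynomials\<close>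

lemma complex_poly_factors:
  fixes p :: "complex poly"
  assumes "p \<noteq> 0"
  shows "\<exists>as. length as = degree p \<and> (\<forall>E. poly p E = lead_coeff p * (\<Prod>a\<leftarrow>as. E - a))"
  using assms
proof (induction "degree p" arbitrary: p)
  case 0
  then obtain c where "p = [:c:]" by (metis degree_eq_zeroE)
  then show ?case by (intro exI[of _ "[]"]) simp
next
  case (Suc n)
  then have "\<not> constant (poly p)" by (metis constant_degree Zero_not_Suc)
  then obtain a where "poly p a = 0" using fundamental_theorem_of_algebra by blast
  then obtain q where q: "p = [:- a, 1:] * q" by (metis dvdE poly_eq_0_iff_dvd)
  then have q0: "q \<noteq> 0" using Suc.prems by auto
  have "degree p = degree [:- a, 1:] + degree q" "lead_coeff p = lead_coeff [:- a, 1:] * lead_coeff q"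
    unfolding q by (rule degree_mult_eq[OF _ q0], simp) (rule lead_coeff_mult)
  then have deg: "degree p = Suc (degree q)" "lead_coeff p = lead_coeff q" by simp_all
  then obtain as where as: "length as = degree q" "\<forall>E. poly q E = lead_coeff q * (\<Prod>a\<leftarrow>as. E - a)"
    using Suc.hyps(1)[of q] Suc.hyps(2) q0 by auto
  have "poly p E = (E - a) * poly q E" for E
    by (simp add: q algebra_simps)
  then show ?case
    using as deg(1) unfolding deg(2) by (intro exI[of _ "a # as"]) (simp add: mult_ac)
qed

fun trace_poly :: "real \<Rightarrow> nat \<Rightarrow> complex poly" where
  "trace_poly V 0 = [:2:]"
| "trace_poly V (Suc 0) = [:0, 1:]"
| "trace_poly V (Suc (Suc 0)) = [:- of_real V, 1:]"
| "trace_poly V (Suc (Suc (Suc n))) = trace_poly V (Suc (Suc n)) * trace_poly V (Suc n) - trace_poly V n"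

lemma poly_trace_poly: "poly (trace_poly V n) E = trace_seq V E n"
  by (induction V n rule: trace_poly.induct) (simp_all)

lemma trace_poly_degree: "degree (trace_poly V n) = fib n \<and> (1 \<le> n \<longrightarrow> lead_coeff (trace_poly V n) = 1)"
proof (induction V n rule: trace_poly.induct)
  case (4 V n)
  define p q r where "p = trace_poly V (Suc (Suc n))" and "q = trace_poly V (Suc n)" and "r = trace_poly V n"
  have pq: "degree p = fib (Suc (Suc n))" "lead_coeff p = 1" "degree q = fib (Suc n)" "lead_coeff q = 1" "degree r = fib n"
    using 4 by (auto simp: p_def q_def r_def)
  have nz: "p \<noteq> 0" "q \<noteq> 0" using pq by auto
  have deg: "degree (p * q) = fib (Suc (Suc (Suc n)))"
    using nz pq by (simp add: degree_mult_eq)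
  have lc: "lead_coeff (p * q) = 1" using pq by (simp add: lead_coeff_mult)
  have less: "degree r < degree (p * q)"
  proof -
    have "0 < fib (Suc n)" "fib n \<le> fib (Suc n)" by (auto intro: fib_neq_0_nat fib_Suc_mono)
    moreover have "fib (Suc n) \<le> fib (Suc (Suc n))" by (rule fib_Suc_mono)
    ultimately show ?thesis unfolding deg pq by simp
  qed
  have "degree (p * q - r) = degree (p * q)"
    using degree_add_eq_left[of "- r" "p * q"] less by simp
  moreover have "coeff r (degree (p * q)) = 0" using less by (rule coeff_eq_0)
  ultimately have "degree (p * q - r) = fib (Suc (Suc (Suc n)))" "lead_coeff (p * q - r) = 1"
    using deg lc by auto
  then show ?case by (simp add: p_def q_def r_def)
qed auto

text \<open>A root in the upper half plane would be an energy whose trace lies in the band, which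
  \<open>trace_seq_not_in_band\<close> excludes; conjugation excludes the lower half plane.\<close>

lemma trace_seq_factors_complex:
  fixes V t :: real
  assumes n: "1 \<le> n" and t: "\<bar>t\<bar> \<le> 2"
  shows "\<exists>zs :: real list. length zs = fib n \<and> (\<forall>E :: complex. trace_seq V E n - of_real t = (\<Prod>z\<leftarrow>zs. E - of_real z))"
proof -
  define p where "p = trace_poly V n + [:- of_real t:]"
  have fn: "0 < fib n" using n by (simp add: fib_neq_0_nat)
  have "degree p = fib n"
    unfolding p_def using degree_add_eq_left[of "[:- of_real t:]" "trace_poly V n"] trace_poly_degree[of V n] fn by simp
  moreover have "coeff [:- complex_of_real t:] (fib n) = 0" using fn by (intro coeff_eq_0) simp
  ultimately have deg: "degree p = fib n" "lead_coeff p = 1"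
    using trace_poly_degree[of V n] n by (auto simp: p_def)
  have val: "poly p E = trace_seq V E n - of_real t" for E
    by (simp add: p_def poly_trace_poly)
  obtain as where as: "length as = fib n" "\<And>E :: complex. trace_seq V E n - of_real t = (\<Prod>a\<leftarrow>as. E - a)"
  proof -
    have "p \<noteq> 0" using deg by auto
    then obtain as where "length as = degree p" "\<forall>E. poly p E = lead_coeff p * (\<Prod>a\<leftarrow>as. E - a)"
      using complex_poly_factors by blast
    then show thesis using that[of as] unfolding deg(2) val by (simp add: deg(1))
  qed
  have real: "Im a = 0" if "a \<in> set as" for a
  proof (rule ccontr)
    assume a0: "Im a \<noteq> 0"
    have "(\<Prod>b\<leftarrow>as. a - b) = 0" using that by (auto simp: prod_list_zero_iff)
    then have z: "trace_seq V a n = of_real t" using as(2)[of a] by simp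
    show False
    proof (cases "0 < Im a")
      case True
      then show ?thesis using trace_seq_not_in_band[of a n t V] n t z by blast
    next
      case False
      then have "0 < Im (cnj a)" using a0 by simp
      moreover have "trace_seq V (cnj a) n = of_real t" by (simp add: trace_seq_cnj z)
      ultimately show ?thesis using trace_seq_not_in_band[of "cnj a" n t V] n t by blast
    qed
  qed
  have "as = map (\<lambda>a. of_real (Re a)) as"
    using real by (intro map_idI[symmetric]) (simp add: complex_eq_iff)
  then have m: "map (\<lambda>a. E - of_real (Re a)) as = map (\<lambda>a. E - a) as" for E :: complex
    using real by (auto simp: complex_eq_iff)
  have "(\<Prod>z\<leftarrow>map Re as. E - of_real z) = (\<Prod>a\<leftarrow>as. E - a)" for E :: complex
    unfolding map_map comp_def m by (rule refl)
  then show ?thesis using as by (intro exI[of _ "map Re as"]) auto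
qed

text \<open>\<open>band_points V n t\<close> lists the roots of \<open>X n = t\<close> with multiplicity. The choice is meaningful
  only for \<open>n \<ge> 1\<close> and \<open>\<bar>t\<bar> \<le> 2\<close>.\<close>

definition lists_band_points :: "real \<Rightarrow> nat \<Rightarrow> real \<Rightarrow> real list \<Rightarrow> bool" where
  "lists_band_points V n t zs \<longleftrightarrow> length zs = fib n \<and>
     (\<forall>E :: complex. trace_seq V E n - of_real t = (\<Prod>z\<leftarrow>zs. E - of_real z))"

definition band_points :: "real \<Rightarrow> nat \<Rightarrow> real \<Rightarrow> real list" where
  "band_points V n t = (if n = 0 then [] else Eps (lists_band_points V n t))"

lemma band_points_spec:
  assumes "1 \<le> n" "\<bar>t\<bar> \<le> 2"
  shows "length (band_points V n t) = fib n \<and>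
    (\<forall>E :: complex. trace_seq V E n - of_real t = (\<Prod>z\<leftarrow>band_points V n t. E - of_real z))"
proof -
  have "\<exists>zs. lists_band_points V n t zs"
    using trace_seq_factors_complex[OF assms, of V] unfolding lists_band_points_def .
  then have "lists_band_points V n t (band_points V n t)"
    using assms(1) by (simp add: band_points_def someI_ex)
  then show ?thesis unfolding lists_band_points_def .
qed

lemma length_band_points: "\<bar>t\<bar> \<le> 2 \<Longrightarrow> length (band_points V n t) = fib n"
  using band_points_spec[of n t V] by (cases "n = 0") (simp add: band_points_def, simp)

lemma band_points_complex:
  "1 \<le> n \<Longrightarrow> \<bar>t\<bar> \<le> 2 \<Longrightarrow> trace_seq V (E :: complex) n - of_real t = (\<Prod>z\<leftarrow>band_points V n t. E - of_real z)"
  using band_points_spec[of n t V] by blast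

lemma band_points_real:
  assumes "1 \<le> n" "\<bar>t\<bar> \<le> 2"
  shows "trace_seq V (E :: real) n - t = (\<Prod>z\<leftarrow>band_points V n t. E - z)"
proof -
  have "of_real (trace_seq V E n - t) = (\<Prod>z\<leftarrow>band_points V n t. complex_of_real E - of_real z)"
    using band_points_complex[OF assms, of V "of_real E"] by (simp add: trace_seq_of_real)
  also have "\<dots> = of_real (\<Prod>z\<leftarrow>band_points V n t. E - z)"
  proof -
    have "(\<Prod>z\<leftarrow>zs. complex_of_real E - of_real z) = of_real (\<Prod>z\<leftarrow>zs. E - z)" for zs
      by (induction zs) simp_all
    then show ?thesis .
  qed
  finally show ?thesis using of_real_eq_iff by blast
qed

section \<open>Counting and interlacing of zeros\<close>

definition zeros :: "real \<Rightarrow> nat \<Rightarrow> real list" where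
  "zeros V n = band_points V n 0"

text \<open>Counting from above makes the sign of a monic polynomial at a point equal to a power of
  -1 with this exponent, independently of the degree; see \<open>above_sign\<close>.\<close>

definition above :: "real list \<Rightarrow> real \<Rightarrow> nat" where
  "above zs t = length (filter (\<lambda>z. t < z) zs)"

lemma above_Nil [simp]: "above [] t = 0" by (simp add: above_def)
lemma above_Cons [simp]: "above (z # zs) t = (if t < z then 1 else 0) + above zs t" by (simp add: above_def)
lemma above_append [simp]: "above (zs @ ws) t = above zs t + above ws t" by (simp add: above_def)

lemma above_le_length: "above zs t \<le> length zs" by (simp add: above_def)

lemma above_antimono: "s \<le> t \<Longrightarrow> above zs t \<le> above zs s"
  by (induction zs) auto

lemma above_sign:
  fixes t :: real
  assumes "t \<notin> set zs"
  shows "0 < (- 1) ^ above zs t * (\<Prod>z\<leftarrow>zs. t - z)"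
  using assms
proof (induction zs)
  case (Cons z zs)
  then have IH: "0 < (- 1) ^ above zs t * (\<Prod>z\<leftarrow>zs. t - z)" and z: "t \<noteq> z" by auto
  show ?case
  proof (cases "t < z")
    case True
    then have "0 < (z - t) * ((- 1) ^ above zs t * (\<Prod>z\<leftarrow>zs. t - z))" using IH by simp
    then show ?thesis using True by (simp add: algebra_simps)
  next
    case False
    then have "0 < (t - z) * ((- 1) ^ above zs t * (\<Prod>z\<leftarrow>zs. t - z))" using IH z by simp
    then show ?thesis using False by (simp add: algebra_simps)
  qed
qed simp

lemma above_right_const:
  "\<exists>s>t. s < t + 1 \<and> s \<notin> set zs \<and> above zs s = above zs t"
proof -
  define F where "F = insert (t + 1) {z \<in> set zs. t < z}"
  have fin: "finite F" "F \<noteq> {}" by (auto simp: F_def)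
  define m where "m = Min F"
  have m: "t < m" "m \<le> t + 1" using Min_in[OF fin] Min_le[OF fin(1), of "t + 1"] by (auto simp: m_def F_def)
  define s where "s = (t + m) / 2"
  have s: "t < s" "s < m" using m by (auto simp: s_def)
  have "z \<ge> m" if "z \<in> set zs" "t < z" for z
    using that fin Min_le[of F z] by (auto simp: m_def F_def)
  then have eq: "\<And>z. z \<in> set zs \<Longrightarrow> (s < z) = (t < z)" and "s \<notin> set zs" using s by force+
  have "above zs s = above zs t" unfolding above_def by (rule arg_cong[where f = length], rule filter_cong) (simp_all add: eq)
  then show ?thesis using s m \<open>s \<notin> set zs\<close> by (intro exI[of _ s]) auto
qed

text \<open>Writing the argument of each factor as \<open>pi / 2\<close> minus an arctan makes the
  argument of the product an explicit continuous function of the height, so no branch has to be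
  chosen.\<close>

lemma prod_list_polar:
  fixes t y :: real
  assumes "0 < y"
  shows "\<exists>r>0. (\<Prod>z\<leftarrow>zs. Complex t y - of_real z) = of_real r * cis (length zs * pi / 2 - (\<Sum>z\<leftarrow>zs. arctan ((t - z) / y)))"
proof (induction zs)
  case (Cons z zs)
  then obtain r where r: "0 < r" "(\<Prod>z\<leftarrow>zs. Complex t y - of_real z) = of_real r * cis (length zs * pi / 2 - (\<Sum>z\<leftarrow>zs. arctan ((t - z) / y)))"
    by blast
  define a where "a = arctan ((t - z) / y)"
  have ca: "0 < cos a" by (simp add: a_def cos_arctan add_pos_nonneg)
  have "sin a = cos a * ((t - z) / y)"
    using ca tan_arctan[of "(t - z) / y"] by (simp add: a_def tan_def field_simps)
  then have "Complex t y - of_real z = of_real (y / cos a) * cis (pi / 2 - a)"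
    using ca assms by (simp add: complex_eq_iff cos_diff sin_diff)
  then have "(\<Prod>z\<leftarrow>z # zs. Complex t y - of_real z) = of_real (y / cos a * r) *
     (cis (pi / 2 - a) * cis (length zs * pi / 2 - (\<Sum>z\<leftarrow>zs. arctan ((t - z) / y))))"
    by (simp add: r)
  also have "cis (pi / 2 - a) * cis (length zs * pi / 2 - (\<Sum>z\<leftarrow>zs. arctan ((t - z) / y)))
      = cis (length (z # zs) * pi / 2 - (\<Sum>z\<leftarrow>z # zs. arctan ((t - z) / y)))"
    unfolding cis_mult by (rule arg_cong[where f = cis]) (simp add: a_def field_simps)
  finally show ?case using r ca assms by (intro exI[of _ "y / cos a * r"]) auto
qed (auto intro!: exI[of _ "1::real"])

lemma arctan_sum_limits:
  fixes t :: real
  shows "((\<lambda>y. \<Sum>z\<leftarrow>zs. arctan ((t - z) / y)) \<longlongrightarrow> 0) at_top"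
    and "t \<notin> set zs \<Longrightarrow> ((\<lambda>y. \<Sum>z\<leftarrow>zs. arctan ((t - z) / y)) \<longlongrightarrow> length zs * pi / 2 - above zs t * pi) (at_right 0)"
proof -
  have "((\<lambda>y. arctan (a / y)) \<longlongrightarrow> arctan 0) at_top" for a :: real
    by (intro tendsto_arctan real_tendsto_divide_at_top[of _ a] tendsto_const filterlim_ident)
  then have lim: "((\<lambda>y. arctan (a / y)) \<longlongrightarrow> 0) at_top" for a :: real by simp
  show "((\<lambda>y. \<Sum>z\<leftarrow>zs. arctan ((t - z) / y)) \<longlongrightarrow> 0) at_top"
  proof (induction zs)
    case (Cons z zs)
    show ?case using tendsto_add[OF lim[of "t - z"] Cons] by simp
  qed simp
  have inv: "filterlim (\<lambda>y. a / y) at_top (at_right (0::real))" if "0 < a" for a :: real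
    using filterlim_tendsto_pos_mult_at_top[OF tendsto_const that filterlim_inverse_at_top_right]
    by (simp add: field_simps)
  have pos: "((\<lambda>y. arctan (a / y)) \<longlongrightarrow> pi / 2) (at_right 0)" if "0 < a" for a :: real
    by (rule filterlim_compose[OF tendsto_arctan_at_top inv[OF that]])
  have neg: "((\<lambda>y. arctan (a / y)) \<longlongrightarrow> - (pi / 2)) (at_right 0)" if "a < 0" for a :: real
    using tendsto_minus[OF pos[of "- a"]] that by (simp add: arctan_minus)
  show "((\<lambda>y. \<Sum>z\<leftarrow>zs. arctan ((t - z) / y)) \<longlongrightarrow> length zs * pi / 2 - above zs t * pi) (at_right 0)" if "t \<notin> set zs"
    using that
  proof (induction zs)
    case (Cons z zs)
    have A: "((\<lambda>y. arctan ((t - z) / y)) \<longlongrightarrow> pi / 2 - (if t < z then pi else 0)) (at_right 0)"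
      using pos[of "t - z"] neg[of "t - z"] Cons.prems by (cases "t < z") auto
    have B: "((\<lambda>y. \<Sum>z\<leftarrow>zs. arctan ((t - z) / y)) \<longlongrightarrow> length zs * pi / 2 - above zs t * pi) (at_right 0)"
      using Cons by simp
    have "(pi / 2 - (if t < z then pi else 0)) + (length zs * pi / 2 - above zs t * pi)
        = length (z # zs) * pi / 2 - above (z # zs) t * pi"
      by (simp add: field_simps)
    then show ?case
      using tendsto_add[OF A B] by simp
  qed simp
qed

text \<open>Along the vertical line over \<open>t\<close> the difference of the two arguments runs
  from 0 at infinity to \<open>pi\<close> times the difference of the counts. If the counts differed
  by 2 or more, the difference would equal \<open>pi\<close> or \<open>- pi\<close> somewhere; there
  one polynomial is a negative multiple of the other, which \<open>ne\<close> forbids.\<close>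

lemma weak_interlacing_aux:
  fixes t :: real
  assumes len: "length zs = length ws"
    and ne: "\<And>E \<tau>. 0 < Im E \<Longrightarrow> 0 < \<tau> \<Longrightarrow> (\<Prod>z\<leftarrow>zs. E - of_real z) + of_real \<tau> * (\<Prod>w\<leftarrow>ws. E - complex_of_real w) \<noteq> 0"
    and t: "t \<notin> set zs" "t \<notin> set ws"
  shows "\<bar>int (above zs t) - int (above ws t)\<bar> \<le> 1"
proof (rule ccontr)
  assume far: "\<not> ?thesis"
  define A where "A = (\<lambda>y. (\<Sum>w\<leftarrow>ws. arctan ((t - w) / y)) - (\<Sum>z\<leftarrow>zs. arctan ((t - z) / y)))"
  define D where "D = real (above zs t) - real (above ws t)"
  have D: "2 \<le> \<bar>D\<bar>" using far unfolding D_def by linarith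
  have A0: "(A \<longlongrightarrow> D * pi) (at_right 0)"
    using tendsto_diff[OF arctan_sum_limits(2)[OF t(2)] arctan_sum_limits(2)[OF t(1)]]
    unfolding A_def D_def len by (simp add: algebra_simps)
  have Ainf: "(A \<longlongrightarrow> 0) at_top"
    using tendsto_diff[OF arctan_sum_limits(1) arctan_sum_limits(1), of t ws t zs] unfolding A_def by simp
  have cont_sum: "continuous_on {0<..} (\<lambda>y. \<Sum>z\<leftarrow>us. arctan ((t - z) / y))" for us
    by (induction us) (auto intro!: continuous_intros)
  have cont: "continuous_on {0<..} A" unfolding A_def by (intro continuous_intros cont_sum)
  have avoid: "\<bar>A y\<bar> \<noteq> pi" if y: "0 < y" for y
  proof
    assume Ay: "\<bar>A y\<bar> = pi"
    obtain r where r: "0 < r" "(\<Prod>z\<leftarrow>zs. Complex t y - of_real z) = of_real r * cis (length zs * pi / 2 - (\<Sum>z\<leftarrow>zs. arctan ((t - z) / y)))"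
      using prod_list_polar[OF y] by blast
    obtain r' where r': "0 < r'" "(\<Prod>z\<leftarrow>ws. Complex t y - of_real z) = of_real r' * cis (length ws * pi / 2 - (\<Sum>z\<leftarrow>ws. arctan ((t - z) / y)))"
      using prod_list_polar[OF y] by blast
    have "length zs * pi / 2 - (\<Sum>z\<leftarrow>zs. arctan ((t - z) / y)) = (length ws * pi / 2 - (\<Sum>z\<leftarrow>ws. arctan ((t - z) / y))) + A y"
      by (simp add: A_def len)
    then have "(\<Prod>z\<leftarrow>zs. Complex t y - of_real z) = of_real r * (cis (length ws * pi / 2 - (\<Sum>z\<leftarrow>ws. arctan ((t - z) / y))) * cis (A y))"
      using r by (simp add: cis_mult)
    moreover have "cis (A y) = -1" 
    proof -
      have "A y = pi \<or> A y = - pi" using Ay by linarith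
      then show ?thesis by (auto simp: complex_eq_iff)
    qed
    ultimately have "(\<Prod>z\<leftarrow>zs. Complex t y - of_real z) + of_real (r / r') * (\<Prod>z\<leftarrow>ws. Complex t y - of_real z) = 0"
      using r' by simp
    then show False using ne[of "Complex t y" "r / r'"] y r r' by simp
  qed
  have "eventually (\<lambda>y. dist (A y) (D * pi) < pi / 2) (at_right 0)"
    using A0 by (rule tendstoD) simp
  then have "eventually (\<lambda>y. pi < \<bar>A y\<bar> \<and> 0 < y) (at_right 0)"
    using eventually_at_right_less
  proof eventually_elim
    case (elim y)
    have "2 * pi \<le> \<bar>D\<bar> * pi" using D by (intro mult_right_mono) auto
    then have "2 * pi \<le> \<bar>D * pi\<bar>" by (simp add: abs_mult)
    then show ?case using elim pi_gt_zero unfolding dist_real_def by linarith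
  qed
  then obtain y0 where y0: "pi < \<bar>A y0\<bar>" "0 < y0"
    using eventually_happens'[of "at_right (0::real)"] by (auto simp: trivial_limit_at_right_real)
  have "eventually (\<lambda>y. dist (A y) 0 < pi) at_top"
    using Ainf by (rule tendstoD) simp
  then have "eventually (\<lambda>y. \<bar>A y\<bar> < pi \<and> y0 \<le> y) at_top"
    using eventually_ge_at_top[of y0] by eventually_elim (simp add: dist_real_def)
  then obtain y1 where y1: "\<bar>A y1\<bar> < pi" "y0 \<le> y1"
    using eventually_happens'[of "at_top :: real filter"] by auto
  have "continuous_on {y0..y1} (\<lambda>y. \<bar>A y\<bar>)"
    by (intro continuous_intros continuous_on_subset[OF cont]) (use y0 in auto)
  then obtain y where "y0 \<le> y" "y \<le> y1" "\<bar>A y\<bar> = pi"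
    using IVT2'[of "\<lambda>y. \<bar>A y\<bar>" y1 pi y0] y0 y1 by force
  then show False using avoid[of y] y0 by auto
qed

lemma weak_interlacing:
  fixes t :: real
  assumes len: "length zs = length ws"
    and ne: "\<And>E \<tau>. 0 < Im E \<Longrightarrow> 0 < \<tau> \<Longrightarrow> (\<Prod>z\<leftarrow>zs. E - of_real z) + of_real \<tau> * (\<Prod>w\<leftarrow>ws. E - complex_of_real w) \<noteq> 0"
  shows "\<bar>int (above zs t) - int (above ws t)\<bar> \<le> 1"
proof -
  obtain s where s: "t < s" "s \<notin> set (zs @ ws)" "above (zs @ ws) s = above (zs @ ws) t"
    using above_right_const[of t "zs @ ws"] by blast
  then have "above zs s = above zs t" "above ws s = above ws t"
    using above_antimono[of t s zs] above_antimono[of t s ws] by auto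
  then show ?thesis using weak_interlacing_aux[OF len ne, of s] s by simp
qed

text \<open>With \<open>r^2 = \<tau> / (1 + \<tau>)\<close> and
  \<open>s^2 = 1 / (1 + \<tau>)\<close>, \<open>expanding_interlacing\<close> says that
  \<open>X (n + 2) + 2 * e\<close> is never a negative multiple of \<open>X (n + 1) * X n\<close> in
  the upper half plane. For \<open>n = 0\<close> the lists have at most one element.\<close>

lemma above_trace_shift:
  assumes "e = 1 \<or> e = -1"
  shows "\<bar>int (above (band_points V (Suc (Suc n)) (- 2 * e)) t) - int (above (zeros V (Suc n)) t) - int (above (zeros V n) t)\<bar> \<le> 1"
proof (cases "n = 0")
  case True
  have "length (band_points V 2 (- 2 * e)) = 1" "length (zeros V 1) = 1" "zeros V 0 = []"
    using assms by (auto simp: length_band_points zeros_def) (simp_all add: band_points_def)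
  then show ?thesis
    using above_le_length[of "band_points V 2 (- 2 * e)" t] above_le_length[of "zeros V 1" t] True
    by (simp add: numeral_2_eq_2)
next
  case False
  then have n: "1 \<le> n" by simp
  have e: "\<bar>- 2 * e\<bar> \<le> 2" using assms by auto
  have "\<bar>int (above (band_points V (Suc (Suc n)) (- 2 * e)) t) - int (above (zeros V (Suc n) @ zeros V n) t)\<bar> \<le> 1"
  proof (rule weak_interlacing)
    show "length (band_points V (Suc (Suc n)) (- 2 * e)) = length (zeros V (Suc n) @ zeros V n)"
      using e by (simp add: length_band_points zeros_def)
    fix E :: complex and \<tau> :: real
    assume E: "0 < Im E" and \<tau>: "0 < \<tau>"
    define s where "s = sqrt (1 / (1 + \<tau>))"
    define r where "r = sqrt (\<tau> / (1 + \<tau>))"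
    have rs2: "r^2 = \<tau> / (1 + \<tau>)" "s^2 = 1 / (1 + \<tau>)" using \<tau> by (auto simp: r_def s_def)
    have rs: "r^2 + s^2 = 1" "s \<noteq> 0"
      using \<tau> unfolding rs2 by (simp_all add: s_def add_divide_distrib[symmetric])
    define x where "x = trace_seq V E (Suc n)"
    define y where "y = trace_seq V E n"
    define z where "z = trace_seq V E (Suc (Suc n))"
    have "of_real (r^2) * (x * y) + of_real (s^2) * (z + 2 * of_real e) \<noteq> 0"
      using expanding_interlacing[OF transfer_det expanding_transfer transfer_det expanding_transfer E rs assms, of "Suc n" n V V]
        E n transfer_tr[of V E "Suc (Suc n)"] by (simp add: transfer_tr x_def y_def z_def)
    moreover have "of_real (r^2) * (x * y) + of_real (s^2) * (z + 2 * of_real e) = of_real (s^2) * ((z + 2 * of_real e) + of_real \<tau> * (x * y))"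
      using \<tau> unfolding rs2 by (simp add: algebra_simps)
    ultimately have "(z + 2 * of_real e) + of_real \<tau> * (x * y) \<noteq> 0" by auto
    moreover have "z + 2 * of_real e = (\<Prod>z\<leftarrow>band_points V (Suc (Suc n)) (- 2 * e). E - of_real z)"
      using band_points_complex[of "Suc (Suc n)" "- 2 * e" V E] e by (simp add: z_def)
    moreover have "x = (\<Prod>z\<leftarrow>zeros V (Suc n). E - of_real z)" "y = (\<Prod>z\<leftarrow>zeros V n. E - of_real z)"
      using band_points_complex[of "Suc n" 0 V E] band_points_complex[of n 0 V E] n by (auto simp: x_def y_def zeros_def)
    ultimately show "(\<Prod>z\<leftarrow>band_points V (Suc (Suc n)) (- 2 * e). E - of_real z) + of_real \<tau> * (\<Prod>w\<leftarrow>zeros V (Suc n) @ zeros V n. E - complex_of_real w) \<noteq> 0"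
      by simp
  qed
  then show ?thesis by simp
qed

text \<open>If \<open>X n + 2 * e\<close> were a negative multiple of \<open>X n\<close>, then
  \<open>X n\<close> would be a real number between -2 and 2, which is impossible in the upper half
  plane.\<close>

lemma above_band_shift:
  assumes "e = 1 \<or> e = -1" "1 \<le> n"
  shows "\<bar>int (above (band_points V n (- 2 * e)) t) - int (above (zeros V n) t)\<bar> \<le> 1"
proof (rule weak_interlacing)
  have e: "\<bar>- 2 * e\<bar> \<le> 2" using assms by auto
  show "length (band_points V n (- 2 * e)) = length (zeros V n)"
    using e by (simp add: length_band_points zeros_def)
  fix E :: complex and \<tau> :: real
  assume E: "0 < Im E" and \<tau>: "0 < \<tau>"
  define x where "x = trace_seq V E n"
  have "x \<noteq> of_real (- 2 * e / (1 + \<tau>))"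
    unfolding x_def
  proof (rule trace_seq_not_in_band[OF E assms(2)])
    have "\<bar>- 2 * e / (1 + \<tau>)\<bar> = 2 / (1 + \<tau>)" using assms(1) \<tau> by auto
    then show "\<bar>- 2 * e / (1 + \<tau>)\<bar> \<le> 2" using \<tau> by (simp add: field_simps)
  qed
  moreover have "1 + complex_of_real \<tau> \<noteq> 0"
    using \<tau> by (metis add_pos_pos less_irrefl of_real_1 of_real_add of_real_eq_0_iff zero_less_one)
  moreover have "complex_of_real (- 2 * e / (1 + \<tau>)) = (- 2 * of_real e) / (1 + of_real \<tau>)" by simp
  ultimately have "x * (1 + of_real \<tau>) \<noteq> - 2 * of_real e"
    by (metis nonzero_eq_divide_eq)
  then have "x * (1 + of_real \<tau>) + 2 * of_real e \<noteq> 0"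
    unfolding eq_neg_iff_add_eq_0 mult_minus_left by simp
  then have "(x + 2 * of_real e) + of_real \<tau> * x \<noteq> 0" by (simp add: algebra_simps)
  moreover have "x + 2 * of_real e = (\<Prod>z\<leftarrow>band_points V n (- 2 * e). E - of_real z)" "x = (\<Prod>z\<leftarrow>zeros V n. E - of_real z)"
    using band_points_complex[of n "- 2 * e" V E] band_points_complex[of n 0 V E] e assms(2) by (auto simp: x_def zeros_def)
  ultimately show "(\<Prod>z\<leftarrow>band_points V n (- 2 * e). E - of_real z) + of_real \<tau> * (\<Prod>w\<leftarrow>zeros V n. E - complex_of_real w) \<noteq> 0"
    by simp
qed

lemma above_fib_coarse:
  "\<bar>int (above (zeros V (n + 2)) t) - int (above (zeros V (n + 1)) t) - int (above (zeros V n) t)\<bar> \<le> 2"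
  using above_trace_shift[of 1 V n t] above_band_shift[of 1 "Suc (Suc n)" V t] by simp

lemma trace_seq_sign:
  fixes t c :: real
  assumes "1 \<le> n" "\<bar>c\<bar> \<le> 2" "trace_seq V t n \<noteq> c"
  shows "0 < (- 1) ^ above (band_points V n c) t * (trace_seq V t n - c)"
proof -
  have e: "trace_seq V t n - c = (\<Prod>z\<leftarrow>band_points V n c. t - z)"
    using band_points_real assms by blast
  moreover have "(\<Prod>z\<leftarrow>band_points V n c. t - z) = 0" if "t \<in> set (band_points V n c)"
    using that by (auto simp: prod_list_zero_iff)
  ultimately have "t \<notin> set (band_points V n c)" using assms(3) by auto
  then show ?thesis unfolding e by (rule above_sign)
qed

text \<open>Parity removes the errors of the two preceding estimates. Since \<open>e\<close> has the
  sign of \<open>X (n + 2)\<close>, adding \<open>2 * e\<close> keeps that sign, so the counts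
  \<open>a\<close> and \<open>b\<close> have equal parity and differ by at most 1: they agree. The
  sign of the triple product makes \<open>b + c + d\<close> even, and the remaining error of at most
  1 vanishes as well.\<close>

lemma above_fib:
  fixes t :: real
  assumes pos: "0 < trace_seq V t (n + 2) * trace_seq V t (n + 1) * trace_seq V t n"
  shows "above (zeros V (n + 2)) t = above (zeros V (n + 1)) t + above (zeros V n) t"
proof -
  define s :: "real \<Rightarrow> real" where "s = sgn"
  define p where "p = trace_seq V t (n + 2)"
  define e :: real where "e = (if 0 < p then 1 else -1)"
  have p0: "p \<noteq> 0" "trace_seq V t (n + 1) \<noteq> 0" "trace_seq V t n \<noteq> 0" using pos by (auto simp: p_def)
  have e: "e = 1 \<or> e = -1" "\<bar>- 2 * e\<bar> \<le> 2" by (auto simp: e_def)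
  have sg: "sgn (trace_seq V t k - c) = (- 1) ^ above (band_points V k c) t" if "1 \<le> k" "\<bar>c\<bar> \<le> 2" "trace_seq V t k \<noteq> c" for k c
  proof -
    have "0 < (- 1) ^ above (band_points V k c) t * (trace_seq V t k - c)" by (rule trace_seq_sign[OF that])
    then show ?thesis by (cases "even (above (band_points V k c) t)") auto
  qed
  have sz: "sgn (trace_seq V t k) = (- 1) ^ above (zeros V k) t" if "trace_seq V t k \<noteq> 0" for k
    using sg[of k 0] that by (cases "k = 0") (auto simp: zeros_def band_points_def)
  have pe: "p + 2 * e \<noteq> 0" "sgn (p + 2 * e) = sgn p"
    using p0 by (auto simp: e_def sgn_if)
  define a b c d where "a = above (band_points V (n + 2) (- 2 * e)) t" and "b = above (zeros V (n + 2)) t"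
    and "c = above (zeros V (n + 1)) t" and "d = above (zeros V n) t"
  have "(- 1 :: real) ^ a = sgn p" "(- 1 :: real) ^ b = sgn p"
    using sg[of "n + 2" "- 2 * e"] sz[of "n + 2"] e pe p0 by (auto simp: p_def a_def b_def)
  then have "even a = even b" by (metis neg_one_even_power neg_one_odd_power one_neq_neg_one)
  moreover have "sgn p * (sgn (trace_seq V t (n + 1)) * sgn (trace_seq V t n)) = 1"
    using pos by (simp add: p_def sgn_mult[symmetric] mult.assoc)
  then have "(- 1 :: real) ^ (b + c + d) = 1"
    using sz[of "n + 2"] sz[of "n + 1"] sz[of n] p0 by (simp add: p_def b_def c_def d_def power_add)
  then have "even (b + c + d)" by (metis neg_one_odd_power one_neq_neg_one)
  moreover have "\<bar>int a - int c - int d\<bar> \<le> 1" "\<bar>int a - int b\<bar> \<le> 1"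
    using above_trace_shift[OF e(1), of V n t] above_band_shift[OF e(1), of "n + 2" V t] by (auto simp: a_def b_def c_def d_def)
  ultimately have "a = b" "b = c + d" by presburger+
  then show ?thesis by (simp add: b_def c_def d_def)
qed

subsection \<open>Harmonic estimates in the upper half plane\<close>

lemma cosh_le_exp_nonneg: "0 \<le> u \<Longrightarrow> 2 * cosh u \<le> 2 * exp (u :: real)"
  by (simp add: cosh_def)

lemma norm_cos_bounds:
  assumes "0 \<le> Im z"
  shows "cmod (2 * cos z) \<le> 2 * exp (Im z)" "exp (Im z) - 1 \<le> cmod (2 * cos z)"
proof -
  define s where "s = sinh (Im z)"
  have eq: "(cmod (cos z))^2 = (cos (Re z))^2 + s^2"
    unfolding norm_cos_squared s_def by (simp add: sinh_def exp_minus power_divide)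
  have s0: "0 \<le> s" using assms by (simp add: s_def)
  have "(cos (Re z))^2 \<le> 1" by (simp add: abs_square_le_1)
  then have "(cmod (cos z))^2 \<le> (cosh (Im z))^2"
    unfolding eq s_def cosh_square_eq by simp
  then have "cmod (cos z) \<le> cosh (Im z)"
    by (rule power2_le_imp_le) (simp add: cosh_real_nonneg)
  then show "cmod (2 * cos z) \<le> 2 * exp (Im z)"
    using cosh_le_exp_nonneg[OF assms] by (simp add: norm_mult)
  have "s \<le> cmod (cos z)"
    by (rule power2_le_imp_le) (auto simp: eq)
  moreover have "exp (Im z) - 1 \<le> 2 * s" using assms by (simp add: s_def sinh_def)
  ultimately show "exp (Im z) - 1 \<le> cmod (2 * cos z)" by (simp add: norm_mult)
qed

lemma contractible_upper_half_plane: "contractible {E. 0 < Im E}"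
  by (intro convex_imp_contractible convex_halfspace_Im_gt)

text \<open>Half the trace omits the segment from -1 to 1 on a simply connected domain, so a
  holomorphic arccos exists. Its imaginary part cannot vanish, hence has constant sign; replacing
  the function by its negative makes the sign positive.\<close>

lemma phase_exists:
  assumes n: "1 \<le> n"
  shows "\<exists>g. g holomorphic_on {E. 0 < Im E} \<and> (\<forall>E. 0 < Im E \<longrightarrow> trace_seq V E n = 2 * cos (g E) \<and> 0 < Im (g E))"
proof -
  define H where "H = {E :: complex. 0 < Im E}"
  have hol: "(\<lambda>E. trace_seq V E n / 2) holomorphic_on H"
    unfolding poly_trace_poly[symmetric] by (intro holomorphic_intros) auto
  have nb: "trace_seq V E n / 2 \<noteq> of_real t" if "E \<in> H" "\<bar>t\<bar> \<le> 1" for E t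
    using trace_seq_not_in_band[of E n "2 * t" V] that n by (auto simp: H_def abs_mult mult.commute)
  obtain g where g: "g holomorphic_on H" "\<And>E. E \<in> H \<Longrightarrow> trace_seq V E n / 2 = cos (g E)"
    using contractible_imp_holomorphic_arccos[OF hol] contractible_upper_half_plane nb[of _ 1] nb[of _ "-1"]
    unfolding H_def by auto
  have im: "Im (g E) \<noteq> 0" if "E \<in> H" for E
  proof
    assume "Im (g E) = 0"
    then have "g E = of_real (Re (g E))" by (simp add: complex_eq_iff)
    then have "cos (g E) = of_real (cos (Re (g E)))" by (metis cos_of_real)
    then show False using nb[OF that, of "cos (Re (g E))"] g(2)[OF that] by simp
  qed
  have conn: "connected ((\<lambda>E. Im (g E)) ` H)"
    by (intro connected_continuous_image continuous_intros holomorphic_on_imp_continuous_on g)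
      (simp add: H_def convex_connected convex_halfspace_Im_gt)
  have iH: "\<i> \<in> H" by (simp add: H_def)
  show ?thesis
  proof (cases "0 < Im (g \<i>)")
    case True
    have "0 < Im (g E)" if "E \<in> H" for E
    proof (rule ccontr)
      assume "\<not> 0 < Im (g E)"
      then have "0 \<in> (\<lambda>E. Im (g E)) ` H"
        using connectedD_interval[OF conn imageI[OF that] imageI[OF iH], of 0] True by auto
      then show False using im by auto
    qed
    then show ?thesis using g by (intro exI[of _ g]) (auto simp: H_def field_simps)
  next
    case False
    then have neg: "Im (g \<i>) < 0" using im[OF iH] by linarith
    have "Im (g E) < 0" if "E \<in> H" for E
    proof (rule ccontr)
      assume "\<not> Im (g E) < 0"
      then have "0 \<in> (\<lambda>E. Im (g E)) ` H"
        using connectedD_interval[OF conn imageI[OF iH] imageI[OF that], of 0] neg by auto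
      then show False using im by auto
    qed
    moreover have "(\<lambda>E. - g E) holomorphic_on H" by (intro holomorphic_intros g)
    ultimately show ?thesis using g by (intro exI[of _ "\<lambda>E. - g E"]) (auto simp: H_def field_simps)
  qed
qed

definition is_phase :: "real \<Rightarrow> nat \<Rightarrow> (complex \<Rightarrow> complex) \<Rightarrow> bool" where
  "is_phase V n g \<longleftrightarrow> g holomorphic_on {E. 0 < Im E} \<and>
     (\<forall>E. 0 < Im E \<longrightarrow> trace_seq V E n = 2 * cos (g E) \<and> 0 < Im (g E))"

definition phase :: "real \<Rightarrow> nat \<Rightarrow> complex \<Rightarrow> complex" where
  "phase V n = Eps (is_phase V n)"

definition height :: "real \<Rightarrow> nat \<Rightarrow> complex \<Rightarrow> real" where
  "height V n E = Im (phase V n E)"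

lemma phase:
  assumes "1 \<le> n"
  shows "phase V n holomorphic_on {E. 0 < Im E}"
    and "0 < Im E \<Longrightarrow> trace_seq V E n = 2 * cos (phase V n E)"
    and "0 < Im E \<Longrightarrow> 0 < Im (phase V n E)"
proof -
  have "\<exists>g. is_phase V n g" using phase_exists[OF assms, of V] unfolding is_phase_def .
  then have "is_phase V n (phase V n)" unfolding phase_def by (rule someI_ex)
  then show "phase V n holomorphic_on {E. 0 < Im E}"
    "0 < Im E \<Longrightarrow> trace_seq V E n = 2 * cos (phase V n E)"
    "0 < Im E \<Longrightarrow> 0 < Im (phase V n E)"
    unfolding is_phase_def by auto
qed

lemma height_bounds:
  assumes "1 \<le> n" "0 < Im E"
  shows "0 < height V n E" "height V n E \<le> ln (cmod (trace_seq V E n) + 1)"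
    "cmod (trace_seq V E n) \<le> 2 * exp (height V n E)"
proof -
  show h: "0 < height V n E" using phase(3)[OF assms] by (simp add: height_def)
  show "cmod (trace_seq V E n) \<le> 2 * exp (height V n E)"
    using norm_cos_bounds(1)[of "phase V n E"] phase(2)[OF assms] h by (simp add: height_def)
  have "exp (height V n E) \<le> cmod (trace_seq V E n) + 1"
    using norm_cos_bounds(2)[of "phase V n E"] phase(2)[OF assms] h by (simp add: height_def)
  then show "height V n E \<le> ln (cmod (trace_seq V E n) + 1)"
    by (simp add: ln_ge_iff add_nonneg_pos)
qed

text \<open>The Schwarz lemma for \<open>f\<close>, which is \<open>g\<close> between the Cayley
  transforms sending \<open>w\<close> and \<open>g w\<close> to 0.\<close>

lemma Schwarz_Pick_half_plane:
  assumes hol: "g holomorphic_on {E. 0 < Im E}" and im: "\<And>E. 0 < Im E \<Longrightarrow> 0 < Im (g E)"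
    and z: "0 < Im z" and w: "0 < Im w"
  shows "cmod (g z - g w) * cmod (z - cnj w) \<le> cmod (g z - cnj (g w)) * cmod (z - w)"
proof -
  define \<phi> where "\<phi> = (\<lambda>t. (w - cnj w * t) / (1 - t))"
  define f where "f = (\<lambda>t. (g (\<phi> t) - g w) / (g (\<phi> t) - cnj (g w)))"
  have nz: "1 - t \<noteq> 0" if "cmod t < 1" for t using that by auto
  have im\<phi>: "0 < Im (\<phi> t)" if "cmod t < 1" for t
  proof -
    have "\<phi> t = (w - cnj w * t) * cnj (1 - t) / of_real ((cmod (1 - t))^2)"
    proof -
      define b where "b = 1 - t"
      have "b \<noteq> 0" using nz[OF that] by (simp add: b_def)
      then show ?thesis
        unfolding \<phi>_def b_def[symmetric] complex_norm_square by simp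
    qed
    moreover have "Im ((w - cnj w * t) * cnj (1 - t)) = Im w * (1 - (cmod t)^2)"
      by (simp add: cmod_power2) (simp add: power2_eq_square algebra_simps)
    moreover have "(cmod t)^2 < 1" using that by (simp add: abs_square_less_1)
    ultimately show ?thesis using w nz[OF that]
      by (simp add: Im_divide_of_real del: of_real_power) 
  qed
  have \<phi>0: "\<phi> 0 = w" by (simp add: \<phi>_def)
  have gne: "g E \<noteq> cnj (g w)" if "0 < Im E" for E
  proof
    assume "g E = cnj (g w)"
    then have "Im (g E) = - Im (g w)" by simp
    then show False using im[OF that] im[OF w] by linarith
  qed
  have hol\<phi>: "\<phi> holomorphic_on ball 0 1"
    unfolding \<phi>_def by (intro holomorphic_intros) auto
  have holg: "(\<lambda>t. g (\<phi> t)) holomorphic_on ball 0 1"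
  proof -
    have "\<phi> ` ball 0 1 \<subseteq> {E. 0 < Im E}" using im\<phi> by auto
    from holomorphic_on_compose_gen[OF hol\<phi> hol this] show ?thesis by (simp add: comp_def)
  qed
  have holf: "f holomorphic_on ball 0 1"
    unfolding f_def using gne im\<phi> by (intro holomorphic_intros holg) auto
  have f0: "f 0 = 0" by (simp add: f_def \<phi>0)
  have less: "cmod (a - b) < cmod (a - cnj b)" if "0 < Im a" "0 < Im b" for a b
  proof -
    have "(Im a - Im b)^2 < (Im a + Im b)^2" using that by (simp add: power2_eq_square algebra_simps)
    then have "(cmod (a - b))^2 < (cmod (a - cnj b))^2" by (simp add: cmod_power2)
    then show ?thesis by (rule power_less_imp_less_base) simp
  qed
  have f1: "cmod (f t) < 1" if "cmod t < 1" for t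
    using less[OF im[OF im\<phi>[OF that]] im[OF w]] gne[OF im\<phi>[OF that]] by (simp add: f_def norm_divide)
  define t where "t = (z - w) / (z - cnj w)"
  have zw: "z - cnj w \<noteq> 0" using less[OF z w] by auto
  have t1: "cmod t < 1" using less[OF z w] zw by (simp add: t_def norm_divide)
  have w0: "w - cnj w \<noteq> 0" using w by (simp add: complex_eq_iff)
  have "1 - t = (w - cnj w) / (z - cnj w)" using zw by (simp add: t_def field_simps)
  moreover have "w - cnj w * t = z * (w - cnj w) / (z - cnj w)" using zw by (simp add: t_def field_simps)
  ultimately have "\<phi> t = z" using zw w0 by (simp add: \<phi>_def)
  then have "cmod ((g z - g w) / (g z - cnj (g w))) \<le> cmod ((z - w) / (z - cnj w))"
    using Schwarz_Lemma(1)[OF holf f0 f1 t1] by (simp add: f_def t_def)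
  moreover have "0 < cmod (g z - cnj (g w))" "0 < cmod (z - cnj w)" using gne[OF z] zw by auto
  ultimately show ?thesis by (simp add: norm_divide field_simps)
qed

text \<open>In the squared Schwarz-Pick inequality the real parts enter as the same summand
  \<open>A\<close> on both sides, with the larger weight on the left. Cancelling it leaves an
  inequality between the imaginary parts.\<close>

lemma Harnack_half_plane:
  assumes hol: "g holomorphic_on {E. 0 < Im E}" and im: "\<And>E. 0 < Im E \<Longrightarrow> 0 < Im (g E)"
    and z: "0 < Im z" and w: "0 < Im w"
  shows "\<bar>Im (g z) - Im (g w)\<bar> * cmod (z - cnj w) \<le> (Im (g z) + Im (g w)) * cmod (z - w)"
proof -
  define p q A D N where "p = Im (g z)" and "q = Im (g w)" and "A = (Re (g z) - Re (g w))^2"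
    and "D = cmod (z - w)" and "N = cmod (z - cnj w)"
  have pq: "0 < p" "0 < q" using im z w by (auto simp: p_def q_def)
  have A: "0 \<le> A" by (simp add: A_def)
  have DN: "D^2 \<le> N^2"
  proof -
    have "(Im z - Im w)^2 \<le> (Im z + Im w)^2" using z w by (simp add: power2_eq_square algebra_simps)
    then show ?thesis by (simp add: D_def N_def cmod_power2)
  qed
  have "(cmod (g z - g w) * N)^2 \<le> (cmod (g z - cnj (g w)) * D)^2"
    using Schwarz_Pick_half_plane[OF assms] unfolding N_def D_def by (intro power_mono) auto
  then have "(A + (p - q)^2) * N^2 \<le> (A + (p + q)^2) * D^2"
    by (simp add: power_mult_distrib cmod_power2 A_def p_def q_def)
  moreover have "A * D^2 \<le> A * N^2" using A DN by (intro mult_left_mono)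
  ultimately have "(p - q)^2 * N^2 \<le> (p + q)^2 * D^2" by (simp add: algebra_simps)
  then have "(\<bar>p - q\<bar> * N)^2 \<le> ((p + q) * D)^2" by (simp add: power_mult_distrib)
  then have "\<bar>p - q\<bar> * N \<le> (p + q) * D"
    by (rule power2_le_imp_le) (use pq in \<open>simp add: D_def\<close>)
  then show ?thesis by (simp add: p_def q_def D_def N_def)
qed

lemma height_vertical:
  assumes n: "1 \<le> n" and y: "0 < y" "y \<le> d"
  shows "y / d * height V n (Complex c d) \<le> height V n (Complex c y)"
proof -
  define p q where "p = height V n (Complex c y)" and "q = height V n (Complex c d)"
  have "\<bar>p - q\<bar> * cmod (Complex c y - cnj (Complex c d)) \<le> (p + q) * cmod (Complex c y - Complex c d)"
    unfolding p_def q_def height_def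
    by (rule Harnack_half_plane[OF phase(1)[OF n] phase(3)[OF n]]) (use y in auto)
  moreover have "Complex c y - cnj (Complex c d) = \<i> * of_real (y + d)" "Complex c y - Complex c d = \<i> * of_real (y - d)"
    by (simp_all add: complex_eq_iff)
  then have "cmod (Complex c y - cnj (Complex c d)) = y + d" "cmod (Complex c y - Complex c d) = d - y"
    using y by (simp_all only: norm_mult norm_of_real norm_ii) auto
  ultimately have "\<bar>p - q\<bar> * (y + d) \<le> (p + q) * (d - y)" by simp
  moreover have "(q - p) * (y + d) \<le> \<bar>p - q\<bar> * (y + d)" using y by (intro mult_right_mono) auto
  ultimately have "q * y \<le> p * d" by (simp add: algebra_simps)
  then show ?thesis using y by (simp add: p_def q_def field_simps)
qed

text \<open>Two points at height \<open>R\<close> and horizontal distance at most \<open>R\<close>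
  have pseudohyperbolic distance below 1/2. The factor 3 is
  \<open>(1 + 1/2) / (1 - 1/2)\<close>.\<close>

lemma height_horizontal:
  assumes n: "1 \<le> n" and R: "0 < R" "\<bar>x\<bar> \<le> R"
  shows "height V n (Complex (c + x) R) \<le> 3 * height V n (Complex c R)"
proof -
  define p q where "p = height V n (Complex (c + x) R)" and "q = height V n (Complex c R)"
  have pq: "0 < p" "0 < q" using height_bounds(1)[OF n] R by (auto simp: p_def q_def)
  define N where "N = cmod (Complex (c + x) R - cnj (Complex c R))"
  have "\<bar>p - q\<bar> * N \<le> (p + q) * cmod (Complex (c + x) R - Complex c R)"
    unfolding p_def q_def height_def N_def
    by (rule Harnack_half_plane[OF phase(1)[OF n] phase(3)[OF n]]) (use R in auto)
  moreover have "cmod (Complex (c + x) R - Complex c R) = \<bar>x\<bar>" by (simp add: cmod_def)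
  moreover have twoN: "2 * \<bar>x\<bar> \<le> N"
  proof (rule power2_le_imp_le)
    have "\<bar>x\<bar>^2 \<le> R^2" using R by (intro power_mono) auto
    then have "x^2 \<le> R^2" by simp
    then have "3 * x^2 \<le> 4 * R^2" using zero_le_power2[of R] by linarith
    then show "(2 * \<bar>x\<bar>)^2 \<le> N^2" by (simp add: N_def cmod_power2 power_mult_distrib)
  qed (simp add: N_def)
  moreover have "(p + q) * (2 * \<bar>x\<bar>) \<le> (p + q) * N"
    using pq twoN by (intro mult_left_mono) auto
  ultimately have "\<bar>p - q\<bar> * N * 2 \<le> (p + q) * N" by simp
  moreover have "0 < N" using R by (auto simp: N_def complex_eq_iff)
  ultimately have "N * (\<bar>p - q\<bar> * 2) \<le> N * (p + q)" by (simp add: mult_ac)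
  then have "\<bar>p - q\<bar> * 2 \<le> p + q" using \<open>0 < N\<close> by (simp only: mult_le_cancel_left_pos)
  moreover have "(p - q) * 2 \<le> \<bar>p - q\<bar> * 2" by (intro mult_right_mono) auto
  ultimately have "(p - q) * 2 \<le> p + q" by linarith
  then have "p \<le> 3 * q" by simp
  then show ?thesis by (simp add: p_def q_def)
qed

text \<open>The maximum principle on a half disc. The height is defined only in the open half plane,
  so on the real diameter it is replaced by its upper bound \<open>ln (cmod X + 1)\<close>, which is
  continuous up to the axis. Holomorphy of \<open>m\<close> below the axis makes \<open>Re m\<close>
  continuous there too.\<close>

lemma height_majorant:
  fixes c R :: real
  assumes n: "1 \<le> n" and R: "0 < R" and d: "0 < d"
    and m: "m holomorphic_on {z. - d < Im z}"
    and line: "\<And>t. \<bar>t - c\<bar> \<le> R \<Longrightarrow> ln (\<bar>trace_seq V t n\<bar> + 1) \<le> Re (m (of_real t))"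
    and arc: "\<And>z. 0 < Im z \<Longrightarrow> cmod (z - of_real c) = R \<Longrightarrow> height V n z \<le> Re (m z)"
    and z0: "0 < Im z0" "cmod (z0 - of_real c) \<le> R"
  shows "height V n z0 \<le> Re (m z0)"
proof (rule field_le_epsilon)
  fix \<epsilon> :: real assume \<epsilon>: "0 < \<epsilon>"
  define F where "F = (\<lambda>z. ln (cmod (trace_seq V z n) + 1) - Re (m z))"
  define K where "K = cbox (Complex (c - R) 0) (Complex (c + R) 1)"
  have contm: "continuous_on {z. - d < Im z} m" using m by (rule holomorphic_on_imp_continuous_on)
  have contF: "continuous_on K F"
    unfolding F_def
  proof (intro continuous_intros)
    show "\<forall>x\<in>K. cmod (trace_seq V x n) + 1 \<noteq> 0" by (metis add_nonneg_pos less_irrefl norm_ge_zero zero_less_one)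
    show "continuous_on K m"
      by (rule continuous_on_subset[OF contm]) (use d in \<open>auto simp: K_def in_cbox_complex_iff\<close>)
  qed
  have "uniformly_continuous_on K F"
    by (rule compact_uniformly_continuous[OF contF]) (simp add: K_def)
  then obtain \<eta> where \<eta>: "0 < \<eta>" "\<And>x x'. x \<in> K \<Longrightarrow> x' \<in> K \<Longrightarrow> dist x' x < \<eta> \<Longrightarrow> dist (F x') (F x) < \<epsilon>"
    unfolding uniformly_continuous_on_def using \<epsilon> by metis
  \<comment> \<open>The diameter is raised to height \<open>\<delta>\<close>, low enough that
    uniform continuity carries the bound on the real line there with loss \<open>\<epsilon>\<close>
    and that \<open>z0\<close> stays in the truncated half disc.\<close>
  define \<delta> where "\<delta> = min (min (\<eta> / 2) 1) (Im z0)"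
  have \<delta>: "0 < \<delta>" "\<delta> < \<eta>" "\<delta> \<le> 1" "\<delta> \<le> Im z0" using \<eta> z0 by (auto simp: \<delta>_def)
  have low: "F (Complex t \<delta>) \<le> \<epsilon>" if t: "\<bar>t - c\<bar> \<le> R" for t
  proof -
    have "Complex t 0 \<in> K" "Complex t \<delta> \<in> K" using t \<delta> by (auto simp: K_def in_cbox_complex_iff abs_le_iff)
    moreover have "dist (Complex t \<delta>) (Complex t 0) < \<eta>" using \<delta> by (simp add: dist_norm cmod_def)
    ultimately have "dist (F (Complex t \<delta>)) (F (Complex t 0)) < \<epsilon>" using \<eta> by blast
    moreover have "F (Complex t 0) \<le> 0"
      using line[OF t] by (simp add: F_def complex_of_real_def[symmetric] trace_seq_of_real)
    ultimately show ?thesis by (simp add: dist_real_def)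
  qed
  define S where "S = {z. cmod (z - of_real c) \<le> R \<and> \<delta> \<le> Im z}"
  have Scl: "closed S"
    unfolding S_def by (intro closed_Collect_conj closed_Collect_le continuous_intros)
  have Sbd: "bounded S"
    by (rule bounded_subset[OF bounded_cball[of "of_real c" R]]) (auto simp: S_def dist_norm norm_minus_commute)
  have SH: "S \<subseteq> {E. 0 < Im E}" "S \<subseteq> {z. - d < Im z}" using \<delta> d by (auto simp: S_def)
  define f where "f = (\<lambda>z. - \<i> * phase V n z - m z)"
  have holf: "f holomorphic_on S"
    unfolding f_def by (intro holomorphic_intros holomorphic_on_subset[OF phase(1)[OF n] SH(1)] holomorphic_on_subset[OF m SH(2)])
  have Ref: "Re (f z) = height V n z - Re (m z)" for z by (simp add: f_def height_def)
  have "Re (f z0) \<le> \<epsilon>"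
  proof (rule maximum_real_frontier[where S = S and f = f and \<xi> = z0 and B = \<epsilon>])
    show "f holomorphic_on interior S" by (rule holomorphic_on_subset[OF holf interior_subset])
    show "continuous_on (closure S) f" using holomorphic_on_imp_continuous_on[OF holf] Scl by simp
    show "bounded S" by (rule Sbd)
    show "z0 \<in> S" using z0 \<delta> by (simp add: S_def)
    fix z assume z: "z \<in> frontier S"
    then have zS: "z \<in> S" "z \<notin> interior S" using Scl by (auto simp: frontier_def)
    have zim: "0 < Im z" using zS SH by auto
    have "open {z. cmod (z - of_real c) < R \<and> \<delta> < Im z}"
      by (intro open_Collect_conj open_Collect_less continuous_intros)
    then have "{z. cmod (z - of_real c) < R \<and> \<delta> < Im z} \<subseteq> interior S"
      by (rule interior_maximal[rotated]) (auto simp: S_def)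
    then have "\<not> (cmod (z - of_real c) < R \<and> \<delta> < Im z)" using zS by blast
    then have "cmod (z - of_real c) = R \<or> Im z = \<delta>" using zS by (auto simp: S_def)
    then consider "cmod (z - of_real c) = R" | "Im z = \<delta>" by blast
    then show "Re (f z) \<le> \<epsilon>"
    proof cases
      case 1
      then show ?thesis using arc[OF zim 1] \<epsilon> by (simp add: Ref)
    next
      case 2
      have "\<bar>Re z - c\<bar> \<le> R"
        using abs_Re_le_cmod[of "z - of_real c"] zS by (simp add: S_def)
      then have "F z \<le> \<epsilon>" using low[of "Re z"] 2 by (metis complex_surj)
      then show ?thesis using height_bounds(2)[OF n zim, of V] by (simp add: Ref F_def)
    qed
  qed
  then show "height V n z0 \<le> Re (m z0) + \<epsilon>" by (simp add: Ref)
qed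

subsection \<open>The trace as a product over its zeros\<close>

lemma norm_prod_list_complex:
  "cmod (\<Prod>z\<leftarrow>zs. Complex x y - of_real z) = (\<Prod>z\<leftarrow>zs. sqrt ((x - z)^2 + y^2))"
proof (induction zs)
  case (Cons a zs)
  have "cmod (Complex x y - of_real a) = sqrt ((x - a)^2 + y^2)" by (simp add: cmod_def)
  then show ?case using Cons by (simp add: norm_mult)
qed simp

lemma norm_trace_seq_product:
  assumes "1 \<le> n"
  shows "cmod (trace_seq V (Complex x y) n) = (\<Prod>z\<leftarrow>zeros V n. sqrt ((x - z)^2 + y^2))"
  using band_points_complex[OF assms, of 0 V "Complex x y"] norm_prod_list_complex[of x y "zeros V n"]
  by (simp add: zeros_def)

lemma norm_trace_seq_mono:
  assumes "1 \<le> n" "0 \<le> y" "y \<le> y'"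
  shows "cmod (trace_seq V (Complex x y) n) \<le> cmod (trace_seq V (Complex x y') n)"
proof -
  have "y^2 \<le> y'^2" using assms by (intro power_mono) auto
  then have "0 \<le> (\<Prod>z\<leftarrow>zs. sqrt ((x - z)^2 + y^2)) \<and> (\<Prod>z\<leftarrow>zs. sqrt ((x - z)^2 + y^2)) \<le> (\<Prod>z\<leftarrow>zs. sqrt ((x - z)^2 + y'^2))" for zs
    by (induction zs) (auto intro!: mult_mono mult_nonneg_nonneg)
  then show ?thesis unfolding norm_trace_seq_product[OF assms(1)] by blast
qed

lemma ln_norm_trace_seq:
  assumes "1 \<le> n" "\<And>z. z \<in> set (zeros V n) \<Longrightarrow> 0 < (x - z)^2 + y^2"
  shows "ln (cmod (trace_seq V (Complex x y) n)) = (\<Sum>z\<leftarrow>zeros V n. ln ((x - z)^2 + y^2) / 2)"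
proof -
  have "0 < (\<Prod>z\<leftarrow>zs. sqrt ((x - z)^2 + y^2)) \<and> ln (\<Prod>z\<leftarrow>zs. sqrt ((x - z)^2 + y^2)) = (\<Sum>z\<leftarrow>zs. ln ((x - z)^2 + y^2) / 2)"
    if "\<And>z. z \<in> set zs \<Longrightarrow> 0 < (x - z)^2 + y^2" for zs
    using that by (induction zs) (auto simp: ln_mult_pos ln_sqrt)
  then show ?thesis using assms by (simp add: norm_trace_seq_product)
qed

subsection \<open>Escaping energies\<close>

definition escapes :: "real \<Rightarrow> real \<Rightarrow> nat \<Rightarrow> bool" where
  "escapes V E m \<longleftrightarrow> 2 < \<bar>trace_seq V E m\<bar> \<and> 2 < \<bar>trace_seq V E (m + 1)\<bar>"

definition trapped :: "real \<Rightarrow> real set" where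
  "trapped V = {E. \<forall>m. \<not> escapes V E m}"

definition escape_time :: "real \<Rightarrow> real \<Rightarrow> nat" where
  "escape_time V E = (LEAST m. escapes V E m)"

text \<open>Symmetric in the two energies, because the older gap may lie on either side. The natural
  subtraction is exact since \<open>above\<close> is antitone.\<close>

definition zcount :: "real \<Rightarrow> nat \<Rightarrow> real \<Rightarrow> real \<Rightarrow> nat" where
  "zcount V n s t = above (zeros V n) (min s t) - above (zeros V n) (max s t)"

lemma zcount_eq: "s \<le> t \<Longrightarrow> zcount V n s t = above (zeros V n) s - above (zeros V n) t"
  by (simp add: zcount_def)

lemma zcount_filter: "s \<le> t \<Longrightarrow> zcount V n s t = length (filter (\<lambda>z. s < z \<and> z \<le> t) (zeros V n))"
proof -
  assume st: "s \<le> t"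
  have "above zs s = above zs t + length (filter (\<lambda>z. s < z \<and> z \<le> t) zs)" for zs
    using st by (induction zs) auto
  then show ?thesis by (simp add: zcount_eq[OF st])
qed

lemma trace_zero_iff:
  assumes "1 \<le> n"
  shows "trace_seq V (E :: real) n = 0 \<longleftrightarrow> E \<in> set (zeros V n)"
  using band_points_real[OF assms, of 0 V E] by (auto simp: zeros_def prod_list_zero_iff)

section \<open>Escape times and numbers of zeros at a fixed coupling\<close>

locale coupling =
  fixes V :: real
  assumes V_pos: "0 < V" and V_small: "V \<le> 1/1000"
begin

abbreviation X :: "real \<Rightarrow> nat \<Rightarrow> real" where "X E n \<equiv> trace_seq V E n"

lemma orbit: "trace_orbit V (X E)"
  by (rule trace_orbit_trace_seq[OF V_pos V_small])

lemma twisted_orbit: "sign_seq s \<Longrightarrow> trace_orbit V (\<lambda>n. s n * X E n)"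
  by (rule trace_orbit.twist[OF orbit])

lemma normalise:
  assumes "X E (n + 1) \<noteq> 0" "X E (n + 2) \<noteq> 0"
  shows "\<exists>s. sign_seq s \<and> s (n + 1) * X E (n + 1) = \<bar>X E (n + 1)\<bar> \<and> s (n + 2) * X E (n + 2) = \<bar>X E (n + 2)\<bar>"
proof -
  have "sgn y = 1 \<or> sgn y = -1" if "y \<noteq> 0" for y :: real using that by (simp add: sgn_if)
  then obtain s where "sign_seq s" "s (n + 1) = sgn (X E (n + 1))" "s (Suc (n + 1)) = sgn (X E (n + 2))"
    using sign_seq_exists[of "sgn (X E (n + 1))" "sgn (X E (n + 2))" "n + 1"] assms by blast
  then show ?thesis by (intro exI[of _ s]) (simp add: abs_sgn mult.commute)
qed

lemma sqrt_V: "0 < sqrt V" "sqrt V * sqrt V = V" "sqrt V \<le> 1/31"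
proof -
  show "0 < sqrt V" "sqrt V * sqrt V = V" using V_pos by auto
  show "sqrt V \<le> 1/31"
    by (rule real_le_lsqrt[of _ "V", simplified]) (use V_pos V_small in \<open>auto simp: power2_eq_square\<close>)
qed

text \<open>The argument starts from the least positive index with two traces of modulus at least 2.
  The trace before it is at most 2 in modulus, also at index 0, where it equals 2; after
  normalisation the root sum is at least 4, so \<open>X (n + 3)\<close> is the larger root and
  \<open>growth_lower\<close> applies.\<close>

lemma weak_escape_growth:
  assumes m: "1 \<le> m" and big: "2 \<le> \<bar>X E m\<bar>" "2 \<le> \<bar>X E (m + 1)\<bar>"
    and N: "m + 2 \<le> N"
  shows "sqrt (V / 2) * fib (N - m - 1) \<le> ln \<bar>X E N\<bar>" "2 + V \<le> \<bar>X E N\<bar>"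
proof -
  define P where "P = (\<lambda>m. 1 \<le> m \<and> 2 \<le> \<bar>X E m\<bar> \<and> 2 \<le> \<bar>X E (m + 1)\<bar>)"
  define k where "k = (LEAST m. P m)"
  have Pm: "P m" using assms by (simp add: P_def)
  have Pk: "P k" unfolding k_def by (rule LeastI[of P, OF Pm])
  have km: "k \<le> m" unfolding k_def by (rule Least_le[of P, OF Pm])
  obtain n where n: "k = n + 1" using Pk unfolding P_def by (metis add.commute le_Suc_ex plus_1_eq_Suc Suc_eq_plus1)
  have Xn: "\<bar>X E n\<bar> \<le> 2"
  proof (cases "n = 0")
    case False
    then have "\<not> P n" using not_less_Least[of n P] n by (simp add: k_def)
    then show ?thesis using False Pk unfolding P_def n by auto
  qed simp
  have k: "2 \<le> \<bar>X E (n + 1)\<bar>" "2 \<le> \<bar>X E (n + 2)\<bar>" using Pk by (auto simp: P_def n)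
  obtain s where s: "sign_seq s" "s (n + 1) * X E (n + 1) = \<bar>X E (n + 1)\<bar>" "s (n + 2) * X E (n + 2) = \<bar>X E (n + 2)\<bar>"
  proof -
    have "X E (n + 1) \<noteq> 0" "X E (n + 2) \<noteq> 0" using k by auto
    then show thesis using normalise[of E n] that by blast
  qed
  interpret y: trace_orbit V "\<lambda>n. s n * X E n" by (rule twisted_orbit[OF s(1)])
  have "2 * 2 \<le> s (n + 1) * X E (n + 1) * (s (n + 2) * X E (n + 2))"
    unfolding s using k by (intro mult_mono) auto
  then have "4 \<le> s (n + 3) * X E (n + 3) + s n * X E n"
    using y.roots_sum[of n] by simp
  moreover have "\<bar>s n * X E n\<bar> \<le> 2" using sign_seq_abs[OF s(1)] Xn by simp
  ultimately have g: "2 \<le> s (n + 1) * X E (n + 1)" "2 \<le> s (n + 2) * X E (n + 2)" "s n * X E n \<le> s (n + 3) * X E (n + 3)"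
    using k s by auto
  obtain j where j: "N = n + 3 + j" using le_Suc_ex[of "n + 3" N] N km n by auto
  have big2: "2 + V \<le> s N * X E N"
    using y.growth_step(1)[of "n + j"] y.growth_forever[OF g, of j] by (simp add: j add_ac)
  then show "2 + V \<le> \<bar>X E N\<bar>" using sign_seq_abs[OF s(1), of N "X E N"] by linarith
  define t where "t = arcosh (s N * X E N / 2)"
  have t: "s N * X E N = 2 * cosh t" "0 \<le> t" using big2 V_pos by (auto simp: t_def)
  have "sqrt (V / 2) * fib (N - m - 1) \<le> sqrt (V / 2) * fib (j + 1)"
    using km n j V_pos by (intro mult_left_mono) (auto intro!: fib_mono)
  also have "\<dots> \<le> t"
    using y.growth_lower[OF g, of j] unfolding t_def j by simp
  also have "\<dots> \<le> ln (2 * cosh t)"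
    by (subst ln_ge_iff) (auto simp: cosh_def add_pos_pos)
  also have "2 * cosh t = \<bar>X E N\<bar>"
    using t big2 V_pos sign_seq_abs[OF s(1), of N "X E N"] by linarith
  finally show "sqrt (V / 2) * fib (N - m - 1) \<le> ln \<bar>X E N\<bar>" .
qed

lemma weak_escape_not_trapped:
  assumes "1 \<le> m" "2 \<le> \<bar>X E m\<bar>" "2 \<le> \<bar>X E (m + 1)\<bar>"
  shows "E \<notin> trapped V"
proof -
  have "escapes V E (m + 2)"
    using weak_escape_growth(2)[OF assms, of "m + 2"] weak_escape_growth(2)[OF assms, of "m + 3"] V_pos
    by (simp add: escapes_def numeral_eq_Suc)
  then show ?thesis by (auto simp: trapped_def)
qed

lemma escape_time:
  assumes "E \<notin> trapped V"
  shows "escapes V E (escape_time V E)" "1 \<le> escape_time V E"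
    "\<And>j. j < escape_time V E \<Longrightarrow> \<not> escapes V E j"
    "\<bar>X E (escape_time V E - 1)\<bar> \<le> 2"
proof -
  obtain m where m: "escapes V E m" using assms by (auto simp: trapped_def)
  show 1: "escapes V E (escape_time V E)" unfolding escape_time_def by (rule LeastI[of "escapes V E", OF m])
  have "\<not> escapes V E 0" by (simp add: escapes_def)
  then show 2: "1 \<le> escape_time V E" using 1 by (cases "escape_time V E") auto
  show 3: "\<not> escapes V E j" if "j < escape_time V E" for j
    using not_less_Least[of j "escapes V E"] that by (simp add: escape_time_def)
  show "\<bar>X E (escape_time V E - 1)\<bar> \<le> 2"
    using 3[of "escape_time V E - 1"] 1 2 by (auto simp: escapes_def)
qed

lemma escape_time_le: "escapes V E m \<Longrightarrow> escape_time V E \<le> m"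
  unfolding escape_time_def by (rule Least_le)

lemma escape_normal_form:
  assumes E: "E \<notin> trapped V" and n: "escape_time V E = n + 1"
  obtains s where "sign_seq s" "2 < s (n + 1) * X E (n + 1)" "2 < s (n + 2) * X E (n + 2)"
    "s n * X E n \<le> s (n + 3) * X E (n + 3)" "\<bar>s n * X E n\<bar> \<le> 2"
proof -
  have k: "2 < \<bar>X E (n + 1)\<bar>" "2 < \<bar>X E (n + 2)\<bar>" using escape_time(1)[OF E] by (auto simp: escapes_def n)
  obtain s where s: "sign_seq s" "s (n + 1) * X E (n + 1) = \<bar>X E (n + 1)\<bar>" "s (n + 2) * X E (n + 2) = \<bar>X E (n + 2)\<bar>"
  proof -
    have "X E (n + 1) \<noteq> 0" "X E (n + 2) \<noteq> 0" using k by auto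
    then show thesis using normalise[of E n] that by blast
  qed
  interpret y: trace_orbit V "\<lambda>n. s n * X E n" by (rule twisted_orbit[OF s(1)])
  have "2 * 2 \<le> s (n + 1) * X E (n + 1) * (s (n + 2) * X E (n + 2))"
    unfolding s using k by (intro mult_mono) auto
  then have "4 \<le> s (n + 3) * X E (n + 3) + s n * X E n"
    using y.roots_sum[of n] by simp
  moreover have "\<bar>s n * X E n\<bar> \<le> 2" using sign_seq_abs[OF s(1)] escape_time(4)[OF E] n by simp
  ultimately show thesis using that[of s] s k by auto
qed

lemma trace_large:
  assumes E: "E \<notin> trapped V" and N: "escape_time V E \<le> N"
  shows "2 < \<bar>X E N\<bar>"
proof -
  have "1 \<le> escape_time V E" "2 < \<bar>X E (escape_time V E)\<bar>" "2 < \<bar>X E (escape_time V E + 1)\<bar>"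
    using escape_time(1,2)[OF E] by (auto simp: escapes_def)
  moreover have "N = escape_time V E \<or> N = escape_time V E + 1 \<or> escape_time V E + 2 \<le> N" using N by linarith
  ultimately show ?thesis
    using weak_escape_growth(2)[of "escape_time V E" E N] V_pos by force
qed

text \<open>With both neighbours at most 2 in modulus, the invariant reads \<open>x^2\<close> minus
  at most \<open>4 * \<bar>x\<bar>\<close>, bounded by \<open>4 + V^2\<close>; this fails for
  \<open>\<bar>x\<bar> > 5\<close>.\<close>

lemma not_escaping_bound:
  assumes "1 \<le> n" "\<not> escapes V E (n - 1)" "\<not> escapes V E n"
  shows "\<bar>X E n\<bar> \<le> 5"
proof (rule ccontr)
  assume "\<not> ?thesis"
  then have big: "5 < \<bar>X E n\<bar>" by simp
  obtain k where k: "n = k + 1" using assms(1) by (metis add.commute le_Suc_ex plus_1_eq_Suc Suc_eq_plus1)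
  define x y w where "x = X E (k + 1)" and "y = X E (k + 2)" and "w = X E k"
  have yw: "\<bar>y\<bar> \<le> 2" "\<bar>w\<bar> \<le> 2" and x: "5 < \<bar>x\<bar>"
    using assms big by (auto simp: escapes_def k x_def y_def w_def numeral_eq_Suc)
  have inv: "y^2 + x^2 + w^2 - y * x * w = 4 + V^2"
    using trace_orbit.invariant[OF orbit, of E k] by (simp add: x_def y_def w_def)
  have "\<bar>y * w\<bar> \<le> 2 * 2" unfolding abs_mult using yw by (intro mult_mono) auto
  then have "\<bar>y * x * w\<bar> \<le> 4 * \<bar>x\<bar>"
    using mult_right_mono[of "\<bar>y * w\<bar>" 4 "\<bar>x\<bar>"] by (simp add: abs_mult mult_ac)
  moreover have "5 * \<bar>x\<bar> \<le> \<bar>x\<bar> * \<bar>x\<bar>" using x by (intro mult_right_mono) auto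
  then have "5 * \<bar>x\<bar> \<le> x^2" by (simp add: power2_eq_square)
  moreover have "V^2 \<le> 1" using V_pos V_small by (simp add: power_le_one)
  ultimately show False using inv x zero_le_power2[of y] zero_le_power2[of w] by linarith
qed

text \<open>The number of steps before the escape during which the traces, after normalisation of signs,
  are known to be positive already; \<open>fib reach\<close> is of order \<open>1 / sqrt V\<close>.\<close>

definition reach :: nat where "reach = (GREATEST i. 2 * sqrt V * fib (i + 1) \<le> 1)"

lemma le_fib_Suc: "n \<le> fib (n + 1)"
proof (induction n rule: less_induct)
  case (less n)
  show ?case
  proof (cases "n \<le> 2")
    case True
    then have "n = 0 \<or> n = 1 \<or> n = 2" by auto
    then show ?thesis by (auto simp: numeral_eq_Suc)
  next
    case False
    then obtain k where k: "n = k + 3" by (metis add.commute le_Suc_ex not_less_eq_eq numeral_2_eq_2 numeral_3_eq_3)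
    have "fib (n + 1) = fib (k + 3) + fib (k + 2)" by (simp add: k numeral_eq_Suc)
    moreover have "k + 2 \<le> fib (k + 3)" using less.IH[of "k + 2"] k by (simp add: numeral_eq_Suc)
    moreover have "1 \<le> fib (k + 2)" using fib_neq_0_nat[of "k + 2"] by linarith
    ultimately show ?thesis using k by simp
  qed
qed

text \<open>The defining inequality fails at \<open>reach + 1\<close>, and
  \<open>fib (reach + 2) \<le> 3 * fib reach\<close> moves this failure back to
  \<open>reach\<close>; hence the factor 6 in the lower bound.\<close>

lemma reach:
  "2 * sqrt V * fib (reach + 1) \<le> 1" "1 / (6 * sqrt V) \<le> fib reach" "3 \<le> reach"
proof -
  define P where "P = (\<lambda>i. 2 * sqrt V * fib (i + 1) \<le> 1)"
  have bound: "i \<le> nat \<lceil>1 / (2 * sqrt V)\<rceil>" if "P i" for i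
  proof -
    have "real i \<le> fib (i + 1)" using le_fib_Suc by simp
    also have "\<dots> \<le> 1 / (2 * sqrt V)" using that sqrt_V by (simp add: P_def field_simps)
    finally show ?thesis by linarith
  qed
  have P3: "P 3" using sqrt_V by (simp add: P_def numeral_eq_Suc)
  have Pb: "P reach" unfolding reach_def P_def[symmetric] by (rule GreatestI_nat[of P, OF P3 bound])
  then show "2 * sqrt V * fib (reach + 1) \<le> 1" by (simp add: P_def)
  show b3: "3 \<le> reach" unfolding reach_def P_def[symmetric] by (rule Greatest_le_nat[of P, OF P3 bound])
  have "\<not> P (reach + 1)"
    using Greatest_le_nat[of P "reach + 1" "nat \<lceil>1 / (2 * sqrt V)\<rceil>"] bound unfolding reach_def P_def[symmetric] by fastforce
  then have "1 < 2 * sqrt V * fib (reach + 2)" by (simp add: P_def)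
  moreover have "fib (reach + 2) \<le> 3 * fib reach"
  proof -
    obtain k where "reach = Suc k" using b3 by (cases reach) auto
    then show ?thesis using fib_Suc_mono[of k] by simp
  qed
  then have "2 * sqrt V * fib (reach + 2) \<le> 2 * sqrt V * (3 * fib reach)"
    using sqrt_V by (intro mult_left_mono) (auto simp flip: of_nat_mult)
  ultimately have "1 \<le> 6 * sqrt V * fib reach" by linarith
  then show "1 / (6 * sqrt V) \<le> fib reach" using sqrt_V by (simp add: field_simps)
qed

text \<open>The product of three consecutive signs of a sign sequence is 1, so the triple product
  may be computed after normalisation. There all three traces are positive: after the escape by
  growth, before it by \<open>backward_window\<close>.\<close>

lemma escape_window:
  assumes E: "E \<notin> trapped V" and j: "escape_time V E - reach \<le> j"
  shows "0 < X E (j + 2) * X E (j + 1) * X E j"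
proof -
  define m where "m = escape_time V E"
  obtain n where n: "m = n + 1" using escape_time(2)[OF E] by (metis add.commute le_Suc_ex m_def)
  obtain s where s: "sign_seq s" "2 < s (n + 1) * X E (n + 1)" "2 < s (n + 2) * X E (n + 2)"
    "s n * X E n \<le> s (n + 3) * X E (n + 3)" "\<bar>s n * X E n\<bar> \<le> 2"
    using escape_normal_form[OF E] n unfolding m_def by blast
  interpret y: trace_orbit V "\<lambda>n. s n * X E n" by (rule twisted_orbit[OF s(1)])
  have late: "0 < s k * X E k" if "m \<le> k" for k
    using y.growth_forever[of n "k - m"] s that by (auto simp: n)
  have pred: "0 < s n * X E n"
  proof -
    have a: "(s (n + 2) * X E (n + 2) - s (n + 1) * X E (n + 1))^2 + (2 - s n * X E n) * (s (n + 2) * X E (n + 2) * (s (n + 1) * X E (n + 1)) - 2 - s n * X E n) = V^2"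
      by (rule y.three_term)
    define u p where "u = s n * X E n" and "p = s (n + 2) * X E (n + 2) * (s (n + 1) * X E (n + 1))"
    have "2 * 2 < p" unfolding p_def using s by (intro mult_strict_mono) auto
    then have "(2 - u) * (2 - u) \<le> (2 - u) * (p - 2 - u)"
      using s(5) by (intro mult_left_mono) (auto simp: u_def abs_le_iff)
    then have "(2 - u) * (2 - u) \<le> V^2"
      using a zero_le_power2[of "s (n + 2) * X E (n + 2) - s (n + 1) * X E (n + 1)"] unfolding u_def p_def by linarith
    also have "\<dots> \<le> V * 1" unfolding power2_eq_square using V_pos V_small by (intro mult_left_mono) auto
    finally have "(2 - u) * (2 - u) \<le> 1/1000" using V_small by linarith
    moreover have "2 * 2 \<le> (2 - u) * (2 - u)" if "u \<le> 0" using that by (intro mult_mono) auto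
    ultimately have "u > 0" by (cases "u \<le> 0") auto
    then show ?thesis by (simp add: u_def)
  qed
  have pos: "0 < s k * X E k \<or> k = 0 \<and> m \<le> 2" if k: "m - reach \<le> k" for k
  proof (cases "m \<le> k")
    case True
    then show ?thesis using late by blast
  next
    case False
    show ?thesis
    proof (cases "3 \<le> m")
      case True
      define i where "i = m - k"
      have i: "i \<le> m" "i \<le> reach" "m - i = k" using k False by (auto simp: i_def)
      have "2 * sqrt V * fib (i + 1) \<le> 2 * sqrt V * fib (reach + 1)"
        using i sqrt_V by (intro mult_left_mono) (auto intro!: fib_mono)
      then have f: "2 * sqrt V * fib (i + 1) \<le> 1" using reach(1) by linarith
      have "1 \<le> s (m - i) * X E (m - i)"
      proof (rule y.backward_window[OF _ _ True _ i(1) f])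
        show "2 < s m * X E m" "2 < s (m + 1) * X E (m + 1)" using s by (auto simp: n numeral_eq_Suc)
        fix j assume "j < m"
        then show "\<not> (2 < \<bar>s j * X E j\<bar> \<and> 2 < \<bar>s (j + 1) * X E (j + 1)\<bar>)"
          using escape_time(3)[OF E, of j] by (simp add: sign_seq_abs[OF s(1)] escapes_def m_def)
      qed
      then show ?thesis using i by simp
    next
      case m2: False
      then show ?thesis using False pred n by (cases "k = n") auto
    qed
  qed
  have ssq: "s (j + 2) * s (j + 1) * s j = 1"
    using s(1) sign_seq_square[OF s(1), of "j + 2"] unfolding sign_seq_def by (simp add: mult.assoc)
  have eq: "X E (j + 2) * X E (j + 1) * X E j = (s (j + 2) * X E (j + 2)) * (s (j + 1) * X E (j + 1)) * (s j * X E j)"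
  proof -
    have "(s (j + 2) * X E (j + 2)) * (s (j + 1) * X E (j + 1)) * (s j * X E j) = (s (j + 2) * s (j + 1) * s j) * (X E (j + 2) * X E (j + 1) * X E j)"
      by (simp only: mult_ac)
    then show ?thesis by (simp only: ssq mult_1)
  qed
  have p12: "0 < s (j + 2) * X E (j + 2)" "0 < s (j + 1) * X E (j + 1)"
    using pos[of "j + 1"] pos[of "j + 2"] j by (auto simp: m_def)
  show ?thesis
  proof (cases "0 < s j * X E j")
    case True
    then show ?thesis unfolding eq using mult_pos_pos[OF mult_pos_pos[OF p12] True] by simp
  next
    case False
    then have j0: "j = 0" "m \<le> 2" using pos[of j] j by (auto simp: m_def)
    \<comment> \<open>The remaining case, index 0 with escape time at most 2, is settled by the
      explicit traces: \<open>\<bar>E - V\<bar> > 2\<close> and a small \<open>V\<close> give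
      \<open>E\<close> and \<open>E - V\<close> the same sign.\<close>
    have "0 < E * (E - V)"
    proof -
      have "2 < \<bar>E - V\<bar>"
        using escape_time(1)[OF E] j0 n by (cases "n = 0") (auto simp: escapes_def m_def numeral_2_eq_2 le_Suc_eq)
      then show ?thesis using V_pos V_small by (cases "0 < E") (auto intro: mult_pos_pos mult_neg_neg)
    qed
    moreover have "X E (j + 2) * X E (j + 1) * X E j = (E * (E - V)) * 2" using j0 by (simp add: numeral_2_eq_2)
    ultimately show ?thesis by simp
  qed
qed

lemma above_fib_escaped:
  assumes "E \<notin> trapped V" "escape_time V E - reach \<le> j"
  shows "above (zeros V (j + 2)) E = above (zeros V (j + 1)) E + above (zeros V j) E"
  by (rule above_fib[OF escape_window[OF assms]])

text \<open>Without a zero in between, the trace keeps its sign, so a minimum of its modulus below 2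
  would be an interior critical point. By \<open>elliptic_twist\<close> there are none.\<close>

lemma large_between:
  assumes n: "1 \<le> n" and "s \<le> t" and st: "2 \<le> \<bar>X s n\<bar>" "2 \<le> \<bar>X t n\<bar>"
    and z: "zcount V n s t = 0" and p: "s \<le> p" "p \<le> t"
  shows "2 \<le> \<bar>X p n\<bar>"
proof (rule ccontr)
  assume small: "\<not> ?thesis"
  have nz: "X q n \<noteq> 0" if "s \<le> q" "q \<le> t" for q
  proof
    assume "X q n = 0"
    then have "q \<in> set (zeros V n)" using trace_zero_iff[OF n] by blast
    moreover have "q \<noteq> s" using \<open>X q n = 0\<close> st(1) by auto
    ultimately have "q \<in> set (filter (\<lambda>z. s < z \<and> z \<le> t) (zeros V n))" using that by auto
    then show False using z zcount_filter[OF assms(2), of V n] by (metis length_0_conv list.set(1) empty_iff)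
  qed
  define f where "f = (\<lambda>q. \<bar>X q n\<bar>)"
  have cont: "continuous_on {s..t} f" unfolding f_def by (intro continuous_intros)
  obtain q where q: "q \<in> {s..t}" "\<And>r. r \<in> {s..t} \<Longrightarrow> f q \<le> f r"
    using continuous_attains_inf[OF compact_Icc _ cont] assms(2) by auto
  have fq: "f q < 2" using q(2)[of p] p small by (auto simp: f_def)
  then have q': "s < q" "q < t" using q st by (auto simp: f_def less_le)
  define \<sigma> where "\<sigma> = sgn (X q n)"
  define d where "d = min (q - s) (t - q)"
  have d: "0 < d" using q' by (simp add: d_def)
  have sgn_const: "\<sigma> * X r n = f r" if r: "r \<in> {s..t}" for r
  proof (rule ccontr)
    assume ne: "\<sigma> * X r n \<noteq> f r"
    then have "sgn (X r n) \<noteq> \<sigma>" by (auto simp: f_def abs_sgn mult.commute)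
    then have "X r n * X q n < 0" using nz[of r] nz[of q] q r by (auto simp: \<sigma>_def sgn_if mult_less_0_iff split: if_splits)
    moreover have "continuous_on {min r q..max r q} (\<lambda>q. X q n)" by (intro continuous_intros)
    ultimately have "\<exists>u. min r q \<le> u \<and> u \<le> max r q \<and> X u n = 0"
      using IVT'[of "\<lambda>q. X q n" "min r q" 0 "max r q"] IVT2'[of "\<lambda>q. X q n" "max r q" 0 "min r q"]
      by (auto simp: mult_less_0_iff min_def max_def split: if_splits)
    then show False using nz q r by (auto simp: min_def max_def split: if_splits)
  qed
  have "((\<lambda>q. \<sigma> * X q n) has_real_derivative \<sigma> * trace_deriv V q n) (at q)"
    by (intro DERIV_cmult trace_seq_has_derivative)
  then have "\<sigma> * trace_deriv V q n = 0"
  proof (rule DERIV_local_min[OF _ d], intro allI impI)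
    fix r assume "\<bar>q - r\<bar> < d"
    then have "r \<in> {s..t}" by (auto simp: d_def)
    then show "\<sigma> * X q n \<le> \<sigma> * X r n" using q sgn_const by auto
  qed
  moreover have "\<sigma> \<noteq> 0" using nz[of q] q by (auto simp: \<sigma>_def sgn_if)
  ultimately have "trace_deriv V q n = 0" by simp
  then show False using elliptic_twist[OF n, of V q] fq by (simp add: f_def)
qed

lemma fib_recurrent_zero:
  fixes z :: "nat \<Rightarrow> nat"
  assumes "\<And>j. j0 \<le> j \<Longrightarrow> z (j + 2) = z (j + 1) + z j" "z j0 = 0" "z (j0 + 1) = 0"
  shows "j0 \<le> j \<Longrightarrow> z j = 0"
proof -
  have "z (j0 + k) = 0 \<and> z (j0 + k + 1) = 0" for k
    using assms by (induction k) (auto simp: numeral_eq_Suc dest: spec[of _ "j0 + _"])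
  then show "j0 \<le> j \<Longrightarrow> z j = 0" by (metis le_Suc_ex)
qed

lemma fib_recurrent_ge:
  fixes z :: "nat \<Rightarrow> nat"
  assumes rec: "\<And>j. j0 \<le> j \<Longrightarrow> z (j + 2) = z (j + 1) + z j" and "z j0 \<noteq> 0 \<or> z (j0 + 1) \<noteq> 0"
  shows "fib k \<le> z (j0 + 1 + k)"
proof -
  have "fib k \<le> z (j0 + 1 + k) \<and> fib (k + 1) \<le> z (j0 + 1 + (k + 1))"
  proof (induction k)
    case 0
    then show ?case using assms(2) rec[of j0] by (auto simp: numeral_eq_Suc)
  next
    case (Suc k)
    have "z (j0 + 1 + (Suc k + 1)) = z (j0 + 1 + (k + 1)) + z (j0 + 1 + k)"
      using rec[of "j0 + 1 + k"] by (simp add: numeral_eq_Suc)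
    then show ?case using Suc by simp
  qed
  then show ?thesis by blast
qed

lemma fib_mult_le: "fib a * fib b \<le> fib (a + b - 1)"
proof (cases a; cases b)
  fix a' b' assume "a = Suc a'" "b = Suc b'"
  then show ?thesis using fib_add[of a' b'] by (simp add: mult.commute)
qed auto

lemma zcount_recurrence:
  assumes "s \<notin> trapped V" "t \<notin> trapped V" "max (escape_time V s) (escape_time V t) - reach \<le> j"
  shows "zcount V (j + 2) s t = zcount V (j + 1) s t + zcount V j s t"
proof -
  have e: "escape_time V s - reach \<le> j" "escape_time V t - reach \<le> j" using assms by auto
  have le: "above (zeros V i) (max s t) \<le> above (zeros V i) (min s t)" for i
    by (intro above_antimono) simp
  show ?thesis
    using above_fib_escaped[OF assms(1) e(1)] above_fib_escaped[OF assms(2) e(2)] le[of j] le[of "j + 1"] le[of "j + 2"]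
    unfolding zcount_def by (auto simp: min_def max_def split: if_splits)
qed

text \<open>The recursion for the counts is exact from index \<open>m - reach\<close> on. If its
  first two terms vanished, so would all later ones, and by \<open>large_between\<close> the trapped
  energy \<open>p\<close> would have large traces from \<open>m\<close> on. Hence the recursion has
  a nonzero seed \<open>reach\<close> steps before \<open>m\<close>, which accounts for the factor
  \<open>fib reach\<close>.\<close>

lemma zcount_lower:
  assumes st: "s \<notin> trapped V" "t \<notin> trapped V" and p: "p \<in> trapped V" "min s t < p" "p < max s t"
    and m: "m = max (escape_time V s) (escape_time V t)" "reach \<le> m" "m \<le> n"
  shows "fib (n - m) * fib reach \<le> zcount V n s t"
proof -
  define z where "z = (\<lambda>j. zcount V j s t)"
  define j0 where "j0 = m - reach"
  have rec: "z (j + 2) = z (j + 1) + z j" if "j0 \<le> j" for j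
    unfolding z_def by (rule zcount_recurrence[OF st]) (use that m in \<open>simp add: j0_def\<close>)
  have m1: "1 \<le> m" using escape_time(2)[OF st(1)] m by simp
  have "z j0 \<noteq> 0 \<or> z (j0 + 1) \<noteq> 0"
  proof (rule ccontr)
    assume "\<not> ?thesis"
    then have z0: "z j = 0" if "j0 \<le> j" for j using fib_recurrent_zero[of j0 z j, OF rec] that by auto
    have "2 \<le> \<bar>X p j\<bar>" if "m \<le> j" for j
    proof (rule large_between)
      show "1 \<le> j" using that m1 by simp
      have "2 < \<bar>X s j\<bar>" "2 < \<bar>X t j\<bar>" using trace_large st that m by auto
      then show "2 \<le> \<bar>X (min s t) j\<bar>" "2 \<le> \<bar>X (max s t) j\<bar>" by (auto simp: min_def max_def)
      have "z j = 0" using z0 that by (simp add: j0_def)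
      then show "zcount V j (min s t) (max s t) = 0" by (simp add: z_def zcount_def min_def max_def split: if_splits)
    qed (use p in auto)
    then show False using weak_escape_not_trapped[of m p] m1 p by simp
  qed
  then have "fib (n - m + reach - 1) \<le> z (j0 + 1 + (n - m + reach - 1))" using fib_recurrent_ge[of j0 z "n - m + reach - 1"] rec by blast
  moreover have "j0 + 1 + (n - m + reach - 1) = n" using m(2,3) reach(3) by (simp add: j0_def)
  ultimately show ?thesis using fib_mult_le[of "n - m" reach] by (simp add: z_def)
qed

lemma open_escapes: "open {E. escapes V E m}"
  unfolding escapes_def by (intro open_Collect_conj open_Collect_less continuous_intros)

lemma closed_trapped: "closed (trapped V)"
proof -
  have "- trapped V = (\<Union>m. {E. escapes V E m})" by (auto simp: trapped_def)
  then show ?thesis unfolding closed_def using open_escapes by auto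
qed

lemma uniform_escape:
  assumes "compact K" "K \<inter> trapped V = {}"
  obtains N where "\<And>j q. N \<le> j \<Longrightarrow> q \<in> K \<Longrightarrow> 2 < \<bar>X q j\<bar>"
proof -
  have "K \<subseteq> \<Union> (range (\<lambda>m. {E. escapes V E m}))" using assms(2) by (auto simp: trapped_def)
  then obtain F where F: "finite F" "K \<subseteq> (\<Union>m\<in>F. {E. escapes V E m})"
    using compactE_image[OF assms(1), of UNIV "\<lambda>m. {E. escapes V E m}"] open_escapes by auto
  define N where "N = Max (insert 0 F)"
  show thesis
  proof (rule that[of N])
    fix j q assume j: "N \<le> j" and q: "q \<in> K"
    then obtain m where m: "m \<in> F" "escapes V q m" using F by auto
    have "m \<le> N" using m F by (simp add: N_def)
    then show "2 < \<bar>X q j\<bar>"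
      using trace_large[of q j] escape_time_le[OF m(2)] m j assms(2) q by auto
  qed
qed

text \<open>For an escape time up to \<open>reach\<close> the exact recursion starts at index 0,
  where the count is 0, so the count at \<open>j\<close> is \<open>fib j\<close> times the count at
  1: all zeros lie on one side of \<open>E\<close>. A trapped energy on the other side is farther
  from every zero, has larger traces and would escape as well.\<close>

lemma early_escape_outside:
  assumes E: "E \<notin> trapped V" and b: "b \<in> trapped V" "b < E" and b': "b' \<in> trapped V" "E < b'"
  shows "reach < escape_time V E"
proof (rule ccontr)
  assume "\<not> ?thesis"
  then have early: "escape_time V E \<le> reach" by simp
  define a where "a = (\<lambda>j. above (zeros V j) E)"
  have rec: "a (j + 2) = a (j + 1) + a j" for j
    unfolding a_def by (rule above_fib_escaped[OF E]) (use early in simp)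
  have a0: "a 0 = 0" by (simp add: a_def zeros_def band_points_def)
  have len: "length (zeros V j) = fib j" for j by (simp add: zeros_def length_band_points)
  have a1: "a 1 \<le> 1" using above_le_length[of "zeros V 1" E] len[of 1] by (simp add: a_def)
  have "a j = fib j * a 1 \<and> a (Suc j) = fib (Suc j) * a 1" for j
  proof (induction j)
    case (Suc j)
    then show ?case using rec[of j] by (simp add: algebra_simps)
  qed (simp add: a0)
  then have aj: "a j = fib j * a 1" for j by blast
  define m where "m = escape_time V E"
  have m: "1 \<le> m" "2 < \<bar>X E m\<bar>" "2 < \<bar>X E (m + 1)\<bar>"
    using escape_time(1,2)[OF E] by (auto simp: m_def escapes_def)
  have prod: "X q j = (\<Prod>z\<leftarrow>zeros V j. q - z)" if "1 \<le> j" for q j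
    using band_points_real[of j 0 V q] that by (simp add: zeros_def)
  have mono: "\<bar>\<Prod>z\<leftarrow>zs. E - z\<bar> \<le> \<bar>\<Prod>z\<leftarrow>zs. q - z\<bar>" if "\<And>z. z \<in> set zs \<Longrightarrow> \<bar>E - z\<bar> \<le> \<bar>q - z\<bar>" for q and zs :: "real list"
    using that by (induction zs) (auto simp: abs_mult intro!: mult_mono)
  consider "a 1 = 0" | "a 1 = 1" using a1 by linarith
  then show False
  proof cases
    case 1
    then have none: "\<not> E < z" if "z \<in> set (zeros V j)" for z j
      using aj[of j] that unfolding a_def above_def by (auto simp: filter_empty_conv)
    have "\<bar>X E j\<bar> \<le> \<bar>X b' j\<bar>" if "1 \<le> j" for j
      unfolding prod[OF that] by (rule mono) (use none b' in fastforce)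
    from this[of m] this[of "m + 1"] have "escapes V b' m" using m by (simp add: escapes_def)
    then show False using b' by (auto simp: trapped_def)
  next
    case 2
    then have all: "E < z" if "z \<in> set (zeros V j)" for z j
      using aj[of j] len[of j] that length_filter_less[of z "zeros V j" "\<lambda>z. E < z"] unfolding a_def above_def by fastforce
    have "\<bar>X E j\<bar> \<le> \<bar>X b j\<bar>" if "1 \<le> j" for j
      unfolding prod[OF that] by (rule mono) (use all b in fastforce)
    from this[of m] this[of "m + 1"] have "escapes V b m" using m by (simp add: escapes_def)
    then show False using b by (auto simp: trapped_def)
  qed
qed

lemma ln3_le: "ln (3::real) \<le> 2" "ln (6::real) \<le> 2"
proof -
  have "ln (6::real) \<le> ln (exp 2)"
  proof (subst ln_le_cancel_iff)
    have "1 + 1 + 1/2 \<le> exp (1::real)" using exp_lower_Taylor_quadratic[of 1] by simp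
    then have "(5/2) * (5/2) \<le> exp 1 * exp (1::real)" by (intro mult_mono) auto
    then show "6 \<le> exp (2::real)" by (simp add: exp_add[symmetric])
  qed auto
  then show "ln (6::real) \<le> 2" by simp
  moreover have "ln (3::real) \<le> ln 6" by simp
  ultimately show "ln (3::real) \<le> 2" by linarith
qed

text \<open>By \<open>first_escape\<close> the rates at the escape are at most
  \<open>4 * sqrt V\<close>, and \<open>growth_upper\<close> adds one more \<open>sqrt V\<close>.
  The factor 15 is 5 times 3, from \<open>fib (j + 2) \<le> 3 * fib j\<close>.\<close>

lemma escaped_upper:
  assumes E: "E \<notin> trapped V" and m: "m = escape_time V E" "3 \<le> m" "m \<le> n"
  shows "ln (\<bar>X E n\<bar> + 1) \<le> 3 + 15 * sqrt V * fib (n - m)"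
proof -
  obtain k where k: "m = k + 3" using m by (metis add.commute le_Suc_ex)
  then have et: "escape_time V E = (k + 2) + 1" using m by simp
  obtain s where s: "sign_seq s" "2 < s (k + 3) * X E (k + 3)" "2 < s (k + 4) * X E (k + 4)"
    "s (k + 2) * X E (k + 2) \<le> s (k + 5) * X E (k + 5)" "\<bar>s (k + 2) * X E (k + 2)\<bar> \<le> 2"
    using escape_normal_form[OF E et] by (auto simp: add_ac numeral_eq_Suc)
  interpret y: trace_orbit V "\<lambda>n. s n * X E n" by (rule twisted_orbit[OF s(1)])
  have nk: "\<bar>s (k + 1) * X E (k + 1)\<bar> \<le> 2 \<or> \<bar>s k * X E k\<bar> \<le> 2"
    using escape_time(3)[OF E, of k] m k by (auto simp: escapes_def sign_seq_abs[OF s(1)])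
  have up: "s (k + 3) * X E (k + 3) \<le> 2 + 11 * V" "s (k + 4) * X E (k + 4) \<le> 2 + 11 * V"
    using y.first_escape[OF s(2,3,5) nk] by auto
  have t: "arcosh (x / 2) \<le> 4 * sqrt V" if "2 < x" "x \<le> 2 + 11 * V" for x
  proof -
    define t where "t = arcosh (x / 2)"
    have t0: "0 \<le> t" "x = 2 * cosh t" using that by (auto simp: t_def)
    then have "t^2 \<le> 11 * V" using cosh_ge_quadratic[of t] that by simp
    also have "\<dots> \<le> (4 * sqrt V)^2" using V_pos by (simp add: power_mult_distrib)
    finally show ?thesis unfolding t_def[symmetric] by (rule power2_le_imp_le) (use V_pos in auto)
  qed
  define j where "j = n - m"
  have n: "n = k + 3 + j" using m k by (simp add: j_def)
  have g: "2 \<le> s ((k + 2) + 1) * X E ((k + 2) + 1)" "2 \<le> s ((k + 2) + 2) * X E ((k + 2) + 2)"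
    "s (k + 2) * X E (k + 2) \<le> s ((k + 2) + 3) * X E ((k + 2) + 3)"
    using s by (auto simp: numeral_eq_Suc)
  have D: "arcosh (s ((k + 2) + 1) * X E ((k + 2) + 1) / 2) \<le> 4 * sqrt V" "arcosh (s ((k + 2) + 2) * X E ((k + 2) + 2) / 2) \<le> 4 * sqrt V"
    using t[OF s(2) up(1)] t[OF s(3) up(2)] by (simp_all add: numeral_eq_Suc)
  define u where "u = arcosh (s n * X E n / 2)"
  have "u \<le> (4 * sqrt V + sqrt V) * fib (j + 2)"
    using y.growth_upper[OF g D, of j] unfolding u_def n by (simp add: numeral_eq_Suc)
  then have u5: "u \<le> 5 * sqrt V * fib (j + 2)" by simp
  have big: "2 \<le> s n * X E n" using y.growth_forever[OF g, of j] by (simp add: n numeral_eq_Suc)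
  have u0: "0 \<le> u" unfolding u_def using big by (intro arcosh_nonneg_real) simp
  have "cosh u = s n * X E n / 2" unfolding u_def using big by (intro cosh_arcosh_real) simp
  then have X: "\<bar>X E n\<bar> = 2 * cosh u"
    using sign_seq_abs[OF s(1), of n "X E n"] big by linarith
  have "exp (- u) \<le> exp u" "1 \<le> exp u" using u0 by auto
  moreover have "2 * cosh u = exp u + exp (- u)" by (simp add: cosh_def)
  ultimately have "\<bar>X E n\<bar> + 1 \<le> 3 * exp u" unfolding X by linarith
  then have "ln (\<bar>X E n\<bar> + 1) \<le> ln (3 * exp u)" by (subst ln_le_cancel_iff) (auto simp: add_nonneg_pos)
  also have "\<dots> = ln 3 + u" by (simp add: ln_mult_pos)
  also have "\<dots> \<le> 2 + 5 * sqrt V * fib (j + 2)" using ln3_le u5 by linarith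
  also have "\<dots> \<le> 3 + 15 * sqrt V * fib j"
  proof (cases j)
    case 0
    then show ?thesis using sqrt_V by simp
  next
    case (Suc i)
    have "fib (j + 2) \<le> 3 * fib j" using fib_Suc_mono[of i] by (simp add: Suc)
    then have "5 * sqrt V * fib (j + 2) \<le> 5 * sqrt V * (3 * fib j)"
      using sqrt_V by (intro mult_left_mono) (auto simp flip: of_nat_mult)
    then show ?thesis by simp
  qed
  finally show ?thesis by (simp add: j_def)
qed

lemma unescaped_upper:
  assumes "1 \<le> n" "E \<in> trapped V \<or> n < escape_time V E"
  shows "ln (\<bar>X E n\<bar> + 1) \<le> 3"
proof -
  have "\<not> escapes V E (n - 1)" "\<not> escapes V E n"
  proof -
    have "\<not> escapes V E j" if "j \<le> n" for j
    proof (cases "E \<in> trapped V")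
      case True
      then show ?thesis by (simp add: trapped_def)
    next
      case False
      then show ?thesis using escape_time(3)[OF False, of j] assms(2) that by simp
    qed
    then show "\<not> escapes V E (n - 1)" "\<not> escapes V E n" by auto
  qed
  then have "\<bar>X E n\<bar> + 1 \<le> 6" using not_escaping_bound[OF assms(1)] by auto
  then have "ln (\<bar>X E n\<bar> + 1) \<le> ln 6" by (subst ln_le_cancel_iff) (auto simp: add_nonneg_pos)
  then show ?thesis using ln3_le by linarith
qed

text \<open>The bound \<open>15 * sqrt V * fib (n - m)\<close> for the growth meets the lower bound
  \<open>fib (n - m) / (6 * sqrt V)\<close> for the number of zeros; 90 is 15 times 6.\<close>

lemma growth_vs_zcount:
  assumes E: "E \<notin> trapped V" and b: "b \<in> trapped V" "b < E" and b': "b' \<in> trapped V" "E < b'"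
    and t: "t \<notin> trapped V" "escape_time V t \<le> escape_time V E"
    and p: "p \<in> trapped V" "min E t < p" "p < max E t" and n: "1 \<le> n"
  shows "ln (\<bar>X E n\<bar> + 1) \<le> 3 + 90 * V * zcount V n E t"
proof (cases "n < escape_time V E")
  case True
  have "0 \<le> 90 * V * zcount V n E t" using V_pos by simp
  then show ?thesis using unescaped_upper[OF n, of E] True by simp
next
  case False
  define m where "m = escape_time V E"
  have bm: "reach < m" using early_escape_outside[OF E b b'] by (simp add: m_def)
  have "fib (n - m) * fib reach \<le> zcount V n E t"
    by (rule zcount_lower[OF E t(1) p]) (use t False bm in \<open>auto simp: m_def\<close>)
  then have z: "real (fib (n - m)) * fib reach \<le> zcount V n E t" by (simp flip: of_nat_mult)
  have "real (fib (n - m)) * (1 / (6 * sqrt V)) \<le> real (fib (n - m)) * fib reach"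
    using reach(2) by (intro mult_left_mono) auto
  then have "real (fib (n - m)) / (6 * sqrt V) \<le> zcount V n E t" using z by simp
  then have "real (fib (n - m)) \<le> 6 * sqrt V * zcount V n E t" using sqrt_V by (simp add: pos_divide_le_eq mult.commute)
  then have "15 * sqrt V * fib (n - m) \<le> 15 * sqrt V * (6 * sqrt V * zcount V n E t)"
    using sqrt_V by (intro mult_left_mono) auto
  also have "\<dots> = 90 * V * zcount V n E t" using sqrt_V(2) by (simp add: algebra_simps)
  finally show ?thesis
    using escaped_upper[OF E m_def, of n] False bm reach(3) by (simp add: m_def)
qed

end

subsection \<open>Gaps are short compared with their distances\<close>

lemma ln_second_difference_le:
  assumes "s < \<bar>w :: real\<bar>" "0 < s"
  shows "ln ((w + s)^2) / 2 + ln ((w - s)^2) / 2 \<le> ln (w^2) - s^2 / w^2"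
proof -
  have sw: "s^2 < w^2"
  proof -
    have "s^2 < \<bar>w\<bar>^2" using assms by (intro power_strict_mono) auto
    then show ?thesis by simp
  qed
  have w: "w \<noteq> 0" "w + s \<noteq> 0" "w - s \<noteq> 0" using assms by auto
  have w2: "0 < w^2" using w by simp
  have "ln ((w + s)^2) + ln ((w - s)^2) = ln ((w + s)^2 * (w - s)^2)"
    by (rule ln_mult_pos[symmetric]) (use w in auto)
  also have "(w + s)^2 * (w - s)^2 = (w^2 - s^2)^2" by (simp add: power2_eq_square algebra_simps)
  also have "ln ((w^2 - s^2)^2) = 2 * ln (w^2 - s^2)" using sw by (simp add: ln_realpow)
  also have "w^2 - s^2 = w^2 * (1 + - (s^2 / w^2))" using w by (simp add: algebra_simps)
  also have "ln (w^2 * (1 + - (s^2 / w^2))) = ln (w^2) + ln (1 + - (s^2 / w^2))"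
    by (rule ln_mult_pos) (use w sw w2 in \<open>auto simp: divide_less_eq\<close>)
  finally have "ln ((w + s)^2) + ln ((w - s)^2) = 2 * (ln (w^2) + ln (1 + - (s^2 / w^2)))" .
  moreover have "ln (1 + - (s^2 / w^2)) \<le> - (s^2 / w^2)"
    by (rule ln_add_one_self_le_self2) (use sw w2 in \<open>simp add: divide_less_eq\<close>)
  ultimately show ?thesis by (simp add: field_simps)
qed

lemma ln_add_square_le:
  assumes "(w :: real) \<noteq> 0"
  shows "ln (w^2 + y^2) / 2 \<le> ln (w^2) / 2 + y^2 / 2 * (1 / w^2)"
proof -
  have w2: "0 < w^2" using assms by simp
  have "w^2 + y^2 = w^2 * (1 + y^2 / w^2)" using assms by (simp add: algebra_simps)
  then have "ln (w^2 + y^2) = ln (w^2) + ln (1 + y^2 / w^2)"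
    using w2 by (simp add: ln_mult_pos add_pos_nonneg)
  moreover have "ln (1 + y^2 / w^2) \<le> y^2 / w^2" by (rule ln_add_one_self_le_self) simp
  ultimately show ?thesis by (simp add: field_simps)
qed

lemma ln_add_square_ge:
  assumes "(w :: real) \<noteq> 0"
  shows "ln (w^2) / 2 + (if \<bar>w\<bar> \<le> D then ln 2 / 2 else 0) \<le> ln (w^2 + D^2) / 2"
proof -
  have w2: "0 < w^2" using assms by simp
  show ?thesis
  proof (cases "\<bar>w\<bar> \<le> D")
    case True
    then have "\<bar>w\<bar>^2 \<le> D^2" by (intro power_mono) auto
    then have "2 * w^2 \<le> w^2 + D^2" by simp
    then have "ln (2 * w^2) \<le> ln (w^2 + D^2)" using w2 by (subst ln_le_cancel_iff) (auto simp: add_pos_nonneg)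
    then show ?thesis using True w2 by (simp add: ln_mult_pos)
  next
    case False
    then show ?thesis using w2 by (auto simp: add_pos_nonneg)
  qed
qed

lemma length_filter_mono:
  "(\<And>x. x \<in> set xs \<Longrightarrow> P x \<Longrightarrow> Q x) \<Longrightarrow> length (filter P xs) \<le> length (filter Q xs)"
  by (induction xs) (auto simp: le_SucI)

lemma sum_list_indicator: "(\<Sum>z\<leftarrow>zs. if P z then c else 0 :: real) = c * length (filter P zs)"
  by (induction zs) (auto simp: algebra_simps)

context coupling
begin

lemma ln_trace_sum:
  assumes "1 \<le> n" "\<And>z. z \<in> set (zeros V n) \<Longrightarrow> x \<noteq> z"
  shows "ln \<bar>X x n\<bar> = (\<Sum>z\<leftarrow>zeros V n. ln ((x - z)^2) / 2)"
proof -
  have "trace_seq V (Complex x 0) n = of_real (X x n)"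
    by (simp add: complex_of_real_def[symmetric] trace_seq_of_real)
  then have "cmod (trace_seq V (Complex x 0) n) = \<bar>X x n\<bar>" by simp
  then show ?thesis using ln_norm_trace_seq[OF assms(1), of V x 0] assms(2) by auto
qed

text \<open>Three estimates of the logarithmic sum over the zeros. Its concavity between zeros
  bounds the sum of \<open>1 / (c - z)^2\<close>, and thereby the height at
  \<open>c + \<i> * g\<close>, by the growth at \<open>c\<close>. At \<open>c + \<i> * D\<close>
  every zero within distance \<open>D\<close> contributes at least \<open>ln 2 / 2\<close>, so the
  height there dominates the count. The Harnack bound along the vertical line compares the two
  heights.\<close>

lemma growth_ge_zcount:
  assumes n: "1 \<le> n" and g: "0 < g" "g \<le> D"
    and big: "\<And>x. \<bar>x - c\<bar> \<le> g / 4 \<Longrightarrow> 2 < \<bar>X x n\<bar>"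
    and near: "\<And>z. z \<in> set (zeros V n) \<Longrightarrow> min c t < z \<Longrightarrow> z \<le> max c t \<Longrightarrow> \<bar>c - z\<bar> \<le> D"
  shows "g / D * (1/3) * zcount V n c t \<le> 18 * ln \<bar>X c n\<bar>"
proof -
  define zs where "zs = zeros V n"
  define s where "s = g / 4"
  define S where "S = (\<Sum>z\<leftarrow>zs. 1 / (c - z)^2)"
  define \<phi> where "\<phi> = (\<lambda>x. ln \<bar>X x n\<bar>)"
  define q where "q = (\<lambda>y. ln (cmod (trace_seq V (Complex c y) n)))"
  have s: "0 < s" using g by (simp add: s_def)
  have far: "s < \<bar>c - z\<bar>" if "z \<in> set zs" for z
  proof (rule ccontr)
    assume "\<not> ?thesis"
    then have "\<bar>z - c\<bar> \<le> g / 4" by (simp add: s_def abs_minus_commute)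
    from big[OF this] have "X z n \<noteq> 0" by auto
    then show False using that trace_zero_iff[OF n] by (auto simp: zs_def)
  qed
  have cz: "c - z \<noteq> 0" if "z \<in> set zs" for z using far[OF that] s by auto
  have \<phi>: "\<phi> x = (\<Sum>z\<leftarrow>zs. ln ((x - z)^2) / 2)" if "\<bar>x - c\<bar> \<le> s" for x
    unfolding \<phi>_def zs_def
  proof (rule ln_trace_sum[OF n])
    fix z assume "z \<in> set (zeros V n)"
    then show "x \<noteq> z" using far[of z] that by (auto simp: zs_def abs_minus_commute)
  qed
  have q: "q y = (\<Sum>z\<leftarrow>zs. ln ((c - z)^2 + y^2) / 2)" for y
    unfolding q_def zs_def by (rule ln_norm_trace_seq[OF n]) (use cz in \<open>auto simp: zs_def intro: add_pos_nonneg\<close>)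
  have \<phi>2: "ln 2 \<le> \<phi> x" if "\<bar>x - c\<bar> \<le> s" for x
    using big[of x] that unfolding \<phi>_def by (subst ln_le_cancel_iff) (auto simp: s_def)
  \<comment> \<open>A second difference: \<open>\<phi>\<close> is positive at \<open>c + s\<close>
    and \<open>c - s\<close>, so the negative terms \<open>s^2 / (c - z)^2\<close> cannot sum to
    more than \<open>2 * \<phi> c\<close>.\<close>
  have "\<phi> (c + s) + \<phi> (c - s) = (\<Sum>z\<leftarrow>zs. ln ((c - z + s)^2) / 2 + ln ((c - z - s)^2) / 2)"
    using s by (simp add: \<phi> sum_list_addf algebra_simps)
  also have "\<dots> \<le> (\<Sum>z\<leftarrow>zs. ln ((c - z)^2) - s^2 / (c - z)^2)"
    by (rule sum_list_mono) (use ln_second_difference_le far s in blast)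
  also have "\<dots> = 2 * \<phi> c - s^2 * S"
    using s by (simp add: \<phi> S_def sum_list_subtractf sum_list_const_mult[symmetric])
  finally have "s^2 * S \<le> 2 * \<phi> c" using \<phi>2[of "c + s"] \<phi>2[of "c - s"] s ln2_ge_two_thirds by simp
  then have gS: "g^2 / 2 * S \<le> 16 * \<phi> c" by (simp add: s_def power_divide)
  have "q g \<le> (\<Sum>z\<leftarrow>zs. ln ((c - z)^2) / 2 + g^2 / 2 * (1 / (c - z)^2))"
    unfolding q by (rule sum_list_mono) (use ln_add_square_le cz in blast)
  also have "\<dots> = \<phi> c + g^2 / 2 * S" using s by (simp add: \<phi> S_def sum_list_addf sum_list_const_mult[symmetric])
  finally have qg: "q g \<le> 17 * \<phi> c" using gS by simp
  have "\<phi> c + ln 2 / 2 * zcount V n c t \<le> \<phi> c + ln 2 / 2 * length (filter (\<lambda>z. \<bar>c - z\<bar> \<le> D) zs)"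
  proof -
    have "zcount V n (min c t) (max c t) = zcount V n c t" by (simp add: zcount_def)
    then have "zcount V n c t = length (filter (\<lambda>z. min c t < z \<and> z \<le> max c t) zs)"
      using zcount_filter[of "min c t" "max c t" V n] by (simp add: zs_def)
    also have "\<dots> \<le> length (filter (\<lambda>z. \<bar>c - z\<bar> \<le> D) zs)"
      by (rule length_filter_mono) (use near in \<open>auto simp: zs_def\<close>)
    finally show ?thesis using ln2_ge_two_thirds by simp
  qed
  also have "\<dots> = (\<Sum>z\<leftarrow>zs. ln ((c - z)^2) / 2 + (if \<bar>c - z\<bar> \<le> D then ln 2 / 2 else 0))"
    using s by (simp add: \<phi> sum_list_addf sum_list_indicator)
  also have "\<dots> \<le> q D"
    unfolding q by (rule sum_list_mono) (use ln_add_square_ge cz in blast)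
  finally have qD: "\<phi> c + ln 2 / 2 * zcount V n c t \<le> q D" .
  have D: "0 < D" using g by simp
  have pos: "0 < cmod (trace_seq V (Complex c y) n)" "1 \<le> cmod (trace_seq V (Complex c y) n)" if "0 \<le> y" for y
  proof -
    have "cmod (trace_seq V (Complex c 0) n) = \<bar>X c n\<bar>"
      by (simp add: complex_of_real_def[symmetric] trace_seq_of_real)
    then show "0 < cmod (trace_seq V (Complex c y) n)" "1 \<le> cmod (trace_seq V (Complex c y) n)"
      using norm_trace_seq_mono[OF n _ that, of V c] big[of c] s by (auto simp: s_def)
  qed
  have "ln (cmod (trace_seq V (Complex c D) n)) \<le> ln (2 * exp (height V n (Complex c D)))"
    using height_bounds(3)[OF n, of "Complex c D" V] D pos[of D] by (subst ln_le_cancel_iff) auto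
  then have "q D \<le> ln 2 + height V n (Complex c D)" by (simp add: q_def ln_mult_pos)
  then have hD: "ln 2 / 2 * zcount V n c t \<le> height V n (Complex c D)" using qD \<phi>2[of c] s by simp
  have "height V n (Complex c g) \<le> ln (cmod (trace_seq V (Complex c g) n) + 1)"
    using height_bounds(2)[OF n, of "Complex c g" V] g by simp
  also have "\<dots> \<le> ln (2 * cmod (trace_seq V (Complex c g) n))"
    using pos[of g] g by (subst ln_le_cancel_iff) auto
  also have "\<dots> = ln 2 + q g" using pos[of g] g by (simp add: q_def ln_mult_pos)
  finally have hg: "height V n (Complex c g) \<le> 18 * \<phi> c" using qg \<phi>2[of c] s by simp
  have "g / D * (1/3 * zcount V n c t) \<le> g / D * height V n (Complex c D)"
  proof (intro mult_left_mono)
    have "1 / 3 * real (zcount V n c t) \<le> ln 2 / 2 * zcount V n c t"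
      using ln2_ge_two_thirds by (intro mult_right_mono) auto
    then show "1 / 3 * real (zcount V n c t) \<le> height V n (Complex c D)" using hD by linarith
  qed (use g in auto)
  also have "\<dots> \<le> height V n (Complex c g)" by (rule height_vertical[OF n g])
  also note hg
  finally show ?thesis by (simp add: \<phi>_def mult.assoc)
qed

text \<open>The growth at the midpoint is at most \<open>90 * V\<close> times the number of zeros
  between \<open>c\<close> and \<open>t\<close>, and at least a multiple of
  \<open>(b - a) / D\<close> times the same number. The energy \<open>t\<close> lies in an older gap
  or outside the spectrum, and \<open>far\<close> keeps the late zeros between \<open>c\<close> and
  \<open>t\<close> within distance \<open>D\<close> of \<open>c\<close>. Dividing by the count,
  which tends to infinity, leaves the claim.\<close>

lemma gap_le_distance:
  assumes ab: "a \<in> trapped V" "b \<in> trapped V" "a < b" "{a<..<b} \<inter> trapped V = {}"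
    and c: "c = (a + b) / 2" and D: "b - a \<le> D"
    and t: "t \<notin> trapped V" "escape_time V t \<le> escape_time V c"
    and p: "p \<in> trapped V" "min c t < p" "p < max c t"
    and far: "\<And>x. min c t \<le> x \<Longrightarrow> x \<le> max c t \<Longrightarrow> D \<le> \<bar>x - c\<bar> \<Longrightarrow> x \<notin> trapped V"
  shows "b - a \<le> 5000 * V * D"
proof -
  define g where "g = b - a"
  have g: "0 < g" "g \<le> D" using ab D by (auto simp: g_def)
  have cU': "a < c" "c < b" using ab c by auto
  then have "c \<in> {a<..<b}" by simp
  then have cU: "c \<notin> trapped V" "a < c" "c < b" using ab(4) cU' by blast+
  have "{c - g / 4..c + g / 4} \<inter> trapped V = {}"
  proof -
    have "{c - g / 4..c + g / 4} \<subseteq> {a<..<b}" using g unfolding c g_def by (auto simp: field_simps)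
    then show ?thesis using ab by blast
  qed
  from uniform_escape[OF compact_Icc this] obtain N1 where
    N1: "\<And>j q. N1 \<le> j \<Longrightarrow> q \<in> {c - g / 4..c + g / 4} \<Longrightarrow> 2 < \<bar>X q j\<bar>" by blast
  define K where "K = {min c t..max c t} \<inter> {x. D \<le> \<bar>x - c\<bar>}"
  have "compact K" unfolding K_def
    by (intro compact_Int_closed compact_Icc closed_Collect_le continuous_intros)
  moreover have "K \<inter> trapped V = {}" using far by (auto simp: K_def)
  ultimately obtain N2 where N2: "\<And>j q. N2 \<le> j \<Longrightarrow> q \<in> K \<Longrightarrow> 2 < \<bar>X q j\<bar>"
    using uniform_escape by blast
  define m where "m = escape_time V c"
  have rm: "reach < m" using early_escape_outside[OF cU(1) ab(1) cU(2) ab(2) cU(3)] by (simp add: m_def)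
  define z where "z = (\<lambda>n. real (zcount V n c t))"
  have zbig: "real (n - m - 1) \<le> z n" if "m < n" for n
  proof -
    have "fib (n - m) * fib reach \<le> zcount V n c t"
      by (rule zcount_lower[OF cU(1) t(1) p]) (use t rm that in \<open>auto simp: m_def\<close>)
    moreover have "1 \<le> fib reach" using reach(3) fib_neq_0_nat[of reach] by linarith
    then have "fib (n - m) * 1 \<le> fib (n - m) * fib reach" by (intro mult_left_mono) auto
    moreover have "n - m - 1 \<le> fib (n - m)" using le_fib_Suc[of "n - m - 1"] that by (simp add: Suc_diff_Suc)
    ultimately have "n - m - 1 \<le> zcount V n c t" by linarith
    then show ?thesis by (simp add: z_def)
  qed
  \<comment> \<open>Late enough for both uniform escapes, and for at least \<open>54 / V\<close>
    zeros, so that the additive constant 54 = 18 * 3 is at most \<open>V * z n\<close>.\<close>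
  define n where "n = m + N1 + N2 + 2 + nat \<lceil>54 / V\<rceil>"
  have n: "N1 \<le> n" "N2 \<le> n" "m < n" "1 \<le> n" by (auto simp: n_def)
  have "54 / V \<le> real (n - m - 1)" by (simp add: n_def) linarith
  then have zn: "54 / V \<le> z n" using zbig[OF n(3)] by linarith
  have z0: "0 < z n" using zn V_pos by (smt (verit) divide_pos_pos)
  have V54: "54 \<le> V * z n" using zn V_pos by (simp add: field_simps)
  have "g / D * (1/3) * z n \<le> 18 * ln \<bar>X c n\<bar>"
    unfolding z_def
  proof (rule growth_ge_zcount[OF n(4) g])
    show "2 < \<bar>X x n\<bar>" if "\<bar>x - c\<bar> \<le> g / 4" for x
      by (rule N1[OF n(1)]) (use that in \<open>unfold atLeastAtMost_iff, linarith\<close>)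
    fix y assume y: "y \<in> set (zeros V n)" "min c t < y" "y \<le> max c t"
    show "\<bar>c - y\<bar> \<le> D"
    proof (rule ccontr)
      assume "\<not> ?thesis"
      then have "y \<in> K" using y by (auto simp: K_def abs_minus_commute)
      from N2[OF n(2) this] have "X y n \<noteq> 0" by auto
      then show False using trace_zero_iff[OF n(4)] y by blast
    qed
  qed
  also have "18 * ln \<bar>X c n\<bar> \<le> 18 * (3 + 90 * V * z n)"
  proof -
    have "2 < \<bar>X c n\<bar>" by (rule N1[OF n(1)]) (use g in auto)
    then have "ln \<bar>X c n\<bar> \<le> ln (\<bar>X c n\<bar> + 1)" by (subst ln_le_cancel_iff) auto
    also have "\<dots> \<le> 3 + 90 * V * z n"
      unfolding z_def by (rule growth_vs_zcount[OF cU(1) ab(1) cU(2) ab(2) cU(3) t p n(4)])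
    finally show ?thesis by simp
  qed
  also have "\<dots> = 54 + 1620 * (V * z n)" by simp
  also have "\<dots> \<le> 1621 * (V * z n)" using V54 by linarith
  finally have "(g / D * (1/3)) * z n \<le> (1621 * V) * z n" by simp
  then have "g / D * (1/3) \<le> 1621 * V" using z0 by (simp only: mult_le_cancel_right_pos)
  moreover have "g / D = 3 * (g / D * (1/3))" by simp
  ultimately have "g / D \<le> 5000 * V" using V_pos by (smt (verit))
  then show ?thesis using g unfolding g_def by (simp add: pos_divide_le_eq)
qed

lemma escapes_outside: "3 \<le> \<bar>E\<bar> \<Longrightarrow> escapes V E 1"
  using V_pos V_small by (auto simp: escapes_def numeral_2_eq_2)

lemma outside_not_trapped: "3 \<le> \<bar>E\<bar> \<Longrightarrow> E \<notin> trapped V" "3 \<le> \<bar>E\<bar> \<Longrightarrow> escape_time V E \<le> 1"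
  using escapes_outside escape_time_le by (auto simp: trapped_def)

lemma trapped_bounds: "E \<in> trapped V \<Longrightarrow> \<bar>E\<bar> < 3"
  using outside_not_trapped by (cases "3 \<le> \<bar>E\<bar>") auto

lemma compact_trapped: "compact (trapped V)"
  unfolding compact_eq_bounded_closed bounded_iff using closed_trapped trapped_bounds by (auto intro!: exI[of _ 3] less_imp_le)

text \<open>The energies in \<open>{-3..3}\<close> at distance at least \<open>\<epsilon>\<close>
  from the trapped set form a compact set, on which all late traces exceed 2 in modulus.\<close>

lemma zeros_near_trapped:
  assumes "0 < \<epsilon>"
  obtains N where "\<And>n z. N \<le> n \<Longrightarrow> z \<in> set (zeros V n) \<Longrightarrow> \<exists>p\<in>trapped V. \<bar>z - p\<bar> < \<epsilon>"
proof -
  define K where "K = {-3..3} \<inter> (- (\<Union>p\<in>trapped V. ball p \<epsilon>))"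
  have "compact K" unfolding K_def by (intro compact_Int_closed compact_Icc closed_Compl open_UN) auto
  moreover have "K \<inter> trapped V = {}" using assms by (force simp: K_def)
  ultimately obtain N where N: "\<And>j q. N \<le> j \<Longrightarrow> q \<in> K \<Longrightarrow> 2 < \<bar>X q j\<bar>"
    using uniform_escape by blast
  show thesis
  proof (rule that[of "N + 1"])
    fix n z assume n: "N + 1 \<le> n" and z: "z \<in> set (zeros V n)"
    have X0: "X z n = 0" using trace_zero_iff[of n V z] n z by simp
    show "\<exists>p\<in>trapped V. \<bar>z - p\<bar> < \<epsilon>"
    proof (rule ccontr)
      assume "\<not> ?thesis"
      then have far: "z \<notin> (\<Union>p\<in>trapped V. ball p \<epsilon>)" by (auto simp: dist_real_def abs_minus_commute)
      have "\<bar>z\<bar> < 3"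
        using trace_large[OF outside_not_trapped(1)[of z], of n] outside_not_trapped(2)[of z] n X0
        by (cases "3 \<le> \<bar>z\<bar>") auto
      then have "z \<in> K" using far by (auto simp: K_def)
      from N[OF _ this, of n] n X0 show False by simp
    qed
  qed
qed

text \<open>Late zeros lie near trapped energies, so at least one exists. If there were only one,
  \<open>p\<close>, every factor of a late trace at \<open>p + 1/2\<close> would be at most 1 in
  modulus, although this energy escapes.\<close>

lemma trapped_nondegenerate: "\<exists>p q. p \<in> trapped V \<and> q \<in> trapped V \<and> p < q"
proof (rule ccontr)
  assume none: "\<not> ?thesis"
  have eq: "p = q" if "p \<in> trapped V" "q \<in> trapped V" for p q
    using none that by (metis linorder_neqE_linordered_idom)
  obtain N where N: "\<And>n z. N \<le> n \<Longrightarrow> z \<in> set (zeros V n) \<Longrightarrow> \<exists>p\<in>trapped V. \<bar>z - p\<bar> < 1/4"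
    using zeros_near_trapped[of "1/4"] by auto
  have ex: "\<exists>z. z \<in> set (zeros V n)" if "1 \<le> n" for n
  proof -
    have "length (zeros V n) = fib n" by (simp add: zeros_def length_band_points)
    then have "zeros V n \<noteq> []" using fib_neq_0_nat[of n] that by auto
    then show ?thesis by (metis list.set_intros(1) neq_Nil_conv)
  qed
  obtain p where p: "p \<in> trapped V" using N[of "N + 1"] ex[of "N + 1"] by auto
  have "p + 1/2 \<notin> trapped V" using eq[OF p, of "p + 1/2"] by auto
  define n where "n = N + 1 + escape_time V (p + 1/2)"
  have prod: "X (p + 1/2) n = (\<Prod>z\<leftarrow>zeros V n. (p + 1/2) - z)"
    using band_points_real[of n 0 V "p + 1/2"] by (simp add: zeros_def n_def)
  have "\<bar>\<Prod>z\<leftarrow>zs. (p + 1/2) - z\<bar> \<le> 1" if "\<And>z. z \<in> set zs \<Longrightarrow> \<bar>z - p\<bar> < 1/4" for zs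
    using that
  proof (induction zs)
    case (Cons z zs)
    have "\<bar>p + 1/2 - z\<bar> \<le> 1" using Cons.prems[OF list.set_intros(1)] by linarith
    then show ?case using Cons mult_mono[of "\<bar>p + 1/2 - z\<bar>" 1 "\<bar>\<Prod>z\<leftarrow>zs. (p + 1/2) - z\<bar>" 1] by (simp add: abs_mult)
  qed simp
  moreover have "\<bar>z - p\<bar> < 1/4" if z: "z \<in> set (zeros V n)" for z
  proof -
    obtain p' where "p' \<in> trapped V" "\<bar>z - p'\<bar> < 1/4" using N[of n z] z by (auto simp: n_def)
    then show ?thesis using eq[OF p, of p'] by simp
  qed
  ultimately have "\<bar>X (p + 1/2) n\<bar> \<le> 1" using prod by simp
  moreover have "2 < \<bar>X (p + 1/2) n\<bar>"
    by (rule trace_large[OF \<open>p + 1/2 \<notin> trapped V\<close>]) (simp add: n_def)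
  ultimately show False by simp
qed

end

subsection \<open>Walking to an escaping energy\<close>

text \<open>The Darboux property of derivatives: a change of sign would produce an interior maximum,
  where the derivative vanishes.\<close>

lemma derivative_stays_positive:
  fixes f :: "real \<Rightarrow> real"
  assumes der: "\<And>t. (f has_real_derivative f' t) (at t)"
    and nz: "\<And>r. a \<le> r \<Longrightarrow> r \<le> t \<Longrightarrow> f' r \<noteq> 0" and pos: "0 < f' a" and t: "a \<le> t"
  shows "0 < f' t"
proof (rule ccontr)
  assume "\<not> ?thesis"
  then have neg: "f' t < 0" using nz[OF t order_refl] by linarith
  then have at: "a < t" using pos t by (cases "a = t") auto
  have "continuous_on {a..t} f" by (rule DERIV_continuous_on[where D = f']) (rule has_field_derivative_at_within[OF der])
  then obtain s where s: "s \<in> {a..t}" "\<And>r. r \<in> {a..t} \<Longrightarrow> f r \<le> f s"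
    using continuous_attains_sup[OF compact_Icc, of a t f] at by auto
  obtain d1 where d1: "0 < d1" "\<And>h. 0 < h \<Longrightarrow> h < d1 \<Longrightarrow> f a < f (a + h)"
    using DERIV_pos_inc_right[OF der pos] by blast
  obtain d2 where d2: "0 < d2" "\<And>h. 0 < h \<Longrightarrow> h < d2 \<Longrightarrow> f t < f (t - h)"
    using DERIV_neg_dec_left[OF der neg] by blast
  have "s \<noteq> a"
  proof
    assume "s = a"
    have "f a < f (a + min (d1 / 2) (t - a))" by (rule d1) (use d1 at in auto)
    moreover have "a + min (d1 / 2) (t - a) \<in> {a..t}" using d1 at by auto
    from s(2)[OF this] have "f (a + min (d1 / 2) (t - a)) \<le> f a" using \<open>s = a\<close> by simp
    ultimately show False by simp
  qed
  moreover have "s \<noteq> t"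
  proof
    assume "s = t"
    have "f t < f (t - min (d2 / 2) (t - a))" by (rule d2) (use d2 at in auto)
    moreover have "t - min (d2 / 2) (t - a) \<in> {a..t}" using d2 at by auto
    from s(2)[OF this] have "f (t - min (d2 / 2) (t - a)) \<le> f t" using \<open>s = t\<close> by simp
    ultimately show False by simp
  qed
  ultimately have st: "a < s" "s < t" using s by auto
  have "f' s = 0"
  proof (rule DERIV_local_max[OF der, of "min (s - a) (t - s)"])
    show "\<forall>y. \<bar>s - y\<bar> < min (s - a) (t - s) \<longrightarrow> f y \<le> f s"
    proof (intro allI impI)
      fix y assume "\<bar>s - y\<bar> < min (s - a) (t - s)"
      then have "y \<in> {a..t}" by auto
      then show "f y \<le> f s" by (rule s(2))
    qed
  qed (use st in auto)
  then show False using nz[of s] st t by simp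
qed

lemma continuous_nonzero_sign:
  fixes h :: "real \<Rightarrow> real"
  assumes "continuous_on {a..b} h" "\<And>t. t \<in> {a..b} \<Longrightarrow> h t \<noteq> 0" "s \<in> {a..b}" "0 < h s" "t \<in> {a..b}"
  shows "0 < h t"
proof (rule ccontr)
  assume "\<not> ?thesis"
  then have neg: "h t < 0" using assms(2)[OF assms(5)] by linarith
  have "connected (h ` {a..b})" by (intro connected_continuous_image assms(1)) simp
  then have "0 \<in> h ` {a..b}"
    using connectedD_interval[of "h ` {a..b}" "h t" "h s" 0] neg assms(3,4,5) by auto
  then show False using assms(2) by auto
qed

lemma neg_factor: "(a :: real) * b < 0 \<Longrightarrow> b < 0 \<Longrightarrow> 0 < a"
  using mult_nonpos_nonpos[of a b] by linarith

text \<open>The condition \<open>F k t \<le> F (k + 3) t\<close> selects the larger root. The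
  segment is unoriented because the next branch starts at \<open>e'\<close> and runs back towards
  \<open>e\<close>.\<close>

definition branch :: "(nat \<Rightarrow> real \<Rightarrow> real) \<Rightarrow> nat \<Rightarrow> real \<Rightarrow> real \<Rightarrow> bool" where
  "branch F k e e' \<longleftrightarrow> F (k + 1) e = 2 \<and> F (k + 2) e' = 2 \<and>
     (\<forall>t\<in>closed_segment e e'. 0 \<le> F (k + 1) t \<and> F (k + 1) t \<le> 2 \<and> 0 \<le> F (k + 2) t \<and> F (k + 2) t \<le> 2 \<and>
        F k t \<le> F (k + 3) t)"

text \<open>Traces along a line of energies after a change of signs, in either direction. The
  assumptions are invariant under \<open>t\<close> to \<open>- t\<close>, so constructions need to
  be carried out in one direction only.\<close>

locale trace_path =
  fixes V :: real and F F' :: "nat \<Rightarrow> real \<Rightarrow> real"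
  assumes orbit: "\<And>t. trace_orbit V (\<lambda>k. F k t)"
    and der: "\<And>k t. (F k has_real_derivative F' k t) (at t)"
    and nz: "\<And>k t. 1 \<le> k \<Longrightarrow> \<bar>F k t\<bar> < 2 \<Longrightarrow> F' k t \<noteq> 0"
    and orientation: "\<And>k t. 1 \<le> k \<Longrightarrow> \<bar>F k t\<bar> < 2 \<Longrightarrow> \<bar>F (k + 1) t\<bar> < 2 \<Longrightarrow>
      (2 * F (k + 2) t - F (k + 1) t * F k t) * (F' (k + 1) t * F' k t) < 0"
begin

lemma V: "0 < V" "V \<le> 1/1000"
  using orbit[of 0] by (auto simp: trace_orbit_def)

lemma cont [continuous_intros]: "continuous_on S (F k)"
  by (rule DERIV_continuous_on[where D = "F' k"]) (rule has_field_derivative_at_within[OF der])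

lemma reflect: "trace_path V (\<lambda>k t. F k (- t)) (\<lambda>k t. - F' k (- t))"
proof
  fix k t
  show "((\<lambda>t. F k (- t)) has_real_derivative - F' k (- t)) (at t)"
    by (rule DERIV_cong[OF DERIV_chain'[OF DERIV_minus[OF DERIV_ident] der]]) simp
qed (use orbit nz orientation in \<open>auto simp: trace_orbit_def\<close>)

text \<open>Where \<open>F (k + 1)\<close> and \<open>F (k + 2)\<close> cross, the larger root is at
  least 2. If it is at least 2 at \<open>e'\<close> too, two traces have reached 2 there. Otherwise
  the last point with value 2 becomes the end of a new branch. On it the two candidates at level
  \<open>k + 4\<close> stay apart by the discriminant, and their order is read off at
  \<open>e'\<close>, where the difference is positive.\<close>

lemma branch_step_forward:
  assumes br: "branch F k e e'" and ee: "e \<le> e'"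
  shows "(\<exists>t\<in>{e..e'}. 2 \<le> F (k + 2) t \<and> 2 \<le> F (k + 3) t) \<or> (\<exists>e''\<in>{e..e'}. branch F (k + 1) e' e'')"
proof (cases "2 \<le> F (k + 3) e'")
  case True
  then show ?thesis using br ee by (auto simp: branch_def intro!: bexI[of _ e'])
next
  case False
  have b: "F (k + 1) e = 2" "F (k + 2) e' = 2"
    "\<And>t. t \<in> {e..e'} \<Longrightarrow> 0 \<le> F (k + 1) t \<and> F (k + 1) t \<le> 2 \<and> 0 \<le> F (k + 2) t \<and> F (k + 2) t \<le> 2 \<and> F k t \<le> F (k + 3) t"
    using br ee by (auto simp: branch_def closed_segment_eq_real_ivl)
  have sum: "F (k + 3) t + F k t = F (k + 1) t * F (k + 2) t" for t
    using trace_orbit.roots_sum[OF orbit[of t], of k] .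
  have disc: "(F (k + 3) t - F k t)^2 = ((F (k + 1) t)^2 - 4) * ((F (k + 2) t)^2 - 4) + 4 * V^2" for t
    using trace_orbit.discriminant[OF orbit[of t], of k] .
  have "\<exists>t0. e \<le> t0 \<and> t0 \<le> e' \<and> F (k + 1) t0 - F (k + 2) t0 = 0"
    by (rule IVT2') (use b ee in \<open>auto intro!: continuous_intros\<close>)
  then obtain t0 where t0: "t0 \<in> {e..e'}" "F (k + 1) t0 = F (k + 2) t0" by auto
  have z0: "2 \<le> F (k + 3) t0"
  proof -
    have "(4 - (F (k + 1) t0)^2)^2 \<le> (F (k + 3) t0 - F k t0)^2"
      unfolding disc t0(2)[symmetric] by (simp add: power2_eq_square algebra_simps)
    then have "4 - (F (k + 1) t0)^2 \<le> F (k + 3) t0 - F k t0"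
      by (rule power2_le_imp_le) (use b(3)[OF t0(1)] in auto)
    then show ?thesis using sum[of t0] t0(2) by (simp add: power2_eq_square)
  qed
  define W where "W = {t \<in> {t0..e'}. 2 \<le> F (k + 3) t}"
  have "compact W" "W \<noteq> {}"
  proof -
    have "W = {t0..e'} \<inter> {t. 2 \<le> F (k + 3) t}" by (auto simp: W_def)
    then show "compact W" by (auto intro!: compact_Int_closed closed_Collect_le continuous_intros)
    show "W \<noteq> {}" using z0 t0 by (auto simp: W_def)
  qed
  then obtain e'' where e'': "e'' \<in> W" "\<And>t. t \<in> W \<Longrightarrow> t \<le> e''"
    using compact_attains_sup[of W] by blast
  have in_seg: "e'' \<in> {e..e'}" using e''(1) t0 by (auto simp: W_def)
  have "\<exists>t. e'' \<le> t \<and> t \<le> e' \<and> F (k + 3) t = 2"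
    by (rule IVT2') (use e''(1) False in \<open>auto simp: W_def intro!: continuous_intros\<close>)
  then obtain t1 where t1: "e'' \<le> t1" "t1 \<le> e'" "F (k + 3) t1 = 2" by blast
  then have "t1 \<in> W" using e''(1) by (auto simp: W_def)
  then have z2: "F (k + 3) e'' = 2" using e''(2)[of t1] t1 by simp
  have small: "F (k + 3) t \<le> 2" if "t \<in> {e''..e'}" for t
  proof (rule ccontr)
    assume "\<not> ?thesis"
    moreover have "t \<in> W" using calculation that e''(1) by (auto simp: W_def)
    then have "t = e''" using e''(2)[of t] that by simp
    ultimately show False using z2 by simp
  qed
  have nonneg: "0 \<le> F (k + 3) t" if "t \<in> {e..e'}" for t
    using sum[of t] b(3)[OF that] mult_nonneg_nonneg[of "F (k + 1) t" "F (k + 2) t"] by linarith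
  have seg: "t \<in> {e..e'}" if "t \<in> {e''..e'}" for t using that in_seg by auto
  define h where "h = (\<lambda>t. F (k + 4) t - F (k + 1) t)"
  have hdisc: "(h t)^2 = ((F (k + 2) t)^2 - 4) * ((F (k + 3) t)^2 - 4) + 4 * V^2" for t
    using trace_orbit.discriminant[OF orbit[of t], of "k + 1"] by (simp add: h_def numeral_eq_Suc)
  have h0: "h t \<noteq> 0" if t: "t \<in> {e''..e'}" for t
  proof
    assume "h t = 0"
    have sq: "y^2 \<le> 4" if "0 \<le> y" "y \<le> 2" for y :: real using power_mono[OF that(2) that(1), of 2] by simp
    have "(F (k + 2) t)^2 \<le> 4" "(F (k + 3) t)^2 \<le> 4" using sq b(3)[OF seg[OF t]] small[OF t] nonneg[OF seg[OF t]] by auto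
    then have "0 \<le> ((F (k + 2) t)^2 - 4) * ((F (k + 3) t)^2 - 4)" by (intro mult_nonpos_nonpos) auto
    moreover have "0 < V^2" using V by simp
    ultimately show False using hdisc[of t] \<open>h t = 0\<close> by (smt (verit) power_zero_numeral)
  qed
  have he: "0 < h e'"
  proof -
    have "(F (k + 3) e' - F k e')^2 = (2 * V)^2" using disc[of e'] b(2) by (simp add: power_mult_distrib)
    then have "F (k + 3) e' - F k e' = 2 * V"
      by (rule power2_eq_imp_eq) (use b(3)[of e'] ee V in auto)
    moreover have "F (k + 4) e' + F (k + 1) e' = F (k + 2) e' * F (k + 3) e'"
      using trace_orbit.roots_sum[OF orbit[of e'], of "k + 1"] by (simp add: numeral_eq_Suc)
    ultimately show ?thesis using sum[of e'] b(2) V by (simp add: h_def)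
  qed
  have "0 < h t" if "t \<in> {e''..e'}" for t
    by (rule continuous_nonzero_sign[of e'' e' h e' t])
      (use h0 he that in_seg in \<open>auto simp: h_def intro!: continuous_intros\<close>)
  then have "F (k + 1) t \<le> F (k + 4) t" if "t \<in> {e''..e'}" for t using that by (force simp: h_def)
  then have "branch F (k + 1) e' e''"
    using b(2) z2 b(3)[OF seg] small nonneg[OF seg] in_seg
    by (auto simp: branch_def closed_segment_eq_real_ivl numeral_eq_Suc)
  then show ?thesis using in_seg by blast
qed

lemma branch_reflect: "branch F k e e' \<Longrightarrow> branch (\<lambda>k t. F k (- t)) k (- e) (- e')"
  unfolding branch_def by (auto simp: closed_segment_eq_real_ivl split: if_splits)

lemma branch_step:
  assumes "branch F k e e'"
  shows "(\<exists>t\<in>closed_segment e e'. 2 \<le> F (k + 2) t \<and> 2 \<le> F (k + 3) t) \<or>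
    (\<exists>e''\<in>closed_segment e e'. branch F (k + 1) e' e'')"
proof (cases "e \<le> e'")
  case True
  then show ?thesis using branch_step_forward[OF assms] by (simp add: closed_segment_eq_real_ivl)
next
  case False
  interpret r: trace_path V "\<lambda>k t. F k (- t)" "\<lambda>k t. - F' k (- t)" by (rule reflect)
  have seg: "t \<in> {- e..- e'} \<Longrightarrow> - t \<in> closed_segment e e'" for t
    using False by (auto simp: closed_segment_eq_real_ivl)
  consider t where "t \<in> {- e..- e'}" "2 \<le> F (k + 2) (- t)" "2 \<le> F (k + 3) (- t)"
    | e'' where "e'' \<in> {- e..- e'}" "branch (\<lambda>k t. F k (- t)) (k + 1) (- e') e''"
    using r.branch_step_forward[OF branch_reflect[OF assms]] False by auto
  then show ?thesis
  proof cases
    case 1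
    then show ?thesis using seg by blast
  next
    case 2
    then have "branch F (k + 1) e' (- e'')" using r.branch_reflect[of "k + 1" "- e'" e''] by simp
    then show ?thesis using seg[OF 2(1)] by blast
  qed
qed

definition weak_escape :: "real set \<Rightarrow> nat \<Rightarrow> bool" where
  "weak_escape S N \<longleftrightarrow> (\<exists>t\<in>S. \<exists>m. 1 \<le> m \<and> m \<le> N \<and> 2 \<le> F m t \<and> 2 \<le> F (m + 1) t)"

lemma weak_escape_mono: "weak_escape S N \<Longrightarrow> S \<subseteq> T \<Longrightarrow> N \<le> N' \<Longrightarrow> weak_escape T N'"
  unfolding weak_escape_def by (meson le_trans subsetD)

text \<open>The segments are nested, so the last one satisfies the inequalities of all levels
  simultaneously; the angle argument is applied at a single energy.\<close>

lemma branch_iterate: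
  assumes "branch F k e e'"
  shows "weak_escape (closed_segment e e') (k + i + 2) \<or>
    (\<exists>f f'. branch F (k + i) f f' \<and> closed_segment f f' \<subseteq> closed_segment e e' \<and>
      (\<forall>t\<in>closed_segment f f'. \<forall>j\<le>i. 0 \<le> F (k + j + 1) t \<and> F (k + j + 1) t \<le> 2 \<and>
         0 \<le> F (k + j + 2) t \<and> F (k + j + 2) t \<le> 2 \<and> F (k + j) t \<le> F (k + j + 3) t))"
proof (induction i)
  case 0
  show ?case using assms by (intro disjI2 exI[of _ e] exI[of _ e']) (auto simp: branch_def)
next
  case (Suc i)
  show ?case
  proof (cases "weak_escape (closed_segment e e') (k + Suc i + 2)")
    case False
    then have "\<not> weak_escape (closed_segment e e') (k + i + 2)" using weak_escape_mono by fastforce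
    then obtain f f' where f: "branch F (k + i) f f'" "closed_segment f f' \<subseteq> closed_segment e e'"
      "\<And>t j. t \<in> closed_segment f f' \<Longrightarrow> j \<le> i \<Longrightarrow> 0 \<le> F (k + j + 1) t \<and> F (k + j + 1) t \<le> 2 \<and>
         0 \<le> F (k + j + 2) t \<and> F (k + j + 2) t \<le> 2 \<and> F (k + j) t \<le> F (k + j + 3) t"
      using Suc.IH by blast
    have "\<not> (\<exists>t\<in>closed_segment f f'. 2 \<le> F (k + i + 2) t \<and> 2 \<le> F (k + i + 3) t)"
    proof
      assume "\<exists>t\<in>closed_segment f f'. 2 \<le> F (k + i + 2) t \<and> 2 \<le> F (k + i + 3) t"
      then obtain t where t: "t \<in> closed_segment f f'" "2 \<le> F (k + i + 2) t" "2 \<le> F (k + i + 2 + 1) t"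
        by (auto simp: numeral_eq_Suc)
      have "weak_escape (closed_segment e e') (k + Suc i + 2)"
        unfolding weak_escape_def
        by (rule bexI[of _ t], rule exI[of _ "k + i + 2"]) (use t f(2) in auto)
      then show False using False by blast
    qed
    then obtain e'' where e'': "e'' \<in> closed_segment f f'" "branch F (k + i + 1) f' e''"
      using branch_step[OF f(1)] by blast
    have sub: "closed_segment f' e'' \<subseteq> closed_segment f f'"
      using e''(1) by (simp add: subset_closed_segment)
    have "0 \<le> F (k + j + 1) t \<and> F (k + j + 1) t \<le> 2 \<and> 0 \<le> F (k + j + 2) t \<and> F (k + j + 2) t \<le> 2 \<and> F (k + j) t \<le> F (k + j + 3) t"
      if t: "t \<in> closed_segment f' e''" and j: "j \<le> Suc i" for t j
    proof (cases "j = Suc i")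
      case True
      then show ?thesis using e''(2) t by (auto simp: branch_def)
    next
      case False
      then show ?thesis using f(3)[of t j] sub t j by auto
    qed
    then show ?thesis
      using e''(2) sub f(2) by (intro disjI2 exI[of _ f'] exI[of _ e'']) auto
  qed simp
qed

text \<open>By \<open>branch_angle\<close> the angles dominate the sums of their two successors, so
  \<open>fib i\<close> times the angle at step \<open>i\<close> stays below 2. For
  \<open>fib i\<close> of order \<open>1 / sqrt V\<close> the traces are so close to 2 that the root
  splitting by \<open>2 * V\<close> lifts the next ones to 2.\<close>

lemma branch_weak_escape:
  assumes br: "branch F k e e'" and i: "5 / sqrt V \<le> fib i"
  shows "weak_escape (closed_segment e e') (k + i + 3)"
proof -
  consider "weak_escape (closed_segment e e') (k + i + 2)"
    | f f' where "closed_segment f f' \<subseteq> closed_segment e e'"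
      "\<And>t j. t \<in> closed_segment f f' \<Longrightarrow> j \<le> i \<Longrightarrow> 0 \<le> F (k + j + 1) t \<and> F (k + j + 1) t \<le> 2 \<and>
         0 \<le> F (k + j + 2) t \<and> F (k + j + 2) t \<le> 2 \<and> F (k + j) t \<le> F (k + j + 3) t"
    using branch_iterate[OF br, of i] by blast
  then show ?thesis
  proof cases
    case 1
    then show ?thesis by (rule weak_escape_mono) auto
  next
    case 2
    interpret o: trace_orbit V "\<lambda>k. F k f" by (rule orbit)
    define x where "x = (\<lambda>j. F (k + j + 1) f)"
    have f2: "f \<in> closed_segment f f'" by simp
    have x: "0 \<le> x j \<and> x j \<le> 2" if "j \<le> i + 1" for j
    proof (cases "j \<le> i")
      case True
      then show ?thesis using 2(2)[OF f2 True] by (simp add: x_def)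
    next
      case False
      then have "j = Suc i" using that by simp
      then show ?thesis using 2(2)[OF f2, of i] by (simp add: x_def numeral_eq_Suc)
    qed
    define a where "a = (\<lambda>j. arccos (x j / 2))"
    have a0: "0 \<le> a j" if "j \<le> i + 1" for j unfolding a_def using x[OF that] by (intro arccos_lbound) auto
    have a_step: "a (j + 1) + a (j + 2) \<le> a j" if "j + 1 \<le> i" for j
      unfolding a_def x_def
      using o.branch_angle[of "k + j + 1"] 2(2)[OF f2, of j] 2(2)[OF f2, of "j + 1"] that
      by (simp add: numeral_eq_Suc)
    have fa: "fib (j + 1) * a j + fib j * a (j + 1) \<le> a 0" if "j \<le> i" for j
      using that
    proof (induction j)
      case (Suc j)
      have "real (fib (j + 1)) * (a (j + 1) + a (j + 2)) \<le> fib (j + 1) * a j"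
        using a_step[of j] Suc.prems by (intro mult_left_mono) auto
      then show ?case using Suc by (simp add: algebra_simps)
    qed simp
    have "a 0 \<le> pi / 2" unfolding a_def using x[of 0] by (intro arccos_le_pi2) auto
    then have "a 0 \<le> 2" using pi_less_4 by linarith
    then have fi: "fib (i + 1) * a i + fib i * a (i + 1) \<le> 2" using fa[of i] by simp
    have sV: "0 < sqrt V" "sqrt V * sqrt V = V" using V by auto
    have f5: "5 \<le> sqrt V * fib i" using i sV by (simp add: pos_divide_le_eq mult.commute)
    \<comment> \<open>From \<open>fib i \<ge> 5 / sqrt V\<close> the angle is at most
      \<open>2 / 5 * sqrt V\<close>, and its square \<open>4 / 25 * V\<close> is below
      \<open>V / 4\<close>. A deficit of \<open>V / 4\<close> in each factor lowers the product by
      at most \<open>V\<close>, half of the splitting.\<close>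
    have close: "2 - V / 4 \<le> x j" if j: "j \<le> i + 1" and small: "fib i * a j \<le> 2" for j
    proof -
      have "5 * a j \<le> sqrt V * (fib i * a j)" using mult_right_mono[OF f5 a0[OF j]] by (simp add: mult.assoc)
      also have "\<dots> \<le> sqrt V * 2" using small sV by (intro mult_left_mono) auto
      finally have "a j \<le> 2 / 5 * sqrt V" by simp
      then have "(a j)^2 \<le> (2 / 5 * sqrt V)^2" using a0[OF j] by (intro power_mono)
      also have "\<dots> \<le> V / 4" using sV V by (simp add: power2_eq_square)
      finally have "(a j)^2 \<le> V / 4" .
      moreover have "1 - (a j)^2 / 2 \<le> cos (a j)"
      proof -
        have "\<bar>sin (a j / 2)\<bar>^2 \<le> \<bar>a j / 2\<bar>^2" by (intro power_mono abs_sin_x_le_abs_x) auto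
        then show ?thesis using cos_double_sin[of "a j / 2"] by (simp add: power_divide)
      qed
      moreover have "x j = 2 * cos (a j)" using x[OF j] by (simp add: a_def cos_arccos)
      ultimately show ?thesis by linarith
    qed
    have "real (fib i) * a i \<le> fib (i + 1) * a i" using a0[of i] fib_Suc_mono[of i] by (intro mult_right_mono) auto
    moreover have "0 \<le> fib i * a (i + 1)" "0 \<le> real (fib i) * a i" using a0[of "i + 1"] a0[of i] by auto
    ultimately have c: "2 - V / 4 \<le> x i" "2 - V / 4 \<le> x (i + 1)" using close[of i] close[of "i + 1"] fi by auto
    define z where "z = F (k + i + 3) f"
    have sum: "z + F (k + i) f = x i * x (i + 1)"
      using o.roots_sum[of "k + i"] by (simp add: z_def x_def numeral_eq_Suc)
    have disc: "(z - F (k + i) f)^2 = ((x i)^2 - 4) * ((x (i + 1))^2 - 4) + 4 * V^2"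
      using o.discriminant[of "k + i"] by (simp add: z_def x_def numeral_eq_Suc)
    have "(2 * V)^2 \<le> (z - F (k + i) f)^2"
    proof -
      have sq: "y^2 \<le> 4" if "0 \<le> y" "y \<le> 2" for y :: real using power_mono[OF that(2) that(1), of 2] by simp
      have "0 \<le> ((x i)^2 - 4) * ((x (i + 1))^2 - 4)" using sq x[of i] x[of "i + 1"] by (intro mult_nonpos_nonpos) auto
      then show ?thesis unfolding disc by (simp add: power_mult_distrib)
    qed
    then have d: "2 * V \<le> z - F (k + i) f"
      by (rule power2_le_imp_le) (use 2(2)[OF f2, of i] in \<open>simp add: z_def\<close>)
    have p: "(2 - V / 4) * (2 - V / 4) \<le> x i * x (i + 1)" using c V by (intro mult_mono) auto
    have "(2 - V / 4) * (2 - V / 4) = 4 - V + V * V / 16" by (simp add: algebra_simps)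
    then have "4 - V \<le> x i * x (i + 1)" using p V by (smt (verit) divide_nonneg_nonneg mult_nonneg_nonneg)
    then have z2: "2 + V / 2 \<le> z" using sum d by linarith
    have nxt: "F (k + i + 4) f = z * x (i + 1) - x i"
      using o.rec[of "k + i + 1"] by (simp add: z_def x_def numeral_eq_Suc)
    have "(2 + V / 2) * (2 - V / 4) \<le> z * x (i + 1)" using z2 c V by (intro mult_mono) auto
    moreover have "(2 + V / 2) * (2 - V / 4) = 4 + V / 2 - V * V / 8" by (simp add: algebra_simps)
    moreover have "V * V \<le> V * 1" using V by (intro mult_left_mono) auto
    ultimately have "4 \<le> z * x (i + 1)" using V by linarith
    then have "2 \<le> F (k + i + 4) f" using nxt x[of i] by simp
    then show ?thesis
      using z2 V 2(1) f2 unfolding weak_escape_def z_def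
      by (intro bexI[of _ f] exI[of _ "k + i + 3"]) (auto simp: numeral_eq_Suc)
  qed
qed

text \<open>If \<open>F (k + 2)\<close> did not reach 2 before \<open>F (k + 1)\<close> vanishes, then by the orientation \<open>F k\<close> would
  increase along the path from at least \<open>- V\<close> to a value below \<open>- V\<close>.\<close>

lemma enter_branch:
  assumes k: "1 \<le> k" and T: "0 < T" and x0: "F (k + 1) 0 = 2" and xT: "F (k + 1) T = 0"
    and x: "\<And>t. 0 < t \<Longrightarrow> t < T \<Longrightarrow> 0 < F (k + 1) t \<and> F (k + 1) t < 2"
    and y0: "0 \<le> F (k + 2) 0" "F (k + 2) 0 < 2" "0 < F' (k + 2) 0"
  shows "\<exists>\<tau>\<in>{0..T}. branch F k 0 \<tau>"
proof -
  have sum: "F (k + 3) t + F k t = F (k + 1) t * F (k + 2) t" for t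
    using trace_orbit.roots_sum[OF orbit[of t], of k] .
  have disc: "(F (k + 3) t - F k t)^2 = ((F (k + 1) t)^2 - 4) * ((F (k + 2) t)^2 - 4) + 4 * V^2" for t
    using trace_orbit.discriminant[OF orbit[of t], of k] .
  have increasing: "F j a < F j b"
    if "a < b" "\<And>t. a < t \<Longrightarrow> t < b \<Longrightarrow> 0 < F' j t" for j a b
  proof (rule DERIV_pos_imp_increasing_open[OF that(1) _ cont])
    fix t assume "a < t" "t < b"
    then show "\<exists>y. (F j has_real_derivative y) (at t) \<and> 0 < y" using der that(2) by blast
  qed
  have x': "F' (k + 1) t < 0" if t: "0 < t" "t < T" for t
  proof (rule ccontr)
    have nzx: "F' (k + 1) s \<noteq> 0" if "t \<le> s" "s < T" for s using nz[of "k + 1" s] x[of s] that t by simp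
    assume "\<not> ?thesis"
    then have pos: "0 < F' (k + 1) t" using nzx[of t] t by simp
    have "F (k + 1) t < F (k + 1) T"
      by (rule increasing[OF t(2)], rule derivative_stays_positive[of "F (k + 1)" "F' (k + 1)" t])
        (use der nzx pos in auto)
    then show False using x[OF t] xT by simp
  qed
  define W where "W = {t \<in> {0..T}. 2 \<le> \<bar>F (k + 2) t\<bar>}"
  have "W = {0..T} \<inter> {t. 2 \<le> \<bar>F (k + 2) t\<bar>}" by (auto simp: W_def)
  then have cW: "compact W" by (auto intro!: compact_Int_closed closed_Collect_le continuous_intros)
  have "\<exists>\<tau>. 0 < \<tau> \<and> \<tau> \<le> T \<and> (\<forall>t. 0 \<le> t \<longrightarrow> t < \<tau> \<longrightarrow> \<bar>F (k + 2) t\<bar> < 2) \<and> (\<tau> \<in> W \<or> \<tau> = T \<and> W = {})"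
  proof (cases "W = {}")
    case True
    then have "\<bar>F (k + 2) t\<bar> < 2" if "0 \<le> t" "t < T" for t 
    proof -
      have "t \<notin> W" using True by simp
      then show ?thesis using that by (simp add: W_def)
    qed
    then show ?thesis using T True by (intro exI[of _ T]) auto
  next
    case False
    then obtain \<tau> where \<tau>: "\<tau> \<in> W" "\<And>t. t \<in> W \<Longrightarrow> \<tau> \<le> t" using compact_attains_inf[OF cW] by blast
    have "\<tau> \<noteq> 0" using \<tau>(1) y0 by (auto simp: W_def)
    moreover have "\<bar>F (k + 2) t\<bar> < 2" if "0 \<le> t" "t < \<tau>" for t
    proof (rule ccontr)
      assume "\<not> ?thesis"
      then have "t \<in> W" using that \<tau>(1) by (auto simp: W_def)
      then show False using \<tau>(2) that by force
    qed
    ultimately show ?thesis using \<tau>(1) by (intro exI[of _ \<tau>]) (auto simp: W_def)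
  qed
  then obtain \<tau> where \<tau>: "0 < \<tau>" "\<tau> \<le> T" "\<And>t. 0 \<le> t \<Longrightarrow> t < \<tau> \<Longrightarrow> \<bar>F (k + 2) t\<bar> < 2"
    "\<tau> \<in> W \<or> \<tau> = T \<and> W = {}" by blast
  have y': "0 < F' (k + 2) t" if "0 \<le> t" "t < \<tau>" for t
    by (rule derivative_stays_positive[of "F (k + 2)" "F' (k + 2)" 0]) (use der y0 nz \<tau> that in auto)
  have yinc: "F (k + 2) 0 < F (k + 2) t" if "0 < t" "t \<le> \<tau>" for t
    by (rule increasing[OF that(1)], rule y') (use that in auto)
  have ec_open: "F k t \<le> F (k + 3) t" if t: "0 < t" "t < \<tau>" for t
  proof -
    have "0 < F (k + 1) t" "F (k + 1) t < 2" using x t \<tau> by auto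
    then have "(2 * F (k + 3) t - F (k + 2) t * F (k + 1) t) * (F' (k + 2) t * F' (k + 1) t) < 0"
      using orientation[of "k + 1" t] \<tau>(3)[of t] t by (simp add: numeral_eq_Suc)
    moreover have "F' (k + 2) t * F' (k + 1) t < 0" using y'[of t] x'[of t] t \<tau> by (simp add: mult_pos_neg)
    ultimately have "0 < 2 * F (k + 3) t - F (k + 2) t * F (k + 1) t" by (rule neg_factor)
    moreover have "F (k + 3) t + F k t = F (k + 2) t * F (k + 1) t" using sum[of t] by (simp add: mult.commute)
    ultimately show ?thesis by linarith
  qed
  have ec: "F k t \<le> F (k + 3) t" if "t \<in> {0..\<tau>}" for t
  proof -
    have "0 \<le> F (k + 3) t - F k t"
      by (rule continuous_ge_on_closure[of "{0<..<\<tau>}" "\<lambda>t. F (k + 3) t - F k t"])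
        (use that ec_open \<tau> in \<open>auto intro!: continuous_intros\<close>)
    then show ?thesis by simp
  qed
  have ec0: "F (k + 3) 0 - F k 0 = 2 * V"
  proof (rule power2_eq_imp_eq)
    show "(F (k + 3) 0 - F k 0)^2 = (2 * V)^2" unfolding disc x0 by (simp add: power_mult_distrib)
  qed (use ec[of 0] \<tau> V in auto)
  \<comment> \<open>Since \<open>F (k + 1)\<close> equals 2 at time 0, the two roots there are
    exactly \<open>F (k + 2) 0\<close> plus and minus \<open>V\<close>, so \<open>F k 0\<close> is
    at least \<open>- V\<close>.\<close>
  have c0: "F k 0 = F (k + 2) 0 - V" using ec0 sum[of 0] x0 by simp
  show ?thesis
  proof (cases "W = {}")
    case False
    then have \<tau>W: "\<tau> \<in> W" using \<tau> by blast
    have y2: "F (k + 2) \<tau> = 2"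
    proof (rule ccontr)
      assume ne: "F (k + 2) \<tau> \<noteq> 2"
      have "F (k + 2) \<tau> > 2" using \<tau>W yinc[of \<tau>] y0 \<tau> ne by (auto simp: W_def)
      then have "\<exists>t. 0 \<le> t \<and> t \<le> \<tau> \<and> F (k + 2) t = 2"
        by (intro IVT') (use y0 \<tau> in \<open>auto intro!: continuous_intros\<close>)
      then obtain t where "0 \<le> t" "t \<le> \<tau>" "F (k + 2) t = 2" by blast
      then show False using \<tau>(3)[of t] ne by (cases "t = \<tau>") auto
    qed
    have xr: "0 \<le> F (k + 1) t \<and> F (k + 1) t \<le> 2" if "t \<in> {0..\<tau>}" for t
    proof -
      have "t = 0 \<or> t = T \<or> 0 < t \<and> t < T" using that \<tau> by auto
      then show ?thesis using x[of t] x0 xT by auto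
    qed
    have yr: "0 \<le> F (k + 2) t \<and> F (k + 2) t \<le> 2" if "t \<in> {0..\<tau>}" for t
      using yinc[of t] y0 y2 \<tau>(3)[of t] that by (cases "t = 0"; cases "t = \<tau>") auto
    have "branch F k 0 \<tau>"
      unfolding branch_def using x0 y2 xr yr ec \<tau> by (auto simp: closed_segment_eq_real_ivl)
    then show ?thesis using \<tau> by (intro bexI[of _ \<tau>]) auto
  next
    case True
    then have \<tau>T: "\<tau> = T" using \<tau> by blast
    have ylt: "\<bar>F (k + 2) t\<bar> < 2" if "0 \<le> t" "t \<le> T" for t 
    proof -
      have "t \<notin> W" using True by simp
      then show ?thesis using that by (simp add: W_def)
    qed
    have cT: "F k T < - V"
    proof -
      have e: "F (k + 3) T = - F k T" using sum[of T] xT by simp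
      then have neg: "F k T \<le> 0" using ec[of T] \<tau>T T by simp
      have "(F (k + 3) T - F k T)^2 = 4 * (4 - (F (k + 2) T)^2 + V^2)" unfolding disc xT by (simp add: algebra_simps)
      then have "(F k T)^2 = 4 - (F (k + 2) T)^2 + V^2" unfolding e by (simp add: power2_eq_square algebra_simps)
      moreover have "\<bar>F (k + 2) T\<bar>^2 < 2^2" using ylt[of T] T by (intro power_strict_mono) auto
      ultimately have "V^2 < (- F k T)^2" by simp
      then have "V < - F k T" by (rule power_less_imp_less_base) (use neg in simp)
      then show ?thesis by simp
    qed
    \<comment> \<open>A level below \<open>F k 0\<close> but at least -1: until it is first reached,
      \<open>F k\<close> stays inside the band and the orientation can be used.\<close>
    define v where "v = max (F k T) (- 1)"
    have v: "v < F k 0" using cT c0 y0 V by (auto simp: v_def)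
    define S where "S = {t \<in> {0..T}. F k t \<le> v}"
    have "S = {0..T} \<inter> {t. F k t \<le> v}" by (auto simp: S_def)
    then have "compact S" by (auto intro!: compact_Int_closed closed_Collect_le continuous_intros)
    moreover have "T \<in> S" using T by (simp add: S_def v_def)
    ultimately obtain b where b: "b \<in> S" "\<And>t. t \<in> S \<Longrightarrow> b \<le> t" using compact_attains_inf[of S] by blast
    have b0: "0 < b" "b \<le> T" using b(1) v by (auto simp: S_def less_le)
    have clow: "- 1 < F k t" if "0 \<le> t" "t < b" for t
    proof -
      have "t \<notin> S" using b(2)[of t] that by auto
      then show ?thesis using that b0 by (auto simp: S_def v_def)
    qed
    have chigh: "F k t < 2" if "0 \<le> t" "t < T" for t
    proof (cases "t = 0")
      case True
      then show ?thesis using c0 y0 V by simp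
    next
      case False
      then have xt: "0 < F (k + 1) t" "F (k + 1) t < 2" using x[of t] that by auto
      have "F (k + 1) t * F (k + 2) t \<le> F (k + 1) t * 2" using ylt[of t] xt that by (intro mult_left_mono) auto
      moreover have "F k t \<le> F (k + 3) t" using ec[of t] \<tau>T that by simp
      ultimately show ?thesis using sum[of t] xt by linarith
    qed
    \<comment> \<open>For \<open>k = j + 1\<close> this is the root difference
      \<open>F (j + 3) - F j\<close>, which cannot vanish while both middle traces are in the band.
      This is the reason for the hypothesis \<open>1 \<le> k\<close>.\<close>
    define h where "h = (\<lambda>t. 2 * F (k + 2) t - F (k + 1) t * F k t)"
    obtain j where j: "k = j + 1" using k by (metis add.commute le_Suc_ex plus_1_eq_Suc Suc_eq_plus1)
    have hsq: "(h t)^2 = ((F k t)^2 - 4) * ((F (k + 1) t)^2 - 4) + 4 * V^2" for t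
    proof -
      have "h t = F (j + 3) t - F j t"
        using trace_orbit.roots_sum[OF orbit[of t], of j] by (simp add: h_def j numeral_eq_Suc mult.commute)
      then show ?thesis using trace_orbit.discriminant[OF orbit[of t], of j] by (simp add: j numeral_eq_Suc)
    qed
    have h0: "0 < h 0" using c0 x0 V by (simp add: h_def)
    have sq: "y^2 \<le> 4" if "\<bar>y\<bar> \<le> 2" for y :: real using power_mono[OF that, of 2] by simp
    have hnz: "h t \<noteq> 0" if t: "0 \<le> t" "t < b" for t
    proof
      assume "h t = 0"
      have "\<bar>F (k + 1) t\<bar> \<le> 2" using x[of t] t b0 x0 by (cases "t = 0") auto
      moreover have "\<bar>F k t\<bar> \<le> 2" using clow[of t] chigh[of t] t b0 by auto
      ultimately have "0 \<le> ((F k t)^2 - 4) * ((F (k + 1) t)^2 - 4)" using sq by (intro mult_nonpos_nonpos) auto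
      moreover have "0 < V^2" using V by simp
      ultimately show False using hsq[of t] \<open>h t = 0\<close> by (smt (verit) power_zero_numeral)
    qed
    have hpos: "0 < h t" if t: "0 \<le> t" "t < b" for t
      by (rule continuous_nonzero_sign[of 0 t h 0 t])
        (use h0 hnz t in \<open>auto simp: h_def intro!: continuous_intros\<close>)
    have "F k 0 < F k b"
    proof (rule increasing[OF b0(1)])
      fix t assume t: "0 < t" "t < b"
      have "\<bar>F k t\<bar> < 2" "\<bar>F (k + 1) t\<bar> < 2" using clow[of t] chigh[of t] x[of t] t b0 by auto
      then have "h t * (F' (k + 1) t * F' k t) < 0" using orientation[OF k, of t] by (simp add: h_def)
      moreover have "0 < h t" using hpos t by simp
      ultimately have "F' (k + 1) t * F' k t < 0" by (meson mult_nonneg_nonneg not_le less_imp_le)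
      then show "0 < F' k t" using x'[of t] t b0 by (auto simp: mult_less_0_iff)
    qed
    then show ?thesis using b(1) v by (simp add: S_def)
  qed
qed

end

section \<open>From a pair of zeros to an escaping energy\<close>

context coupling
begin

lemma trace_path_line:
  assumes s: "sign_seq s" and \<theta>: "\<theta> = 1 \<or> \<theta> = -1"
  shows "trace_path V (\<lambda>k t. s k * X (b + \<theta> * t) k) (\<lambda>k t. s k * \<theta> * trace_deriv V (b + \<theta> * t) k)"
proof (rule trace_path.intro)
  fix k t
  show "trace_orbit V (\<lambda>k. s k * X (b + \<theta> * t) k)" by (rule twisted_orbit[OF s])
  have "((\<lambda>t. b + \<theta> * t) has_real_derivative \<theta>) (at t)" by (auto intro!: derivative_eq_intros)
  from DERIV_cmult[OF DERIV_chain'[OF this trace_seq_has_derivative], of "s k" V k]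
  show "((\<lambda>t. s k * X (b + \<theta> * t) k) has_real_derivative s k * \<theta> * trace_deriv V (b + \<theta> * t) k) (at t)"
    by (simp add: mult_ac)
  have sk: "s j \<noteq> 0" for j using sign_seq_square[OF s, of j] by auto
  show "s k * \<theta> * trace_deriv V (b + \<theta> * t) k \<noteq> 0" if "1 \<le> k" "\<bar>s k * X (b + \<theta> * t) k\<bar> < 2"
    using elliptic_twist[of k V "b + \<theta> * t"] that sk[of k] \<theta> by (auto simp: sign_seq_abs[OF s])
  assume k: "1 \<le> k" "\<bar>s k * X (b + \<theta> * t) k\<bar> < 2" "\<bar>s (k + 1) * X (b + \<theta> * t) (k + 1)\<bar> < 2"
  define x where "x = X (b + \<theta> * t)"
  define x' where "x' = trace_deriv V (b + \<theta> * t)"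
  have o: "(2 * x (k + 2) - x (k + 1) * x k) * (x' (k + 1) * x' k) < 0"
    using trace_orientation[of k V "b + \<theta> * t"] k by (simp add: x_def x'_def sign_seq_abs[OF s])
  have s2: "s (k + 2) = s (k + 1) * s k" using s by (simp add: sign_seq_def)
  have "(2 * (s (k + 2) * x (k + 2)) - s (k + 1) * x (k + 1) * (s k * x k)) * (s (k + 1) * \<theta> * x' (k + 1) * (s k * \<theta> * x' k))
      = (s (k + 1) * s (k + 1)) * (s k * s k) * (\<theta> * \<theta>) * ((2 * x (k + 2) - x (k + 1) * x k) * (x' (k + 1) * x' k))"
    unfolding s2 by (simp add: algebra_simps)
  also have "\<dots> = (2 * x (k + 2) - x (k + 1) * x k) * (x' (k + 1) * x' k)"
    using \<theta> by (auto simp: sign_seq_square[OF s] simp del: power2_eq_square)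
  finally have "(2 * (s (k + 2) * x (k + 2)) - s (k + 1) * x (k + 1) * (s k * x k)) * (s (k + 1) * \<theta> * x' (k + 1) * (s k * \<theta> * x' k)) < 0"
    using o by (rule ord_eq_less_trans)
  then show "(2 * (s (k + 2) * X (b + \<theta> * t) (k + 2)) - s (k + 1) * X (b + \<theta> * t) (k + 1) * (s k * X (b + \<theta> * t) k)) *
       (s (k + 1) * \<theta> * trace_deriv V (b + \<theta> * t) (k + 1) * (s k * \<theta> * trace_deriv V (b + \<theta> * t) k)) < 0"
    unfolding x_def x'_def .
qed

text \<open>The walk leaves an end \<open>b\<close> of a block where
  \<open>\<bar>X (k + 1)\<bar>\<close> is at least 2 in direction \<open>\<theta>\<close>; the
  second condition in \<open>y\<close> says that \<open>\<bar>X (k + 2)\<bar>\<close> does not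
  decrease there. The signs are chosen so that \<open>X (k + 1)\<close> starts at 2 and
  \<open>X (k + 2)\<close> starts nonnegative and increasing, as \<open>enter_branch\<close>
  requires.\<close>

lemma block_exit:
  assumes k: "1 \<le> k" and \<theta>: "\<theta> = 1 \<or> \<theta> = -1" and T: "0 < T"
    and x0: "\<bar>X b (k + 1)\<bar> = 2" and xT: "X (b + \<theta> * T) (k + 1) = 0"
    and x: "\<And>t. 0 < t \<Longrightarrow> t < T \<Longrightarrow> X (b + \<theta> * t) (k + 1) \<noteq> 0 \<and> \<bar>X (b + \<theta> * t) (k + 1)\<bar> < 2"
    and y: "\<bar>X b (k + 2)\<bar> < 2" "0 \<le> \<theta> * X b (k + 2) * trace_deriv V b (k + 2)"
    and i: "5 / sqrt V \<le> fib i"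
  shows "\<exists>t\<in>{0..T}. \<exists>m. 1 \<le> m \<and> m \<le> k + i + 3 \<and> 2 \<le> \<bar>X (b + \<theta> * t) m\<bar> \<and> 2 \<le> \<bar>X (b + \<theta> * t) (m + 1)\<bar>"
proof -
  define d where "d = trace_deriv V b (k + 2)"
  have d0: "d \<noteq> 0" using elliptic_twist[of "k + 2" V b] y by (auto simp: d_def)
  have xb: "X b (k + 1) \<noteq> 0" using x0 by auto
  have pm: "sgn r = 1 \<or> sgn r = -1" if "r \<noteq> 0" for r :: real using that by (simp add: sgn_if)
  have "\<theta> * d \<noteq> 0" using \<theta> d0 by auto
  then obtain s where s: "sign_seq s" "s (k + 1) = sgn (X b (k + 1))" "s (k + 2) = sgn (\<theta> * d)"
    using sign_seq_exists[of "sgn (X b (k + 1))" "sgn (\<theta> * d)" "k + 1"] pm[OF xb] pm[of "\<theta> * d"] by auto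
  interpret p: trace_path V "\<lambda>k t. s k * X (b + \<theta> * t) k" "\<lambda>k t. s k * \<theta> * trace_deriv V (b + \<theta> * t) k"
    by (rule trace_path_line[OF s(1) \<theta>])
  have F0: "s (k + 1) * X (b + \<theta> * 0) (k + 1) = 2" using x0 s(2) by (simp add: abs_sgn mult.commute)
  have "\<exists>\<tau>\<in>{0..T}. branch (\<lambda>k t. s k * X (b + \<theta> * t) k) k 0 \<tau>"
  proof (rule p.enter_branch[OF k T F0])
    show "s (k + 1) * X (b + \<theta> * T) (k + 1) = 0" using xT by simp
    show "0 < s (k + 1) * X (b + \<theta> * t) (k + 1) \<and> s (k + 1) * X (b + \<theta> * t) (k + 1) < 2" if t: "0 < t" "t < T" for t
    proof
      have sk: "s (k + 1) \<noteq> 0" using sign_seq_square[OF s(1), of "k + 1"] by auto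
      show "0 < s (k + 1) * X (b + \<theta> * t) (k + 1)"
      proof (rule continuous_nonzero_sign[of 0 t "\<lambda>t. s (k + 1) * X (b + \<theta> * t) (k + 1)" 0])
        show "continuous_on {0..t} (\<lambda>t. s (k + 1) * X (b + \<theta> * t) (k + 1))" by (rule p.cont)
        show "s (k + 1) * X (b + \<theta> * r) (k + 1) \<noteq> 0" if "r \<in> {0..t}" for r
          using x[of r] xb that t sk by (cases "r = 0") auto
      qed (use F0 t in auto)
      show "s (k + 1) * X (b + \<theta> * t) (k + 1) < 2"
        using x[OF t] sign_seq_abs[OF s(1), of "k + 1" "X (b + \<theta> * t) (k + 1)"] by linarith
    qed
    have ypos: "0 \<le> X b (k + 2) * (\<theta> * d)" using y(2) by (simp add: d_def mult_ac)
    show "0 \<le> s (k + 2) * X (b + \<theta> * 0) (k + 2)"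
    proof (cases "0 < \<theta> * d")
      case True
      then have "0 \<le> X b (k + 2)" using ypos by (metis mult_less_cancel_right mult_zero_left not_le not_less_iff_gr_or_eq)
      then show ?thesis unfolding s(3) using True by simp
    next
      case False
      have neg: "\<theta> * d < 0" using False \<open>\<theta> * d \<noteq> 0\<close> by argo
      then have "X b (k + 2) \<le> 0" using ypos mult_pos_neg[of "X b (k + 2)" "\<theta> * d"] by linarith
      then show ?thesis unfolding s(3) sgn_neg[OF neg] by simp
    qed
    show "s (k + 2) * X (b + \<theta> * 0) (k + 2) < 2"
      using y(1) sign_seq_abs[OF s(1), of "k + 2" "X b (k + 2)"] by simp
    have "sgn (\<theta> * d) * (\<theta> * d) = \<bar>\<theta> * d\<bar>" by (metis abs_sgn mult.commute)
    then have "0 < sgn (\<theta> * d) * (\<theta> * d)" using \<open>\<theta> * d \<noteq> 0\<close> by argo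
    then show "0 < s (k + 2) * \<theta> * trace_deriv V (b + \<theta> * 0) (k + 2)"
      unfolding s(3) by (simp add: d_def mult.assoc)
  qed
  then obtain \<tau> where \<tau>: "\<tau> \<in> {0..T}" "branch (\<lambda>k t. s k * X (b + \<theta> * t) k) k 0 \<tau>" by blast
  obtain t m where t: "t \<in> closed_segment 0 \<tau>" "1 \<le> m" "m \<le> k + i + 3"
    "2 \<le> s m * X (b + \<theta> * t) m" "2 \<le> s (m + 1) * X (b + \<theta> * t) (m + 1)"
    using p.branch_weak_escape[OF \<tau>(2) i] unfolding p.weak_escape_def by blast
  have "t \<in> {0..T}" using t(1) \<tau>(1) by (auto simp: closed_segment_eq_real_ivl split: if_splits)
  moreover have "2 \<le> \<bar>X (b + \<theta> * t) m\<bar>" "2 \<le> \<bar>X (b + \<theta> * t) (m + 1)\<bar>"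
    using t(4,5) sign_seq_abs[OF s(1)] abs_ge_self order_trans by metis+
  ultimately show ?thesis using t(2,3) by blast
qed

text \<open>Between neighbouring zeros Rolle gives a critical point, which by
  \<open>elliptic_twist\<close> lies in a block \<open>{a..c}\<close> where the modulus is at least
  2. If \<open>X (k + 2)\<close> also reaches modulus 2 on the block, this is already an escape. If
  not, it is monotone there, so its modulus grows outwards at one end of the block, and
  \<open>block_exit\<close> starts there.\<close>

lemma escape_between_zeros:
  assumes k: "1 \<le> k" and z: "p < q'" "X p (k + 1) = 0" "X q' (k + 1) = 0" and i: "5 / sqrt V \<le> fib i"
  shows "\<exists>E\<in>{p..q'}. \<exists>m. 1 \<le> m \<and> m \<le> k + i + 3 \<and> 2 \<le> \<bar>X E m\<bar> \<and> 2 \<le> \<bar>X E (m + 1)\<bar>"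
proof -
  define Z where "Z = {z \<in> set (zeros V (k + 1)). p < z}"
  have Zero: "X E (k + 1) = 0 \<longleftrightarrow> E \<in> set (zeros V (k + 1))" for E using trace_zero_iff[of "k + 1" V E] by simp
  have Z: "finite Z" "q' \<in> Z" using z Zero[of q'] by (auto simp: Z_def)
  define q where "q = Min Z"
  have "q \<in> Z" unfolding q_def by (rule Min_in) (use Z in auto)
  then have q: "p < q" "X q (k + 1) = 0" using Zero by (auto simp: Z_def)
  have qq': "q \<le> q'" unfolding q_def by (rule Min_le) (use Z in auto)
  have nz: "X t (k + 1) \<noteq> 0" if "p < t" "t < q" for t
  proof
    assume "X t (k + 1) = 0"
    then have "t \<in> Z" using Zero that by (simp add: Z_def)
    then have "q \<le> t" unfolding q_def using Z by (intro Min_le) auto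
    then show False using that by simp
  qed
  have cont: "continuous_on S (\<lambda>t. X t j)" for S j by (intro continuous_intros)
  have "\<exists>\<xi>. p < \<xi> \<and> \<xi> < q \<and> ((\<lambda>t. X t (k + 1)) has_real_derivative 0) (at \<xi>)"
  proof (rule Rolle)
    show "(\<lambda>t. X t (k + 1)) differentiable (at x)" for x
      unfolding real_differentiable_def using trace_seq_has_derivative by blast
  qed (use q z cont in auto)
  then obtain \<xi> where \<xi>: "p < \<xi>" "\<xi> < q" "trace_deriv V \<xi> (k + 1) = 0"
    using DERIV_unique[OF trace_seq_has_derivative] by blast
  have \<xi>2: "2 \<le> \<bar>X \<xi> (k + 1)\<bar>" using elliptic_twist[of "k + 1" V \<xi>] \<xi> by force
  define B where "B = {t \<in> {p..q}. 2 \<le> \<bar>X t (k + 1)\<bar>}"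
  have Beq: "B = {p..q} \<inter> {t. 2 \<le> \<bar>X t (k + 1)\<bar>}" by (auto simp: B_def)
  have cB: "compact B" "B \<noteq> {}"
  proof -
    show "compact B" unfolding Beq by (intro compact_Int_closed compact_Icc closed_Collect_le continuous_intros)
    have "\<xi> \<in> B" using \<xi> \<xi>2 by (simp add: B_def)
    then show "B \<noteq> {}" by blast
  qed
  obtain a where a: "a \<in> B" "\<And>t. t \<in> B \<Longrightarrow> a \<le> t" using compact_attains_inf[OF cB] by blast
  obtain c where c: "c \<in> B" "\<And>t. t \<in> B \<Longrightarrow> t \<le> c" using compact_attains_sup[OF cB] by blast
  have "a \<noteq> p" using a(1) z(2) by (auto simp: B_def)
  moreover have "c \<noteq> q" using c(1) q(2) by (auto simp: B_def)
  ultimately have ac: "p < a" "a \<le> c" "c < q" using a(1) c(1) a(2)[OF c(1)] by (auto simp: B_def)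
  have lowa: "\<bar>X t (k + 1)\<bar> < 2" if "p \<le> t" "t < a" for t
  proof -
    have "t \<notin> B" using a(2)[of t] that by auto
    then show ?thesis using that ac by (auto simp: B_def)
  qed
  have lowc: "\<bar>X t (k + 1)\<bar> < 2" if "c < t" "t \<le> q" for t
  proof -
    have "t \<notin> B" using c(2)[of t] that by auto
    then show ?thesis using that ac by (auto simp: B_def)
  qed
  have conta: "continuous_on S (\<lambda>t. \<bar>X t (k + 1)\<bar>)" for S by (intro continuous_intros)
  have a2: "\<bar>X a (k + 1)\<bar> = 2"
  proof -
    have "\<exists>t. p \<le> t \<and> t \<le> a \<and> \<bar>X t (k + 1)\<bar> = 2"
      by (rule IVT') (use a(1) z(2) ac conta in \<open>auto simp: B_def\<close>)
    then obtain t where t: "p \<le> t" "t \<le> a" "\<bar>X t (k + 1)\<bar> = 2" by blast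
    then show ?thesis using lowa[of t] by (cases "t = a") auto
  qed
  have c2: "\<bar>X c (k + 1)\<bar> = 2"
  proof -
    have "\<exists>t. c \<le> t \<and> t \<le> q \<and> \<bar>X t (k + 1)\<bar> = 2"
      by (rule IVT2') (use c(1) q(2) ac conta in \<open>auto simp: B_def\<close>)
    then obtain t where t: "c \<le> t" "t \<le> q" "\<bar>X t (k + 1)\<bar> = 2" by blast
    then show ?thesis using lowc[of t] by (cases "t = c") auto
  qed
  have block: "2 \<le> \<bar>X t (k + 1)\<bar>" if t: "t \<in> {a..c}" for t
  proof (rule large_between[of "k + 1" a c t])
    have "filter (\<lambda>z. a < z \<and> z \<le> c) (zeros V (k + 1)) = []"
      unfolding filter_empty_conv
    proof (intro ballI notI)
      fix r assume r: "r \<in> set (zeros V (k + 1))" "a < r \<and> r \<le> c"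
      then have "X r (k + 1) = 0" using Zero by blast
      then show False using nz[of r] r ac by simp
    qed
    then show "zcount V (k + 1) a c = 0" using zcount_filter[OF ac(2), of V "k + 1"] by simp
  qed (use a2 c2 ac t in auto)
  show ?thesis
  proof (cases "\<exists>t\<in>{a..c}. 2 \<le> \<bar>X t (k + 2)\<bar>")
    case True
    then obtain t where t: "t \<in> {a..c}" "2 \<le> \<bar>X t (k + 2)\<bar>" by blast
    then show ?thesis using block[OF t(1)] ac qq' by (intro bexI[of _ t] exI[of _ "k + 1"]) auto
  next
    case False
    define d where "d = (\<lambda>t. trace_deriv V t (k + 2))"
    have ysmall: "\<bar>X t (k + 2)\<bar> < 2" if "t \<in> {a..c}" for t using False that by (auto simp: not_le)
    have dnz: "d t \<noteq> 0" if "t \<in> {a..c}" for t using elliptic_twist[of "k + 2" V t] ysmall[OF that] by (auto simp: d_def)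
    show ?thesis
    proof (cases "0 \<le> X c (k + 2) * d c")
      case True
      have "\<exists>t\<in>{0..q - c}. \<exists>m. 1 \<le> m \<and> m \<le> k + i + 3 \<and> 2 \<le> \<bar>X (c + 1 * t) m\<bar> \<and> 2 \<le> \<bar>X (c + 1 * t) (m + 1)\<bar>"
        by (rule block_exit[OF k, of 1 "q - c"])
          (use ac c2 q nz lowc True ysmall i in \<open>auto simp: d_def\<close>)
      then obtain t m where t: "t \<in> {0..q - c}" "1 \<le> m" "m \<le> k + i + 3" "2 \<le> \<bar>X (c + t) m\<bar>" "2 \<le> \<bar>X (c + t) (m + 1)\<bar>"
        by auto
      show ?thesis by (rule bexI[of _ "c + t"], rule exI[of _ m]) (use t ac qq' in auto)
    next
      case False
      \<comment> \<open>If the modulus decreases in the outward direction at \<open>c\<close>,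
        monotonicity across the block gives \<open>X a (k + 2)\<close> the same sign, and the
        modulus does not decrease outwards at \<open>a\<close>.\<close>
      have da: "X a (k + 2) * d a \<le> 0"
      proof (cases "0 < d a")
        case True
        have pos: "0 < d t" if "t \<in> {a..c}" for t
          by (rule derivative_stays_positive[of "\<lambda>t. X t (k + 2)" d a])
            (use trace_seq_has_derivative dnz True that in \<open>auto simp: d_def\<close>)
        have "X a (k + 2) \<le> X c (k + 2)"
          by (rule DERIV_nonneg_imp_nondecreasing[OF ac(2)])
            (use trace_seq_has_derivative pos in \<open>fastforce simp: d_def less_imp_le\<close>)
        moreover have "X c (k + 2) < 0" using False pos[of c] ac by (auto simp: mult_less_0_iff not_le)
        ultimately show ?thesis using True by (auto simp: mult_le_0_iff)
      next
        case neg: False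
        then have neg: "d a < 0" using dnz[of a] ac by auto
        have pos: "0 < - d t" if "t \<in> {a..c}" for t
          by (rule derivative_stays_positive[of "\<lambda>t. - X t (k + 2)" "\<lambda>t. - d t" a])
            (use DERIV_minus[OF trace_seq_has_derivative] dnz neg that in \<open>auto simp: d_def\<close>)
        have "X c (k + 2) \<le> X a (k + 2)"
          by (rule DERIV_nonpos_imp_nonincreasing[OF ac(2)])
            (use trace_seq_has_derivative pos in \<open>fastforce simp: d_def less_imp_le\<close>)
        moreover have "0 < X c (k + 2)" using False pos[of c] ac by (auto simp: mult_less_0_iff not_le)
        ultimately show ?thesis using neg by (auto simp: mult_le_0_iff)
      qed
      have "\<exists>t\<in>{0..a - p}. \<exists>m. 1 \<le> m \<and> m \<le> k + i + 3 \<and> 2 \<le> \<bar>X (a + - 1 * t) m\<bar> \<and> 2 \<le> \<bar>X (a + - 1 * t) (m + 1)\<bar>"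
      proof (rule block_exit[OF k, of "-1" "a - p"])
        show "X (a + - 1 * t) (k + 1) \<noteq> 0 \<and> \<bar>X (a + - 1 * t) (k + 1)\<bar> < 2" if "0 < t" "t < a - p" for t
          using nz[of "a - t"] lowa[of "a - t"] that ac by auto
      qed (use ac a2 z da ysmall i in \<open>auto simp: d_def\<close>)
      then obtain t m where t: "t \<in> {0..a - p}" "1 \<le> m" "m \<le> k + i + 3" "2 \<le> \<bar>X (a - t) m\<bar>" "2 \<le> \<bar>X (a - t) (m + 1)\<bar>"
        by auto
      show ?thesis by (rule bexI[of _ "a - t"], rule exI[of _ m]) (use t ac qq' in auto)
    qed
  qed
qed

end

subsection \<open>Growth on intervals without large gaps\<close>

lemma (in coupling) two_exp_bound: "0 \<le> u \<Longrightarrow> ln (2 * exp u + 1 :: real) \<le> u + 2"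
proof -
  assume "0 \<le> u"
  then have "2 * exp u + 1 \<le> 3 * exp u" using one_le_exp_iff[of u] by linarith
  then have "ln (2 * exp u + 1) \<le> ln (3 * exp u)" by (subst ln_le_cancel_iff) (auto intro: add_pos_pos)
  also have "\<dots> = ln 3 + u" by (simp add: ln_mult_pos)
  finally show ?thesis using ln3_le by linarith
qed

text \<open>The right side is a harmonic polynomial that is at least 1 on the upper arc, nonnegative
  on the diameter and of order \<open>y / \<rho>\<close> above the centre: an elementary substitute
  for the harmonic measure of the arc.\<close>

lemma parabola_arc:
  fixes x y \<rho> :: real
  assumes "0 < y" "x^2 + y^2 = \<rho>^2" "0 < \<rho>"
  shows "1 \<le> 3 * y / \<rho> + (x^2 - y^2) / \<rho>^2"
proof -
  have "y^2 \<le> \<rho>^2" using assms zero_le_power2[of x] by linarith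
  then have y: "y \<le> \<rho>" by (rule power2_le_imp_le) (use assms in auto)
  have "y * y \<le> y * \<rho>" using y assms by (intro mult_left_mono) auto
  then have "2 * y^2 \<le> 3 * y * \<rho>" using assms mult_pos_pos[of y \<rho>] unfolding power2_eq_square by linarith
  then have "\<rho>^2 \<le> 3 * y * \<rho> + (x^2 - y^2)" using assms(2) by linarith
  then have "\<rho>^2 / \<rho>^2 \<le> (3 * y * \<rho> + (x^2 - y^2)) / \<rho>^2" by (intro divide_right_mono) auto
  then show ?thesis using assms by (simp add: add_divide_distrib power2_eq_square)
qed

text \<open>The majorant has three parts: a quadratic harmonic polynomial that is at least \<open>M\<close> on the arc,
  a Poisson kernel with pole at height \<open>- g\<close> for \<open>\<bar>x\<bar> \<le> g\<close>, and the complement of a Poisson kernel with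
  pole at height \<open>- 961 * g\<close> for \<open>\<bar>x\<bar> \<ge> 961 * g\<close>. Both kernels contribute only \<open>h / 8\<close> at height
  \<open>31 * g\<close>.\<close>

lemma local_majorant:
  assumes n: "1 \<le> n" and g: "0 < g" "31 * g \<le> \<rho>" and nn: "0 \<le> h" "0 \<le> B" "0 \<le> M"
    and far: "\<And>x. \<bar>x\<bar> \<le> \<rho> \<Longrightarrow> ln (\<bar>trace_seq V (t + x) n\<bar> + 1) \<le> 2 * h"
    and mid: "\<And>x. g < \<bar>x\<bar> \<Longrightarrow> \<bar>x\<bar> < 961 * g \<Longrightarrow> \<bar>x\<bar> \<le> \<rho> \<Longrightarrow> ln (\<bar>trace_seq V (t + x) n\<bar> + 1) \<le> B"
    and arc: "\<And>z. 0 < Im z \<Longrightarrow> cmod (z - of_real t) = \<rho> \<Longrightarrow> height V n z \<le> M"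
  shows "height V n (Complex t (31 * g)) \<le> 93 * M * g / \<rho> + B + h / 4"
proof -
  define s where "s = 961 * g"
  \<comment> \<open>Since 961 is the square of 31, the height \<open>31 * g\<close> is the geometric
    mean of \<open>g\<close> and \<open>s\<close>, and both kernels take the value
    \<open>4 * h / 32\<close> there.\<close>
  have \<rho>: "0 < \<rho>" and s: "0 < s" using g by (auto simp: s_def)
  define m :: "complex \<Rightarrow> complex" where "m = (\<lambda>z. of_real M * (- 3 * \<i> * (z - of_real t) / of_real \<rho> + (z - of_real t)^2 / of_real (\<rho>^2)) + of_real B
     + of_real (4 * h * g) * (\<i> / (z - of_real t + \<i> * of_real g))
     + of_real (4 * h) * (1 - of_real s * (\<i> / (z - of_real t + \<i> * of_real s))))"
  define \<psi> where "\<psi> = (\<lambda>x y. M * (3 * y / \<rho> + (x^2 - y^2) / \<rho>^2) + B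
     + 4 * h * g * ((y + g) / (x^2 + (y + g)^2)) + 4 * h * (1 - s * ((y + s) / (x^2 + (y + s)^2))))"
  have Rei: "Re (\<i> / (Complex x y - of_real t + \<i> * of_real c)) = (y + c) / ((x - t)^2 + (y + c)^2)" for x y c
    by (simp add: Re_divide)
  have rr: "Re (of_real r * z) = r * Re z" for r z by simp
  have Rem: "Re (m (Complex x y)) = \<psi> (x - t) y" for x y
  proof -
    have e: "Re (- 3 * \<i> * (Complex x y - of_real t) / of_real \<rho>) = 3 * y / \<rho>"
      by (simp add: Re_divide_of_real)
    have e2: "Re ((Complex x y - of_real t)^2 / of_real (\<rho>^2)) = ((x - t)^2 - y^2) / \<rho>^2"
      by (subst Re_divide_of_real) (simp add: Re_power2)
    show ?thesis
      unfolding m_def \<psi>_def by (simp only: plus_complex.sel minus_complex.sel Re_complex_of_real rr Rei one_complex.sel e e2)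
  qed
  have term1: "0 \<le> 4 * h * g * ((y + g) / (x^2 + (y + g)^2))" if "0 \<le> y" for x y
    using nn g that by (intro mult_nonneg_nonneg divide_nonneg_nonneg) auto
  have term2: "0 \<le> 4 * h * (1 - s * ((y + s) / (x^2 + (y + s)^2)))" if "0 \<le> y" for x y
  proof -
    have "s * (y + s) \<le> (y + s) * (y + s)" using that s by (intro mult_right_mono) auto
    then have "s * (y + s) \<le> x^2 + (y + s)^2" using zero_le_power2[of x] unfolding power2_eq_square[of "y + s"] by linarith
    moreover have "0 < x^2 + (y + s)^2" using that s by (intro add_nonneg_pos) auto
    ultimately have "s * ((y + s) / (x^2 + (y + s)^2)) \<le> 1" by (simp add: pos_divide_le_eq)
    then show ?thesis using nn by simp
  qed
  have "height V n (Complex t (31 * g)) \<le> Re (m (Complex t (31 * g)))"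
  proof (rule height_majorant[OF n \<rho> g(1)])
    have gs: "g \<le> s" using g by (simp add: s_def)
    have nz: "z - of_real t + \<i> * of_real c \<noteq> 0" if "- g < Im z" "g \<le> c" for z c
      using that by (auto simp: complex_eq_iff)
    show "m holomorphic_on {z. - g < Im z}"
      unfolding m_def by (intro holomorphic_intros) (use nz[of _ g] nz[of _ s] gs \<rho> in auto)
    show "ln (\<bar>trace_seq V r n\<bar> + 1) \<le> Re (m (of_real r))" if r: "\<bar>r - t\<bar> \<le> \<rho>" for r
    proof -
      define x where "x = r - t"
      have x: "\<bar>x\<bar> \<le> \<rho>" "r = t + x" using r by (auto simp: x_def)
      have m: "Re (m (of_real r)) = \<psi> x 0" using Rem[of r 0] by (simp add: complex_of_real_def x_def)
      have M0: "0 \<le> M * (3 * 0 / \<rho> + (x^2 - 0^2) / \<rho>^2)" using nn by (intro mult_nonneg_nonneg) auto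
      note pos = M0 nn(2) term1[of 0 x] term2[of 0 x]
      consider "\<bar>x\<bar> \<le> g" | "g < \<bar>x\<bar>" "\<bar>x\<bar> < s" | "s \<le> \<bar>x\<bar>" by linarith
      then show ?thesis
      proof cases
        case 1
        then have "\<bar>x\<bar>^2 \<le> g^2" by (intro power_mono) auto
        then have "x^2 + g^2 \<le> 2 * (g * g)" by (simp add: power2_eq_square)
        moreover have "0 < x^2 + g^2" using g by (simp add: add_nonneg_pos)
        ultimately have "1 / 2 \<le> g * (g / (x^2 + g^2))" by (simp add: pos_le_divide_eq)
        then have "4 * h * (1 / 2) \<le> 4 * h * (g * (g / (x^2 + g^2)))" using nn by (intro mult_left_mono) auto
        then show ?thesis unfolding m \<psi>_def using pos far[OF x(1)] x(2) by (simp add: mult.assoc)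
      next
        case 2
        then show ?thesis unfolding m \<psi>_def using pos mid[of x] x by (simp add: s_def)
      next
        case 3
        then have "s^2 \<le> \<bar>x\<bar>^2" using s by (intro power_mono) auto
        then have "2 * (s * s) \<le> x^2 + s^2" by (simp add: power2_eq_square)
        moreover have "0 < x^2 + s^2" using s by (simp add: add_nonneg_pos)
        ultimately have "s * (s / (x^2 + s^2)) \<le> 1 / 2" by (simp add: pos_divide_le_eq)
        then have "4 * h * (1 / 2) \<le> 4 * h * (1 - s * (s / (x^2 + s^2)))" using nn by (intro mult_left_mono) auto
        then show ?thesis unfolding m \<psi>_def using pos far[OF x(1)] x(2) by simp
      qed
    qed
    show "height V n z \<le> Re (m z)" if z: "0 < Im z" "cmod (z - of_real t) = \<rho>" for z
    proof -
      define x y where "x = Re z - t" and "y = Im z"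
      have zc: "z = Complex (x + t) y" by (simp add: x_def y_def complex_eq_iff)
      have "x^2 + y^2 = \<rho>^2" using z(2) by (simp add: x_def y_def flip: z(2) cmod_power2)
          (simp add: cmod_power2)
      then have "1 \<le> 3 * y / \<rho> + (x^2 - y^2) / \<rho>^2" using parabola_arc[of y x \<rho>] z \<rho> by (simp add: y_def)
      then have "M * 1 \<le> M * (3 * y / \<rho> + (x^2 - y^2) / \<rho>^2)" using nn by (intro mult_left_mono)
      moreover have "Re (m z) = \<psi> x y" unfolding zc Rem by simp
      ultimately show ?thesis
        using arc[OF z] term1[of y x] term2[of y x] nn z unfolding \<psi>_def y_def[symmetric] by simp
    qed
    show "0 < Im (Complex t (31 * g))" using g by simp
    have "Complex t (31 * g) - of_real t = \<i> * of_real (31 * g)" by (simp add: complex_eq_iff)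
    then show "cmod (Complex t (31 * g) - of_real t) \<le> \<rho>"
      using g by (simp add: norm_mult)
  qed
  also have "\<dots> = \<psi> 0 (31 * g)" by (simp add: Rem)
  also have "\<dots> \<le> 93 * M * g / \<rho> + B + h / 4"
  proof -
    have e0: "M * (3 * (31 * g) / \<rho> + (0^2 - (31 * g)^2) / \<rho>^2) \<le> M * (93 * g / \<rho>)"
      using nn by (intro mult_left_mono) (auto simp: divide_nonneg_nonneg)
    have "g * ((31 * g + g) / (0^2 + (31 * g + g)^2)) = 1 / 32"
      using g by (simp add: power2_eq_square)
    then have e1: "4 * h * g * ((31 * g + g) / (0^2 + (31 * g + g)^2)) = h / 8"
      unfolding mult.assoc by simp
    have e: "s * ((31 * g + s) / (0^2 + (31 * g + s)^2)) = 31 / 32"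
      using g by (simp add: power2_eq_square s_def)
    have e2: "4 * h * (1 - s * ((31 * g + s) / (0^2 + (31 * g + s)^2))) = h / 8"
      unfolding e by simp
    have "\<psi> 0 (31 * g) \<le> M * (93 * g / \<rho>) + B + h / 8 + h / 8"
      unfolding \<psi>_def e1 e2 by (intro add_right_mono e0)
    then show ?thesis by simp
  qed
  finally show ?thesis .
qed

context coupling
begin

text \<open>At height \<open>s\<close> every zero within distance \<open>s\<close> of
  \<open>t\<close> contributes \<open>ln 2 / 2\<close> beyond its share in
  \<open>ln \<bar>X t n\<bar>\<close>, which is nonnegative by \<open>X1\<close>.\<close>

lemma zcount_le_height:
  assumes n: "1 \<le> n" and X1: "1 \<le> \<bar>X t n\<bar>" and s: "0 < s"
    and near: "\<And>z. z \<in> set (zeros V n) \<Longrightarrow> min a b < z \<Longrightarrow> z \<le> max a b \<Longrightarrow> \<bar>t - z\<bar> \<le> s"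
  shows "zcount V n a b \<le> 3 * (height V n (Complex t s) + 1)"
proof -
  define zs where "zs = zeros V n"
  have tz: "t - z \<noteq> 0" if "z \<in> set zs" for z
  proof
    assume "t - z = 0"
    then have "X t n = 0" using trace_zero_iff[OF n, of V t] that by (simp add: zs_def)
    then show False using X1 by simp
  qed
  have "zcount V n (min a b) (max a b) = zcount V n a b" by (simp add: zcount_def)
  then have "zcount V n a b = length (filter (\<lambda>z. min a b < z \<and> z \<le> max a b) zs)"
    using zcount_filter[of "min a b" "max a b" V n] by (simp add: zs_def)
  also have "\<dots> \<le> length (filter (\<lambda>z. \<bar>t - z\<bar> \<le> s) zs)"
    by (rule length_filter_mono) (use near in \<open>auto simp: zs_def\<close>)
  finally have "ln 2 / 2 * zcount V n a b \<le> ln 2 / 2 * length (filter (\<lambda>z. \<bar>t - z\<bar> \<le> s) zs)"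
    using ln2_ge_two_thirds by simp
  also have "0 \<le> ln \<bar>X t n\<bar>" using X1 by simp
  then have "ln 2 / 2 * length (filter (\<lambda>z. \<bar>t - z\<bar> \<le> s) zs) \<le> ln \<bar>X t n\<bar> + ln 2 / 2 * length (filter (\<lambda>z. \<bar>t - z\<bar> \<le> s) zs)" by simp
  also have "\<dots> = (\<Sum>z\<leftarrow>zs. ln ((t - z)^2) / 2 + (if \<bar>t - z\<bar> \<le> s then ln 2 / 2 else 0))"
    using ln_trace_sum[OF n, of t] tz by (simp add: zs_def sum_list_addf sum_list_indicator)
  also have "\<dots> \<le> (\<Sum>z\<leftarrow>zs. ln ((t - z)^2 + s^2) / 2)"
    by (rule sum_list_mono) (use ln_add_square_ge tz in blast)
  also have "\<dots> = ln (cmod (trace_seq V (Complex t s) n))"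
    unfolding zs_def by (rule ln_norm_trace_seq[OF n, symmetric]) (use s in \<open>simp add: add_nonneg_pos\<close>)
  also have "\<dots> \<le> ln (2 * exp (height V n (Complex t s)))"
  proof -
    have "1 \<le> cmod (trace_seq V (Complex t s) n)"
      using norm_trace_seq_mono[OF n, of 0 s V t] X1 s
      by (simp add: complex_of_real_def[symmetric] trace_seq_of_real)
    then show ?thesis using height_bounds(3)[OF n, of "Complex t s" V] s by (subst ln_le_cancel_iff) auto
  qed
  also have "\<dots> = ln 2 + height V n (Complex t s)" by (simp add: ln_mult_pos)
  finally have "ln 2 / 2 * zcount V n a b \<le> 1 + height V n (Complex t s)"
    using ln_le_minus_one[of 2] by simp
  moreover have "1 / 3 * real (zcount V n a b) \<le> ln 2 / 2 * zcount V n a b"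
    using ln2_ge_two_thirds by (intro mult_right_mono) auto
  ultimately have "1 / 3 * real (zcount V n a b) \<le> 1 + height V n (Complex t s)" by (rule order_trans[rotated])
  then show ?thesis by simp
qed

lemma gap_around:
  assumes E: "E \<notin> trapped V" and p: "p \<in> trapped V" "p \<le> E" and q: "q \<in> trapped V" "E \<le> q"
  obtains a b where "a \<in> trapped V" "b \<in> trapped V" "a < E" "E < b" "{a<..<b} \<inter> trapped V = {}"
proof -
  have "compact (trapped V \<inter> {..E})" "compact (trapped V \<inter> {E..})"
    using compact_trapped by (auto intro!: compact_Int_closed)
  moreover have "trapped V \<inter> {..E} \<noteq> {}" "trapped V \<inter> {E..} \<noteq> {}" using p q by auto
  ultimately obtain a b where a: "a \<in> trapped V \<inter> {..E}" "\<And>t. t \<in> trapped V \<inter> {..E} \<Longrightarrow> t \<le> a"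
    and b: "b \<in> trapped V \<inter> {E..}" "\<And>t. t \<in> trapped V \<inter> {E..} \<Longrightarrow> b \<le> t"
    using compact_attains_sup compact_attains_inf by metis
  show thesis
  proof (rule that[of a b])
    show "a < E" "E < b" using a b E by (auto simp: less_le)
    show "{a<..<b} \<inter> trapped V = {}"
    proof (rule ccontr)
      assume "\<not> ?thesis"
      then obtain t where t: "a < t" "t < b" "t \<in> trapped V" by auto
      then show False using a(2)[of t] b(2)[of t] by (cases "t \<le> E") auto
    qed
  qed (use a b in auto)
qed

end

context coupling
begin

lemma cmod_trace_real: "cmod (trace_seq V (Complex t 0) n) = \<bar>X t n\<bar>"
  by (simp add: complex_of_real_def[symmetric] trace_seq_of_real)

lemma ln_trace_le_height:
  assumes n: "1 \<le> n" and y: "0 \<le> y" "y \<le> d" "0 < d"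
  shows "ln (cmod (trace_seq V (Complex x y) n) + 1) \<le> height V n (Complex x d) + 2"
proof -
  have "cmod (trace_seq V (Complex x y) n) \<le> 2 * exp (height V n (Complex x d))"
    using norm_trace_seq_mono[OF n y(1,2), of V x] height_bounds(3)[OF n, of "Complex x d" V] y by simp
  then have "ln (cmod (trace_seq V (Complex x y) n) + 1) \<le> ln (2 * exp (height V n (Complex x d)) + 1)"
    by (subst ln_le_cancel_iff) (auto intro: add_nonneg_pos)
  also have "\<dots> \<le> height V n (Complex x d) + 2"
    by (rule two_exp_bound) (use height_bounds(1)[OF n, of "Complex x d" V] y in simp)
  finally show ?thesis .
qed

text \<open>The point \<open>u\<close> of the proof maximises \<open>ln (\<bar>X\<bar> + 1)\<close> times the distance to the end points of the
  interval, so that near \<open>u\<close> this logarithm is at most twice its value there. Gaps close to the one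
  containing \<open>u\<close> are younger by \<open>gap_le_distance\<close>, which bounds the growth in them.\<close>

lemma growth_in_dense_interval:
  assumes V7: "V \<le> 1 / 10^7" and n: "1 \<le> n" and R: "0 < R"
    and hull: "p \<in> trapped V" "p \<le> E0 - R" "q \<in> trapped V" "E0 + R \<le> q"
    and dense: "\<And>a b. a \<in> trapped V \<Longrightarrow> b \<in> trapped V \<Longrightarrow> a < b \<Longrightarrow> {a<..<b} \<inter> trapped V = {} \<Longrightarrow>
      min b (E0 + R) - max a (E0 - R) \<le> \<delta> * R"
    and M: "M = height V n (Complex E0 R)" "2 \<le> M" "1 \<le> M * \<delta>"
    and t: "\<bar>t - E0\<bar> \<le> R / 2"
  shows "ln (\<bar>X t n\<bar> + 1) \<le> 6000 * M * \<delta>"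
proof -
  define f where "f = (\<lambda>t. ln (\<bar>X t n\<bar> + 1))"
  define r where "r = (\<lambda>t. R - \<bar>t - E0\<bar>)"
  have f0: "0 \<le> f t" for t by (simp add: f_def)
  have "continuous_on {E0 - R..E0 + R} (\<lambda>t. f t * r t)"
    unfolding f_def r_def by (intro continuous_intros ballI) (metis abs_ge_zero add_nonneg_pos less_irrefl zero_less_one)
  then obtain u where u: "u \<in> {E0 - R..E0 + R}" "\<And>t. t \<in> {E0 - R..E0 + R} \<Longrightarrow> f t * r t \<le> f u * r u"
    using continuous_attains_sup[OF compact_Icc, of "E0 - R" "E0 + R" "\<lambda>t. f t * r t"] R by auto
  have \<delta>: "0 < \<delta>" using M zero_less_mult_pos[of M \<delta>] by linarith
  have ru: "0 \<le> r u" "r u \<le> R" using u(1) by (auto simp: r_def abs_le_iff)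
  have RM: "R \<le> M * \<delta> * R" using mult_right_mono[OF M(3), of R] R by simp
  have arc: "ln (cmod (trace_seq V (Complex x y) n) + 1) \<le> 4 * M" if "\<bar>x - E0\<bar> \<le> R" "0 \<le> y" "y \<le> R" for x y
  proof -
    have "ln (cmod (trace_seq V (Complex x y) n) + 1) \<le> height V n (Complex x R) + 2"
      by (rule ln_trace_le_height[OF n that(2,3) R])
    also have "height V n (Complex x R) \<le> 3 * M"
      using height_horizontal[OF n R that(1), of V E0] by (simp add: M(1))
    finally show ?thesis using M(2) by linarith
  qed
  have f4: "f x \<le> 4 * M" if "\<bar>x - E0\<bar> \<le> R" for x
    using arc[OF that, of 0] R cmod_trace_real[of x n] by (simp add: f_def)
  have "f u * r u \<le> 3000 * (M * \<delta> * R)"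
  \<comment> \<open>In the first case the growth is bounded or \<open>u\<close> is close to an end,
    and the claim is immediate. Otherwise the gap around \<open>u\<close> is shorter than the
    distance to the ends; 62 = 2 * 31 leaves room for a half disc of radius
    \<open>r u / 2 \<ge> 31 * g\<close>.\<close>
  proof (cases "f u \<le> 3 \<or> r u \<le> 62 * (\<delta> * R)")
    case True
    then show ?thesis
    proof
      assume "f u \<le> 3"
      then have "f u * r u \<le> 3 * R" using f0[of u] ru by (intro mult_mono) auto
      then show ?thesis using RM R by linarith
    next
      assume "r u \<le> 62 * (\<delta> * R)"
      then have "f u * r u \<le> 4 * M * (62 * (\<delta> * R))"
        using f0[of u] ru f4[of u] M(2) u(1) by (intro mult_mono) (auto simp: abs_le_iff)
      moreover have "0 \<le> M * \<delta> * R" using RM R by linarith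
      ultimately show ?thesis by simp
    qed
  next
    case False
    define h where "h = f u"
    have h: "3 < h" and rbig: "62 * (\<delta> * R) < r u" using False by (auto simp: h_def)
    have rpos: "0 < r u" using rbig \<delta> R mult_pos_pos[of \<delta> R] by linarith
    have uJ: "E0 - R < u" "u < E0 + R" using rpos by (auto simp: r_def abs_less_iff)
    have untr: "u \<notin> trapped V" using unescaped_upper[OF n, of u] h by (auto simp: h_def f_def)
    obtain a b where ab: "a \<in> trapped V" "b \<in> trapped V" "a < u" "u < b" "{a<..<b} \<inter> trapped V = {}"
      using gap_around[OF untr hull(1) _ hull(3)] hull(2,4) uJ by (metis less_imp_le order_trans)
    define g where "g = b - a"
    have g0: "0 < g" using ab by (simp add: g_def)
    have le: "min b (E0 + R) - max a (E0 - R) \<le> \<delta> * R" using dense[OF ab(1,2) _ ab(5)] ab by simp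
    have dR: "0 < \<delta> * R" using \<delta> R by simp
    have ru': "r u \<le> u - (E0 - R)" "r u \<le> E0 + R - u" by (auto simp: r_def)
    have gR: "g \<le> \<delta> * R"
      using le ru' ab rbig dR unfolding g_def min_def max_def by (auto split: if_splits)
    define \<rho> where "\<rho> = r u / 2"
    have g31: "31 * g \<le> \<rho>" using gR rbig by (simp add: \<rho>_def)
    have inJ: "r u / 2 \<le> r (u + x) \<and> u + x \<in> {E0 - R..E0 + R} \<and> \<bar>(u + x) - E0\<bar> \<le> R" if x: "\<bar>x\<bar> \<le> \<rho>" for x
    proof -
      have "\<bar>(u + x) - E0\<bar> \<le> \<bar>u - E0\<bar> + \<bar>x\<bar>" by linarith
      moreover have "(R - A) / 2 \<le> R - C" if "C \<le> A + B" "B \<le> (R - A) / 2" for A B C :: real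
        using that by (simp add: field_simps)
      ultimately have "r u / 2 \<le> r (u + x)" using x unfolding \<rho>_def r_def by blast
      moreover have "C \<le> R" if "(R - A) / 2 \<le> R - C" "0 < R - A" for A C :: real
        using that by (simp add: field_simps)
      from this[of "\<bar>u - E0\<bar>"] have "\<bar>(u + x) - E0\<bar> \<le> R" using calculation rpos unfolding r_def by blast
      ultimately show ?thesis by (simp add: abs_le_iff)
    qed
    define us where "us = height V n (Complex u (961 * g))"
    define u31 where "u31 = height V n (Complex u (31 * g))"
    have us0: "0 < us" "0 < u31" using height_bounds(1)[OF n] g0 by (auto simp: us_def u31_def)
    define B where "B = 3 + 270 * V * (us + 1)"
    define c where "c = (a + b) / 2"
    have c: "a < c" "c < b" using ab by (auto simp: c_def)
    then have cU: "c \<notin> trapped V" using ab(5) by auto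
    have Xu: "1 \<le> \<bar>X u n\<bar>"
    proof (rule ccontr)
      assume "\<not> ?thesis"
      then have "h \<le> ln 2" unfolding h_def f_def by (subst ln_le_cancel_iff) auto
      then show False using h ln_le_minus_one[of 2] by simp
    qed
    have "height V n (Complex u (31 * g)) \<le> 93 * (4 * M) * g / \<rho> + B + h / 4"
    proof (rule local_majorant[OF n g0 g31])
      show "0 \<le> h" "0 \<le> B" "0 \<le> 4 * M" using h us0 V_pos M by (auto simp: B_def)
      show "ln (\<bar>X (u + x) n\<bar> + 1) \<le> 2 * h" if x: "\<bar>x\<bar> \<le> \<rho>" for x
      proof -
        have "f (u + x) * (r u / 2) \<le> f (u + x) * r (u + x)" using inJ[OF x] f0 by (intro mult_left_mono) auto
        also have "\<dots> \<le> h * r u" using u(2) inJ[OF x] by (simp add: h_def)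
        finally have "f (u + x) * r u \<le> (2 * h) * r u" by simp
        then show ?thesis using rpos unfolding f_def by (simp only: mult_le_cancel_right_pos)
      qed
      show "height V n z \<le> 4 * M" if z: "0 < Im z" "cmod (z - of_real u) = \<rho>" for z
      proof -
        have "\<bar>Re z - u\<bar> \<le> \<rho>" using abs_Re_le_cmod[of "z - of_real u"] z by simp
        then have x: "\<bar>Re z - E0\<bar> \<le> R" using inJ[of "Re z - u"] by simp
        have "\<bar>Im z\<bar> \<le> \<rho>" using abs_Im_le_cmod[of "z - of_real u"] z by simp
        then have y: "Im z \<le> R" using ru rpos by (simp add: \<rho>_def)
        show ?thesis using height_bounds(2)[OF n z(1), of V] arc[OF x _ y] z(1) by simp
      qed
      fix x assume x: "g < \<bar>x\<bar>" "\<bar>x\<bar> < 961 * g" "\<bar>x\<bar> \<le> \<rho>"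
      define t where "t = u + x"
      have out: "t < a \<or> b < t" using x(1) ab by (auto simp: t_def g_def abs_if split: if_splits)
      have tpq: "p \<le> t" "t \<le> q" using inJ[OF x(3)] hull by (auto simp: t_def)
      show "ln (\<bar>X (u + x) n\<bar> + 1) \<le> B"
      proof (cases "t \<in> trapped V")
        case True
        then have "ln (\<bar>X t n\<bar> + 1) \<le> 3" using unescaped_upper[OF n] by blast
        moreover have "0 \<le> 270 * V * (us + 1)" using V_pos us0 by simp
        ultimately show ?thesis by (simp add: B_def t_def)
      next
        case False
        then have pt: "p < t" "t < q" using tpq hull by (auto simp: less_le)
        define w where "w = (if t < a then a else b)"
        have w: "w \<in> trapped V" "min t c < w" "w < max t c" using ab c out by (auto simp: w_def)
        have far: "\<bar>t - c\<bar> < 962 * g"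
          using x(2) ab c unfolding t_def g_def abs_less_iff by auto
        \<comment> \<open>An older gap that close would make the gap of \<open>u\<close> shorter
          than itself by \<open>gap_le_distance\<close>, since 5000 * 962 / 10^7 is below 1. So the
          gap of \<open>u\<close> is the older one, and the growth at \<open>t\<close> is
          \<open>V\<close> times a number of zeros near \<open>u\<close>.\<close>
        have "escape_time V c \<le> escape_time V t"
        proof (rule ccontr)
          assume "\<not> ?thesis"
          then have "b - a \<le> 5000 * V * (962 * g)"
            using far w g0 by (intro gap_le_distance[OF ab(1,2) _ ab(5) c_def, of "962 * g" t w])
              (use ab False in \<open>auto simp: g_def min.commute max.commute\<close>)
          also have "\<dots> \<le> 5000 * (1 / 10^7) * (962 * g)" using V7 g0 by (intro mult_right_mono mult_left_mono) auto
          finally show False using g0 by (simp add: g_def[symmetric])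
        qed
        from growth_vs_zcount[OF False hull(1) pt(1) hull(3) pt(2) cU this w n]
        have "ln (\<bar>X t n\<bar> + 1) \<le> 3 + 90 * V * zcount V n t c" .
        also have "zcount V n t c \<le> 3 * (us + 1)"
          unfolding us_def
        proof (rule zcount_le_height[OF n Xu])
          fix z assume z: "min t c < z" "z \<le> max t c"
          have "\<bar>c - u\<bar> \<le> 961 * g" using c ab g0 by (auto simp: g_def abs_le_iff)
          moreover have "\<bar>t - u\<bar> \<le> 961 * g" using x(2) by (simp add: t_def)
          ultimately show "\<bar>u - z\<bar> \<le> 961 * g" using z unfolding min_def max_def abs_le_iff by (auto split: if_splits)
        qed (use g0 in simp)
        then have "3 + 90 * V * zcount V n t c \<le> 3 + 90 * V * (3 * (us + 1))"
          using V_pos by (intro add_left_mono mult_left_mono) auto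
        finally show ?thesis by (simp add: B_def t_def algebra_simps)
      qed
    qed
    then have m1: "u31 \<le> 372 * (M * g / \<rho>) + B + h / 4" by (simp add: u31_def)
    have "us \<le> 31 * u31"
    proof -
      have "31 * g / (961 * g) * us \<le> u31"
        unfolding us_def u31_def by (rule height_vertical[OF n]) (use g0 in auto)
      then show ?thesis using g0 by simp
    qed
    \<comment> \<open>The neighbouring gaps contribute to the majorant a small multiple of the very
      height that is being estimated, because 270 * 31 / 10^7 is small; that part is absorbed on the
      left side.\<close>
    then have "270 * V * (us + 1) \<le> 270 * (1 / 10^7) * (31 * u31 + 1)"
      using V7 V_pos us0 by (intro mult_mono) auto
    then have m2: "B \<le> 4 + u31 / 2" using us0 unfolding B_def by simp
    have m3: "h \<le> u31 + 2"
      using ln_trace_le_height[OF n, of 0 "31 * g" u] g0 cmod_trace_real[of u n] by (simp add: h_def f_def u31_def)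
    have "h \<le> 1488 * (M * g / \<rho>) + 20" using m1 m2 m3 by linarith
    then have "h * \<rho> \<le> (1488 * (M * g / \<rho>) + 20) * \<rho>" using rpos by (intro mult_right_mono) (auto simp: \<rho>_def)
    also have "\<dots> = 1488 * (M * g) + 20 * \<rho>" using rpos by (simp add: \<rho>_def algebra_simps)
    also have "\<dots> \<le> 1488 * (M * (\<delta> * R)) + 20 * (R / 2)"
      using gR M(2) ru by (intro add_mono mult_left_mono) (auto simp: \<rho>_def)
    finally have "h * r u \<le> 2976 * (M * \<delta> * R) + 20 * R" by (simp add: \<rho>_def mult_ac)
    then show ?thesis using RM R unfolding h_def by linarith
  qed
  moreover have "f t * (R / 2) \<le> f t * r t" using t f0[of t] by (intro mult_left_mono) (auto simp: r_def)
  moreover have "f t * r t \<le> f u * r u" by (intro u(2)) (use t R in \<open>unfold atLeastAtMost_iff, linarith\<close>)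
  ultimately have "f t * R \<le> (6000 * M * \<delta>) * R" by (simp add: algebra_simps)
  then show ?thesis using R unfolding f_def by (simp only: mult_le_cancel_right_pos)
qed

text \<open>The logarithmic sum is compared at the heights \<open>R\<close>, \<open>R / 24\<close>
  and \<open>R / 1152\<close>. Harnack makes it at least \<open>M / 24 - 1\<close> at the second
  height, and small growth on the real line makes it at most \<open>M / 48 + \<eta> + 1\<close> at
  the third. Distant zeros can account for only part of this increase, so the rest comes from zeros
  in the interval.\<close>

lemma zeros_in_interval:
  assumes n: "1 \<le> n" and R: "0 < R" and M: "M = height V n (Complex E0 R)" "2000 \<le> M"
    and line: "\<And>t. \<bar>t - E0\<bar> \<le> R / 2 \<Longrightarrow> ln (\<bar>X t n\<bar> + 1) \<le> \<eta>" and \<eta>: "\<eta> \<le> M / 400"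
  shows "M / 1000 \<le> length (filter (\<lambda>z. E0 - R / 2 < z \<and> z \<le> E0 + R / 2) (zeros V n))"
proof -
  define zs where "zs = zeros V n"
  define P where "P = (\<lambda>z. E0 - R / 2 < z \<and> z \<le> E0 + R / 2)"
  define L where "L = (\<lambda>y. ln (cmod (trace_seq V (Complex E0 y) n)))"
  have sum: "L y = (\<Sum>z\<leftarrow>zs. ln ((E0 - z)^2 + y^2) / 2)" if "0 < y" for y
    unfolding L_def zs_def by (rule ln_norm_trace_seq[OF n]) (use that in \<open>simp add: add_nonneg_pos\<close>)
  have low: "height V n (Complex E0 y) - 1 \<le> L y" if "0 < y" "1 \<le> height V n (Complex E0 y)" for y
  proof -
    define u where "u = height V n (Complex E0 y)"
    define N where "N = cmod (trace_seq V (Complex E0 y) n)"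
    have "u \<le> ln (N + 1)" using height_bounds(2)[OF n, of "Complex E0 y" V] that by (simp add: u_def N_def)
    then have "exp u \<le> N + 1" by (subst (asm) ln_ge_iff) (auto simp: N_def intro: add_nonneg_pos)
    moreover have "1 \<le> exp (u - 1)" using that by (simp add: u_def)
    moreover have "2 * exp (u - 1) \<le> exp 1 * exp (u - 1)"
      using exp_ge_add_one_self[of 1] by (intro mult_right_mono) auto
    then have "2 * exp (u - 1) \<le> exp u" by (simp flip: exp_add)
    ultimately have "exp (u - 1) \<le> N" by linarith
    then have "u - 1 \<le> ln N" by (subst ln_ge_iff) (auto intro: less_le_trans[OF exp_gt_zero])
    then show ?thesis by (simp add: L_def u_def N_def)
  qed
  have up: "L y \<le> 1 + height V n (Complex E0 y)" if "0 < y" "0 < cmod (trace_seq V (Complex E0 y) n)" for y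
  proof -
    have "L y \<le> ln (2 * exp (height V n (Complex E0 y)))"
      unfolding L_def using height_bounds(3)[OF n, of "Complex E0 y" V] that by (subst ln_le_cancel_iff) auto
    also have "\<dots> = ln 2 + height V n (Complex E0 y)" by (simp add: ln_mult_pos)
    finally show ?thesis using ln_le_minus_one[of 2] by simp
  qed
  have posn: "0 < cmod (trace_seq V (Complex E0 y) n)" if "0 < y" for y
    using trace_seq_not_in_band[of "Complex E0 y" n 0 V] that n by simp
  \<comment> \<open>At height \<open>y2\<close> the arc contributes
    \<open>4 * M * 3 * y2 / (R / 2) = M / 48\<close>, half of the lower bound \<open>M / 24\<close>
    at \<open>y1\<close>.\<close>
  define y1 y2 where "y1 = R / 24" and "y2 = R / 1152"
  have y: "0 < y1" "0 < y2" using R by (auto simp: y1_def y2_def)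
  have "y1 / R * M \<le> height V n (Complex E0 y1)"
    unfolding M(1) by (rule height_vertical[OF n]) (use R in \<open>auto simp: y1_def\<close>)
  then have h1: "M / 24 \<le> height V n (Complex E0 y1)" using R by (simp add: y1_def)
  have "y2 / R * M \<le> height V n (Complex E0 y2)"
    unfolding M(1) by (rule height_vertical[OF n]) (use R in \<open>auto simp: y2_def\<close>)
  then have h2: "M / 1152 \<le> height V n (Complex E0 y2)" using R by (simp add: y2_def)
  have L1: "M / 24 - 1 \<le> L y1" using low[OF y(1)] h1 M(2) by linarith
  have L20: "0 \<le> L y2" using low[OF y(2)] h2 M(2) by linarith
  have \<eta>0: "0 \<le> \<eta>" using line[of E0] R by (smt (verit) abs_ge_zero abs_le_zero_iff divide_pos_pos ln_ge_zero)
  have "height V n (Complex E0 y2) \<le> M / 48 + \<eta>"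
  proof -
    define \<rho> where "\<rho> = R / 2"
    define m :: "complex \<Rightarrow> complex" where "m = (\<lambda>z. of_real (4 * M) * (- 3 * \<i> * (z - of_real E0) / of_real \<rho> + (z - of_real E0)^2 / of_real (\<rho>^2)) + of_real \<eta>)"
    have \<rho>: "0 < \<rho>" using R by (simp add: \<rho>_def)
    have rr: "Re (of_real r * z) = r * Re z" for r z by simp
    have Rem: "Re (m (Complex x y)) = 4 * M * (3 * y / \<rho> + ((x - E0)^2 - y^2) / \<rho>^2) + \<eta>" for x y
    proof -
      have e: "Re (- 3 * \<i> * (Complex x y - of_real E0) / of_real \<rho>) = 3 * y / \<rho>"
        by (simp add: Re_divide_of_real)
      have e2: "Re ((Complex x y - of_real E0)^2 / of_real (\<rho>^2)) = ((x - E0)^2 - y^2) / \<rho>^2"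
        by (subst Re_divide_of_real) (simp add: Re_power2)
      show ?thesis unfolding m_def by (simp only: plus_complex.sel Re_complex_of_real rr e e2)
    qed
    have "height V n (Complex E0 y2) \<le> Re (m (Complex E0 y2))"
    proof (rule height_majorant[OF n \<rho>, of 1])
      show "m holomorphic_on {z. - 1 < Im z}"
        unfolding m_def by (intro holomorphic_intros) (use \<rho> in auto)
      show "ln (\<bar>X t n\<bar> + 1) \<le> Re (m (of_real t))" if t: "\<bar>t - E0\<bar> \<le> \<rho>" for t
      proof -
        have "Re (m (of_real t)) = 4 * M * ((t - E0)^2 / \<rho>^2) + \<eta>" using Rem[of t 0] by (simp add: complex_of_real_def)
        moreover have "0 \<le> 4 * M * ((t - E0)^2 / \<rho>^2)" using M(2) by (intro mult_nonneg_nonneg) auto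
        moreover have "ln (\<bar>X t n\<bar> + 1) \<le> \<eta>" using line[of t] t by (simp add: \<rho>_def)
        ultimately show ?thesis by linarith
      qed
      show "height V n z \<le> Re (m z)" if z: "0 < Im z" "cmod (z - of_real E0) = \<rho>" for z
      proof -
        have "(Re z - E0)^2 + (Im z)^2 = (cmod (z - of_real E0))^2" by (simp add: cmod_power2)
        then have "1 \<le> 3 * Im z / \<rho> + ((Re z - E0)^2 - (Im z)^2) / \<rho>^2"
          unfolding z(2) by (rule parabola_arc[OF z(1) _ \<rho>])
        then have "4 * M * 1 \<le> 4 * M * (3 * Im z / \<rho> + ((Re z - E0)^2 - (Im z)^2) / \<rho>^2)"
          using M(2) by (intro mult_left_mono) auto
        moreover have "Re (m z) = 4 * M * (3 * Im z / \<rho> + ((Re z - E0)^2 - (Im z)^2) / \<rho>^2) + \<eta>"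
          using Rem[of "Re z" "Im z"] by simp
        moreover have "height V n z \<le> 4 * M"
        proof -
          have "\<bar>Re z - E0\<bar> \<le> R" using abs_Re_le_cmod[of "z - of_real E0"] z R by (simp add: \<rho>_def)
          then have h3: "height V n (Complex (Re z) R) \<le> 3 * M"
            using height_horizontal[OF n R, of "Re z - E0" V E0] by (simp add: M(1))
          have "Im z \<le> R" using abs_Im_le_cmod[of "z - of_real E0"] z R by (simp add: \<rho>_def)
          then have "ln (cmod (trace_seq V (Complex (Re z) (Im z)) n) + 1) \<le> height V n (Complex (Re z) R) + 2"
            by (intro ln_trace_le_height[OF n]) (use z R in auto)
          then show ?thesis using height_bounds(2)[OF n z(1), of V] h3 M(2) by simp
        qed
        ultimately show ?thesis using \<eta>0 by linarith
      qed
      have "Complex E0 y2 - of_real E0 = \<i> * of_real y2" by (simp add: complex_eq_iff)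
      then have "cmod (Complex E0 y2 - of_real E0) = y2" using y(2) by (simp add: norm_mult)
      then show "cmod (Complex E0 y2 - of_real E0) \<le> \<rho>" using R by (simp add: \<rho>_def y2_def)
    qed (use y in auto)
    also have "\<dots> \<le> 4 * M * (3 * y2 / \<rho>) + \<eta>"
      unfolding Rem using M(2) by (intro add_right_mono mult_left_mono) auto
    also have "\<dots> = M / 48 + \<eta>" using R by (simp add: \<rho>_def y2_def)
    finally show ?thesis .
  qed
  then have L2: "L y2 \<le> 1 + M / 48 + \<eta>" using up[OF y(2) posn[OF y(2)]] by linarith
  have L3: "L R \<le> 1 + M" using up[OF R posn[OF R]] by (simp add: M(1))
  \<comment> \<open>A zero outside the interval changes the sum between \<open>y2\<close> and
    \<open>y1\<close> by at most \<open>w z / 1152\<close>, but between \<open>y2\<close> and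
    \<open>R\<close> by at least \<open>0.09 * w z\<close>. The latter bounds the total weight by
    \<open>12 * M\<close>, so the former is at most \<open>M / 96\<close>.\<close>
  define w where "w = (\<lambda>z. if P z then 0 else R^2 / (E0 - z)^2)"
  define T where "T = (\<Sum>z\<leftarrow>zs. w z)"
  have outside: "R^2 \<le> 4 * (E0 - z)^2" "0 < (E0 - z)^2" if "\<not> P z" for z
  proof -
    have "z \<le> E0 - R / 2 \<or> E0 + R / 2 < z" using that by (auto simp: P_def not_less not_le)
    then have "R / 2 \<le> \<bar>E0 - z\<bar>" by (elim disjE) linarith+
    then have "(R / 2)^2 \<le> \<bar>E0 - z\<bar>^2" using R by (intro power_mono) auto
    then have l: "(R / 2)^2 \<le> (E0 - z)^2" by simp
    then show "R^2 \<le> 4 * (E0 - z)^2" by (simp add: power_divide)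
    have "0 < (R / 2)^2" using R by simp
    then show "0 < (E0 - z)^2" using l by linarith
  qed
  have t1: "0.09 * w z \<le> ln ((E0 - z)^2 + R^2) / 2 - ln ((E0 - z)^2 + y2^2) / 2" for z
  proof -
    define A B where "A = (E0 - z)^2 + R^2" and "B = (E0 - z)^2 + y2^2"
    have "0 < R^2" "0 < y2^2" using R y by auto
    then have AB: "0 < B" "0 < A" by (simp_all add: A_def B_def add_nonneg_pos)
    have "ln (B / A) \<le> B / A - 1" using AB by (intro ln_le_minus_one) simp
    then have lnAB: "1 - B / A \<le> ln A - ln B" using AB by (simp add: ln_div)
    have y2R: "y2^2 \<le> R^2 / 100" using R by (simp add: y2_def power_divide)
    have "B \<le> A" using y2R \<open>0 < R^2\<close> unfolding A_def B_def by linarith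
    then have "B / A \<le> 1" using AB by simp
    show ?thesis
    proof (cases "P z")
      case True
      then show ?thesis using lnAB \<open>B / A \<le> 1\<close> by (simp add: w_def A_def[symmetric] B_def[symmetric])
    next
      case False
      define D where "D = (E0 - z)^2"
      have D: "R^2 \<le> 4 * D" "0 < D" using outside[OF False] by (auto simp: D_def)
      have AD: "A \<le> 5 * D" using D by (simp add: A_def D_def)
      have "0.18 * (R^2 / D) * A \<le> 0.18 * (R^2 / D) * (5 * D)"
        using AD D by (intro mult_left_mono) auto
      also have "\<dots> = 0.9 * R^2" using D by simp
      also have "\<dots> \<le> A - B" using y2R \<open>0 < R^2\<close> unfolding A_def B_def by linarith
      finally have "0.18 * (R^2 / D) \<le> (A - B) / A" using AB by (simp add: pos_le_divide_eq)
      also have "\<dots> = 1 - B / A" using AB by (simp add: diff_divide_distrib)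
      finally have "0.18 * (R^2 / D) \<le> ln A - ln B" using lnAB by linarith
      moreover have wz: "w z = R^2 / D" using False by (simp add: w_def D_def)
      ultimately show ?thesis unfolding A_def[symmetric] B_def[symmetric] wz by linarith
    qed
  qed
  have "0.09 * T \<le> (\<Sum>z\<leftarrow>zs. ln ((E0 - z)^2 + R^2) / 2 - ln ((E0 - z)^2 + y2^2) / 2)"
    unfolding T_def sum_list_const_mult[symmetric] by (rule sum_list_mono) (rule t1)
  also have "\<dots> = L R - L y2" using sum R y by (simp add: sum_list_subtractf)
  finally have T12: "T \<le> 12 * M" using L3 L20 M(2) by simp
  have t2: "ln ((E0 - z)^2 + y1^2) / 2 - ln ((E0 - z)^2 + y2^2) / 2 \<le> (if P z then 5 else 0) + w z / 1152" for z
  proof -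
    define A B where "A = (E0 - z)^2 + y1^2" and "B = (E0 - z)^2 + y2^2"
    have "0 < y1^2" "0 < y2^2" using y by auto
    then have AB: "0 < B" "0 < A" by (simp_all add: A_def B_def add_nonneg_pos)
    show ?thesis
    proof (cases "P z")
      case True
      have "A \<le> 48^2 * B" using zero_le_power2[of "E0 - z"] by (simp add: A_def B_def y1_def y2_def power_divide)
      also have "48^2 * B \<le> exp 10 * B"
      proof (intro mult_right_mono)
        have "5 / 2 \<le> exp (1 :: real)" using exp_lower_Taylor_quadratic[of 1] by simp
        then have "(5 / 2) ^ 10 \<le> exp (1 :: real) ^ 10" by (intro power_mono) auto
        also have "\<dots> = exp 10" by (simp flip: exp_of_nat_mult)
        finally show "48^2 \<le> exp (10 :: real)" by (simp add: power_divide)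
      qed (use AB in simp)
      finally have "ln A \<le> ln (exp 10 * B)" using AB by (subst ln_le_cancel_iff) auto
      then have "ln A \<le> 10 + ln B" using AB by (simp add: ln_mult_pos)
      then show ?thesis using True by (simp add: w_def A_def[symmetric] B_def[symmetric])
    next
      case False
      define D where "D = (E0 - z)^2"
      have D: "0 < D" using outside[OF False] by (auto simp: D_def)
      have "ln (A / B) \<le> A / B - 1" using AB by (intro ln_le_minus_one) simp
      then have "ln A - ln B \<le> (A - B) / B" using AB by (simp add: ln_div diff_divide_distrib)
      also have "\<dots> \<le> y1^2 / D" using D by (intro frac_le) (auto simp: A_def B_def D_def)
      also have "\<dots> = R^2 / D / 576" by (simp add: y1_def power_divide)
      finally have "ln A - ln B \<le> R^2 / D / 576" .
      moreover have wz: "w z = R^2 / D" using False by (simp add: w_def D_def)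
      ultimately show ?thesis using False unfolding A_def[symmetric] B_def[symmetric] wz by simp
    qed
  qed
  have "L y1 - L y2 = (\<Sum>z\<leftarrow>zs. ln ((E0 - z)^2 + y1^2) / 2 - ln ((E0 - z)^2 + y2^2) / 2)"
    using sum y by (simp add: sum_list_subtractf)
  also have "\<dots> \<le> (\<Sum>z\<leftarrow>zs. (if P z then 5 else 0) + w z / 1152)" by (rule sum_list_mono) (rule t2)
  also have "\<dots> = 5 * length (filter P zs) + T / 1152"
    using sum_list_const_mult[of "1 / 1152" w zs] by (simp add: sum_list_addf sum_list_indicator T_def)
  finally have "L y1 - L y2 \<le> 5 * length (filter P zs) + T / 1152" .
  then have "M / 1000 \<le> length (filter P zs)" using L1 L2 T12 \<eta> M(2) by linarith
  then show ?thesis by (simp add: P_def zs_def)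
qed

end

section \<open>Large gaps in every interval\<close>

context coupling
begin

text \<open>At a double zero the derivative of the trace would vanish, against
  \<open>elliptic_twist\<close>.\<close>

lemma distinct_zeros:
  assumes n: "1 \<le> n"
  shows "distinct (zeros V n)"
proof (rule ccontr)
  assume "\<not> ?thesis"
  then obtain xs ys zs z where split: "zeros V n = xs @ [z] @ ys @ [z] @ zs"
    using not_distinct_decomp by blast
  define G where "G = (\<lambda>E. \<Prod>r\<leftarrow>xs @ ys @ zs. E - r)"
  have prod: "X E n = (E - z) * G E * (E - z)" for E
    using band_points_real[OF n, of 0 V E] split by (simp add: zeros_def G_def mult_ac)
  have contG: "isCont (\<lambda>E. \<Prod>r\<leftarrow>rs. E - r) z" for rs :: "real list"
    by (induction rs) (auto intro!: continuous_intros)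
  have "((\<lambda>E. X E n) has_real_derivative 0) (at z)"
    unfolding CARAT_DERIV
  proof (intro exI conjI)
    show "\<forall>E. X E n - X z n = (E - z) * G E * (E - z)" by (simp add: prod)
    show "isCont (\<lambda>E. (E - z) * G E) z" unfolding G_def by (intro continuous_intros contG)
  qed simp
  then have "trace_deriv V z n = 0" using DERIV_unique[OF trace_seq_has_derivative] by blast
  then show False using elliptic_twist[OF n, of V z] prod[of z] by simp
qed

text \<open>The coarse recursion has an error of 2 at each end point, 4 in total. Adding 4 to the
  counts makes them Fibonacci-subadditive, and the two seeds become at most 5.\<close>

lemma zcount_fib_bound:
  assumes l: "zcount V j s t \<le> 1" "zcount V (j + 1) s t \<le> 1"
  shows "zcount V (j + k) s t \<le> 5 * fib (k + 1)"
proof -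
  define z where "z = (\<lambda>j. zcount V j s t)"
  have step: "z (i + 2) \<le> z (i + 1) + z i + 4" for i
  proof -
    define A B where "A = (\<lambda>i. int (above (zeros V i) (min s t)))" and "B = (\<lambda>i. int (above (zeros V i) (max s t)))"
    have "above (zeros V i) (max s t) \<le> above (zeros V i) (min s t)" for i
      by (intro above_antimono) simp
    then have zi: "int (z i) = A i - B i" for i by (simp add: z_def zcount_def A_def B_def of_nat_diff)
    have "\<bar>A (i + 2) - A (i + 1) - A i\<bar> \<le> 2" "\<bar>B (i + 2) - B (i + 1) - B i\<bar> \<le> 2"
      using above_fib_coarse[of V i "min s t"] above_fib_coarse[of V i "max s t"] by (simp_all only: A_def B_def)
    then have "int (z (i + 2)) \<le> int (z (i + 1)) + int (z i) + 4" unfolding zi by linarith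
    then show ?thesis by simp
  qed
  have "z (j + k) + 4 \<le> 5 * fib (k + 1) \<and> z (j + k + 1) + 4 \<le> 5 * fib (k + 2)"
  proof (induction k)
    case 0
    then show ?case using l by (simp add: z_def numeral_eq_Suc)
  next
    case (Suc k)
    have "fib (Suc k + 2) = fib (k + 2) + fib (k + 1)" by (simp add: numeral_eq_Suc)
    then show ?case using Suc step[of "j + k"] by (simp add: numeral_eq_Suc)
  qed
  then show ?thesis by (simp add: z_def)
qed

lemma fib_add_bound: "1 \<le> a \<Longrightarrow> fib (a + b) \<le> fib a * fib (b + 2)"
proof -
  assume "1 \<le> a"
  then obtain a' where a: "a = Suc a'" by (cases a) auto
  have "fib (a + b) = fib (Suc b) * fib (Suc a') + fib b * fib a'"
    using fib_add[of a' b] by (simp add: a add.commute)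
  also have "\<dots> \<le> fib (Suc b) * fib (Suc a') + fib b * fib (Suc a')"
    using fib_Suc_mono[of a'] by (intro add_left_mono mult_left_mono) auto
  also have "\<dots> = fib a * fib (b + 2)" by (simp add: a algebra_simps)
  finally show ?thesis .
qed

text \<open>For the least such \<open>i\<close> the preceding Fibonacci number is below
  \<open>5 / sqrt V\<close>, and nine further steps at most double it each time; 2560 is
  \<open>5 * 2^9\<close>.\<close>

lemma fib_window_exists: "\<exists>i. 5 / sqrt V \<le> fib i \<and> fib (i + 8) \<le> 2560 / sqrt V"
proof -
  define P where "P = (\<lambda>i. 5 / sqrt V \<le> fib i)"
  have "P (nat \<lceil>5 / sqrt V\<rceil> + 1)"
  proof -
    have "5 / sqrt V \<le> real (nat \<lceil>5 / sqrt V\<rceil>)" by linarith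
    also have "\<dots> \<le> fib (nat \<lceil>5 / sqrt V\<rceil> + 1)" using le_fib_Suc by simp
    finally show ?thesis by (simp add: P_def)
  qed
  then have Pi: "P (LEAST i. P i)" by (rule LeastI)
  define i where "i = (LEAST i. P i)"
  have Pi: "P i" using Pi by (simp add: i_def)
  have big: "10 < 5 / sqrt V" using sqrt_V by (simp add: less_divide_eq)
  have i2: "2 \<le> i"
  proof (rule ccontr)
    assume "\<not> ?thesis"
    then have "i = 0 \<or> i = 1" by auto
    then have "real (fib i) \<le> 1" by auto
    then show False using Pi big unfolding P_def by linarith
  qed
  obtain j where j: "i = Suc (Suc j)" using i2 by (metis add_2_eq_Suc le_Suc_ex)
  have "\<not> P (Suc j)" using not_less_Least[of "Suc j" P] j by (simp add: i_def[symmetric])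
  then have less: "fib (Suc j) < 5 / sqrt V" by (simp add: P_def)
  have dbl: "fib (Suc (Suc m)) \<le> 2 * fib (Suc m)" for m using fib_Suc_mono[of m] by simp
  have pow: "fib (Suc j + m) \<le> 2 ^ m * fib (Suc j)" for m
  proof (induction m)
    case (Suc m)
    have "fib (Suc j + Suc m) \<le> 2 * fib (Suc j + m)" using dbl[of "j + m"] by simp
    then show ?case using Suc by simp
  qed simp
  have "fib (i + 8) \<le> 2 ^ 9 * fib (Suc j)" using pow[of 9] by (simp add: j add.commute)
  then have "real (fib (i + 8)) \<le> 512 * fib (Suc j)" by (simp flip: of_nat_mult of_nat_le_iff)
  also have "\<dots> \<le> 512 * (5 / sqrt V)" using less by simp
  finally show ?thesis using Pi by (auto simp: P_def)
qed

text \<open>At height 10 each of the \<open>fib n\<close> zeros contributes at least 1 to the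
  logarithmic sum, and \<open>height_vertical\<close> carries the bound down to height
  \<open>R\<close>.\<close>

lemma height_tends_to_infinity:
  assumes R: "0 < R" "R \<le> 3"
  shows "R / 10 * fib n - 1 \<le> height V n (Complex E0 R) \<or> n = 0"
proof (cases "n = 0")
  case False
  then have n: "1 \<le> n" by simp
  have "ln (cmod (trace_seq V (Complex E0 10) n)) = (\<Sum>z\<leftarrow>zeros V n. ln ((E0 - z)^2 + 10^2) / 2)"
    by (rule ln_norm_trace_seq[OF n]) (simp add: add_nonneg_pos)
  also have "\<dots> \<ge> (\<Sum>z\<leftarrow>zeros V n. 1)"
  proof (rule sum_list_mono)
    fix z
    have "exp 2 \<le> (9::real)"
    proof -
      have "exp (1::real) \<le> 3" using exp_le by simp
      then have "exp 1 * exp 1 \<le> 3 * (3::real)" by (intro mult_mono) auto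
      then show ?thesis by (simp flip: exp_add)
    qed
    also have "9 \<le> (E0 - z)^2 + 10^2" by (rule order_trans[of _ "10^2"]) auto
    finally have "2 \<le> ln ((E0 - z)^2 + 10^2)" by (subst ln_ge_iff) (auto intro: add_nonneg_pos)
    then show "1 \<le> ln ((E0 - z)^2 + 10^2) / 2" by simp
  qed
  also have "(\<Sum>z\<leftarrow>zeros V n. 1 :: real) = fib n"
    using sum_list_triv[of "1 :: real" "zeros V n"] by (simp add: zeros_def length_band_points)
  finally have f: "fib n \<le> ln (cmod (trace_seq V (Complex E0 10) n))" .
  have posn: "0 < cmod (trace_seq V (Complex E0 10) n)"
    using trace_seq_not_in_band[of "Complex E0 10" n 0 V] n by simp
  have "ln (cmod (trace_seq V (Complex E0 10) n)) \<le> ln (2 * exp (height V n (Complex E0 10)))"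
    using height_bounds(3)[OF n, of "Complex E0 10" V] posn by (subst ln_le_cancel_iff) auto
  also have "\<dots> = ln 2 + height V n (Complex E0 10)" by (simp add: ln_mult_pos)
  finally have h: "real (fib n) - 1 \<le> height V n (Complex E0 10)" using f ln_le_minus_one[of 2] by simp
  have "R / 10 * (real (fib n) - 1) \<le> R / 10 * height V n (Complex E0 10)" using h R by (intro mult_left_mono) auto
  also have "\<dots> \<le> height V n (Complex E0 R)" by (rule height_vertical[OF n]) (use R in auto)
  finally have "R / 10 * (real (fib n) - 1) \<le> height V n (Complex E0 R)" .
  moreover have "R / 10 * (real (fib n) - 1) = R / 10 * fib n - R / 10" by (simp only: right_diff_distrib mult_1_right)
  ultimately show ?thesis using R by linarith
qed simp

text \<open>If there were no such gap, \<open>growth_in_dense_interval\<close> and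
  \<open>zeros_in_interval\<close> would bound all growth in the middle half of the interval by a
  tiny multiple of \<open>V\<close> times the number of zeros there. The escape produced from the
  first two zeros exceeds this bound.\<close>

theorem large_gap_in_interval:
  assumes V7: "V \<le> 1 / 10^7" and R: "0 < R"
    and hull: "p \<in> trapped V" "p \<le> E0 - R" "q \<in> trapped V" "E0 + R \<le> q"
  shows "\<exists>a b. a \<in> trapped V \<and> b \<in> trapped V \<and> a < b \<and> {a<..<b} \<inter> trapped V = {} \<and>
    V / 10^12 * R < min b (E0 + R) - max a (E0 - R)"
proof (rule ccontr)
  assume none: "\<not> ?thesis"
  \<comment> \<open>The power \<open>10^12\<close> makes the final constant
    \<open>6000 * 5000 * 2560 / 10^12\<close> smaller than 1/2, while the growth of the escape has
    the factor \<open>sqrt (V / 2)\<close>.\<close>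
  define \<delta> where "\<delta> = V / 10^12"
  have \<delta>: "0 < \<delta>" "\<delta> \<le> 1 / 10^12" using V_pos V_small by (auto simp: \<delta>_def)
  have dense: "min b (E0 + R) - max a (E0 - R) \<le> \<delta> * R"
    if "a \<in> trapped V" "b \<in> trapped V" "a < b" "{a<..<b} \<inter> trapped V = {}" for a b
    using none that unfolding \<delta>_def not_ex not_le by (meson not_le)
  have R3: "R \<le> 3" using trapped_bounds[OF hull(1)] trapped_bounds[OF hull(3)] hull by linarith
  define M where "M = (\<lambda>n. height V n (Complex E0 R))"
  define e1 e2 where "e1 = E0 - R / 2" and "e2 = E0 + R / 2"
  have e12: "e1 \<le> e2" using R by (simp add: e1_def e2_def)
  define B where "B = 2000 + 1 / \<delta>"
  define n0 where "n0 = nat \<lceil>10 / R * (B + 1)\<rceil> + 1"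
  have B: "2000 \<le> B" using \<delta> by (simp add: B_def)
  have Mbig: "B \<le> M n" if "n0 \<le> n" for n
  proof -
    have n: "n \<noteq> 0" using that by (auto simp: n0_def)
    have "10 / R * (B + 1) \<le> real (n - 1)" using that unfolding n0_def by linarith
    also have "\<dots> \<le> fib n" using le_fib_Suc[of "n - 1"] n by simp
    finally have "R / 10 * (10 / R * (B + 1)) \<le> R / 10 * fib n" using R by (intro mult_left_mono) auto
    then have "B + 1 \<le> R / 10 * fib n" using R by simp
    then show ?thesis using height_tends_to_infinity[OF R R3, of n E0] n by (simp add: M_def)
  qed
  have growth: "ln (\<bar>X t n\<bar> + 1) \<le> 6000 * M n * \<delta>" if "n0 \<le> n" "\<bar>t - E0\<bar> \<le> R / 2" for t n
  proof (rule growth_in_dense_interval[OF V7 _ R hull dense M_def[THEN fun_cong] _ _ that(2)])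
    show "1 \<le> n" using that by (simp add: n0_def)
    show "2 \<le> M n" using Mbig[OF that(1)] B by simp
    have "1 = 1 / \<delta> * \<delta>" using \<delta> by simp
    also have "\<dots> \<le> M n * \<delta>" using Mbig[OF that(1)] \<delta> by (intro mult_right_mono) (auto simp: B_def)
    finally show "1 \<le> M n * \<delta>" .
  qed
  have zeros: "M n / 1000 \<le> zcount V n e1 e2" if "n0 \<le> n" for n
  proof -
    have "M n / 1000 \<le> length (filter (\<lambda>z. E0 - R / 2 < z \<and> z \<le> E0 + R / 2) (zeros V n))"
    proof (rule zeros_in_interval[OF _ R])
      show "1 \<le> n" using that by (simp add: n0_def)
      show "M n = height V n (Complex E0 R)" by (simp add: M_def)
      show M2: "2000 \<le> M n" using Mbig[OF that] B by simp
      show "ln (\<bar>X t n\<bar> + 1) \<le> 6000 * M n * \<delta>" if "\<bar>t - E0\<bar> \<le> R / 2" for t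
        by (rule growth[OF \<open>n0 \<le> n\<close> that])
      have "M n * \<delta> \<le> M n * (1 / 10^12)" using \<delta> M2 by (intro mult_left_mono) auto
      then show "6000 * M n * \<delta> \<le> M n / 400" using M2 by simp
    qed
    then show ?thesis using zcount_filter[OF e12, of V n] by (simp add: e1_def e2_def)
  qed
  define Z where "Z = (\<lambda>j. zcount V j e1 e2)"
  have "2 \<le> Z n0" using zeros[of n0] Mbig[of n0] B by (simp add: Z_def)
  then have Zl: "2 \<le> Z (LEAST j. 2 \<le> Z j)" by (rule LeastI)
  \<comment> \<open>Minimality is used twice: level \<open>l\<close> supplies two zeros to walk
    between, and at most one zero at each of the two preceding levels bounds all later counts by
    \<open>zcount_fib_bound\<close>.\<close>
  define l where "l = (LEAST j. 2 \<le> Z j)"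
  have Zl: "2 \<le> Z l" using Zl by (simp add: l_def)
  have Zless: "Z j \<le> 1" if "j < l" for j using not_less_Least[of j "\<lambda>j. 2 \<le> Z j"] that by (simp add: l_def)
  have Zfib: "Z j \<le> fib j" for j
  proof -
    have "Z j = length (filter (\<lambda>z. e1 < z \<and> z \<le> e2) (zeros V j))" using zcount_filter[OF e12] by (simp add: Z_def)
    also have "\<dots> \<le> length (zeros V j)" by simp
    also have "\<dots> = fib j" by (simp add: zeros_def length_band_points)
    finally show ?thesis .
  qed
  have l3: "3 \<le> l"
  proof (rule ccontr)
    assume "\<not> ?thesis"
    then have "l = 0 \<or> l = 1 \<or> l = 2" by auto
    then show False using Zl Zfib[of l] by (auto simp: numeral_2_eq_2)
  qed
  define k where "k = l - 2"
  have k: "l = k + 2" "1 \<le> k" using l3 by (auto simp: k_def)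
  define zl where "zl = filter (\<lambda>z. e1 < z \<and> z \<le> e2) (zeros V l)"
  have zl: "distinct zl" "2 \<le> length zl"
    using distinct_zeros[of l] l3 Zl zcount_filter[OF e12, of V l] by (auto simp: zl_def Z_def)
  have "0 < length zl" "1 < length zl" using zl(2) by auto
  then have ne: "zl ! 0 \<noteq> zl ! 1" and mem: "zl ! 0 \<in> set zl" "zl ! 1 \<in> set zl"
    using nth_eq_iff_index_eq[OF zl(1)] by auto
  define z1 z2 where "z1 = min (zl ! 0) (zl ! 1)" and "z2 = max (zl ! 0) (zl ! 1)"
  have z12: "z1 < z2" "z1 \<in> set zl" "z2 \<in> set zl" using ne mem by (auto simp: z1_def z2_def min_def max_def)
  then have z: "X z1 l = 0" "X z2 l = 0" "e1 < z1" "z2 \<le> e2"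
    using trace_zero_iff[of l V] l3 by (auto simp: zl_def)
  obtain i where i: "5 / sqrt V \<le> fib i" "fib (i + 8) \<le> 2560 / sqrt V" using fib_window_exists by blast
  obtain E m where E: "E \<in> {z1..z2}" "1 \<le> m" "m \<le> l + i + 2" "2 \<le> \<bar>X E m\<bar>" "2 \<le> \<bar>X E (m + 1)\<bar>"
  proof -
    have "\<exists>E\<in>{z1..z2}. \<exists>m. 1 \<le> m \<and> m \<le> (k + 1) + i + 3 \<and> 2 \<le> \<bar>X E m\<bar> \<and> 2 \<le> \<bar>X E (m + 1)\<bar>"
      by (rule escape_between_zeros[OF _ z12(1) _ _ i(1)]) (use z k in \<open>auto simp: numeral_2_eq_2\<close>)
    then show thesis using that k by fastforce
  qed
  have EJ: "\<bar>E - E0\<bar> \<le> R / 2" using E(1) z(3,4) unfolding e1_def e2_def atLeastAtMost_iff by linarith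
  define a where "a = n0 + 1"
  define n where "n = a + (l + i + 3)"
  have n: "n0 \<le> n" "m + 2 \<le> n" using E(3) by (auto simp: n_def a_def)
  have "sqrt (V / 2) * fib a \<le> sqrt (V / 2) * fib (n - m - 1)"
    using E(3) V_pos by (intro mult_left_mono) (auto intro!: fib_mono simp: n_def)
  also have "\<dots> \<le> ln \<bar>X E n\<bar>" by (rule weak_escape_growth(1)[OF E(2,4,5) n(2)])
  also have "\<dots> \<le> ln (\<bar>X E n\<bar> + 1)"
    using weak_escape_growth(2)[OF E(2,4,5) n(2)] V_pos by (subst ln_le_cancel_iff) auto
  also have "\<dots> \<le> 6000 * M n * \<delta>" by (rule growth[OF n(1) EJ])
  also have "\<dots> \<le> 6000 * (5000 * (fib a * (2560 / sqrt V))) * \<delta>"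
  proof (intro mult_right_mono mult_left_mono)
    have "Z n \<le> 5 * fib (a + i + 6)"
    proof -
      have "zcount V (k + (a + i + 5)) e1 e2 \<le> 5 * fib (a + i + 5 + 1)"
        by (rule zcount_fib_bound) (use Zless[of k] Zless[of "k + 1"] k in \<open>auto simp: Z_def\<close>)
      then show ?thesis by (simp add: Z_def n_def k algebra_simps numeral_eq_Suc)
    qed
    also have "\<dots> \<le> 5 * (fib a * fib (i + 8))" using fib_add_bound[of a "i + 6"] by (simp add: a_def add_ac)
    finally have "real (Z n) \<le> real (5 * (fib a * fib (i + 8)))" by (simp only: of_nat_le_iff)
    also have "\<dots> = 5 * (real (fib a) * real (fib (i + 8)))" by simp
    also have "\<dots> \<le> 5 * (fib a * (2560 / sqrt V))" using i(2) by (intro mult_left_mono) auto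
    finally have "real (Z n) \<le> 5 * (fib a * (2560 / sqrt V))" .
    then show "M n \<le> 5000 * (fib a * (2560 / sqrt V))" using zeros[OF n(1)] by (simp add: Z_def)
  qed (use \<delta> in auto)
  also have "\<dots> = (6000 * 5000 * 2560 / 10^12) * (V / sqrt V) * fib a" by (simp add: \<delta>_def)
  also have "V / sqrt V = sqrt V" using V_pos by (simp add: real_div_sqrt)
  finally have "(sqrt (V / 2)) * fib a \<le> (6000 * 5000 * 2560 / 10^12 * sqrt V) * fib a" .
  moreover have "0 < real (fib a)" using fib_neq_0_nat[of a] by (simp add: a_def)
  ultimately have "sqrt (V / 2) \<le> 6000 * 5000 * 2560 / 10^12 * sqrt V" by (simp only: mult_le_cancel_right_pos)
  also have "\<dots> \<le> 1 / 2 * sqrt V" using sqrt_V by simp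
  finally have "sqrt (V / 2) \<le> 1 / 2 * sqrt V" .
  then have "(sqrt (V / 2))^2 \<le> (1 / 2 * sqrt V)^2" using V_pos by (intro power_mono) auto
  then show False using V_pos by (simp add: power_mult_distrib power_divide)
qed

end

subsection \<open>Thickness and denseness of sets with balanced gaps\<close>

definition is_gap :: "real set \<Rightarrow> real \<Rightarrow> real \<Rightarrow> bool" where
  "is_gap C a b \<longleftrightarrow> a \<in> C \<and> b \<in> C \<and> a < b \<and> {a<..<b} \<inter> C = {}"

text \<open>A greedy enumeration by a largest remaining element. Finiteness of the size levels
  provides the maxima, and it also ensures that every element is chosen: otherwise infinitely many
  chosen ones would be at least as large.\<close>

lemma order_by_size:
  fixes f :: "'a \<Rightarrow> real"
  assumes inf: "infinite A" and pos: "\<And>x. x \<in> A \<Longrightarrow> 0 < f x" and fin: "\<And>r. 0 < r \<Longrightarrow> finite {x \<in> A. r \<le> f x}"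
  shows "\<exists>U. bij_betw U {1..} A \<and> (\<forall>i j. 1 \<le> i \<longrightarrow> i \<le> (j :: nat) \<longrightarrow> f (U j) \<le> f (U i))"
proof -
  define best where "best = (\<lambda>F x. x \<in> A - F \<and> (\<forall>y\<in>A - F. f y \<le> f x))"
  have ex: "\<exists>x. best F x" if F: "finite F" for F
  proof -
    have "A - F \<noteq> {}" using inf F by (metis finite.emptyI infinite_super Diff_eq_empty_iff finite_subset)
    then obtain y where y: "y \<in> A - F" by blast
    define B where "B = {x \<in> A. f y \<le> f x} - F"
    have B: "finite B" "y \<in> B" using fin[OF pos[of y]] y by (auto simp: B_def)
    have "Max (f ` B) \<in> f ` B" using B by (intro Max_in) auto
    then obtain x where x: "x \<in> B" "f x = Max (f ` B)" by auto
    have "f z \<le> f x" if "z \<in> A - F" for z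
    proof (cases "f y \<le> f z")
      case True
      then have "z \<in> B" using that by (simp add: B_def)
      then show ?thesis using B x(2) by simp
    next
      case False
      moreover have "f y \<le> f x" using x(1) by (simp add: B_def)
      ultimately show ?thesis by linarith
    qed
    then show ?thesis using x(1) by (auto simp: best_def B_def)
  qed
  define pick where "pick = (\<lambda>F. SOME x. best F x)"
  have pick: "best F (pick F)" if "finite F" for F
    unfolding pick_def by (rule someI_ex[OF ex[OF that]])
  define S where "S = rec_nat {} (\<lambda>_ F. insert (pick F) F)"
  have S0: "S 0 = {}" and SS: "S (Suc n) = insert (pick (S n)) (S n)" for n by (simp_all add: S_def)
  have finS: "finite (S n)" for n by (induction n) (simp_all add: S0 SS)
  have SA: "S n \<subseteq> A" for n
  proof (induction n)
    case (Suc n)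
    then show ?case using pick[OF finS[of n]] by (auto simp: SS best_def)
  qed (simp add: S0)
  have mono: "S m \<subseteq> S n" if "m \<le> n" for m n
    using that by (induction n) (auto simp: SS le_Suc_eq)
  define W where "W = (\<lambda>n. pick (S n))"
  have WA: "W n \<in> A - S n" for n using pick[OF finS[of n]] by (simp add: W_def best_def)
  have WS: "W m \<in> S n" if "m < n" for m n using mono[of "Suc m" n] that by (auto simp: W_def SS)
  have dec: "f (W n) \<le> f (W m)" if "m \<le> n" for m n
  proof -
    have "W n \<in> A - S m" using WA[of n] mono[OF that] by blast
    then show ?thesis using pick[OF finS[of m]] unfolding best_def W_def by blast
  qed
  have inj: "inj W"
  proof (rule linorder_injI)
    fix m n :: nat assume "m < n"
    then show "W m \<noteq> W n" using WS[of m n] WA[of n] by auto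
  qed
  have surj: "range W = A"
  proof
    show "range W \<subseteq> A" using WA by auto
    show "A \<subseteq> range W"
    proof
      fix x assume x: "x \<in> A"
      show "x \<in> range W"
      proof (rule ccontr)
        assume no: "x \<notin> range W"
        have "x \<notin> S n" for n
        proof (induction n)
          case (Suc n)
          have "x \<noteq> pick (S n)" using no by (auto simp: W_def)
          then show ?case using Suc by (simp add: SS)
        qed (simp add: S0)
        then have "f x \<le> f (W n)" for n using pick[OF finS[of n]] x by (auto simp: best_def W_def)
        then have "range W \<subseteq> {y \<in> A. f x \<le> f y}" using WA by auto
        then have "finite (range W)" using fin[OF pos[OF x]] by (rule finite_subset)
        then show False using inj by (simp add: finite_image_iff)
      qed
    qed
  qed
  have "bij_betw (\<lambda>n. W (n - 1)) {1..} A"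
  proof -
    have "bij_betw (\<lambda>n :: nat. n - 1) {1..} UNIV" by (rule bij_betw_byWitness[of _ "\<lambda>n. n + 1"]) auto
    moreover have "bij_betw W UNIV A" using inj surj by (simp add: bij_betw_def)
    ultimately show ?thesis using bij_betw_trans by (fastforce simp: comp_def)
  qed
  then show ?thesis using dec by (intro exI[of _ "\<lambda>n. W (n - 1)"]) (auto intro: diff_le_mono)
qed

text \<open>When the gaps are removed in order of decreasing length, \<open>spacing\<close> and the
  two end conditions bound every bridge from below, and \<open>density\<close> bounds it from above.
  The length in \<open>density\<close> is that of the part of the gap inside the window.\<close>

locale balanced_gaps =
  fixes C :: "real set" and \<kappa> \<epsilon> :: real
  assumes compact: "compact C" and nondegenerate: "\<exists>p\<in>C. \<exists>q\<in>C. p < q"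
    and \<kappa>: "0 < \<kappa>" and \<epsilon>: "0 < \<epsilon>"
    and spacing: "\<And>a b a' b'. is_gap C a b \<Longrightarrow> is_gap C a' b' \<Longrightarrow> b \<le> a' \<Longrightarrow> min (b - a) (b' - a') \<le> \<kappa> * (a' - b)"
    and right_end: "\<And>a b. is_gap C a b \<Longrightarrow> b - a \<le> \<kappa> * (Sup C - b)"
    and left_end: "\<And>a b. is_gap C a b \<Longrightarrow> b - a \<le> \<kappa> * (a - Inf C)"
    and density: "\<And>E R p q. 0 < R \<Longrightarrow> p \<in> C \<Longrightarrow> p \<le> E - R \<Longrightarrow> q \<in> C \<Longrightarrow> E + R \<le> q \<Longrightarrow>
      \<exists>a b. is_gap C a b \<and> \<epsilon> * R < min b (E + R) - max a (E - R)"
begin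

lemma nonempty: "C \<noteq> {}" using nondegenerate by auto

lemma bdd: "bdd_above C" "bdd_below C"
  using compact_imp_bounded[OF compact] by (auto intro: bounded_imp_bdd_above bounded_imp_bdd_below)

lemma Sup_mem: "Sup C \<in> C" and Inf_mem: "Inf C \<in> C"
  using closed_contains_Sup[OF nonempty bdd(1)] closed_contains_Inf[OF nonempty bdd(2)] compact_imp_closed[OF compact] by auto

lemma mem_bounds: "x \<in> C \<Longrightarrow> Inf C \<le> x" "x \<in> C \<Longrightarrow> x \<le> Sup C"
  using bdd by (auto intro: cInf_lower cSup_upper)

lemma hull: "convex hull C = {Inf C..Sup C}"
proof
  show "convex hull C \<subseteq> {Inf C..Sup C}" by (rule hull_minimal) (use mem_bounds in auto)
  have "closed_segment (Inf C) (Sup C) \<subseteq> convex hull C"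
    by (rule closed_segment_subset) (use Inf_mem Sup_mem in \<open>auto simp: hull_inc\<close>)
  then show "{Inf C..Sup C} \<subseteq> convex hull C"
    using mem_bounds(1)[OF Sup_mem] by (simp add: closed_segment_eq_real_ivl)
qed

lemma gap_around:
  assumes "x \<in> {Inf C..Sup C} - C"
  obtains a b where "is_gap C a b" "a < x" "x < b"
proof -
  have "compact (C \<inter> {..x})" "compact (C \<inter> {x..})"
    using compact by (auto intro!: compact_Int_closed)
  moreover have "C \<inter> {..x} \<noteq> {}" "C \<inter> {x..} \<noteq> {}" using assms Sup_mem Inf_mem by auto
  ultimately obtain a b where a: "a \<in> C \<inter> {..x}" "\<And>t. t \<in> C \<inter> {..x} \<Longrightarrow> t \<le> a"
    and b: "b \<in> C \<inter> {x..}" "\<And>t. t \<in> C \<inter> {x..} \<Longrightarrow> b \<le> t"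
    using compact_attains_sup compact_attains_inf by metis
  have ne: "a < x" "x < b" using a b assms by (auto simp: less_le)
  have "t \<notin> C" if "a < t" "t < b" for t
    using a(2)[of t] b(2)[of t] that by (cases "t \<le> x") auto
  then have "{a<..<b} \<inter> C = {}" by auto
  then have "is_gap C a b" using ne a(1) b(1) by (auto simp: is_gap_def)
  then show thesis using that ne by blast
qed

lemma gap_separation:
  assumes "is_gap C a b" "is_gap C a' b'" "a \<noteq> a' \<or> b \<noteq> b'"
  shows "b \<le> a' \<or> b' \<le> a"
proof (rule ccontr)
  assume "\<not> ?thesis"
  then have l: "a' < b" "a < b'" by auto
  have "\<not> (a < a' \<and> a' < b)" "\<not> (a' < a \<and> a < b')" "\<not> (a < b' \<and> b' < b)" "\<not> (a' < b \<and> b < b')"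
    using assms by (auto simp: is_gap_def)
  then show False using l assms(3) by linarith
qed

lemma component_eq_gap:
  assumes g: "is_gap C a b" and x: "a < x" "x < b"
  shows "connected_component_set ({Inf C..Sup C} - C) x = {a<..<b}"
proof
  let ?S = "{Inf C..Sup C} - C"
  have ab: "a \<in> C" "b \<in> C" "a < b" "{a<..<b} \<inter> C = {}" using g by (auto simp: is_gap_def)
  show "{a<..<b} \<subseteq> connected_component_set ?S x"
    by (rule connected_component_maximal)
      (use x ab mem_bounds(1)[of a] mem_bounds(2)[of b] in auto)
  show "connected_component_set ?S x \<subseteq> {a<..<b}"
  proof
    fix y assume y: "y \<in> connected_component_set ?S x"
    have con: "connected (connected_component_set ?S x)" by simp
    have xm: "x \<in> connected_component_set ?S x"
      using x ab mem_bounds(1)[of a] mem_bounds(2)[of b] by auto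
    have sub: "connected_component_set ?S x \<subseteq> ?S" by (rule connected_component_subset)
    have "a \<notin> connected_component_set ?S x" "b \<notin> connected_component_set ?S x" using sub ab by auto
    then show "y \<in> {a<..<b}"
      using connectedD_interval[OF con y xm, of a] connectedD_interval[OF con xm y, of b] x
      by (metis greaterThanLessThan_iff less_imp_le not_le)
  qed
qed

lemma gaps_eq: "gaps C = {{a<..<b} | a b. is_gap C a b}"
proof
  show "gaps C \<subseteq> {{a<..<b} | a b. is_gap C a b}"
  proof
    fix G assume "G \<in> gaps C"
    then obtain x where x: "x \<in> {Inf C..Sup C} - C" "G = connected_component_set ({Inf C..Sup C} - C) x"
      unfolding gaps_def hull components_def by auto
    then show "G \<in> {{a<..<b} | a b. is_gap C a b}" using gap_around[OF x(1)] component_eq_gap by (metis (mono_tags, lifting) mem_Collect_eq)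
  qed
  show "{{a<..<b} | a b. is_gap C a b} \<subseteq> gaps C"
  proof clarify
    fix a b assume g: "is_gap C a b"
    then have ab: "a < b" "a \<in> C" "b \<in> C" "{a<..<b} \<inter> C = {}" by (auto simp: is_gap_def)
    have m: "a < (a + b) / 2" "(a + b) / 2 < b" using ab by auto
    then have "(a + b) / 2 \<in> {a<..<b}" by simp
    then have "(a + b) / 2 \<notin> C" using ab(4) by blast
    then have "(a + b) / 2 \<in> {Inf C..Sup C} - C"
      using mem_bounds(1)[OF ab(2)] mem_bounds(2)[OF ab(3)] m by auto
    then show "{a<..<b} \<in> gaps C"
      unfolding gaps_def hull components_def using component_eq_gap[OF g m] by blast
  qed
qed

lemma gap_interval_inject:
  assumes "is_gap C a b" "{a<..<b} = {a'<..<b'}"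
  shows "a' = a \<and> b' = b"
proof -
  have "a < b" using assms by (simp add: is_gap_def)
  then show ?thesis using greaterThanLessThan_eq_iff[of a b a' b'] assms(2) by auto
qed

text \<open>The left ends of gaps of length at least \<open>r\<close> are at distance at least
  \<open>r\<close> from each other, so \<open>\<lfloor>a / r\<rfloor>\<close> is injective on them
  with bounded values.\<close>

lemma finite_large_gaps:
  assumes r: "0 < r"
  shows "finite {G \<in> gaps C. r \<le> measure lborel G}"
proof -
  define A where "A = {a. \<exists>b. is_gap C a b \<and> r \<le> b - a}"
  define B where "B = (\<lambda>a. SOME b. is_gap C a b \<and> r \<le> b - a)"
  have uniq: "b = b'" if "is_gap C a b" "is_gap C a b'" for a b b'
    using gap_separation[OF that] that by (auto simp: is_gap_def)
  have "finite A"
  proof (rule finite_imageD)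
    have "(\<lambda>a. \<lfloor>a / r\<rfloor>) ` A \<subseteq> {\<lfloor>Inf C / r\<rfloor>..\<lfloor>Sup C / r\<rfloor>}"
      using mem_bounds r by (auto simp: A_def is_gap_def intro!: floor_mono divide_right_mono)
    then show "finite ((\<lambda>a. \<lfloor>a / r\<rfloor>) ` A)" by (rule finite_subset) simp
    have less: "\<lfloor>a / r\<rfloor> < \<lfloor>a' / r\<rfloor>" if "a \<in> A" "a' \<in> A" "a < a'" for a a'
    proof -
      obtain b b' where b: "is_gap C a b" "r \<le> b - a" "is_gap C a' b'" using \<open>a \<in> A\<close> \<open>a' \<in> A\<close> by (auto simp: A_def)
      then have "b \<le> a'" using gap_separation[OF b(1,3)] that(3) by (auto simp: is_gap_def)
      then have "a + r \<le> a'" using b by simp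
      then have "(a + r) / r \<le> a' / r" using r by (intro divide_right_mono) auto
      then have "a / r + 1 \<le> a' / r" using r by (simp add: add_divide_distrib)
      then show ?thesis by linarith
    qed
    show "inj_on (\<lambda>a. \<lfloor>a / r\<rfloor>) A"
    proof (rule inj_onI)
      fix a a' assume "a \<in> A" "a' \<in> A" "\<lfloor>a / r\<rfloor> = \<lfloor>a' / r\<rfloor>"
      then show "a = a'" using less[of a a'] less[of a' a] by (cases a a' rule: linorder_cases) auto
    qed
  qed
  moreover have "{G \<in> gaps C. r \<le> measure lborel G} \<subseteq> (\<lambda>a. {a<..<B a}) ` A"
  proof
    fix G assume "G \<in> {G \<in> gaps C. r \<le> measure lborel G}"
    then obtain a b where ab: "is_gap C a b" "G = {a<..<b}" "r \<le> measure lborel G" by (auto simp: gaps_eq)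
    then have r': "r \<le> b - a" by (simp add: is_gap_def)
    then have "is_gap C a (B a) \<and> r \<le> B a - a" unfolding B_def using ab(1) by (intro someI_ex[of "\<lambda>b. is_gap C a b \<and> r \<le> b - a"]) blast
    then have "B a = b" using uniq ab(1) by blast
    then show "G \<in> (\<lambda>a. {a<..<B a}) ` A" using ab r' by (auto simp: A_def)
  qed
  ultimately show ?thesis using finite_surj by blast
qed

text \<open>If there were finitely many gaps, \<open>density\<close> could be applied between the
  last right end and \<open>Sup C\<close> and would give a further gap. The interval is
  nondegenerate because \<open>right_end\<close> keeps gaps away from \<open>Sup C\<close>.\<close>

lemma infinite_gaps: "infinite (gaps C)"
proof
  assume fin: "finite (gaps C)"
  define Bs where "Bs = {b. \<exists>a. is_gap C a b}"
  have "Bs \<subseteq> Sup ` gaps C"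
  proof
    fix b assume "b \<in> Bs"
    then obtain a where "is_gap C a b" by (auto simp: Bs_def)
    then have "{a<..<b} \<in> gaps C" "Sup {a<..<b} = b" by (auto simp: gaps_eq is_gap_def)
    then show "b \<in> Sup ` gaps C" by (metis imageI)
  qed
  then have finB: "finite Bs" using fin finite_surj by blast
  define p where "p = (if Bs = {} then Inf C else Max Bs)"
  have p: "p \<in> C" "p < Sup C"
  proof -
    have "p \<in> C \<and> p < Sup C"
    proof (cases "Bs = {}")
      case True
      obtain x y where "x \<in> C" "y \<in> C" "x < y" using nondegenerate by blast
      then have "Inf C < Sup C" using mem_bounds(1)[of x] mem_bounds(2)[of y] by linarith
      then show ?thesis using True Inf_mem by (simp add: p_def)
    next
      case False
      then have "p \<in> Bs" using finB by (simp add: p_def)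
      then obtain a where g: "is_gap C a p" by (auto simp: Bs_def)
      have "0 < p - a" using g by (simp add: is_gap_def)
      then have "0 < \<kappa> * (Sup C - p)" using right_end[OF g] by linarith
      then show ?thesis using \<kappa> g by (auto simp: zero_less_mult_iff is_gap_def)
    qed
    then show "p \<in> C" "p < Sup C" by auto
  qed
  define R where "R = (Sup C - p) / 2"
  have "\<exists>a b. is_gap C a b \<and> \<epsilon> * R < min b ((p + Sup C) / 2 + R) - max a ((p + Sup C) / 2 - R)"
    by (rule density[of R p _ "Sup C"]) (use p Sup_mem in \<open>auto simp: R_def field_simps\<close>)
  then obtain a b where ab: "is_gap C a b" "\<epsilon> * R < min b (Sup C) - max a p" by (auto simp: R_def field_simps)
  have "0 < \<epsilon> * R" using \<epsilon> p by (simp add: R_def)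
  then have "p < b" using ab(2) by linarith
  moreover have "b \<in> Bs" using ab(1) by (auto simp: Bs_def)
  then have "b \<le> p" using finB by (auto simp: p_def)
  ultimately show False by simp
qed

lemma presentation_gap:
  assumes "U \<in> presentations C" "1 \<le> n"
  obtains a b where "is_gap C a b" "U n = {a<..<b}"
proof -
  have "U n \<in> gaps C" using assms by (auto simp: presentations_def bij_betw_def)
  then show thesis using that by (auto simp: gaps_eq)
qed

text \<open>The bridge ends at the nearest already removed gap to the right, or at the end of the
  hull. The last conclusion records that none of the first \<open>n\<close> gaps lies inside it; the
  upper estimate of its length rests on this.\<close>

lemma bridge_right:
  assumes U: "U \<in> presentations C" and n: "1 \<le> n" and g: "is_gap C a b" "U n = {a<..<b}"
  obtains d where "bridge C U n b = {b..d}" "d \<in> C" "b \<le> d"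
    "d = Sup C \<or> (\<exists>i b'. 1 \<le> i \<and> i \<le> n \<and> is_gap C d b' \<and> U i = {d<..<b'})"
    "\<And>i a' b'. 1 \<le> i \<Longrightarrow> i \<le> n \<Longrightarrow> is_gap C a' b' \<Longrightarrow> U i = {a'<..<b'} \<Longrightarrow> b \<le> a' \<Longrightarrow> d \<le> a'"
proof -
  define D where "D = insert (Sup C) {a'. b \<le> a' \<and> (\<exists>i b'. 1 \<le> i \<and> i \<le> n \<and> is_gap C a' b' \<and> U i = {a'<..<b'})}"
  have "D \<subseteq> insert (Sup C) ((\<lambda>i. Inf (U i)) ` {1..n})"
  proof
    fix x assume "x \<in> D"
    then consider "x = Sup C" | i b' where "1 \<le> i" "i \<le> n" "is_gap C x b'" "U i = {x<..<b'}" by (auto simp: D_def)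
    then show "x \<in> insert (Sup C) ((\<lambda>i. Inf (U i)) ` {1..n})"
    proof cases
      case 2
      then have "Inf (U i) = x" by (simp add: is_gap_def)
      then show ?thesis using 2 by (metis atLeastAtMost_iff imageI insertI2)
    qed simp
  qed
  then have fD: "finite D" by (rule finite_subset) simp
  have Dne: "D \<noteq> {}" by (simp add: D_def)
  define d where "d = Min D"
  have dD: "d \<in> D" unfolding d_def using fD Dne by (rule Min_in)
  have dle: "d \<le> x" if "x \<in> D" for x unfolding d_def using fD that by (rule Min_le)
  have ab: "a \<in> C" "b \<in> C" "a < b" using g(1) by (auto simp: is_gap_def)
  have bS: "b \<le> Sup C" using mem_bounds(2)[OF ab(2)] .
  have bd: "b \<le> d" using dD bS by (auto simp: D_def)
  have dC: "d \<in> C" using dD Sup_mem by (auto simp: D_def is_gap_def)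
  define S where "S = {Inf C..Sup C} - (\<Union>i\<in>{1..n}. U i)"
  have cases: "d = Sup C \<or> (\<exists>i b'. 1 \<le> i \<and> i \<le> n \<and> is_gap C d b' \<and> U i = {d<..<b'})" using dD by (auto simp: D_def)
  have min: "d \<le> a'" if "1 \<le> i" "i \<le> n" "is_gap C a' b'" "U i = {a'<..<b'}" "b \<le> a'" for i a' b'
    by (rule dle) (use that in \<open>auto simp: D_def\<close>)
  have sub: "{b..d} \<subseteq> S"
  proof
    fix x assume x: "x \<in> {b..d}"
    have "x \<notin> U i" if i: "1 \<le> i" "i \<le> n" for i
    proof
      assume xi: "x \<in> U i"
      obtain a' b' where g': "is_gap C a' b'" "U i = {a'<..<b'}" by (rule presentation_gap[OF U i(1)])
      have "\<not> (a' < b \<and> b < b')" using g' ab by (auto simp: is_gap_def)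
      then have "b \<le> a'" using xi x g' by auto
      then show False using min[OF i g'] xi x g' by auto
    qed
    then show "x \<in> S" using x mem_bounds(1)[OF ab(2)] mem_bounds(2)[OF dC] by (auto simp: S_def)
  qed
  have "connected_component_set S b = {b..d}"
  proof
    show "{b..d} \<subseteq> connected_component_set S b"
      by (rule connected_component_maximal) (use bd sub in auto)
    show "connected_component_set S b \<subseteq> {b..d}"
    proof
      fix y assume y: "y \<in> connected_component_set S b"
      have con: "connected (connected_component_set S b)" by simp
      have bm: "b \<in> connected_component_set S b" using sub bd by auto
      have subS: "connected_component_set S b \<subseteq> S" by (rule connected_component_subset)
      have mid: "(max a y + b) / 2 \<in> U n" if "y < b" using that ab g by auto
      have "\<not> y < b"
      proof
        assume yb: "y < b"
        have "(max a y + b) / 2 \<in> connected_component_set S b"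
          by (rule connectedD_interval[OF con y bm]) (use yb ab in auto)
        then show False using mid[OF yb] subS n by (auto simp: S_def)
      qed
      moreover have "\<not> d < y"
      proof
        assume dy: "d < y"
        have "y \<le> Sup C" using y subS by (auto simp: S_def)
        then obtain i b' where i: "1 \<le> i" "i \<le> n" "is_gap C d b'" "U i = {d<..<b'}" using cases dy by auto
        have db: "d < b'" using i by (simp add: is_gap_def)
        have "(d + min y b') / 2 \<in> connected_component_set S b"
          by (rule connectedD_interval[OF con bm y]) (use dy bd db in auto)
        then have "(d + min y b') / 2 \<in> S" using subS by blast
        moreover have "(d + min y b') / 2 \<in> U i" using i dy db by auto
        ultimately show False using i unfolding S_def by (metis DiffD2 UN_I atLeastAtMost_iff)
      qed
      ultimately show "y \<in> {b..d}" by simp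
    qed
  qed
  then have "bridge C U n b = {b..d}" by (simp add: bridge_def hull S_def)
  then show thesis using that dC bd cases min by blast
qed

lemma bridge_left:
  assumes U: "U \<in> presentations C" and n: "1 \<le> n" and g: "is_gap C a b" "U n = {a<..<b}"
  obtains d where "bridge C U n a = {d..a}" "d \<in> C" "d \<le> a"
    "d = Inf C \<or> (\<exists>i a'. 1 \<le> i \<and> i \<le> n \<and> is_gap C a' d \<and> U i = {a'<..<d})"
    "\<And>i a' b'. 1 \<le> i \<Longrightarrow> i \<le> n \<Longrightarrow> is_gap C a' b' \<Longrightarrow> U i = {a'<..<b'} \<Longrightarrow> b' \<le> a \<Longrightarrow> b' \<le> d"
proof -
  define D where "D = insert (Inf C) {b'. b' \<le> a \<and> (\<exists>i a'. 1 \<le> i \<and> i \<le> n \<and> is_gap C a' b' \<and> U i = {a'<..<b'})}"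
  have "D \<subseteq> insert (Inf C) ((\<lambda>i. Sup (U i)) ` {1..n})"
  proof
    fix x assume "x \<in> D"
    then consider "x = Inf C" | i a' where "1 \<le> i" "i \<le> n" "is_gap C a' x" "U i = {a'<..<x}" by (auto simp: D_def)
    then show "x \<in> insert (Inf C) ((\<lambda>i. Sup (U i)) ` {1..n})"
    proof cases
      case 2
      then have "Sup (U i) = x" by (simp add: is_gap_def)
      then show ?thesis using 2 by (metis atLeastAtMost_iff imageI insertI2)
    qed simp
  qed
  then have fD: "finite D" by (rule finite_subset) simp
  have Dne: "D \<noteq> {}" by (simp add: D_def)
  define d where "d = Max D"
  have dD: "d \<in> D" unfolding d_def using fD Dne by (rule Max_in)
  have dle: "x \<le> d" if "x \<in> D" for x unfolding d_def using fD that by (rule Max_ge)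
  have ab: "a \<in> C" "b \<in> C" "a < b" using g(1) by (auto simp: is_gap_def)
  have aI: "Inf C \<le> a" using mem_bounds(1)[OF ab(1)] .
  have da: "d \<le> a" using dD aI by (auto simp: D_def)
  have dC: "d \<in> C" using dD Inf_mem by (auto simp: D_def is_gap_def)
  define S where "S = {Inf C..Sup C} - (\<Union>i\<in>{1..n}. U i)"
  have cases: "d = Inf C \<or> (\<exists>i a'. 1 \<le> i \<and> i \<le> n \<and> is_gap C a' d \<and> U i = {a'<..<d})" using dD by (auto simp: D_def)
  have min: "b' \<le> d" if "1 \<le> i" "i \<le> n" "is_gap C a' b'" "U i = {a'<..<b'}" "b' \<le> a" for i a' b'
    by (rule dle) (use that in \<open>auto simp: D_def\<close>)
  have sub: "{d..a} \<subseteq> S"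
  proof
    fix x assume x: "x \<in> {d..a}"
    have "x \<notin> U i" if i: "1 \<le> i" "i \<le> n" for i
    proof
      assume xi: "x \<in> U i"
      obtain a' b' where g': "is_gap C a' b'" "U i = {a'<..<b'}" by (rule presentation_gap[OF U i(1)])
      have "\<not> (a' < a \<and> a < b')" using g' ab by (auto simp: is_gap_def)
      then have "b' \<le> a" using xi x g' by auto
      then show False using min[OF i g'] xi x g' by auto
    qed
    then show "x \<in> S" using x mem_bounds(2)[OF ab(1)] mem_bounds(1)[OF dC] by (auto simp: S_def)
  qed
  have "connected_component_set S a = {d..a}"
  proof
    show "{d..a} \<subseteq> connected_component_set S a"
      by (rule connected_component_maximal) (use da sub in auto)
    show "connected_component_set S a \<subseteq> {d..a}"
    proof
      fix y assume y: "y \<in> connected_component_set S a"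
      have con: "connected (connected_component_set S a)" by simp
      have am: "a \<in> connected_component_set S a" using sub da by auto
      have subS: "connected_component_set S a \<subseteq> S" by (rule connected_component_subset)
      have mid: "(a + min b y) / 2 \<in> U n" if "a < y" using that ab g by auto
      have "\<not> a < y"
      proof
        assume yb: "a < y"
        have "(a + min b y) / 2 \<in> connected_component_set S a"
          by (rule connectedD_interval[OF con am y]) (use yb ab in auto)
        then show False using mid[OF yb] subS n by (auto simp: S_def)
      qed
      moreover have "\<not> y < d"
      proof
        assume dy: "y < d"
        have "Inf C \<le> y" using y subS by (auto simp: S_def)
        then obtain i a' where i: "1 \<le> i" "i \<le> n" "is_gap C a' d" "U i = {a'<..<d}" using cases dy by auto
        have db: "a' < d" using i by (simp add: is_gap_def)
        have "(max y a' + d) / 2 \<in> connected_component_set S a"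
          by (rule connectedD_interval[OF con y am]) (use dy da db in auto)
        then have "(max y a' + d) / 2 \<in> S" using subS by blast
        moreover have "(max y a' + d) / 2 \<in> U i" using i dy db by auto
        ultimately show False using i unfolding S_def by (metis DiffD2 UN_I atLeastAtMost_iff)
      qed
      ultimately show "y \<in> {d..a}" by simp
    qed
  qed
  then have "bridge C U n a = {d..a}" by (simp add: bridge_def hull S_def)
  then show thesis using that dC da cases min by blast
qed

definition decreasing :: "(nat \<Rightarrow> real set) \<Rightarrow> bool" where
  "decreasing U \<longleftrightarrow> (\<forall>i j. 1 \<le> i \<longrightarrow> i \<le> j \<longrightarrow> measure lborel (U j) \<le> measure lborel (U i))"

lemma decreasing_presentation: "\<exists>U\<in>presentations C. decreasing U"
proof -
  have "0 < measure lborel G" if "G \<in> gaps C" for G using that by (auto simp: gaps_eq is_gap_def)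
  from order_by_size[OF infinite_gaps this finite_large_gaps]
  show ?thesis unfolding presentations_def decreasing_def by auto
qed

lemma boundary_point:
  assumes U: "U \<in> presentations C" and u: "(n, u) \<in> gap_boundary_points C U"
  obtains a b where "1 \<le> n" "is_gap C a b" "U n = {a<..<b}" "u = a \<or> u = b"
proof -
  have n: "1 \<le> n" and fr: "u \<in> frontier (U n)" using u by (auto simp: gap_boundary_points_def)
  obtain a b where g: "is_gap C a b" "U n = {a<..<b}" by (rule presentation_gap[OF U n])
  have "a < b" using g(1) by (simp add: is_gap_def)
  then have "frontier (U n) = {a, b}" unfolding g(2) by (auto simp: frontier_def)
  then show thesis using that n g fr by auto
qed

lemma gap_length_measure: "is_gap C a b \<Longrightarrow> measure lborel {a<..<b} = b - a"
  by (simp add: is_gap_def)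

lemma gap_inside:
  assumes g: "is_gap C a b" and C: "p \<in> C" "q \<in> C" and ov: "max a p < min b q"
  shows "p \<le> a" "b \<le> q"
proof -
  have "p \<notin> {a<..<b}" "q \<notin> {a<..<b}" using g C by (auto simp: is_gap_def)
  then show "p \<le> a" "b \<le> q" using ov g by (auto simp: is_gap_def)
qed

text \<open>A gap at the far end of the bridge was removed earlier, so it is at least as long, and
  \<open>spacing\<close> applies with the present gap as the shorter one. Conversely
  \<open>density\<close> puts a gap inside the bridge; it is removed later and is therefore not
  longer than the present one. The factor 2 arises because \<open>R\<close> is half the
  bridge.\<close>

lemma local_thickness_bounds:
  assumes U: "U \<in> presentations C" "decreasing U" and u: "(n, u) \<in> gap_boundary_points C U"
  shows "1 / \<kappa> \<le> local_thickness C U n u" "local_thickness C U n u \<le> 2 / \<epsilon>"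
proof -
  obtain a b where n: "1 \<le> n" and g: "is_gap C a b" "U n = {a<..<b}" and uab: "u = a \<or> u = b"
    by (rule boundary_point[OF U(1) u])
  have ab: "a < b" "a \<in> C" "b \<in> C" using g by (auto simp: is_gap_def)
  have "\<exists>l. measure lborel (bridge C U n u) = l \<and> b - a \<le> \<kappa> * l \<and> \<epsilon> * l \<le> 2 * (b - a)"
    using uab
  proof
    assume u: "u = b"
    obtain d where d: "bridge C U n b = {b..d}" "d \<in> C" "b \<le> d"
      "d = Sup C \<or> (\<exists>i b'. 1 \<le> i \<and> i \<le> n \<and> is_gap C d b' \<and> U i = {d<..<b'})"
      "\<And>i a' b'. 1 \<le> i \<Longrightarrow> i \<le> n \<Longrightarrow> is_gap C a' b' \<Longrightarrow> U i = {a'<..<b'} \<Longrightarrow> b \<le> a' \<Longrightarrow> d \<le> a'"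
      by (rule bridge_right[OF U(1) n g], rule that) (assumption | blast)+
    have "b - a \<le> \<kappa> * (d - b)"
      using d(4)
    proof
      assume "\<exists>i b'. 1 \<le> i \<and> i \<le> n \<and> is_gap C d b' \<and> U i = {d<..<b'}"
      then obtain i b' where i: "1 \<le> i" "i \<le> n" "is_gap C d b'" "U i = {d<..<b'}" by blast
      have "b - a \<le> b' - d"
        using U(2) i n g gap_length_measure[OF g(1)] gap_length_measure[OF i(3)] unfolding decreasing_def by metis
      then show ?thesis using spacing[OF g(1) i(3) d(3)] by simp
    qed (use right_end[OF g(1)] in simp)
    moreover have "\<epsilon> * (d - b) \<le> 2 * (b - a)"
    proof (cases "b = d")
      case False
      define R where "R = (d - b) / 2"
      have R: "0 < R" using False d(3) by (simp add: R_def)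
      have "\<exists>a' b'. is_gap C a' b' \<and> \<epsilon> * R < min b' ((b + d) / 2 + R) - max a' ((b + d) / 2 - R)"
        by (rule density[OF R ab(3) _ d(2)]) (auto simp: R_def field_simps)
      then obtain a' b' where g': "is_gap C a' b'" "\<epsilon> * R < min b' d - max a' b" by (auto simp: R_def field_simps)
      have "0 < \<epsilon> * R" using \<epsilon> R by simp
      then have "max a' b < min b' d" using g'(2) by linarith
      then have in_bd: "b \<le> a'" "b' \<le> d" by (rule gap_inside[OF g'(1) ab(3) d(2)])+
      have "{a'<..<b'} \<in> U ` {1..}" using U(1) g'(1) by (auto simp: presentations_def bij_betw_def gaps_eq)
      then obtain j where j: "1 \<le> j" "U j = {a'<..<b'}" by auto
      have "n \<le> j"
      proof (rule ccontr)
        assume "\<not> n \<le> j"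
        then have "d \<le> a'" using d(5)[OF j(1) _ g'(1) j(2) in_bd(1)] by simp
        then show False using in_bd g'(1) by (simp add: is_gap_def)
      qed
      then have "b' - a' \<le> b - a"
        using U(2) j n g gap_length_measure[OF g(1)] gap_length_measure[OF g'(1)] unfolding decreasing_def by metis
      then have "\<epsilon> * R \<le> b - a" using g'(2) in_bd by linarith
      then show ?thesis by (simp add: R_def)
    qed (use ab in simp)
    ultimately show ?thesis using d(1,3) u by auto
  next
    assume u: "u = a"
    obtain d where d: "bridge C U n a = {d..a}" "d \<in> C" "d \<le> a"
      "d = Inf C \<or> (\<exists>i a'. 1 \<le> i \<and> i \<le> n \<and> is_gap C a' d \<and> U i = {a'<..<d})"
      "\<And>i a' b'. 1 \<le> i \<Longrightarrow> i \<le> n \<Longrightarrow> is_gap C a' b' \<Longrightarrow> U i = {a'<..<b'} \<Longrightarrow> b' \<le> a \<Longrightarrow> b' \<le> d"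
      by (rule bridge_left[OF U(1) n g], rule that) (assumption | blast)+
    have "b - a \<le> \<kappa> * (a - d)"
      using d(4)
    proof
      assume "\<exists>i a'. 1 \<le> i \<and> i \<le> n \<and> is_gap C a' d \<and> U i = {a'<..<d}"
      then obtain i a' where i: "1 \<le> i" "i \<le> n" "is_gap C a' d" "U i = {a'<..<d}" by blast
      have "b - a \<le> d - a'"
        using U(2) i n g gap_length_measure[OF g(1)] gap_length_measure[OF i(3)] unfolding decreasing_def by metis
      then show ?thesis using spacing[OF i(3) g(1) d(3)] by simp
    qed (use left_end[OF g(1)] in simp)
    moreover have "\<epsilon> * (a - d) \<le> 2 * (b - a)"
    proof (cases "a = d")
      case False
      define R where "R = (a - d) / 2"
      have R: "0 < R" using False d(3) by (simp add: R_def)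
      have "\<exists>a' b'. is_gap C a' b' \<and> \<epsilon> * R < min b' ((d + a) / 2 + R) - max a' ((d + a) / 2 - R)"
        by (rule density[OF R d(2) _ ab(2)]) (auto simp: R_def field_simps)
      then obtain a' b' where g': "is_gap C a' b'" "\<epsilon> * R < min b' a - max a' d" by (auto simp: R_def field_simps)
      have "0 < \<epsilon> * R" using \<epsilon> R by simp
      then have "max a' d < min b' a" using g'(2) by linarith
      then have in_bd: "d \<le> a'" "b' \<le> a" by (rule gap_inside[OF g'(1) d(2) ab(2)])+
      have "{a'<..<b'} \<in> U ` {1..}" using U(1) g'(1) by (auto simp: presentations_def bij_betw_def gaps_eq)
      then obtain j where j: "1 \<le> j" "U j = {a'<..<b'}" by auto
      have "n \<le> j"
      proof (rule ccontr)
        assume "\<not> n \<le> j"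
        then have "b' \<le> d" using d(5)[OF j(1) _ g'(1) j(2) in_bd(2)] by simp
        then show False using in_bd g'(1) by (simp add: is_gap_def)
      qed
      then have "b' - a' \<le> b - a"
        using U(2) j n g gap_length_measure[OF g(1)] gap_length_measure[OF g'(1)] unfolding decreasing_def by metis
      then have "\<epsilon> * R \<le> b - a" using g'(2) in_bd by linarith
      then show ?thesis by (simp add: R_def)
    qed (use ab in simp)
    ultimately show ?thesis using d(1,3) u by auto
  qed
  then obtain l where l: "measure lborel (bridge C U n u) = l" "b - a \<le> \<kappa> * l" "\<epsilon> * l \<le> 2 * (b - a)" by blast
  have lt: "local_thickness C U n u = l / (b - a)"
    using l(1) gap_length_measure[OF g(1)] by (simp add: local_thickness_def g(2))
  show "1 / \<kappa> \<le> local_thickness C U n u" unfolding lt using l(2) ab \<kappa> by (simp add: field_simps)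
  show "local_thickness C U n u \<le> 2 / \<epsilon>" unfolding lt using l(3) ab \<epsilon> by (simp add: field_simps)
qed

theorem thickness_ge: "ereal (1 / \<kappa>) \<le> thickness C"
proof -
  obtain U where U: "U \<in> presentations C" "decreasing U" using decreasing_presentation by blast
  have "ereal (1 / \<kappa>) \<le> (INF (n, u)\<in>gap_boundary_points C U. ereal (local_thickness C U n u))"
    by (rule INF_greatest) (use local_thickness_bounds(1)[OF U] in auto)
  also have "\<dots> \<le> thickness C" unfolding thickness_def by (rule SUP_upper[OF U(1)])
  finally show ?thesis .
qed

theorem denseness_le: "denseness C \<le> ereal (2 / \<epsilon>)"
proof -
  obtain U where U: "U \<in> presentations C" "decreasing U" using decreasing_presentation by blast
  have "denseness C \<le> (SUP (n, u)\<in>gap_boundary_points C U. ereal (local_thickness C U n u))"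
    unfolding denseness_def by (rule INF_lower[OF U(1)])
  also have "\<dots> \<le> ereal (2 / \<epsilon>)"
    by (rule SUP_least) (use local_thickness_bounds(2)[OF U] in auto)
  finally show ?thesis .
qed

text \<open>Any two presentations are compared at one point, the right end of the first gap of
  \<open>W\<close>. Its bridge with respect to \<open>W\<close> extends to \<open>Sup C\<close>,
  hence is at least as long as the one with respect to \<open>U\<close>, and the gap is the
  same.\<close>

theorem thickness_le_denseness: "thickness C \<le> denseness C"
  unfolding thickness_def denseness_def
proof (intro SUP_least INF_greatest)
  fix U W assume U: "U \<in> presentations C" and W: "W \<in> presentations C"
  obtain a b where g: "is_gap C a b" "W 1 = {a<..<b}" by (rule presentation_gap[OF W order_refl])
  have "{a<..<b} \<in> U ` {1..}" using U g(1) by (auto simp: presentations_def bij_betw_def gaps_eq)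
  then obtain n where n: "1 \<le> n" "U n = {a<..<b}" by auto
  have ab: "a < b" "b \<in> C" using g by (auto simp: is_gap_def)
  have "b \<in> frontier {a<..<b}" using ab by (auto simp: frontier_def)
  then have bp: "(n, b) \<in> gap_boundary_points C U" "(1, b) \<in> gap_boundary_points C W"
    using n g ab by (auto simp: gap_boundary_points_def)
  obtain d where d: "bridge C U n b = {b..d}" "d \<in> C" "b \<le> d" by (rule bridge_right[OF U n(1) g(1) n(2)], rule that)
  obtain e where e: "bridge C W 1 b = {b..e}" "e \<in> C" "b \<le> e"
    "e = Sup C \<or> (\<exists>i b'. 1 \<le> i \<and> i \<le> 1 \<and> is_gap C e b' \<and> W i = {e<..<b'})"
    by (rule bridge_right[OF W order_refl g], rule that)
  have "e = Sup C"
  proof (rule ccontr)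
    assume "e \<noteq> Sup C"
    then obtain i b' where "1 \<le> i" "i \<le> 1" "is_gap C e b'" "W i = {e<..<b'}" using e(4) by blast
    then have "{a<..<b} = {e<..<b'}" using g(2) by (metis le_antisym)
    then have "e = a" using gap_interval_inject[OF g(1)] by blast
    then show False using e(3) ab by simp
  qed
  then have "d \<le> e" using mem_bounds(2)[OF d(2)] by simp
  then have "local_thickness C U n b \<le> local_thickness C W 1 b"
    unfolding local_thickness_def d(1) e(1) n(2) g(2) using d(3) e(3) ab by (simp add: divide_right_mono)
  then have le: "ereal (local_thickness C U n b) \<le> ereal (local_thickness C W 1 b)" by simp
  have "(INF (n, u)\<in>gap_boundary_points C U. ereal (local_thickness C U n u)) \<le> ereal (local_thickness C U n b)"
    using INF_lower[OF bp(1), of "\<lambda>(n, u). ereal (local_thickness C U n u)"] by simp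
  also note le
  also have "ereal (local_thickness C W 1 b) \<le> (SUP (n, u)\<in>gap_boundary_points C W. ereal (local_thickness C W n u))"
    using SUP_upper[OF bp(2), of "\<lambda>(n, u). ereal (local_thickness C W n u)"] by simp
  finally show "(INF (n, u)\<in>gap_boundary_points C U. ereal (local_thickness C U n u)) \<le>
    (SUP (n, u)\<in>gap_boundary_points C W. ereal (local_thickness C W n u))" .
qed

end

section \<open>The trapped set has balanced gaps\<close>

context coupling
begin

lemma gap_midpoint:
  assumes "is_gap (trapped V) a b"
  shows "a < (a + b) / 2" "(a + b) / 2 < b" "(a + b) / 2 \<notin> trapped V"
proof -
  show m: "a < (a + b) / 2" "(a + b) / 2 < b" using assms by (auto simp: is_gap_def)
  then have "(a + b) / 2 \<in> {a<..<b}" by simp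
  then show "(a + b) / 2 \<notin> trapped V" using assms unfolding is_gap_def by blast
qed

lemma absorb_length:
  assumes "V \<le> 1 / 10^7" "x \<le> 5000 * V * (d + x)" "0 < x"
  shows "x \<le> 10000 * V * d"
proof -
  have "5000 * V * x \<le> 1 / 2 * x" using assms by (intro mult_right_mono) auto
  then show ?thesis using assms(2) unfolding distrib_left by linarith
qed

text \<open>\<open>gap_le_distance\<close> applies to whichever of the two gaps has the later escape
  time. It measures the distance from the far end of that gap; \<open>absorb_length\<close> removes
  the length of the gap itself at the price of doubling the constant.\<close>

lemma gap_spacing:
  assumes V7: "V \<le> 1 / 10^7" and g: "is_gap (trapped V) a b" "is_gap (trapped V) a' b'" and le: "b \<le> a'"
  shows "min (b - a) (b' - a') \<le> 10000 * V * (a' - b)"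
proof -
  define c c' where "c = (a + b) / 2" and "c' = (a' + b') / 2"
  note m = gap_midpoint[OF g(1), folded c_def] gap_midpoint[OF g(2), folded c'_def]
  have ab: "a \<in> trapped V" "b \<in> trapped V" "a < b" "{a<..<b} \<inter> trapped V = {}"
    "a' \<in> trapped V" "b' \<in> trapped V" "a' < b'" "{a'<..<b'} \<inter> trapped V = {}" using g by (auto simp: is_gap_def)
  note half = absorb_length[OF V7]
  have cc: "c \<le> c'" using m le by linarith
  show ?thesis
  proof (cases "escape_time V c' \<le> escape_time V c")
    case True
    have "b - a \<le> 5000 * V * (a' - a)"
    proof (rule gap_le_distance[OF ab(1-4) c_def _ m(6) True ab(2)])
      fix x assume x: "min c c' \<le> x" "x \<le> max c c'" "a' - a \<le> \<bar>x - c\<bar>"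
      have "a' - a \<le> x - c" "x \<le> c'" using x cc by auto
      then have "a' < x \<and> x < b'" using ab(3,7) by (simp add: c_def c'_def field_simps)
      then have "x \<in> {a'<..<b'}" by simp
      then show "x \<notin> trapped V" using ab(8) by blast
    qed (use m le in auto)
    then have "b - a \<le> 10000 * V * (a' - b)" using half[of "b - a" "a' - b"] ab by simp
    then show ?thesis by linarith
  next
    case False
    then have et: "escape_time V c \<le> escape_time V c'" by simp
    have "b' - a' \<le> 5000 * V * (b' - b)"
    proof (rule gap_le_distance[OF ab(5-8) c'_def _ m(3) et ab(5)])
      fix x assume x: "min c' c \<le> x" "x \<le> max c' c" "b' - b \<le> \<bar>x - c'\<bar>"
      have "b' - b \<le> c' - x" "c \<le> x" using x cc by auto
      then have "a < x \<and> x < b" using ab(3,7) by (simp add: c_def c'_def field_simps)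
      then have "x \<in> {a<..<b}" by simp
      then show "x \<notin> trapped V" using ab(4) by blast
    qed (use m le in auto)
    then have "b' - a' \<le> 10000 * V * (a' - b)" using half[of "b' - a'" "a' - b"] ab by simp
    then show ?thesis by linarith
  qed
qed

text \<open>The energies 3 and -3 escape at step 1, so the exterior of the spectrum acts as an
  oldest gap on either side.\<close>

lemma gap_le_end_distance:
  assumes V7: "V \<le> 1 / 10^7" and g: "is_gap (trapped V) a b"
  shows "b - a \<le> 10000 * V * (Sup (trapped V) - b)" "b - a \<le> 10000 * V * (a - Inf (trapped V))"
proof -
  define c where "c = (a + b) / 2"
  note m = gap_midpoint[OF g, folded c_def]
  have ab: "a \<in> trapped V" "b \<in> trapped V" "a < b" "{a<..<b} \<inter> trapped V = {}" using g by (auto simp: is_gap_def)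
  note half = absorb_length[OF V7]
  have bdd: "bdd_above (trapped V)" "bdd_below (trapped V)"
    using compact_imp_bounded[OF compact_trapped] by (auto intro: bounded_imp_bdd_above bounded_imp_bdd_below)
  have S: "x \<le> Sup (trapped V)" "Inf (trapped V) \<le> x" if "x \<in> trapped V" for x
    using that bdd by (auto intro: cSup_upper cInf_lower)
  have a3: "\<bar>a\<bar> < 3" "\<bar>b\<bar> < 3" using trapped_bounds ab by auto
  have et: "escape_time V 3 \<le> escape_time V c" "escape_time V (- 3) \<le> escape_time V c"
    using outside_not_trapped(2)[of 3] outside_not_trapped(2)[of "- 3"] escape_time(2)[OF m(3)] by auto
  have out: "3 \<notin> trapped V" "- 3 \<notin> trapped V" using outside_not_trapped(1) by auto
  have "b - a \<le> 5000 * V * (Sup (trapped V) - a)"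
  proof (rule gap_le_distance[OF ab c_def _ out(1) et(1) ab(2)])
    fix x assume x: "min c 3 \<le> x" "x \<le> max c 3" "Sup (trapped V) - a \<le> \<bar>x - c\<bar>"
    have "Sup (trapped V) < x" using x m a3 S(1)[OF ab(2)] by (auto simp: min_def max_def abs_if split: if_splits)
    then show "x \<notin> trapped V" using S(1)[of x] by auto
  qed (use m a3 S(1)[OF ab(2)] in auto)
  then show "b - a \<le> 10000 * V * (Sup (trapped V) - b)"
    using half[of "b - a" "Sup (trapped V) - b"] ab by simp
  have "b - a \<le> 5000 * V * (b - Inf (trapped V))"
  proof (rule gap_le_distance[OF ab c_def _ out(2) et(2) ab(1)])
    fix x assume x: "min c (- 3) \<le> x" "x \<le> max c (- 3)" "b - Inf (trapped V) \<le> \<bar>x - c\<bar>"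
    have "x < Inf (trapped V)" using x m a3 S(2)[OF ab(1)] by (auto simp: min_def max_def abs_if split: if_splits)
    then show "x \<notin> trapped V" using S(2)[of x] by auto
  qed (use m a3 S(2)[OF ab(1)] in auto)
  then show "b - a \<le> 10000 * V * (a - Inf (trapped V))"
    using half[of "b - a" "a - Inf (trapped V)"] ab by simp
qed

lemma balanced_gaps_trapped:
  assumes V7: "V \<le> 1 / 10^7"
  shows "balanced_gaps (trapped V) (10000 * V) (V / 10^12)"
proof
  show "compact (trapped V)" by (rule compact_trapped)
  show "\<exists>p\<in>trapped V. \<exists>q\<in>trapped V. p < q" using trapped_nondegenerate by blast
  show "0 < 10000 * V" "0 < V / 10^12" using V_pos by auto
  show "min (b - a) (b' - a') \<le> 10000 * V * (a' - b)"
    if "is_gap (trapped V) a b" "is_gap (trapped V) a' b'" "b \<le> a'" for a b a' b'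
    by (rule gap_spacing[OF V7 that])
  show "b - a \<le> 10000 * V * (Sup (trapped V) - b)" "b - a \<le> 10000 * V * (a - Inf (trapped V))"
    if "is_gap (trapped V) a b" for a b
    using gap_le_end_distance[OF V7 that] by auto
  show "\<exists>a b. is_gap (trapped V) a b \<and> V / 10^12 * R < min b (E + R) - max a (E - R)"
    if "0 < R" "p \<in> trapped V" "p \<le> E - R" "q \<in> trapped V" "E + R \<le> q" for E R p q
    using large_gap_in_interval[OF V7 that(1-5)] unfolding is_gap_def by blast
qed

end

subsection \<open>The Fibonacci word\<close>

text \<open>As a first difference of floors the letters depend on the phase through floors only, so
  repetitions of the word reduce to floor identities. \<open>indicator_sturmian\<close> identifies
  them with the letters of the potential.\<close>

definition sturmian :: "real \<Rightarrow> int \<Rightarrow> int" where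
  "sturmian \<omega> n = \<lfloor>of_int (n + 1) * golden_alpha + \<omega>\<rfloor> - \<lfloor>of_int n * golden_alpha + \<omega>\<rfloor>"

lemma golden_alpha_square: "golden_alpha * golden_alpha = 1 - golden_alpha"
proof -
  have "sqrt 5 * sqrt 5 = (5 :: real)" by simp
  then show ?thesis by (simp add: golden_alpha_def field_simps)
qed

lemma golden_alpha_bounds: "6 / 10 < golden_alpha" "golden_alpha < 65 / 100"
proof -
  have "22 / 10 < sqrt 5" by (rule real_less_rsqrt) (simp add: power2_eq_square)
  moreover have "sqrt 5 < 23 / 10" by (rule real_less_lsqrt) (simp_all add: power2_eq_square)
  ultimately show "6 / 10 < golden_alpha" "golden_alpha < 65 / 100" by (simp_all add: golden_alpha_def)
qed

lemma indicator_sturmian: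
  "indicator {1 - golden_alpha..<1} (frac (of_int n * golden_alpha + \<omega>)) = (of_int (sturmian \<omega> n) :: real)"
proof -
  define x where "x = of_int n * golden_alpha + \<omega>"
  have e: "of_int (n + 1) * golden_alpha + \<omega> = of_int \<lfloor>x\<rfloor> + (frac x + golden_alpha)"
    by (simp add: x_def frac_def algebra_simps)
  have s: "sturmian \<omega> n = \<lfloor>frac x + golden_alpha\<rfloor>"
    unfolding sturmian_def e x_def[symmetric] by simp
  have f: "0 \<le> frac x" "frac x < 1" by (auto simp: frac_lt_1)
  have "\<lfloor>frac x + golden_alpha\<rfloor> = (if 1 - golden_alpha \<le> frac x then 1 else 0)"
    using f golden_alpha_bounds by (auto intro!: floor_unique)
  then show ?thesis using f by (simp add: s x_def[symmetric] indicator_def)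
qed

lemma fib_golden: "fib (Suc k) * golden_alpha = fib k - (- golden_alpha) ^ Suc k"
proof (induction k rule: fib.induct)
  case 2
  then show ?case using golden_alpha_square by simp
next
  case (3 k)
  have "real (fib (Suc (Suc (Suc k)))) * golden_alpha = real (fib (Suc (Suc k))) * golden_alpha + real (fib (Suc k)) * golden_alpha"
    by (simp add: algebra_simps)
  also have "\<dots> = fib (Suc (Suc k)) - (- golden_alpha) ^ Suc k * (1 - golden_alpha)"
    unfolding 3 by (simp add: algebra_simps)
  also have "(- golden_alpha) ^ Suc k * (1 - golden_alpha) = (- golden_alpha) ^ Suc (Suc (Suc k))"
    using golden_alpha_square by (simp add: mult_ac)
  finally show ?case .
qed simp

text \<open>For a rational value with denominator \<open>q\<close>, the number
  \<open>(- golden_alpha) ^ Suc k * q\<close> would be an integer by \<open>fib_golden\<close>, yet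
  it is nonzero and below 1 in modulus for large \<open>k\<close>.\<close>

lemma golden_alpha_irrational: "golden_alpha \<notin> \<rat>"
proof
  assume "golden_alpha \<in> \<rat>"
  then obtain p q :: int where pq: "golden_alpha = of_int p / of_int q" "0 < q" by (metis Rats_cases')
  have "real_of_int q \<noteq> 0" using pq(2) by simp
  then have pq': "golden_alpha * of_int q = of_int p" unfolding pq(1) by simp
  obtain k where k: "golden_alpha ^ k < 1 / of_int q"
    using real_arch_pow_inv[of "1 / of_int q" golden_alpha] pq golden_alpha_bounds by auto
  have eqw: "(- golden_alpha) ^ Suc k * of_int q = of_int (int (fib k) * q - int (fib (Suc k)) * p)"
  proof -
    have "(- golden_alpha) ^ Suc k = real (fib k) - real (fib (Suc k)) * golden_alpha" using fib_golden[of k] by linarith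
    then have "(- golden_alpha) ^ Suc k * real_of_int q = real (fib k) * real_of_int q - real (fib (Suc k)) * (golden_alpha * real_of_int q)"
      by (simp only: left_diff_distrib mult.assoc)
    then show ?thesis unfolding pq' by simp
  qed
  have absw: "\<bar>of_int (int (fib k) * q - int (fib (Suc k)) * p)\<bar> = golden_alpha ^ Suc k * (of_int q :: real)"
    unfolding eqw[symmetric] using pq(2) golden_alpha_bounds by (simp add: abs_mult power_abs)
  have "golden_alpha ^ Suc k * (of_int q :: real) < 1"
  proof -
    have "golden_alpha ^ Suc k \<le> golden_alpha ^ k" using golden_alpha_bounds by (intro power_decreasing) auto
    then have "golden_alpha ^ Suc k < 1 / of_int q" using k by linarith
    then show ?thesis using pq by (simp add: pos_less_divide_eq)
  qed
  with absw have "\<bar>int (fib k) * q - int (fib (Suc k)) * p\<bar> < 1" by linarith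
  then have "int (fib k) * q - int (fib (Suc k)) * p = 0" by linarith
  then have "golden_alpha ^ Suc k * (of_int q :: real) = 0"
    using absw by simp
  then show False using pq golden_alpha_bounds by simp
qed

text \<open>Best approximation: in the basis of two consecutive convergents an integer vector with first
  coordinate between \<open>0\<close> and \<open>F'\<close> has coefficients of opposite signs.\<close>

lemma lattice_gap:
  fixes i j :: int and F F' :: nat
  assumes m: "0 < i * int F + j * int F'" "i * int F + j * int F' < int F'"
    and b: "- 1 \<le> of_int i - of_int j * golden_alpha" "of_int i - of_int j * golden_alpha \<le> 0"
  shows False
proof -
  consider "j = 0" | "1 \<le> j" | "j \<le> - 1" by linarith
  then show False
  proof cases
    case 1
    then have "i \<le> 0" using b by simp
    then have "i * int F \<le> 0" by (simp add: mult_nonpos_nonneg)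
    then show False using m 1 by simp
  next
    case 2
    then have "int F' \<le> j * int F'" using mult_right_mono[of 1 j "int F'"] by simp
    then have "i * int F < 0" using m by linarith
    then have "i \<le> - 1" by (simp add: mult_less_0_iff)
    then have "of_int i \<le> (- 1 :: real)" by (metis of_int_le_iff of_int_minus of_int_1)
    moreover have "golden_alpha \<le> of_int j * golden_alpha"
      using mult_right_mono[of 1 "of_int j" golden_alpha] 2 golden_alpha_bounds by simp
    ultimately show False using b golden_alpha_bounds by linarith
  next
    case 3
    then have "j * int F' \<le> 0" by (simp add: mult_nonpos_nonneg)
    then have "0 < i * int F" using m by linarith
    then have "1 \<le> i" by (simp add: zero_less_mult_iff)
    then have "(1 :: real) \<le> of_int i" by simp
    moreover have "of_int j * golden_alpha \<le> 0" using 3 golden_alpha_bounds by (simp add: mult_nonpos_nonneg)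
    ultimately show False using b golden_alpha_bounds by linarith
  qed
qed

text \<open>The shift changes the multiple of the golden mean by \<open>fib k - e\<close> with a
  tiny \<open>e\<close>, so the floors can disagree only if an integer lies within \<open>e\<close>
  of \<open>x\<close> on one side. Cassini's identity makes consecutive Fibonacci pairs a basis of
  the integer lattice, and \<open>lattice_gap\<close> excludes so good an approximation.\<close>

lemma floor_golden_shift:
  assumes m: "0 < m" "m < int (fib (Suc (Suc k)))"
  shows "\<lfloor>of_int (m + int (fib (Suc k))) * golden_alpha\<rfloor> = \<lfloor>of_int m * golden_alpha\<rfloor> + int (fib k)"
proof -
  define e where "e = (- golden_alpha) ^ Suc k"
  define x where "x = of_int m * golden_alpha"
  have e1: "golden_alpha * real (fib (Suc k)) = real (fib k) - e"
    using fib_golden[of k] by (simp add: e_def mult.commute)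
  have e2: "golden_alpha * real (fib (Suc (Suc k))) = real (fib (Suc k)) + golden_alpha * e"
    using fib_golden[of "Suc k"] by (simp add: e_def mult.commute)
  have e0: "e \<noteq> 0" "\<bar>e\<bar> < 1"
  proof -
    show "e \<noteq> 0" using golden_alpha_bounds by (simp add: e_def)
    have "golden_alpha ^ Suc k < 1" using golden_alpha_bounds by (intro power_Suc_less_one) auto
    then show "\<bar>e\<bar> < 1" using golden_alpha_bounds by (simp add: e_def power_abs abs_mult)
  qed
  have no: False if q: "0 \<le> (x - of_int q) / e" "(x - of_int q) / e \<le> 1" for q :: int
  proof -
    define D :: int where "D = (int (fib (Suc k)))^2 - int (fib (Suc (Suc k))) * int (fib k)"
    have "D = (- 1) ^ k" using fib_Cassini_int[of k] by (simp add: D_def)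
    then have DD: "D * D = 1" by (simp flip: power_add)
    define i j where "i = D * (m * int (fib (Suc k)) - q * int (fib (Suc (Suc k))))" and "j = D * (q * int (fib (Suc k)) - m * int (fib k))"
    have "i * int (fib (Suc k)) + j * int (fib (Suc (Suc k))) = D * D * m"
      by (simp add: i_def j_def D_def power2_eq_square algebra_simps del: fib.simps)
    then have mi: "i * int (fib (Suc k)) + j * int (fib (Suc (Suc k))) = m" by (simp add: DD del: fib.simps)
    have "i * int (fib k) + j * int (fib (Suc k)) = D * D * q"
      by (simp add: i_def j_def D_def power2_eq_square algebra_simps del: fib.simps)
    then have qi: "i * int (fib k) + j * int (fib (Suc k)) = q" by (simp add: DD del: fib.simps)
    have "x - of_int q = of_int i * (golden_alpha * real (fib (Suc k)) - real (fib k)) + of_int j * (golden_alpha * real (fib (Suc (Suc k))) - real (fib (Suc k)))"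
      unfolding x_def mi[symmetric] qi[symmetric] by (simp add: algebra_simps del: fib.simps)
    also have "\<dots> = - e * (of_int i - of_int j * golden_alpha)" unfolding e1 e2 by (simp add: algebra_simps)
    finally have "(x - of_int q) / e = - (of_int i - of_int j * golden_alpha)" using e0 by simp
    then show False using q m unfolding mi[symmetric] by (intro lattice_gap[of i "fib (Suc k)" j "fib (Suc (Suc k))"]) auto
  qed
  have "\<lfloor>x - e\<rfloor> = \<lfloor>x\<rfloor>"
  proof (rule ccontr)
    assume ne: "\<lfloor>x - e\<rfloor> \<noteq> \<lfloor>x\<rfloor>"
    show False
    proof (cases "0 < e")
      case True
      then have "\<lfloor>x - e\<rfloor> \<le> \<lfloor>x\<rfloor>" by (intro floor_mono) simp
      then have "x - e < of_int \<lfloor>x\<rfloor>" using ne by linarith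
      then have "x - of_int \<lfloor>x\<rfloor> \<le> e" "0 \<le> x - of_int \<lfloor>x\<rfloor>" by linarith+
      then show False using no[of "\<lfloor>x\<rfloor>"] True by simp
    next
      case False
      then have neg: "e < 0" using e0 by simp
      then have "\<lfloor>x\<rfloor> \<le> \<lfloor>x - e\<rfloor>" by (intro floor_mono) simp
      then have "of_int (\<lfloor>x\<rfloor> + 1) \<le> x - e" using ne by linarith
      moreover have "x \<le> of_int (\<lfloor>x\<rfloor> + 1)" by simp
      ultimately show False using no[of "\<lfloor>x\<rfloor> + 1"] neg by (simp add: divide_nonpos_neg neg_divide_le_eq)
    qed
  qed
  moreover have "of_int (m + int (fib (Suc k))) * golden_alpha = x - e + of_int (int (fib k))"
    using e1 by (simp add: x_def algebra_simps)
  ultimately show ?thesis unfolding x_def by (simp del: of_int_add of_int_of_nat_eq)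
qed

lemma sturmian_repeat:
  assumes "0 < n" "n + 1 < int (fib (Suc (Suc k)))"
  shows "sturmian 0 (n + int (fib (Suc k))) = sturmian 0 n"
proof -
  have "n + int (fib (Suc k)) + 1 = n + 1 + int (fib (Suc k))" by simp
  then show ?thesis
    unfolding sturmian_def using floor_golden_shift[of n k] floor_golden_shift[of "n + 1" k] assms
    by (simp only: add_0_right)
qed

lemma sturmian_0: "sturmian 0 1 = 1" "sturmian 0 2 = 0"
proof -
  have "\<lfloor>golden_alpha\<rfloor> = 0" "\<lfloor>2 * golden_alpha\<rfloor> = 1" "\<lfloor>3 * golden_alpha\<rfloor> = 1"
    using golden_alpha_bounds by (auto intro!: floor_unique)
  then show "sturmian 0 1 = 1" "sturmian 0 2 = 0" by (simp_all add: sturmian_def)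
qed

text \<open>By Kronecker's theorem every finite factor of one word occurs in any other, at a
  positive position. Floors are right continuous, so a finite window is unchanged under small phase
  shifts to the right.\<close>

lemma sturmian_window:
  "\<exists>a>0. \<forall>i. 1 \<le> i \<longrightarrow> i \<le> L \<longrightarrow> sturmian \<omega>' (a + i) = sturmian \<omega> (p + i)"
proof -
  define \<theta> where "\<theta> = of_int p * golden_alpha + \<omega>"
  define y where "y = (\<lambda>i :: int. of_int i * golden_alpha + \<theta>)"
  define G where "G = (\<lambda>i. of_int \<lfloor>y i\<rfloor> + 1 - y i) ` {1..L + 1}"
  define \<eta> where "\<eta> = Min (insert 1 G)"
  have fin: "finite G" by (simp add: G_def)
  have \<eta>: "0 < \<eta>" "\<eta> \<le> 1" unfolding \<eta>_def using fin by (auto simp: G_def)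
  have \<eta>i: "\<eta> \<le> of_int \<lfloor>y i\<rfloor> + 1 - y i" if "1 \<le> i" "i \<le> L + 1" for i
    unfolding \<eta>_def using fin that by (intro Min_le) (auto simp: G_def)
  have stable: "\<lfloor>y i + s\<rfloor> = \<lfloor>y i\<rfloor>" if "1 \<le> i" "i \<le> L + 1" "0 \<le> s" "s < \<eta>" for i s
    using \<eta>i[OF that(1,2)] that(3,4) by (intro floor_unique) linarith+
  \<comment> \<open>The target is the middle of the admissible shifts from 0 to
    \<open>\<eta>\<close>, so an approximation up to \<open>\<eta> / 2\<close> on either side stays
    admissible.\<close>
  define t where "t = \<theta> - \<omega>' + \<eta> / 2"
  obtain k where k: "0 < k" "\<bar>frac (real k * golden_alpha) - frac t\<bar> < \<eta> / 2"
    by (rule Kronecker_approx_1_explicit[OF golden_alpha_irrational, of "frac t" "\<eta> / 2"])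
      (use \<eta> frac_lt_1[of t] in \<open>auto intro: less_imp_le\<close>)
  define N where "N = \<lfloor>real k * golden_alpha\<rfloor> - \<lfloor>t\<rfloor>"
  define s where "s = real k * golden_alpha + \<omega>' - \<theta> - of_int N"
  have "s = \<eta> / 2 + (frac (real k * golden_alpha) - frac t)"
    by (simp add: s_def N_def frac_def t_def)
  then have s: "0 \<le> s" "s < \<eta>" using k(2) by linarith+
  have shift: "of_int (int k + i) * golden_alpha + \<omega>' = y i + s + of_int N" for i
    by (simp add: y_def s_def algebra_simps)
  have orig: "of_int (p + i) * golden_alpha + \<omega> = y i" for i
    by (simp add: y_def \<theta>_def algebra_simps)
  have "sturmian \<omega>' (int k + i) = sturmian \<omega> (p + i)" if i: "1 \<le> i" "i \<le> L" for i
  proof -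
    have "sturmian \<omega>' (int k + i) = \<lfloor>y (i + 1) + s + of_int N\<rfloor> - \<lfloor>y i + s + of_int N\<rfloor>"
      unfolding sturmian_def using shift[of i] shift[of "i + 1"] by (simp only: add.assoc)
    also have "\<dots> = \<lfloor>y (i + 1)\<rfloor> - \<lfloor>y i\<rfloor>" using stable[of i s] stable[of "i + 1" s] i s by simp
    also have "\<dots> = sturmian \<omega> (p + i)"
      unfolding sturmian_def using orig[of i] orig[of "i + 1"] by (simp only: add.assoc)
    finally show ?thesis .
  qed
  then show ?thesis using k(1) by (intro exI[of _ "int k"]) auto
qed

text \<open>The prefix of length \<open>fib (k + 4)\<close> is the prefix of length
  \<open>fib (k + 3)\<close> followed by that of length \<open>fib (k + 2)\<close>, by
  \<open>sturmian_repeat\<close>; this matches the recursion of \<open>transfer\<close>. The first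
  two levels are computed from the letters 1, 0.\<close>

lemma transfer_word:
  fixes u :: "nat \<Rightarrow> real"
  assumes "2 \<le> k"
    and "\<And>n. n < fib k \<Longrightarrow> u (a + n + 2) = (E - V * of_int (sturmian 0 (int n + 1))) * u (a + n + 1) - u (a + n)"
  shows "(u (a + fib k + 1), u (a + fib k)) = mat2_app (transfer V E k) (u (a + 1), u a)"
proof -
  define P where "P = (\<lambda>k. \<forall>a. (\<forall>n < fib k. u (a + n + 2) = (E - V * of_int (sturmian 0 (int n + 1))) * u (a + n + 1) - u (a + n)) \<longrightarrow>
    (u (a + fib k + 1), u (a + fib k)) = mat2_app (transfer V E k) (u (a + 1), u a))"
  have "P (k + 2) \<and> P (k + 3)" for k
  proof (induction k)
    case 0
    have "P 2"
      unfolding P_def using sturmian_0(1) by (auto simp: numeral_2_eq_2)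
    moreover have "P 3"
      unfolding P_def
    proof (intro allI impI)
      fix a assume h: "\<forall>n < fib 3. u (a + n + 2) = (E - V * of_int (sturmian 0 (int n + 1))) * u (a + n + 1) - u (a + n)"
      have f3: "fib 3 = 2" by (simp add: numeral_3_eq_3)
      have e2: "u (a + 2) = (E - V) * u (a + 1) - u a" using h[rule_format, of 0] sturmian_0(1) f3 by simp
      have e3: "u (a + 2 + 1) = E * ((E - V) * u (a + 1) - u a) - u (a + 1)"
        using h[rule_format, of 1] sturmian_0(2) f3 e2 by (simp add: numeral_eq_Suc)
      have tr: "transfer V E 3 = mat2_mul (E, -1, 1, 0) (mat2_mul (1, - V, 0, 1) (E, -1, 1, 0))"
        by (simp add: numeral_3_eq_3)
      show "(u (a + fib 3 + 1), u (a + fib 3)) = mat2_app (transfer V E 3) (u (a + 1), u a)"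
        unfolding f3 tr e2 e3 by (simp add: algebra_simps)
    qed
    ultimately show ?case by (simp only: add_0_left simp_thms)
  next
    case (Suc k)
    have "P (k + 4)"
      unfolding P_def
    proof (intro allI impI)
      fix a assume h: "\<forall>n < fib (k + 4). u (a + n + 2) = (E - V * of_int (sturmian 0 (int n + 1))) * u (a + n + 1) - u (a + n)"
      have f: "fib (k + 4) = fib (k + 3) + fib (k + 2)" by (simp add: numeral_eq_Suc)
      have one: "(u (a + fib (k + 3) + 1), u (a + fib (k + 3))) = mat2_app (transfer V E (k + 3)) (u (a + 1), u a)"
        using Suc h unfolding P_def f by auto
      define a' where "a' = a + fib (k + 3)"
      have "u (a' + n + 2) = (E - V * of_int (sturmian 0 (int n + 1))) * u (a' + n + 1) - u (a' + n)" if n: "n < fib (k + 2)" for n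
      proof -
        have "2 \<le> fib (k + 3)" using fib_mono[of 3 "k + 3"] by (simp add: numeral_3_eq_3)
        then have "sturmian 0 ((int n + 1) + int (fib (Suc (k + 2)))) = sturmian 0 (int n + 1)"
          using n f by (intro sturmian_repeat) (simp_all add: numeral_eq_Suc)
        moreover have "int (fib (k + 3) + n) + 1 = (int n + 1) + int (fib (Suc (k + 2)))" by (simp add: numeral_eq_Suc)
        ultimately have rep: "sturmian 0 (int (fib (k + 3) + n) + 1) = sturmian 0 (int n + 1)" by metis
        have "u (a + (fib (k + 3) + n) + 2) = (E - V * of_int (sturmian 0 (int (fib (k + 3) + n) + 1))) * u (a + (fib (k + 3) + n) + 1) - u (a + (fib (k + 3) + n))"
          using h n f by auto
        then show ?thesis unfolding rep by (simp only: a'_def add.assoc)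
      qed
      then have two: "(u (a' + fib (k + 2) + 1), u (a' + fib (k + 2))) = mat2_app (transfer V E (k + 2)) (u (a' + 1), u a')"
        using Suc unfolding P_def by blast
      have tr: "transfer V E (k + 4) = mat2_mul (transfer V E (k + 2)) (transfer V E (k + 3))" by (simp add: numeral_eq_Suc)
      show "(u (a + fib (k + 4) + 1), u (a + fib (k + 4))) = mat2_app (transfer V E (k + 4)) (u (a + 1), u a)"
        unfolding tr mat2_app_mul using one two by (simp add: a'_def f add.assoc)
    qed
    then show ?case using Suc by (simp add: numeral_eq_Suc)
  qed
  then have "P k" using assms(1) by (metis add.commute le_Suc_ex)
  then show ?thesis using assms(2) unfolding P_def by blast
qed

subsection \<open>Finite truncations of the operator\<close>

lemma linear_coefficient_zero:
  fixes b c :: real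
  assumes "\<And>t. 0 \<le> t * b + t^2 * c"
  shows "b = 0"
proof (rule ccontr)
  assume b: "b \<noteq> 0"
  define d where "d = \<bar>c\<bar> + 1"
  have d: "0 < d" "c < d" by (auto simp: d_def)
  have "0 \<le> (- b / d) * b + (- b / d)^2 * c" by (rule assms)
  also have "\<dots> < (- b / d) * b + (- b / d)^2 * d"
    using b d by (intro add_strict_left_mono mult_strict_left_mono) auto
  also have "\<dots> = 0" using d by (simp add: power2_eq_square field_simps)
  finally show False by simp
qed

text \<open>A minimiser \<open>\<psi>\<close> of \<open>\<parallel>B \<psi>\<parallel>\<close> on the unit sphere satisfies \<open>B (B \<psi>) = \<mu>\<^sup>2 \<psi>\<close>, so that \<open>\<psi>\<close> or
  \<open>B \<psi> + \<mu> \<psi>\<close> is an eigenvector with eigenvalue \<open>- \<mu>\<close> or \<open>\<mu>\<close>.\<close>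

lemma symmetric_lower_bound:
  fixes B :: "(int \<Rightarrow> real) \<Rightarrow> int \<Rightarrow> real"
  assumes fin: "finite I" and e: "0 < e"
    and lin: "\<And>a b \<psi> \<phi> n. B (\<lambda>n. a * \<psi> n + b * \<phi> n) n = a * B \<psi> n + b * B \<phi> n"
    and sym: "\<And>\<psi> \<phi>. (\<Sum>n\<in>I. \<phi> n * B \<psi> n) = (\<Sum>n\<in>I. B \<phi> n * \<psi> n)"
    and cont: "\<And>n. continuous_on UNIV (\<lambda>\<psi>. B \<psi> n)"
    and local: "\<And>\<psi> \<phi> n. n \<in> I \<Longrightarrow> (\<And>j. j \<in> I \<Longrightarrow> \<psi> j = \<phi> j) \<Longrightarrow> B \<psi> n = B \<phi> n"
    and eig: "\<And>\<nu> \<psi> n. \<bar>\<nu>\<bar> \<le> e \<Longrightarrow> (\<And>n. n \<in> I \<Longrightarrow> B \<psi> n = \<nu> * \<psi> n) \<Longrightarrow> n \<in> I \<Longrightarrow> \<psi> n = 0"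
  shows "e^2 * (\<Sum>n\<in>I. (\<psi> n)^2) \<le> (\<Sum>n\<in>I. (B \<psi> n)^2)"
proof (rule ccontr)
  assume less: "\<not> ?thesis"
  define q where "q = (\<lambda>\<psi> :: int \<Rightarrow> real. \<Sum>n\<in>I. (\<psi> n)^2)"
  define J where "J = (\<lambda>\<psi>. \<Sum>n\<in>I. (B \<psi> n)^2)"
  define cut where "cut = (\<lambda>\<psi> n. if n \<in> I then \<psi> n else (0 :: real))"
  have q0: "0 \<le> q \<psi>" and J0: "0 \<le> J \<psi>" for \<psi> by (auto simp: q_def J_def sum_nonneg)
  have scale: "B (\<lambda>n. a * \<psi> n) n = a * B \<psi> n" for a \<psi> n using lin[of a \<psi> 0 \<psi> n] by simp
  have Jcut: "J (cut \<psi>) = J \<psi>" and qcut: "q (cut \<psi>) = q \<psi>" for \<psi>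
    unfolding J_def q_def using local[of _ "cut \<psi>" \<psi>] by (auto simp: cut_def intro!: sum.cong)
  have Jscale: "J (\<lambda>n. a * \<psi> n) = a^2 * J \<psi>" and qscale: "q (\<lambda>n. a * \<psi> n) = a^2 * q \<psi>" for a \<psi>
    by (simp_all add: J_def q_def scale power_mult_distrib sum_distrib_left)
  \<comment> \<open>Coordinates outside \<open>I\<close> are frozen at 0, so the product of all
    coordinate sets is compact in the product topology and no finite-dimensional vector space is
    needed.\<close>
  define K where "K = (\<Pi>\<^sub>E n\<in>UNIV. if n \<in> I then {-1..1} else {0 :: real}) \<inter> {\<psi>. q \<psi> = 1}"
  have contn: "continuous_on UNIV (\<lambda>\<psi> :: int \<Rightarrow> real. \<psi> n)" for n by (rule continuous_on_product_coordinates)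
  have "compact (\<Pi>\<^sub>E n\<in>UNIV. if n \<in> I then {-1..1} else {0 :: real})"
    unfolding compactin_euclidean_iff[symmetric] euclidean_product_topology[symmetric] compactin_PiE by auto
  then have "compact K"
    unfolding K_def q_def by (intro compact_Int_closed closed_Collect_eq continuous_intros contn)
  have inK: "cut (\<lambda>n. \<psi> n / sqrt (q \<psi>)) \<in> K" if "0 < q \<psi>" for \<psi>
  proof -
    define \<phi> where "\<phi> = (\<lambda>n. \<psi> n / sqrt (q \<psi>))"
    have "\<phi> = (\<lambda>n. (1 / sqrt (q \<psi>)) * \<psi> n)" by (simp add: \<phi>_def)
    then have q1: "q \<phi> = 1" using qscale[of "1 / sqrt (q \<psi>)" \<psi>] that by (simp add: power_divide)
    have "\<bar>\<phi> n\<bar> \<le> 1" if n: "n \<in> I" for n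
    proof -
      have "(\<phi> n)^2 \<le> q \<phi>" unfolding q_def using fin n by (intro member_le_sum) auto
      then show ?thesis using q1 by (simp add: abs_square_le_1)
    qed
    then have "cut \<phi> \<in> K" using q1 qcut[of \<phi>] by (auto simp: K_def cut_def abs_le_iff)
    then show ?thesis by (simp add: \<phi>_def)
  qed
  have less': "J \<psi> < e^2 * q \<psi>" using less by (simp add: J_def q_def not_le)
  then have q\<psi>: "0 < q \<psi>" using J0[of \<psi>] q0[of \<psi>] by (cases "q \<psi> = 0") auto
  have "continuous_on K J" unfolding J_def by (intro continuous_intros continuous_on_subset[OF cont]) auto
  then obtain \<psi>0 where \<psi>0: "\<psi>0 \<in> K" "\<And>\<phi>. \<phi> \<in> K \<Longrightarrow> J \<psi>0 \<le> J \<phi>"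
    using continuous_attains_inf[OF \<open>compact K\<close>] inK[OF q\<psi>] by blast
  define m where "m = J \<psi>0"
  have lower: "m * q \<phi> \<le> J \<phi>" for \<phi>
  proof (cases "q \<phi> = 0")
    case False
    then have pos: "0 < q \<phi>" using q0[of \<phi>] by linarith
    have "m \<le> J (cut (\<lambda>n. \<phi> n / sqrt (q \<phi>)))" unfolding m_def by (rule \<psi>0(2)[OF inK[OF pos]])
    also have "\<dots> = J (\<lambda>n. (1 / sqrt (q \<phi>)) * \<phi> n)" unfolding Jcut by simp
    also have "\<dots> = J \<phi> / q \<phi>" unfolding Jscale using pos by (simp add: power_divide)
    finally show ?thesis using pos by (simp add: field_simps)
  qed (use J0 in simp)
  have q1: "q \<psi>0 = 1" using \<psi>0(1) by (simp add: K_def)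
  have "m * q \<psi> \<le> J \<psi>" by (rule lower)
  then have "m * q \<psi> < e^2 * q \<psi>" using less' by linarith
  then have me: "m < e^2" using q\<psi> by simp
  have crit: "(\<Sum>n\<in>I. B \<psi>0 n * B \<phi> n) = m * (\<Sum>n\<in>I. \<psi>0 n * \<phi> n)" for \<phi>
  proof -
    define b where "b = 2 * ((\<Sum>n\<in>I. B \<psi>0 n * B \<phi> n) - m * (\<Sum>n\<in>I. \<psi>0 n * \<phi> n))"
    have "0 \<le> t * b + t^2 * (J \<phi> - m * q \<phi>)" for t
    proof -
      define \<psi>t where "\<psi>t = (\<lambda>n. 1 * \<psi>0 n + t * \<phi> n)"
      have "J \<psi>t = J \<psi>0 + 2 * t * (\<Sum>n\<in>I. B \<psi>0 n * B \<phi> n) + t^2 * J \<phi>"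
        unfolding J_def \<psi>t_def lin
        by (simp add: power2_sum power_mult_distrib sum.distrib sum_distrib_left mult_ac)
      moreover have "q \<psi>t = q \<psi>0 + 2 * t * (\<Sum>n\<in>I. \<psi>0 n * \<phi> n) + t^2 * q \<phi>"
        unfolding q_def \<psi>t_def
        by (simp add: power2_sum power_mult_distrib sum.distrib sum_distrib_left mult_ac)
      moreover have "m * q \<psi>t \<le> J \<psi>t" by (rule lower)
      ultimately show ?thesis using q1 by (simp add: b_def m_def algebra_simps)
    qed
    then have "b = 0" by (rule linear_coefficient_zero)
    then show ?thesis by (simp add: b_def)
  qed
  define r where "r = (\<lambda>n. 1 * B (B \<psi>0) n + (- m) * \<psi>0 n)"
  have "(\<Sum>n\<in>I. (r n)^2) = (\<Sum>n\<in>I. B (B \<psi>0) n * r n) - m * (\<Sum>n\<in>I. \<psi>0 n * r n)"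
    by (simp add: r_def power2_eq_square algebra_simps sum.distrib sum_subtractf sum_distrib_left)
  also have "(\<Sum>n\<in>I. B (B \<psi>0) n * r n) = (\<Sum>n\<in>I. B \<psi>0 n * B r n)" using sym[of "B \<psi>0" r] by (simp add: mult.commute)
  also have "\<dots> - m * (\<Sum>n\<in>I. \<psi>0 n * r n) = 0" using crit[of r] by simp
  finally have "\<forall>n\<in>I. (r n)^2 = 0" using sum_nonneg_eq_0_iff[OF fin, of "\<lambda>n. (r n)^2"] by simp
  then have BB: "B (B \<psi>0) n = m * \<psi>0 n" if "n \<in> I" for n using that by (simp add: r_def)
  define \<mu> where "\<mu> = sqrt m"
  have m0: "0 \<le> m" using J0 by (simp add: m_def)
  have \<mu>: "\<mu> * \<mu> = m" "\<bar>\<mu>\<bar> \<le> e"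
  proof -
    show "\<mu> * \<mu> = m" using m0 by (simp add: \<mu>_def)
    have "sqrt m \<le> sqrt (e^2)" using me by (intro real_sqrt_le_mono) simp
    then show "\<bar>\<mu>\<bar> \<le> e" using e m0 by (simp add: \<mu>_def)
  qed
  define \<phi> where "\<phi> = (\<lambda>n. 1 * B \<psi>0 n + \<mu> * \<psi>0 n)"
  have "\<phi> n = 0" if "n \<in> I" for n
  proof (rule eig[OF \<mu>(2) _ that])
    show "B \<phi> n = \<mu> * \<phi> n" if "n \<in> I" for n
      unfolding \<phi>_def lin using BB[OF that] \<mu>(1) by (simp add: algebra_simps)
  qed
  then have "B \<psi>0 n = (- \<mu>) * \<psi>0 n" if "n \<in> I" for n using that by (simp add: \<phi>_def add_eq_0_iff)
  then have "\<psi>0 n = 0" if "n \<in> I" for n using eig[of "- \<mu>" \<psi>0 n] \<mu>(2) that by simp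
  then have "q \<psi>0 = 0" by (simp add: q_def)
  then show False using q1 by simp
qed

definition jacobi :: "(int \<Rightarrow> real) \<Rightarrow> (int \<Rightarrow> 'a::real_normed_algebra_1) \<Rightarrow> int \<Rightarrow> 'a" where
  "jacobi w f n = f (n + 1) + f (n - 1) + of_real (w n) * f n"

text \<open>The periodic closure of a finite Jacobi matrix. Unlike a truncation with free ends it
  has eigenvectors that are governed by the trace of the transfer matrix alone.\<close>

definition cyclic :: "int \<Rightarrow> (int \<Rightarrow> real) \<Rightarrow> (int \<Rightarrow> real) \<Rightarrow> int \<Rightarrow> real" where
  "cyclic N w \<psi> n = \<psi> ((n + 1) mod N) + \<psi> ((n - 1) mod N) + w n * \<psi> n"

lemma cyclic_lower_bound:
  assumes N: "0 < N" and e: "0 < e"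
    and eig: "\<And>\<nu> \<psi> n. \<bar>\<nu>\<bar> \<le> e \<Longrightarrow> (\<And>n. n \<in> {0..<N} \<Longrightarrow> cyclic N w \<psi> n = \<nu> * \<psi> n) \<Longrightarrow> n \<in> {0..<N} \<Longrightarrow> \<psi> n = 0"
  shows "e^2 * (\<Sum>n\<in>{0..<N}. (\<psi> n)^2) \<le> (\<Sum>n\<in>{0..<N}. (cyclic N w \<psi> n)^2)"
proof (rule symmetric_lower_bound[OF _ e])
  show "cyclic N w (\<lambda>n. a * \<psi> n + b * \<phi> n) n = a * cyclic N w \<psi> n + b * cyclic N w \<phi> n" for a b \<psi> \<phi> n
    by (simp add: cyclic_def algebra_simps)
  show "continuous_on UNIV (\<lambda>\<psi>. cyclic N w \<psi> n)" for n
    unfolding cyclic_def by (intro continuous_intros continuous_on_product_coordinates)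
  show "cyclic N w \<psi> n = cyclic N w \<phi> n" if "n \<in> {0..<N}" "\<And>j. j \<in> {0..<N} \<Longrightarrow> \<psi> j = \<phi> j" for \<psi> \<phi> n
    unfolding cyclic_def using that N by simp
  have shift: "(\<Sum>n\<in>{0..<N}. \<phi> n * \<psi> ((n + 1) mod N)) = (\<Sum>n\<in>{0..<N}. \<phi> ((n - 1) mod N) * \<psi> n)" for \<phi> \<psi> :: "int \<Rightarrow> real"
    by (rule sum.reindex_bij_witness[of _ "\<lambda>n. (n - 1) mod N" "\<lambda>n. (n + 1) mod N"])
      (use N in \<open>auto simp: mod_simps\<close>)
  show "(\<Sum>n\<in>{0..<N}. \<phi> n * cyclic N w \<psi> n) = (\<Sum>n\<in>{0..<N}. cyclic N w \<phi> n * \<psi> n)" for \<psi> \<phi>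
    using shift[of \<phi> \<psi>] shift[of \<psi> \<phi>]
    by (simp add: cyclic_def algebra_simps sum.distrib)
qed (use eig in auto)

context coupling
begin

lemma stable_escape:
  assumes "E \<notin> trapped V"
  obtains e N0 where "0 < e" "\<And>j q. N0 \<le> j \<Longrightarrow> \<bar>q - E\<bar> \<le> e \<Longrightarrow> 2 < \<bar>X q j\<bar>"
proof -
  have "open (- trapped V)" using closed_trapped by (simp add: open_Compl)
  then obtain d where d: "0 < d" "ball E d \<subseteq> - trapped V" using assms open_contains_ball by blast
  have "{E - d / 2..E + d / 2} \<inter> trapped V = {}"
  proof -
    have "q \<in> - trapped V" if "q \<in> {E - d / 2..E + d / 2}" for q
    proof (rule subsetD[OF d(2)])
      show "q \<in> ball E d" using that d(1) by (simp add: dist_real_def) linarith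
    qed
    then show ?thesis by blast
  qed
  from uniform_escape[OF compact_Icc this] obtain N0 where
    N0: "\<And>j q. N0 \<le> j \<Longrightarrow> q \<in> {E - d / 2..E + d / 2} \<Longrightarrow> 2 < \<bar>X q j\<bar>" by blast
  show thesis
  proof (rule that[of "d / 2" N0])
    fix j q assume j: "N0 \<le> j" and q: "\<bar>q - E\<bar> \<le> d / 2"
    have "q \<in> {E - d / 2..E + d / 2}" using q unfolding atLeastAtMost_iff by linarith
    then show "2 < \<bar>X q j\<bar>" by (rule N0[OF j])
  qed (use d in simp)
qed

text \<open>An eigenvector of the cyclic matrix gives a fixed vector of the transfer matrix at
  energy \<open>E + \<nu>\<close> over one period. With determinant 1, a nonzero fixed vector would
  force the trace to be 2.\<close>

lemma no_periodic_solution: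
  assumes k: "2 \<le> k" and N: "N = int (fib k)" and X: "X (E + \<nu>) k \<noteq> 2"
    and w: "\<And>n. w n = V * of_int (sturmian 0 (if n = 0 then N else n)) - E"
    and \<psi>: "\<And>n. n \<in> {0..<N} \<Longrightarrow> cyclic N w \<psi> n = \<nu> * \<psi> n" and n: "n \<in> {0..<N}"
  shows "\<psi> n = 0"
proof -
  define u where "u = (\<lambda>j :: nat. \<psi> (int j mod N))"
  have N0: "0 < N" using N fib_neq_0_nat[of k] k by simp
  have rec: "u (0 + j + 2) = ((E + \<nu>) - V * of_int (sturmian 0 (int j + 1))) * u (0 + j + 1) - u (0 + j)" if j: "j < fib k" for j
  proof -
    define p where "p = (int j + 1) mod N"
    have p: "p \<in> {0..<N}" using N0 by (simp add: p_def)
    \<comment> \<open>The word begins at site 1 but residues begin at 0, so residue 0 carries the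
      letter of site \<open>N\<close>.\<close>
    have letter: "(if p = 0 then N else p) = int j + 1"
    proof (cases "int j + 1 = N")
      case False
      then have "int j + 1 < N" using j N by simp
      then have "p = int j + 1" unfolding p_def by (intro mod_pos_pos_trivial) auto
      then show ?thesis by simp
    qed (simp add: p_def)
    have "(p + 1) mod N = int (j + 2) mod N" "(p - 1) mod N = int j mod N"
      by (simp_all add: p_def mod_simps add.commute)
    then have "u (j + 2) + u j + w p * u (j + 1) = \<nu> * u (j + 1)"
      using \<psi>[OF p] by (simp add: cyclic_def u_def p_def add.commute)
    moreover have "w p = V * of_int (sturmian 0 (int j + 1)) - E" using w[of p] letter by simp
    ultimately show ?thesis by (simp add: algebra_simps)
  qed
  have "(u (fib k + 1), u (fib k)) = mat2_app (transfer V (E + \<nu>) k) (u 1, u 0)"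
    using transfer_word[OF k rec] by simp
  moreover have "u (fib k + 1) = u 1" "u (fib k) = u 0"
    by (simp_all add: u_def N mod_simps)
  ultimately have fixed: "(u 1, u 0) = mat2_app (transfer V (E + \<nu>) k) (u 1, u 0)" by simp
  obtain a b c d where M: "transfer V (E + \<nu>) k = (a, b, c, d)" by (cases "transfer V (E + \<nu>) k")
  have det: "a * d - b * c = 1" using transfer_det[of V "E + \<nu>" k] by (simp add: M)
  have tr: "a + d \<noteq> 2" using X transfer_tr[of V "E + \<nu>" k] by (simp add: M)
  have e1: "(a - 1) * u 1 + b * u 0 = 0" "c * u 1 + (d - 1) * u 0 = 0"
    using fixed by (auto simp: M algebra_simps)
  have D: "(a - 1) * (d - 1) - b * c = 2 - (a + d)" using det by (simp add: algebra_simps)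
  have "((a - 1) * (d - 1) - b * c) * u 1 = (d - 1) * ((a - 1) * u 1 + b * u 0) - b * (c * u 1 + (d - 1) * u 0)"
    by (simp add: algebra_simps)
  then have z1: "(2 - (a + d)) * u 1 = 0" unfolding D e1 by simp
  have "((a - 1) * (d - 1) - b * c) * u 0 = (a - 1) * (c * u 1 + (d - 1) * u 0) - c * ((a - 1) * u 1 + b * u 0)"
    by (simp add: algebra_simps)
  then have z0: "(2 - (a + d)) * u 0 = 0" unfolding D e1 by simp
  have "u 0 = 0" "u 1 = 0" using z0 z1 tr by auto
  then have "u j = 0 \<and> u (j + 1) = 0" if "j \<le> fib k" for j
    using that
  proof (induction j)
    case (Suc j)
    then show ?case using rec[of j] by simp
  qed simp
  moreover have "nat n \<le> fib k" using n N by auto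
  ultimately have "u (nat n) = 0" by blast
  then show ?thesis using n by (simp add: u_def)
qed

text \<open>The support of \<open>f\<close> sees a finite factor of the word, which also occurs in
  the word of phase 0; where \<open>f\<close> vanishes the potential does not matter. So
  \<open>f\<close> can be moved into a long cycle. The constant \<open>e\<close> does not depend on
  the length, since all late traces exceed 2 on a whole neighbourhood of \<open>E\<close>.\<close>

lemma escape_lower_bound:
  assumes E: "E \<notin> trapped V"
  obtains e where "0 < e" "\<And>\<omega> (f :: int \<Rightarrow> real) p L. (\<And>n. n \<le> p \<or> p + L < n \<Longrightarrow> f n = 0) \<Longrightarrow>
    e^2 * (\<Sum>n\<in>{p..p + L + 1}. (f n)^2) \<le> (\<Sum>n\<in>{p..p + L + 1}. (jacobi (\<lambda>n. V * of_int (sturmian \<omega> n) - E) f n)^2)"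
proof -
  obtain e N0 where e: "0 < e" "\<And>j q. N0 \<le> j \<Longrightarrow> \<bar>q - E\<bar> \<le> e \<Longrightarrow> 2 < \<bar>X q j\<bar>" by (rule stable_escape[OF E]) blast
  show thesis
  proof (rule that[OF e(1)])
    fix \<omega> and f :: "int \<Rightarrow> real" and p L :: int
    assume supp: "\<And>n. n \<le> p \<or> p + L < n \<Longrightarrow> f n = 0"
    obtain q where q: "0 < q" "\<And>i. 1 \<le> i \<Longrightarrow> i \<le> L \<Longrightarrow> sturmian 0 (q + i) = sturmian \<omega> (p + i)"
      using sturmian_window[of L 0 \<omega> p] by blast
    define k where "k = N0 + 2 + nat (q + \<bar>L\<bar> + 4)"
    define N where "N = int (fib k)"
    have k: "2 \<le> k" "N0 \<le> k" by (auto simp: k_def)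
    have Nbig: "q + L + 2 < N" "q + 2 < N"
    proof -
      have "k - 1 \<le> fib k" using le_fib_Suc[of "k - 1"] k(1) by (simp del: fib.simps)
      moreover have "nat (q + \<bar>L\<bar> + 4) \<le> k - 1" by (simp add: k_def)
      ultimately have "nat (q + \<bar>L\<bar> + 4) \<le> fib k" by (rule order_trans[rotated])
      then have "int (nat (q + \<bar>L\<bar> + 4)) \<le> N" unfolding N_def by (simp only: of_nat_le_iff)
      then show "q + L + 2 < N" "q + 2 < N" using q(1) by linarith+
    qed
    define w where "w = (\<lambda>n. V * of_int (sturmian 0 (if n = 0 then N else n)) - E)"
    define \<psi> where "\<psi> = (\<lambda>n. f (p - q + n))"
    have \<psi>0: "\<psi> n = 0" if "n \<le> q \<or> q + L < n" for n using supp that by (auto simp: \<psi>_def)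
    have bound: "e^2 * (\<Sum>n\<in>{0..<N}. (\<psi> n)^2) \<le> (\<Sum>n\<in>{0..<N}. (cyclic N w \<psi> n)^2)"
    proof (rule cyclic_lower_bound[OF _ e(1)])
      show "0 < N" using Nbig q by simp
      fix \<nu> \<psi> n assume "\<bar>\<nu>\<bar> \<le> e" "\<And>n. n \<in> {0..<N} \<Longrightarrow> cyclic N w \<psi> n = \<nu> * \<psi> n" "n \<in> {0..<N}"
      moreover have "X (E + \<nu>) k \<noteq> 2" using e(2)[OF k(2), of "E + \<nu>"] \<open>\<bar>\<nu>\<bar> \<le> e\<close> by auto
      ultimately show "\<psi> n = 0" using no_periodic_solution[OF k(1) N_def _ , of E \<nu> w \<psi> n] by (simp add: w_def)
    qed
    define g where "g = jacobi (\<lambda>n. V * of_int (sturmian \<omega> n) - E) f"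
    have g: "cyclic N w \<psi> n = g (p - q + n)" if n: "n \<in> {0..<N}" for n
    proof -
      have "\<psi> ((n + 1) mod N) = \<psi> (n + 1)"
        using n \<psi>0[of 0] \<psi>0[of N] Nbig q by (cases "n + 1 = N") auto
      moreover have "\<psi> ((n - 1) mod N) = \<psi> (n - 1)"
      proof (cases "n = 0")
        case True
        then have "(n - 1) mod N = N - 1" using Nbig q by (simp add: zmod_minus1)
        then show ?thesis using \<psi>0[of "N - 1"] \<psi>0[of "- 1"] True Nbig q by simp
      qed (use n in auto)
      moreover have "w n * \<psi> n = (V * of_int (sturmian \<omega> (p - q + n)) - E) * \<psi> n"
      proof (cases "q < n \<and> n \<le> q + L")
        case True
        then show ?thesis using q(1) q(2)[of "n - q"] by (simp add: w_def algebra_simps)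
      qed (use \<psi>0[of n] in auto)
      ultimately show ?thesis by (simp add: cyclic_def g_def jacobi_def \<psi>_def algebra_simps)
    qed
    have g0: "g n = 0" if "n < p \<or> p + L + 1 < n" for n
      using that supp by (auto simp: g_def jacobi_def)
    have f0: "f n = 0" if "n < p \<or> p + L + 1 < n" for n using that supp by auto
    have move: "(\<Sum>n\<in>{0..<N}. (h (p - q + n))^2) = (\<Sum>n\<in>{p..p + L + 1}. (h n)^2)"
      if h0: "\<And>n. n < p \<or> p + L + 1 < n \<Longrightarrow> h n = 0" for h :: "int \<Rightarrow> real"
    proof -
      have "(\<Sum>n\<in>{0..<N}. (h (p - q + n))^2) = (\<Sum>n\<in>{p - q..<p - q + N}. (h n)^2)"
        by (rule sum.reindex_bij_witness[of _ "\<lambda>n. n - (p - q)" "\<lambda>n. p - q + n"]) auto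
      also have "\<dots> = (\<Sum>n\<in>{p..p + L + 1}. (h n)^2)"
        by (rule sum.mono_neutral_right) (use h0 Nbig q in auto)
      finally show ?thesis .
    qed
    have mf: "(\<Sum>n\<in>{0..<N}. (f (p - q + n))^2) = (\<Sum>n\<in>{p..p + L + 1}. (f n)^2)"
      by (rule move) (rule f0)
    have mg: "(\<Sum>n\<in>{0..<N}. (g (p - q + n))^2) = (\<Sum>n\<in>{p..p + L + 1}. (g n)^2)"
      by (rule move) (rule g0)
    have "(\<Sum>n\<in>{0..<N}. (cyclic N w \<psi> n)^2) = (\<Sum>n\<in>{0..<N}. (g (p - q + n))^2)" using g by (intro sum.cong) auto
    then show "e^2 * (\<Sum>n\<in>{p..p + L + 1}. (f n)^2) \<le> (\<Sum>n\<in>{p..p + L + 1}. (jacobi (\<lambda>n. V * of_int (sturmian \<omega> n) - E) f n)^2)"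
      using bound mf mg by (simp add: \<psi>_def g_def)
  qed
qed

end

subsection \<open>Inverting Jacobi operators\<close>

text \<open>A quantitative form of square summability through finite sums only, so that all
  estimates can be made on finite windows.\<close>

definition square_bound :: "(int \<Rightarrow> complex) \<Rightarrow> real \<Rightarrow> bool" where
  "square_bound \<psi> c \<longleftrightarrow> (\<forall>F. finite F \<longrightarrow> (\<Sum>n\<in>F. (cmod (\<psi> n))^2) \<le> c)"

lemma square_bound_l2:
  assumes "square_bound \<psi> c"
  shows "\<psi> \<in> l2" "l2_norm \<psi> \<le> sqrt c"
proof -
  have s: "(\<lambda>n. (cmod (\<psi> n))^2) summable_on UNIV"
    by (rule nonneg_bdd_above_summable_on) (use assms in \<open>auto simp: square_bound_def bdd_above_def\<close>)
  then show "\<psi> \<in> l2" by (simp add: l2_def)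
  have "(\<Sum>\<^sub>\<infinity>n. (cmod (\<psi> n))^2) \<le> c"
    by (rule infsum_le_finite_sums[OF s]) (use assms in \<open>auto simp: square_bound_def\<close>)
  then show "l2_norm \<psi> \<le> sqrt c" unfolding l2_norm_def by (rule real_sqrt_le_mono)
qed

lemma l2_square_bound:
  assumes "\<psi> \<in> l2"
  shows "square_bound \<psi> ((l2_norm \<psi>)^2)"
proof -
  have "0 \<le> (\<Sum>\<^sub>\<infinity>n. (cmod (\<psi> n))^2)" by (rule infsum_nonneg) simp
  then have "(l2_norm \<psi>)^2 = (\<Sum>\<^sub>\<infinity>n. (cmod (\<psi> n))^2)" by (simp add: l2_norm_def)
  then show ?thesis
    unfolding square_bound_def using assms by (auto simp: l2_def intro!: finite_sum_le_infsum)
qed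

lemma square_bound_point: "square_bound \<psi> c \<Longrightarrow> cmod (\<psi> n) \<le> sqrt c"
  unfolding square_bound_def by (rule real_le_rsqrt) (use spec[of _ "{n}"] in force)

lemma l2_norm_nonneg: "0 \<le> l2_norm \<psi>"
  unfolding l2_norm_def by (intro real_sqrt_ge_zero infsum_nonneg) simp

lemma three_square_le: "(a + b + c)^2 \<le> 3 * (a^2 + b^2 + (c :: real)^2)"
proof -
  have "0 \<le> (a - b)^2 + (b - c)^2 + (a - c)^2" by simp
  then show ?thesis by (simp add: power2_eq_square algebra_simps)
qed

lemma shift_sum:
  assumes "\<And>n. n < a \<or> b < n \<Longrightarrow> h n = (0 :: real)"
  shows "(\<Sum>n\<in>{a - 1..b + 1}. h (n + 1)) = (\<Sum>n\<in>{a - 1..b + 1 :: int}. h n)"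
proof -
  have "(\<Sum>n\<in>{a - 1..b + 1}. h (n + 1)) = (\<Sum>n\<in>{a..b + 2}. h n)"
    by (rule sum.reindex_bij_witness[of _ "\<lambda>n. n - 1" "\<lambda>n. n + 1"]) auto
  also have "\<dots> = (\<Sum>n\<in>{a..b}. h n)" by (rule sum.mono_neutral_right) (use assms in auto)
  also have "\<dots> = (\<Sum>n\<in>{a - 1..b + 1}. h n)" by (rule sum.mono_neutral_left) (use assms in auto)
  finally show ?thesis .
qed

lemma jacobi_lin: "jacobi w (\<lambda>n. \<psi> n + \<phi> n) = (\<lambda>n. jacobi w \<psi> n + jacobi w \<phi> n)"
  and jacobi_scale: "jacobi w (\<lambda>n. c * \<psi> n) = (\<lambda>n. c * jacobi w \<psi> n)"
  and jacobi_diff: "jacobi w (\<lambda>n. \<psi> n - \<phi> n) = (\<lambda>n. jacobi w \<psi> n - jacobi w \<phi> n)"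
  for \<psi> \<phi> :: "int \<Rightarrow> 'a::real_normed_field"
  by (auto simp: jacobi_def algebra_simps)

locale jacobi_gap =
  fixes w :: "int \<Rightarrow> real" and c e :: real
  assumes w_bound: "\<And>n. \<bar>w n\<bar> \<le> c" and e_pos: "0 < e"
    and lower: "\<And>(f :: int \<Rightarrow> real) p L. (\<And>n. n \<le> p \<or> p + L < n \<Longrightarrow> f n = 0) \<Longrightarrow>
      e^2 * (\<Sum>n\<in>{p..p + L + 1}. (f n)^2) \<le> (\<Sum>n\<in>{p..p + L + 1}. (jacobi w f n)^2)"
begin

text \<open>An upper bound for the squared norm of the Jacobi operator: three terms, two shifts of
  norm 1 and a potential bounded by \<open>c\<close>. Its inverse is the step size below.\<close>

definition \<kappa> :: real where "\<kappa> = 3 * (2 + c^2)"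

text \<open>The contraction rate of the squared norm. The maximum with 1/2 only keeps it
  positive.\<close>

definition \<rho> :: real where "\<rho> = max (1 / 2) (1 - e^2 / \<kappa>)"

text \<open>One step of gradient descent for \<open>\<parallel>jacobi w \<psi>\<parallel>\<^sup>2\<close>. It is a contraction, and summing the
  corrections over all steps inverts the operator.\<close>

definition step :: "(int \<Rightarrow> 'a::real_normed_field) \<Rightarrow> int \<Rightarrow> 'a" where
  "step \<psi> = (\<lambda>n. \<psi> n - of_real (1 / \<kappa>) * jacobi w (jacobi w \<psi>) n)"

lemma \<kappa>_pos: "0 < \<kappa>"
  by (simp add: \<kappa>_def add_pos_nonneg)

lemma \<rho>: "0 < \<rho>" "\<rho> < 1"
  using e_pos \<kappa>_pos by (auto simp: \<rho>_def)

lemma w_square: "(w n)^2 \<le> c^2"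
  using power_mono[OF w_bound[of n] abs_ge_zero, of 2] by simp

lemma jacobi_square_bound:
  assumes "square_bound \<psi> b"
  shows "square_bound (jacobi w \<psi>) (\<kappa> * b)"
  unfolding square_bound_def
proof (intro allI impI)
  fix F :: "int set" assume F: "finite F"
  have sh: "(\<Sum>n\<in>F. (cmod (\<psi> (n + i)))^2) \<le> b" for i
  proof -
    have "(\<Sum>n\<in>F. (cmod (\<psi> (n + i)))^2) = (\<Sum>n\<in>(\<lambda>n. n + i) ` F. (cmod (\<psi> n))^2)"
      by (subst sum.reindex) (auto simp: inj_on_def)
    also have "\<dots> \<le> b" using assms F unfolding square_bound_def by blast
    finally show ?thesis .
  qed
  have "(cmod (jacobi w \<psi> n))^2 \<le> 3 * ((cmod (\<psi> (n + 1)))^2 + (cmod (\<psi> (n + - 1)))^2 + c^2 * (cmod (\<psi> (n + 0)))^2)" for n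
  proof -
    have "cmod (jacobi w \<psi> n) \<le> cmod (\<psi> (n + 1)) + cmod (\<psi> (n - 1)) + \<bar>w n\<bar> * cmod (\<psi> n)"
      unfolding jacobi_def by (intro order_trans[OF norm_triangle_ineq] add_mono norm_triangle_ineq) (simp add: norm_mult)
    then have "(cmod (jacobi w \<psi> n))^2 \<le> (cmod (\<psi> (n + 1)) + cmod (\<psi> (n - 1)) + \<bar>w n\<bar> * cmod (\<psi> n))^2" by (intro power_mono) auto
    also have "\<dots> \<le> 3 * ((cmod (\<psi> (n + 1)))^2 + (cmod (\<psi> (n - 1)))^2 + (\<bar>w n\<bar> * cmod (\<psi> n))^2)" by (rule three_square_le)
    also have "(\<bar>w n\<bar> * cmod (\<psi> n))^2 \<le> c^2 * (cmod (\<psi> n))^2"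
      unfolding power_mult_distrib using w_square[of n] by (intro mult_right_mono) auto
    finally show ?thesis by simp
  qed
  then have "(\<Sum>n\<in>F. (cmod (jacobi w \<psi> n))^2) \<le> (\<Sum>n\<in>F. 3 * ((cmod (\<psi> (n + 1)))^2 + (cmod (\<psi> (n + - 1)))^2 + c^2 * (cmod (\<psi> (n + 0)))^2))"
    by (intro sum_mono)
  also have "\<dots> = 3 * ((\<Sum>n\<in>F. (cmod (\<psi> (n + 1)))^2) + (\<Sum>n\<in>F. (cmod (\<psi> (n + - 1)))^2) + c^2 * (\<Sum>n\<in>F. (cmod (\<psi> (n + 0)))^2))"
    by (simp add: sum.distrib sum_distrib_left)
  also have "\<dots> \<le> 3 * (b + b + c^2 * b)"
    by (intro mult_left_mono add_mono sh) auto
  finally show "(\<Sum>n\<in>F. (cmod (jacobi w \<psi> n))^2) \<le> \<kappa> * b" by (simp add: \<kappa>_def algebra_simps)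
qed

text \<open>With the symmetric operator \<open>A\<close>, the squared norm of
  \<open>f - A (A f) / \<kappa>\<close> is that of \<open>f\<close> minus
  \<open>2 / \<kappa>\<close> times that of \<open>A f\<close> plus at most
  \<open>1 / \<kappa>\<close> times that of \<open>A f\<close>. The lower bound \<open>e^2\<close>
  for \<open>A\<close> gives the factor. The margin 2 in the window is the range of \<open>A\<close>
  applied twice.\<close>

lemma step_contracts_finite:
  fixes f :: "int \<Rightarrow> real"
  assumes supp: "\<And>n. N < \<bar>n\<bar> \<Longrightarrow> f n = 0" and N: "0 \<le> N"
  shows "(\<Sum>n\<in>{- N - 2..N + 2}. (step f n)^2) \<le> \<rho> * (\<Sum>n\<in>{- N - 2..N + 2}. (f n)^2)"
proof -
  define I where "I = {- N - 2..N + 2}"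
  define A where "A = (jacobi w :: (int \<Rightarrow> real) \<Rightarrow> int \<Rightarrow> real)"
  have sh: "(\<Sum>n\<in>I. h (n + 1)) = (\<Sum>n\<in>I. h n)" if "\<And>n. N + 1 < \<bar>n\<bar> \<Longrightarrow> h n = 0" for h :: "int \<Rightarrow> real"
  proof -
    have "{- N - 1 - 1..N + 1 + 1} = I" by (auto simp: I_def)
    moreover have "h n = 0" if "n < - N - 1 \<or> N + 1 < n" for n
      by (rule \<open>\<And>n. N + 1 < \<bar>n\<bar> \<Longrightarrow> h n = 0\<close>) (use that in auto)
    ultimately show ?thesis using shift_sum[of "- N - 1" "N + 1" h] by simp
  qed
  have A0: "A f n = 0" if "N + 1 < \<bar>n\<bar>" for n
    using supp[of n] supp[of "n + 1"] supp[of "n - 1"] that by (simp add: A_def jacobi_def)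
  have sym: "(\<Sum>n\<in>I. f n * A (A f) n) = (\<Sum>n\<in>I. A f n * A f n)"
  proof -
    have 1: "(\<Sum>n\<in>I. f n * A f (n + 1)) = (\<Sum>n\<in>I. f (n - 1) * A f n)"
      using sh[of "\<lambda>n. f (n - 1) * A f n"] A0 by simp
    have 2: "(\<Sum>n\<in>I. f n * A f (n - 1)) = (\<Sum>n\<in>I. f (n + 1) * A f n)"
      using sh[of "\<lambda>n. f n * A f (n - 1)"] supp by simp
    have "(\<Sum>n\<in>I. f n * A (A f) n) = (\<Sum>n\<in>I. f n * A f (n + 1)) + (\<Sum>n\<in>I. f n * A f (n - 1)) + (\<Sum>n\<in>I. w n * f n * A f n)"
      by (subst (1) A_def) (simp add: jacobi_def sum.distrib[symmetric] algebra_simps)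
    also have "\<dots> = (\<Sum>n\<in>I. (f (n - 1) + f (n + 1) + w n * f n) * A f n)"
      unfolding 1 2 by (simp add: sum.distrib[symmetric] algebra_simps)
    also have "\<dots> = (\<Sum>n\<in>I. A f n * A f n)"
      by (intro sum.cong) (auto simp: A_def jacobi_def add_ac)
    finally show ?thesis .
  qed
  define a where "a = (\<Sum>n\<in>I. (A f n)^2)"
  define q where "q = (\<Sum>n\<in>I. (f n)^2)"
  have AA: "(\<Sum>n\<in>I. (A (A f) n)^2) \<le> \<kappa> * a"
  proof -
    have "(A (A f) n)^2 \<le> 3 * ((A f (n + 1))^2 + (A f (n - 1))^2 + c^2 * (A f n)^2)" for n
    proof -
      have "A (A f) n = A f (n + 1) + A f (n - 1) + w n * A f n"
        by (subst (1) A_def) (simp add: jacobi_def)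
      then have "(A (A f) n)^2 \<le> 3 * ((A f (n + 1))^2 + (A f (n - 1))^2 + (w n * A f n)^2)"
        using three_square_le by simp
      also have "(w n * A f n)^2 \<le> c^2 * (A f n)^2"
        unfolding power_mult_distrib using w_square[of n] by (intro mult_right_mono) auto
      finally show ?thesis by simp
    qed
    then have "(\<Sum>n\<in>I. (A (A f) n)^2) \<le> (\<Sum>n\<in>I. 3 * ((A f (n + 1))^2 + (A f (n - 1))^2 + c^2 * (A f n)^2))"
      by (intro sum_mono)
    also have "\<dots> = 3 * ((\<Sum>n\<in>I. (A f (n + 1))^2) + (\<Sum>n\<in>I. (A f (n - 1))^2) + c^2 * a)"
      by (simp add: sum.distrib sum_distrib_left a_def)
    also have "(\<Sum>n\<in>I. (A f (n + 1))^2) = a" unfolding a_def using sh[of "\<lambda>n. (A f n)^2"] A0 by simp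
    also have "(\<Sum>n\<in>I. (A f (n - 1))^2) \<le> a"
    proof -
      have "(\<Sum>n\<in>I. (A f (n - 1))^2) = (\<Sum>n\<in>{- N - 3..N + 1}. (A f n)^2)"
        unfolding I_def by (rule sum.reindex_bij_witness[of _ "\<lambda>n. n + 1" "\<lambda>n. n - 1"]) auto
      also have "\<dots> = (\<Sum>n\<in>{- N - 2..N + 1}. (A f n)^2)"
        by (rule sum.mono_neutral_right) (use A0 in auto)
      also have "\<dots> \<le> a" unfolding a_def I_def by (rule sum_mono2) auto
      finally show ?thesis .
    qed
    finally show ?thesis by (simp add: \<kappa>_def algebra_simps)
  qed
  have low: "e^2 * q \<le> a"
  proof -
    have "{- N - 2..- N - 2 + (2 * N + 3) + 1} = I" by (auto simp: I_def)
    moreover have "f n = 0" if "n \<le> - N - 2 \<or> - N - 2 + (2 * N + 3) < n" for n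
      by (rule supp) (use that N in auto)
    ultimately show ?thesis
      using lower[of "- N - 2" "2 * N + 3" f] by (simp add: q_def a_def A_def)
  qed
  have "(\<Sum>n\<in>I. (step f n)^2) = q - 2 / \<kappa> * (\<Sum>n\<in>I. f n * A (A f) n) + 1 / \<kappa>^2 * (\<Sum>n\<in>I. (A (A f) n)^2)"
    unfolding q_def sum_distrib_left sum.distrib[symmetric] sum_subtractf[symmetric]
    by (intro sum.cong) (auto simp: step_def A_def power2_diff power_mult_distrib power_divide)
  also have "(\<Sum>n\<in>I. f n * A (A f) n) = a" unfolding sym a_def by (simp add: power2_eq_square)
  also have "q - 2 / \<kappa> * a + 1 / \<kappa>^2 * (\<Sum>n\<in>I. (A (A f) n)^2) \<le> q - 2 / \<kappa> * a + 1 / \<kappa>^2 * (\<kappa> * a)"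
    using AA by (intro add_left_mono mult_left_mono) auto
  also have "\<dots> = q - a / \<kappa>" using \<kappa>_pos by (simp add: power2_eq_square)
  also have "\<dots> \<le> q - e^2 * q / \<kappa>" using low \<kappa>_pos by (simp add: divide_right_mono)
  also have "\<dots> = (1 - e^2 / \<kappa>) * q" by (simp add: algebra_simps)
  also have "\<dots> \<le> \<rho> * q" by (intro mult_right_mono) (auto simp: \<rho>_def q_def sum_nonneg)
  finally show ?thesis by (simp add: I_def q_def)
qed

lemma step_Re: "Re (step \<psi> n) = step (\<lambda>n. Re (\<psi> n)) n"
  and step_Im: "Im (step \<psi> n) = step (\<lambda>n. Im (\<psi> n)) n"
  by (simp_all add: step_def jacobi_def)

lemma step_square_bound:
  assumes "square_bound \<psi> b"
  shows "square_bound (step \<psi>) (\<rho> * b)"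
  unfolding square_bound_def
proof (intro allI impI)
  fix F :: "int set" assume F: "finite F"
  define M where "M = Max (insert 0 (abs ` F))"
  have M: "\<bar>n\<bar> \<le> M" if "n \<in> F" for n unfolding M_def using F that by (intro Max_ge) auto
  have M0: "0 \<le> M" unfolding M_def using F by (intro Max_ge) auto
  \<comment> \<open>One step sees neighbours up to distance 2, so cutting off beyond
    \<open>M + 2\<close> does not change it on \<open>F\<close>.\<close>
  define N where "N = M + 2"
  define \<phi> where "\<phi> = (\<lambda>n. if \<bar>n\<bar> \<le> N then \<psi> n else 0)"
  define I where "I = {- N - 2..N + 2}"
  have "(\<Sum>n\<in>F. (cmod (step \<psi> n))^2) = (\<Sum>n\<in>F. (cmod (step \<phi> n))^2)"
  proof (intro sum.cong refl)
    fix n assume "n \<in> F"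
    from M[OF this] have "step \<psi> n = step \<phi> n"
      by (simp add: step_def jacobi_def \<phi>_def N_def abs_le_iff)
    then show "(cmod (step \<psi> n))^2 = (cmod (step \<phi> n))^2" by simp
  qed
  also have "\<dots> \<le> (\<Sum>n\<in>I. (cmod (step \<phi> n))^2)"
    by (rule sum_mono2) (use M in \<open>force simp: I_def N_def abs_le_iff\<close>)+
  also have "\<dots> = (\<Sum>n\<in>I. (step (\<lambda>n. Re (\<phi> n)) n)^2) + (\<Sum>n\<in>I. (step (\<lambda>n. Im (\<phi> n)) n)^2)"
    by (simp add: cmod_power2 step_Re step_Im sum.distrib)
  also have "\<dots> \<le> \<rho> * (\<Sum>n\<in>I. (Re (\<phi> n))^2) + \<rho> * (\<Sum>n\<in>I. (Im (\<phi> n))^2)"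
    unfolding I_def using M0 by (intro add_mono step_contracts_finite) (auto simp: \<phi>_def N_def)
  also have "\<dots> = \<rho> * (\<Sum>n\<in>I. (cmod (\<phi> n))^2)"
    by (simp add: cmod_power2 sum.distrib distrib_left)
  also have "\<dots> \<le> \<rho> * (\<Sum>n\<in>I. (cmod (\<psi> n))^2)"
    using \<rho> by (intro mult_left_mono sum_mono) (auto simp: \<phi>_def)
  also have "\<dots> \<le> \<rho> * b"
    using assms \<rho> unfolding square_bound_def by (intro mult_left_mono) (auto simp: I_def)
  finally show "(\<Sum>n\<in>F. (cmod (step \<psi> n))^2) \<le> \<rho> * b" .
qed

lemma iterate_square_bound: "square_bound \<psi> b \<Longrightarrow> square_bound ((step ^^ j) \<psi>) (\<rho> ^ j * b)"
proof (induction j)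
  case (Suc j)
  then show ?case using step_square_bound[of "(step ^^ j) \<psi>" "\<rho> ^ j * b"] by (simp add: mult.assoc)
qed simp

text \<open>The correction subtracted in step \<open>j\<close> is \<open>jacobi w\<close> applied to
  this sequence. The images under \<open>jacobi w\<close> telescope, so the sum of the layers is the
  inverse applied to \<open>\<psi>\<close>.\<close>

definition layer :: "nat \<Rightarrow> (int \<Rightarrow> complex) \<Rightarrow> int \<Rightarrow> complex" where
  "layer j \<psi> n = of_real (1 / \<kappa>) * jacobi w ((step ^^ j) \<psi>) n"

definition resolvent :: "(int \<Rightarrow> complex) \<Rightarrow> int \<Rightarrow> complex" where
  "resolvent \<psi> n = (\<Sum>j. layer j \<psi> n)"

lemma layer_square_bound:
  assumes "square_bound \<psi> b"
  shows "square_bound (layer j \<psi>) (\<rho> ^ j * b / \<kappa>)"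
  unfolding square_bound_def
proof (intro allI impI)
  fix F :: "int set" assume F: "finite F"
  have "(\<Sum>n\<in>F. (cmod (layer j \<psi> n))^2) = 1 / \<kappa>^2 * (\<Sum>n\<in>F. (cmod (jacobi w ((step ^^ j) \<psi>) n))^2)"
    using \<kappa>_pos by (simp add: layer_def norm_mult norm_divide power_divide sum_distrib_left power_mult_distrib)
  also have "\<dots> \<le> 1 / \<kappa>^2 * (\<kappa> * (\<rho> ^ j * b))"
    using jacobi_square_bound[OF iterate_square_bound[OF assms, of j]] F
    unfolding square_bound_def by (intro mult_left_mono) auto
  also have "\<dots> = \<rho> ^ j * b / \<kappa>" using \<kappa>_pos by (simp add: power2_eq_square)
  finally show "(\<Sum>n\<in>F. (cmod (layer j \<psi> n))^2) \<le> \<rho> ^ j * b / \<kappa>" .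
qed

lemma sqrt_rho: "0 < sqrt \<rho>" "sqrt \<rho> < 1"
  using \<rho> by auto

lemma layer_summable:
  assumes "\<psi> \<in> l2"
  shows "summable (\<lambda>j. layer j \<psi> n)"
proof (rule summable_comparison_test')
  define b where "b = (l2_norm \<psi>)^2"
  have sb: "square_bound \<psi> b" using l2_square_bound[OF assms] by (simp add: b_def)
  show "summable (\<lambda>j. sqrt (b / \<kappa>) * sqrt \<rho> ^ j)"
    using sqrt_rho by (intro summable_mult summable_geometric) simp
  fix j :: nat
  have "cmod (layer j \<psi> n) \<le> sqrt (\<rho> ^ j * b / \<kappa>)" by (rule square_bound_point[OF layer_square_bound[OF sb]])
  then show "cmod (layer j \<psi> n) \<le> sqrt (b / \<kappa>) * sqrt \<rho> ^ j"
    by (simp add: real_sqrt_mult real_sqrt_divide real_sqrt_power mult_ac)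
qed

lemma iterate_tendsto:
  assumes "\<psi> \<in> l2"
  shows "(\<lambda>j. (step ^^ j) \<psi> n) \<longlonglongrightarrow> 0"
proof (rule Lim_null_comparison)
  define b where "b = (l2_norm \<psi>)^2"
  have sb: "square_bound \<psi> b" using l2_square_bound[OF assms] by (simp add: b_def)
  have "cmod ((step ^^ j) \<psi> n) \<le> sqrt b * sqrt \<rho> ^ j" for j
    using square_bound_point[OF iterate_square_bound[OF sb, of j], of n] by (simp add: real_sqrt_mult real_sqrt_power mult.commute)
  then show "\<forall>\<^sub>F j in sequentially. norm ((step ^^ j) \<psi> n) \<le> sqrt b * sqrt \<rho> ^ j" by simp
  show "(\<lambda>j. sqrt b * sqrt \<rho> ^ j) \<longlonglongrightarrow> 0"
    using sqrt_rho by (intro tendsto_mult_right_zero LIMSEQ_power_zero) simp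
qed

lemma jacobi_layer: "jacobi w (layer j \<psi>) n = (step ^^ j) \<psi> n - (step ^^ Suc j) \<psi> n"
proof -
  have "jacobi w (layer j \<psi>) n = of_real (1 / \<kappa>) * jacobi w (jacobi w ((step ^^ j) \<psi>)) n"
    unfolding layer_def[abs_def] jacobi_scale ..
  also have "\<dots> = (step ^^ j) \<psi> n - step ((step ^^ j) \<psi>) n" by (simp add: step_def)
  finally show ?thesis by simp
qed

lemma telescope:
  assumes "\<psi> \<in> l2"
  shows "(\<lambda>j. jacobi w (layer j \<psi>) n) sums \<psi> n"
  using telescope_sums'[OF iterate_tendsto[OF assms, of n]] by (simp add: jacobi_layer)

lemma jacobi_resolvent:
  assumes "\<psi> \<in> l2"
  shows "jacobi w (resolvent \<psi>) = \<psi>"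
proof
  fix n
  have s: "(\<lambda>j. layer j \<psi> m) sums resolvent \<psi> m" for m
    unfolding resolvent_def by (rule summable_sums[OF layer_summable[OF assms]])
  have "(\<lambda>j. jacobi w (layer j \<psi>) n) sums jacobi w (resolvent \<psi>) n"
    unfolding jacobi_def by (intro sums_add sums_mult s)
  then show "jacobi w (resolvent \<psi>) n = \<psi> n" using telescope[OF assms] sums_unique2 by blast
qed

lemma step_jacobi: "step (jacobi w \<psi>) = jacobi w (step \<psi>)"
  unfolding step_def jacobi_diff jacobi_scale ..

lemma iterate_jacobi: "(step ^^ j) (jacobi w \<psi>) = jacobi w ((step ^^ j) \<psi>)"
  by (induction j) (simp_all add: step_jacobi)

lemma resolvent_jacobi:
  assumes "\<psi> \<in> l2"
  shows "resolvent (jacobi w \<psi>) = \<psi>"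
proof
  fix n
  have "layer j (jacobi w \<psi>) n = jacobi w (layer j \<psi>) n" for j
    unfolding layer_def[abs_def] jacobi_scale iterate_jacobi ..
  then show "resolvent (jacobi w \<psi>) n = \<psi> n"
    using sums_unique[OF telescope[OF assms, of n]] by (simp add: resolvent_def)
qed

lemma step_lin: "step (\<lambda>n. \<psi> n + \<phi> n) = (\<lambda>n. step \<psi> n + step \<phi> n)"
  and step_scale: "step (\<lambda>n. a * \<psi> n) = (\<lambda>n. a * step \<psi> n)" for \<psi> \<phi> :: "int \<Rightarrow> complex"
  unfolding step_def jacobi_lin jacobi_scale by (auto simp: algebra_simps)

lemma iterate_lin: "(step ^^ j) (\<lambda>n. \<psi> n + \<phi> n) = (\<lambda>n. (step ^^ j) \<psi> n + (step ^^ j) \<phi> n)"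
  and iterate_scale: "(step ^^ j) (\<lambda>n. a * \<psi> n) = (\<lambda>n. a * (step ^^ j) \<psi> n)" for \<psi> \<phi> :: "int \<Rightarrow> complex"
  by (induction j) (simp_all add: step_lin step_scale)

lemma resolvent_lin:
  assumes "\<psi> \<in> l2" "\<phi> \<in> l2"
  shows "resolvent (\<lambda>n. \<psi> n + \<phi> n) = (\<lambda>n. resolvent \<psi> n + resolvent \<phi> n)"
proof
  fix n
  have "layer j (\<lambda>n. \<psi> n + \<phi> n) n = layer j \<psi> n + layer j \<phi> n" for j
    unfolding layer_def iterate_lin jacobi_lin by (simp add: algebra_simps)
  then show "resolvent (\<lambda>n. \<psi> n + \<phi> n) n = resolvent \<psi> n + resolvent \<phi> n"
    using suminf_add[OF layer_summable[OF assms(1)] layer_summable[OF assms(2)], of n n] by (simp add: resolvent_def)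
qed

lemma resolvent_scale:
  assumes "\<psi> \<in> l2"
  shows "resolvent (\<lambda>n. a * \<psi> n) = (\<lambda>n. a * resolvent \<psi> n)"
proof
  fix n
  have "layer j (\<lambda>n. a * \<psi> n) n = a * layer j \<psi> n" for j
    unfolding layer_def iterate_scale jacobi_scale by simp
  then show "resolvent (\<lambda>n. a * \<psi> n) n = a * resolvent \<psi> n"
    using suminf_mult[OF layer_summable[OF assms, of n], of a] by (simp add: resolvent_def)
qed

text \<open>Minkowski's inequality on each finite set and a geometric series of ratio
  \<open>sqrt \<rho>\<close> bound the partial sums uniformly; pointwise convergence passes the
  bound to the limit.\<close>

lemma resolvent_square_bound:
  assumes "\<psi> \<in> l2"
  shows "square_bound (resolvent \<psi>) ((1 / (sqrt \<kappa> * (1 - sqrt \<rho>)) * l2_norm \<psi>)^2)"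
  unfolding square_bound_def
proof (intro allI impI)
  fix F :: "int set" assume F: "finite F"
  define b where "b = (l2_norm \<psi>)^2"
  have sb: "square_bound \<psi> b" using l2_square_bound[OF assms] by (simp add: b_def)
  define D where "D = 1 / (sqrt \<kappa> * (1 - sqrt \<rho>)) * l2_norm \<psi>"
  have D0: "0 \<le> D" using \<kappa>_pos sqrt_rho l2_norm_nonneg[of \<psi>] by (simp add: D_def)
  have one: "L2_set (\<lambda>n. cmod (layer j \<psi> n)) F \<le> l2_norm \<psi> / sqrt \<kappa> * sqrt \<rho> ^ j" for j
  proof -
    have "L2_set (\<lambda>n. cmod (layer j \<psi> n)) F \<le> sqrt (\<rho> ^ j * b / \<kappa>)"
      unfolding L2_set_def using layer_square_bound[OF sb, of j] F unfolding square_bound_def by (intro real_sqrt_le_mono) blast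
    also have "\<dots> = l2_norm \<psi> / sqrt \<kappa> * sqrt \<rho> ^ j"
      using l2_norm_nonneg[of \<psi>] by (simp add: real_sqrt_mult real_sqrt_divide real_sqrt_power b_def)
    finally show ?thesis .
  qed
  have part: "L2_set (\<lambda>n. cmod (\<Sum>j<J. layer j \<psi> n)) F \<le> (\<Sum>j<J. l2_norm \<psi> / sqrt \<kappa> * sqrt \<rho> ^ j)" for J
  proof (induction J)
    case (Suc J)
    have "L2_set (\<lambda>n. cmod (\<Sum>j<Suc J. layer j \<psi> n)) F \<le> L2_set (\<lambda>n. cmod (\<Sum>j<J. layer j \<psi> n) + cmod (layer J \<psi> n)) F"
      by (intro L2_set_mono) (auto intro: norm_triangle_ineq)
    also have "\<dots> \<le> L2_set (\<lambda>n. cmod (\<Sum>j<J. layer j \<psi> n)) F + L2_set (\<lambda>n. cmod (layer J \<psi> n)) F"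
      by (rule L2_set_triangle_ineq)
    finally show ?case using Suc one[of J] by simp
  qed (simp add: L2_set_def)
  have geo: "(\<Sum>j<J. l2_norm \<psi> / sqrt \<kappa> * sqrt \<rho> ^ j) \<le> D" for J
  proof -
    have "(\<Sum>j<J. sqrt \<rho> ^ j) \<le> (\<Sum>j. sqrt \<rho> ^ j)"
      using sqrt_rho by (intro sum_le_suminf summable_geometric) auto
    also have "\<dots> = 1 / (1 - sqrt \<rho>)" using sqrt_rho by (intro suminf_geometric) simp
    finally have "l2_norm \<psi> / sqrt \<kappa> * (\<Sum>j<J. sqrt \<rho> ^ j) \<le> l2_norm \<psi> / sqrt \<kappa> * (1 / (1 - sqrt \<rho>))"
      using \<kappa>_pos l2_norm_nonneg[of \<psi>] by (intro mult_left_mono) auto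
    then show ?thesis by (simp add: sum_distrib_left D_def)
  qed
  have fin: "(\<Sum>n\<in>F. (cmod (\<Sum>j<J. layer j \<psi> n))^2) \<le> D^2" for J
  proof -
    have "sqrt (\<Sum>n\<in>F. (cmod (\<Sum>j<J. layer j \<psi> n))^2) \<le> D"
      using order_trans[OF part[of J] geo[of J]] by (simp add: L2_set_def)
    then have "(sqrt (\<Sum>n\<in>F. (cmod (\<Sum>j<J. layer j \<psi> n))^2))^2 \<le> D^2" by (intro power_mono) (auto simp: sum_nonneg)
    then show ?thesis by (simp add: sum_nonneg)
  qed
  have lim: "(\<lambda>J. \<Sum>n\<in>F. (cmod (\<Sum>j<J. layer j \<psi> n))^2) \<longlonglongrightarrow> (\<Sum>n\<in>F. (cmod (resolvent \<psi> n))^2)"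
    unfolding resolvent_def by (intro tendsto_intros summable_LIMSEQ layer_summable assms)
  have "(\<Sum>n\<in>F. (cmod (resolvent \<psi> n))^2) \<le> D^2"
    by (rule LIMSEQ_le_const2[OF lim]) (use fin in blast)
  then show "(\<Sum>n\<in>F. (cmod (resolvent \<psi> n))^2) \<le> (1 / (sqrt \<kappa> * (1 - sqrt \<rho>)) * l2_norm \<psi>)^2"
    by (simp add: D_def)
qed

lemma resolvent_bounded: "bounded_operator_l2 resolvent"
proof -
  have "l2_norm (resolvent \<psi>) \<le> 1 / (sqrt \<kappa> * (1 - sqrt \<rho>)) * l2_norm \<psi>" if "\<psi> \<in> l2" for \<psi>
  proof -
    have "0 \<le> 1 / (sqrt \<kappa> * (1 - sqrt \<rho>)) * l2_norm \<psi>"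
      using \<kappa>_pos sqrt_rho l2_norm_nonneg[of \<psi>] by simp
    then show ?thesis
      using square_bound_l2(2)[OF resolvent_square_bound[OF that]] by (simp only: real_sqrt_abs abs_of_nonneg)
  qed
  then show ?thesis
    unfolding bounded_operator_l2_def
    using square_bound_l2(1)[OF resolvent_square_bound] resolvent_lin resolvent_scale by blast
qed

end

subsection \<open>The spectrum of the Fibonacci Hamiltonian\<close>

lemma l2_finite_support:
  assumes fin: "finite I" and supp: "\<And>n. n \<notin> I \<Longrightarrow> \<psi> n = 0"
  shows "\<psi> \<in> l2" "(l2_norm \<psi>)^2 = (\<Sum>n\<in>I. (cmod (\<psi> n))^2)"
proof -
  have sb: "square_bound \<psi> (\<Sum>n\<in>I. (cmod (\<psi> n))^2)"
    unfolding square_bound_def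
  proof (intro allI impI)
    fix F :: "int set" assume F: "finite F"
    have "(\<Sum>n\<in>F. (cmod (\<psi> n))^2) = (\<Sum>n\<in>F \<inter> I. (cmod (\<psi> n))^2)"
      by (rule sum.mono_neutral_right) (use F supp in auto)
    also have "\<dots> \<le> (\<Sum>n\<in>I. (cmod (\<psi> n))^2)" by (rule sum_mono2) (use fin in auto)
    finally show "(\<Sum>n\<in>F. (cmod (\<psi> n))^2) \<le> (\<Sum>n\<in>I. (cmod (\<psi> n))^2)" .
  qed
  show l2: "\<psi> \<in> l2" by (rule square_bound_l2[OF sb])
  have s0: "0 \<le> (\<Sum>n\<in>I. (cmod (\<psi> n))^2)" by (simp add: sum_nonneg)
  have "(l2_norm \<psi>)^2 \<le> (sqrt (\<Sum>n\<in>I. (cmod (\<psi> n))^2))^2"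
    by (intro power_mono square_bound_l2(2)[OF sb] l2_norm_nonneg)
  then have "(l2_norm \<psi>)^2 \<le> (\<Sum>n\<in>I. (cmod (\<psi> n))^2)" using s0 by simp
  moreover have "(\<Sum>n\<in>I. (cmod (\<psi> n))^2) \<le> (l2_norm \<psi>)^2"
    using l2_square_bound[OF l2] fin unfolding square_bound_def by blast
  ultimately show "(l2_norm \<psi>)^2 = (\<Sum>n\<in>I. (cmod (\<psi> n))^2)" by simp
qed

text \<open>For a matrix \<open>A\<close> of determinant 1 the symmetric matrix
  \<open>A\<^sup>T A - 1\<close> has determinant \<open>- ((a - d)^2 + (b + c)^2)\<close>, so it is
  not positive definite.\<close>

lemma contracting_vector:
  fixes a b c d :: real
  assumes "a * d - b * c = 1"
  shows "\<exists>x y. 0 < x^2 + y^2 \<and> (a * x + b * y)^2 + (c * x + d * y)^2 \<le> x^2 + y^2"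
proof -
  define p q s where "p = a^2 + c^2 - 1" and "q = a * b + c * d" and "s = b^2 + d^2 - 1"
  have form: "(a * x + b * y)^2 + (c * x + d * y)^2 - (x^2 + y^2) = p * x^2 + 2 * q * x * y + s * y^2" for x y
    by (simp add: p_def q_def s_def power2_eq_square algebra_simps)
  have "p * s - q^2 = (a * d - b * c)^2 - (a^2 + b^2 + c^2 + d^2) + 1"
    by (simp add: p_def q_def s_def power2_eq_square algebra_simps)
  also have "\<dots> = 2 - (a^2 + b^2 + c^2 + d^2)" using assms by simp
  also have "\<dots> = - ((a - d)^2 + (b + c)^2)" using assms by (simp add: power2_eq_square algebra_simps)
  finally have det: "p * s - q^2 \<le> 0" by simp
  show ?thesis
  proof (cases "p \<le> 0")
    case True
    then show ?thesis using form[of 1 0] by (intro exI[of _ 1] exI[of _ 0]) simp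
  next
    case False
    have "p * (- q)^2 + 2 * q * (- q) * p + s * p^2 = p * (p * s - q^2)"
      by (simp add: power2_eq_square algebra_simps)
    also have "\<dots> \<le> 0" using False det by (simp add: mult_nonneg_nonpos)
    finally have "(a * (- q) + b * p)^2 + (c * (- q) + d * p)^2 \<le> (- q)^2 + p^2" using form[of "- q" p] by linarith
    moreover have "0 < (- q)^2 + p^2" using False by (simp add: add_nonneg_pos)
    ultimately show ?thesis by blast
  qed
qed

text \<open>The initial data \<open>a\<close> and \<open>b\<close> are in the order of the vector
  \<open>(u 1, u 0)\<close> on which the transfer matrices act.\<close>

fun solution :: "real \<Rightarrow> real \<Rightarrow> real \<Rightarrow> real \<Rightarrow> nat \<Rightarrow> real" where
  "solution V E a b 0 = b"
| "solution V E a b (Suc 0) = a"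
| "solution V E a b (Suc (Suc n)) = (E - V * of_int (sturmian 0 (int n + 1))) * solution V E a b (Suc n) - solution V E a b n"

context coupling
begin

lemma hamiltonian_jacobi:
  "fibonacci_hamiltonian V \<omega> \<psi> n - of_real E * \<psi> n = jacobi (\<lambda>n. V * of_int (sturmian \<omega> n) - E) \<psi> n"
  unfolding fibonacci_hamiltonian_def jacobi_def indicator_sturmian by (simp add: algebra_simps)

lemma spectrum_subset_trapped: "fibonacci_spectrum V \<omega> \<subseteq> trapped V"
proof
  fix E assume E: "E \<in> fibonacci_spectrum V \<omega>"
  show "E \<in> trapped V"
  proof (rule ccontr)
    assume "E \<notin> trapped V"
    then obtain e where e: "0 < e" "\<And>\<omega> (f :: int \<Rightarrow> real) p L. (\<And>n. n \<le> p \<or> p + L < n \<Longrightarrow> f n = 0) \<Longrightarrow>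
      e^2 * (\<Sum>n\<in>{p..p + L + 1}. (f n)^2) \<le> (\<Sum>n\<in>{p..p + L + 1}. (jacobi (\<lambda>n. V * of_int (sturmian \<omega> n) - E) f n)^2)"
      using escape_lower_bound by blast
    define w where "w = (\<lambda>n. V * of_int (sturmian \<omega> n) - E)"
    interpret jacobi_gap w "V + \<bar>E\<bar>" e
    proof
      show "\<bar>w n\<bar> \<le> V + \<bar>E\<bar>" for n
      proof -
        have "(of_int (sturmian \<omega> n) :: real) = 0 \<or> (of_int (sturmian \<omega> n) :: real) = 1"
          unfolding indicator_sturmian[symmetric] by (simp add: indicator_def)
        then show ?thesis using V_pos by (auto simp: w_def)
      qed
      show "0 < e" by (rule e)
      show "e^2 * (\<Sum>n\<in>{p..p + L + 1}. (f n)^2) \<le> (\<Sum>n\<in>{p..p + L + 1}. (jacobi w f n)^2)"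
        if "\<And>n. n \<le> p \<or> p + L < n \<Longrightarrow> f n = 0" for f :: "int \<Rightarrow> real" and p L
        unfolding w_def by (rule e(2)) (rule that)
    qed
    have "of_real E \<notin> spectrum_l2 (fibonacci_hamiltonian V \<omega>)"
      unfolding spectrum_l2_def mem_Collect_eq not_not hamiltonian_jacobi w_def[symmetric]
      using resolvent_bounded resolvent_jacobi jacobi_resolvent by blast
    then show False using E by (simp add: fibonacci_spectrum_def)
  qed
qed

text \<open>The word begins with two copies of its prefix of length \<open>fib k\<close>, and by the Cayley-Hamilton
  theorem the initial data are a bounded combination of the values after one and after two copies.\<close>

lemma gordon_sum:
  assumes E: "E \<in> trapped V" and k: "4 \<le> k"
  shows "a^2 + b^2 \<le> 52 * (\<Sum>j\<in>{fib k..2 * fib k + 1}. (solution V E a b j)^2)"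
proof -
  define u where "u = solution V E a b"
  define F where "F = fib k"
  have F3: "3 \<le> F" using fib_mono[OF k] by (simp add: F_def numeral_eq_Suc)
  have rec: "u (0 + n + 2) = (E - V * of_int (sturmian 0 (int n + 1))) * u (0 + n + 1) - u (0 + n)" for n
    by (simp add: u_def numeral_2_eq_2)
  have one: "(u (F + 1), u F) = mat2_app (transfer V E k) (u 1, u 0)"
    using transfer_word[of k u 0 E V] rec k by (simp add: F_def)
  have two: "(u (F + F + 1), u (F + F)) = mat2_app (transfer V E k) (u (F + 1), u F)"
    unfolding F_def
  proof (rule transfer_word)
    fix n assume n: "n < fib k"
    define j where "j = k - 2"
    have j: "k = Suc (Suc j)" "2 \<le> j" using k by (auto simp: j_def)
    have "2 \<le> fib (Suc j)" using fib_mono[of 3 "Suc j"] j by (simp add: numeral_3_eq_3)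
    then have "sturmian 0 ((int n + 1) + int (fib (Suc (Suc j)))) = sturmian 0 (int n + 1)"
      using n j by (intro sturmian_repeat) simp_all
    then have s: "sturmian 0 (int (fib k + n) + 1) = sturmian 0 (int n + 1)" by (simp add: j add_ac del: fib.simps)
    show "u (fib k + n + 2) = (E - V * of_int (sturmian 0 (int n + 1))) * u (fib k + n + 1) - u (fib k + n)"
      using rec[of "fib k + n"] unfolding s by simp
  qed (use k in simp)
  obtain p q r s where M: "transfer V E k = (p, q, r, s)" by (cases "transfer V E k")
  have det: "p * s - q * r = 1" using transfer_det[of V E k] by (simp add: M)
  have tr: "p + s = X E k" using transfer_tr[of V E k] by (simp add: M)
  have t5: "\<bar>X E k\<bar> \<le> 5" using E k by (intro not_escaping_bound) (auto simp: trapped_def)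
  have e1: "u (F + 1) = p * a + q * b" "u F = r * a + s * b" using one by (simp_all add: M u_def)
  have e2: "u (2 * F + 1) = p * u (F + 1) + q * u F" "u (2 * F) = r * u (F + 1) + s * u F"
    using two by (simp_all add: M mult_2)
  have "(p + s) * u (F + 1) - u (2 * F + 1) = (p * s - q * r) * a"
    unfolding e2 unfolding e1 by (simp add: algebra_simps)
  then have a: "a = X E k * u (F + 1) - u (2 * F + 1)" unfolding det tr by simp
  have "(p + s) * u F - u (2 * F) = (p * s - q * r) * b"
    unfolding e2 unfolding e1 by (simp add: algebra_simps)
  then have b: "b = X E k * u F - u (2 * F)" unfolding det tr by simp
  \<comment> \<open>The factor 50 is twice \<open>5^2\<close>, from the bound 5 for traces at
    trapped energies.\<close>
  have est: "(X E k * x - y)^2 \<le> 50 * x^2 + 2 * y^2" for x y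
  proof -
    have "(X E k)^2 \<le> 25" using power_mono[OF t5, of 2] by simp
    then have "(X E k * x)^2 \<le> 25 * x^2" unfolding power_mult_distrib by (intro mult_right_mono) auto
    moreover have "0 \<le> (X E k * x + y)^2" by simp
    ultimately show ?thesis by (simp add: power2_sum power2_diff)
  qed
  have "a^2 + b^2 \<le> (50 * (u (F + 1))^2 + 2 * (u (2 * F + 1))^2) + (50 * (u F)^2 + 2 * (u (2 * F))^2)"
    using est[of "u (F + 1)" "u (2 * F + 1)"] est[of "u F" "u (2 * F)"] a b by simp
  also have "\<dots> \<le> 52 * ((u (F + 1))^2 + (u (2 * F + 1))^2 + (u F)^2 + (u (2 * F))^2)" by simp
  also have "(u (F + 1))^2 + (u (2 * F + 1))^2 + (u F)^2 + (u (2 * F))^2 = (\<Sum>j\<in>{F + 1, 2 * F + 1, F, 2 * F}. (u j)^2)"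
    using F3 by simp
  also have "\<dots> \<le> (\<Sum>j\<in>{F..2 * F + 1}. (u j)^2)" by (rule sum_mono2) (use F3 in auto)
  finally show ?thesis by (simp add: F_def u_def)
qed

text \<open>The windows of \<open>gordon_sum\<close> for the indices 4, 6, 8 and so on are disjoint,
  because \<open>fib (k + 2)\<close> exceeds \<open>2 * fib k + 1\<close>. Each carries a fixed
  share of the initial data, so no solution is square summable.\<close>

lemma solution_sum:
  assumes E: "E \<in> trapped V"
  shows "real (i + 1) * (a^2 + b^2) \<le> 52 * (\<Sum>j\<in>{1..2 * fib (4 + 2 * i) + 1}. (solution V E a b j)^2)"
proof (induction i)
  case 0
  have "(\<Sum>j\<in>{fib 4..2 * fib 4 + 1}. (solution V E a b j)^2) \<le> (\<Sum>j\<in>{1..2 * fib 4 + 1}. (solution V E a b j)^2)"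
    by (rule sum_mono2) (auto simp: numeral_eq_Suc)
  then show ?case using gordon_sum[OF E order_refl, of a b] by simp
next
  case (Suc i)
  define G where "G = fib (4 + 2 * i)"
  define F where "F = fib (4 + 2 * Suc i)"
  have "F = 2 * G + fib (3 + 2 * i)" by (simp add: F_def G_def numeral_eq_Suc)
  moreover have "2 \<le> fib (3 + 2 * i)" using fib_mono[of 3 "3 + 2 * i"] by (simp add: numeral_eq_Suc)
  ultimately have FG: "2 * G + 1 < F" by simp
  have "(\<Sum>j\<in>{1..2 * G + 1}. (solution V E a b j)^2) + (\<Sum>j\<in>{F..2 * F + 1}. (solution V E a b j)^2)
      = (\<Sum>j\<in>{1..2 * G + 1} \<union> {F..2 * F + 1}. (solution V E a b j)^2)"
    using FG by (intro sum.union_disjoint[symmetric]) auto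
  also have "\<dots> \<le> (\<Sum>j\<in>{1..2 * F + 1}. (solution V E a b j)^2)" by (rule sum_mono2) (use FG in auto)
  finally show ?case
    using Suc gordon_sum[OF E, of "4 + 2 * Suc i" a b] unfolding F_def[symmetric] G_def[symmetric]
    by (simp add: algebra_simps)
qed

text \<open>A solution cut off to \<open>N\<close> sites is mapped by the operator minus
  \<open>E\<close> to a sequence on four sites, made of boundary values.
  \<open>contracting_vector\<close> chooses initial data for which these are bounded by the initial
  ones, while the mass of the cut-off solution grows without bound. A bounded inverse cannot
  exist.\<close>

lemma trapped_subset_spectrum: "trapped V \<subseteq> fibonacci_spectrum V \<omega>"
proof
  fix E assume E: "E \<in> trapped V"
  show "E \<in> fibonacci_spectrum V \<omega>"
  proof (rule ccontr)
    assume "E \<notin> fibonacci_spectrum V \<omega>"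
    then obtain S where S: "bounded_operator_l2 S"
      "\<And>\<psi>. \<psi> \<in> l2 \<Longrightarrow> S (\<lambda>n. fibonacci_hamiltonian V \<omega> \<psi> n - of_real E * \<psi> n) = \<psi>"
      unfolding fibonacci_spectrum_def spectrum_l2_def by blast
    define w where "w = (\<lambda>n. V * of_int (sturmian \<omega> n) - E)"
    have S2: "S (jacobi w \<psi>) = \<psi>" if "\<psi> \<in> l2" for \<psi>
      using S(2)[OF that] unfolding hamiltonian_jacobi w_def .
    obtain B where B: "\<And>\<psi>. \<psi> \<in> l2 \<Longrightarrow> l2_norm (S \<psi>) \<le> B * l2_norm \<psi>"
      using S(1) unfolding bounded_operator_l2_def by blast
    \<comment> \<open>The inverse would give \<open>i + 1 \<le> 104 * B^2\<close>, where 104 is 52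
      from \<open>solution_sum\<close> times 2 for the two pairs of boundary values.\<close>
    define i where "i = nat \<lceil>104 * B^2\<rceil>"
    define k where "k = 4 + 2 * Suc i"
    define N where "N = fib k"
    have k: "4 \<le> k" by (simp add: k_def)
    have N8: "3 \<le> N" using fib_mono[OF k] by (simp add: N_def numeral_eq_Suc)
    obtain p q r s where M: "transfer V E k = (p, q, r, s)" by (cases "transfer V E k")
    have det: "p * s - q * r = 1" using transfer_det[of V E k] by (simp add: M)
    obtain a b where ab: "0 < a^2 + b^2" "(p * a + q * b)^2 + (r * a + s * b)^2 \<le> a^2 + b^2"
      using contracting_vector[OF det] by blast
    define u where "u = solution V E a b"
    have u01: "u 0 = b" "u 1 = a" by (simp_all add: u_def)
    have rec: "u (Suc (Suc n)) = (E - V * of_int (sturmian 0 (int n + 1))) * u (Suc n) - u n" for n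
      by (simp add: u_def)
    have "(u (N + 1), u N) = mat2_app (transfer V E k) (u 1, u 0)"
      using transfer_word[of k u 0 E V] rec k by (simp add: N_def)
    then have uN: "(u (N + 1))^2 + (u N)^2 \<le> a^2 + b^2" using ab(2) u01 by (simp add: M)
    obtain m where m: "0 < m" "\<And>j. 1 \<le> j \<Longrightarrow> j \<le> int N \<Longrightarrow> sturmian \<omega> (m + j) = sturmian 0 j"
      using sturmian_window[of "int N" \<omega> 0 0] by auto
    define \<psi> where "\<psi> = (\<lambda>n. if m + 1 \<le> n \<and> n \<le> m + int N then complex_of_real (u (nat (n - m))) else 0)"
    define I where "I = {m + 1..m + int N}"
    define I' where "I' = {m, m + 1, m + int N, m + int N + 1}"
    have \<psi>l2: "\<psi> \<in> l2" and \<psi>n: "(l2_norm \<psi>)^2 = (\<Sum>n\<in>I. (cmod (\<psi> n))^2)"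
    proof -
      have "\<psi> n = 0" if "n \<notin> I" for n using that by (auto simp: I_def \<psi>_def)
      moreover have "finite I" by (simp add: I_def)
      ultimately show "\<psi> \<in> l2" "(l2_norm \<psi>)^2 = (\<Sum>n\<in>I. (cmod (\<psi> n))^2)"
        using l2_finite_support[of I \<psi>] by blast+
    qed
    have \<psi>j: "\<psi> (m + int j) = (if 1 \<le> j \<and> j \<le> N then complex_of_real (u j) else 0)" for j
      by (simp add: \<psi>_def)
    have inner: "jacobi w \<psi> (m + int j) = \<psi> (m + int (j + 1)) + \<psi> (m + int (j - 1)) + of_real (V * of_int (sturmian 0 (int j)) - E) * of_real (u j)"
      if j: "1 \<le> j" "j \<le> N" for j
    proof -
      have i: "m + int j + 1 = m + int (j + 1)" "m + int j - 1 = m + int (j - 1)" using j by auto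
      show ?thesis
        unfolding jacobi_def i w_def using \<psi>j[of j] m(2)[of "int j"] j by simp
    qed
    have rec': "u (j + 1) + u (j - 1) + (V * of_int (sturmian 0 (int j)) - E) * u j = 0" if "1 \<le> j" for j
    proof -
      obtain n where n: "j = Suc n" using \<open>1 \<le> j\<close> by (cases j) auto
      show ?thesis using rec[of n] by (simp add: n algebra_simps)
    qed
    have J0: "jacobi w \<psi> m = of_real (u 1)"
      using N8 by (simp add: jacobi_def \<psi>_def)
    have JN1: "jacobi w \<psi> (m + int N + 1) = of_real (u N)"
      using N8 by (simp add: jacobi_def \<psi>_def)
    have J1: "jacobi w \<psi> (m + 1) = of_real (- u 0)"
    proof -
      have "jacobi w \<psi> (m + 1) = of_real (u 2 + (V * of_int (sturmian 0 1) - E) * u 1)"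
        using inner[of 1] \<psi>j[of 2] \<psi>j[of 0] N8 by (simp add: numeral_2_eq_2)
      also have "u 2 + (V * of_int (sturmian 0 1) - E) * u 1 = - u 0" using rec'[of 1] by (simp add: numeral_2_eq_2)
      finally show ?thesis .
    qed
    have JN: "jacobi w \<psi> (m + int N) = of_real (- u (N + 1))"
    proof -
      have "jacobi w \<psi> (m + int N) = of_real (u (N - 1) + (V * of_int (sturmian 0 (int N)) - E) * u N)"
        using inner[of N] \<psi>j[of "N + 1"] \<psi>j[of "N - 1"] N8 by simp
      also have "u (N - 1) + (V * of_int (sturmian 0 (int N)) - E) * u N = - u (N + 1)" using rec'[of N] N8 by simp
      finally show ?thesis .
    qed
    have Jelse: "jacobi w \<psi> n = 0" if n: "n \<notin> I'" for n
    proof (cases "m + 1 < n \<and> n < m + int N")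
      case True
      define j where "j = nat (n - m)"
      have j: "2 \<le> j" "j < N" "n = m + int j" using True by (auto simp: j_def)
      have "jacobi w \<psi> n = of_real (u (j + 1) + u (j - 1) + (V * of_int (sturmian 0 (int j)) - E) * u j)"
      proof -
        have "1 \<le> j - 1 \<and> j - 1 \<le> N" "1 \<le> j + 1 \<and> j + 1 \<le> N" using j by auto
        then have nb: "\<psi> (m + int (j + 1)) = of_real (u (j + 1))" "\<psi> (m + int (j - 1)) = of_real (u (j - 1))"
          unfolding \<psi>j by simp_all
        have "jacobi w \<psi> n = of_real (u (j + 1)) + of_real (u (j - 1)) + of_real (V * of_int (sturmian 0 (int j)) - E) * of_real (u j)"
          using inner[of j] j unfolding nb by simp
        then show ?thesis by simp
      qed
      moreover have "u (j + 1) + u (j - 1) + (V * of_int (sturmian 0 (int j)) - E) * u j = 0"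
        by (rule rec') (use j in simp)
      ultimately show ?thesis by (simp only: of_real_0)
    next
      case False
      then have "n < m \<or> m + int N + 1 < n" using n by (auto simp: I'_def)
      then show ?thesis by (auto simp: jacobi_def \<psi>_def)
    qed
    have Jl2: "jacobi w \<psi> \<in> l2" and Jn: "(l2_norm (jacobi w \<psi>))^2 = (\<Sum>n\<in>I'. (cmod (jacobi w \<psi> n))^2)"
    proof -
      have "finite I'" by (simp add: I'_def)
      then show "jacobi w \<psi> \<in> l2" "(l2_norm (jacobi w \<psi>))^2 = (\<Sum>n\<in>I'. (cmod (jacobi w \<psi> n))^2)"
        using l2_finite_support[of I' "jacobi w \<psi>"] Jelse by blast+
    qed
    have "(\<Sum>n\<in>I'. (cmod (jacobi w \<psi> n))^2) = (u 1)^2 + (u 0)^2 + (u (N + 1))^2 + (u N)^2"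
      unfolding I'_def using N8 J0 J1 JN JN1 by simp
    also have "\<dots> \<le> 2 * (a^2 + b^2)" using uN u01 by simp
    finally have J2: "(l2_norm (jacobi w \<psi>))^2 \<le> 2 * (a^2 + b^2)" using Jn by simp
    have \<psi>sum: "(l2_norm \<psi>)^2 = (\<Sum>j\<in>{1..N}. (u j)^2)"
    proof -
      have "(\<Sum>n\<in>I. (cmod (\<psi> n))^2) = (\<Sum>j\<in>{1..N}. (cmod (\<psi> (m + int j)))^2)"
        unfolding I_def by (rule sum.reindex_bij_witness[of _ "\<lambda>j. m + int j" "\<lambda>n. nat (n - m)"]) auto
      also have "\<dots> = (\<Sum>j\<in>{1..N}. (u j)^2)" using \<psi>j by (intro sum.cong) auto
      finally show ?thesis using \<psi>n by simp
    qed
    have "l2_norm \<psi> \<le> B * l2_norm (jacobi w \<psi>)" using B[OF Jl2] S2[OF \<psi>l2] by simp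
    then have "(l2_norm \<psi>)^2 \<le> (B * l2_norm (jacobi w \<psi>))^2" by (intro power_mono l2_norm_nonneg)
    also have "\<dots> \<le> B^2 * (2 * (a^2 + b^2))" unfolding power_mult_distrib using J2 by (intro mult_left_mono) auto
    finally have up: "(\<Sum>j\<in>{1..N}. (u j)^2) \<le> B^2 * (2 * (a^2 + b^2))" using \<psi>sum by simp
    have "(\<Sum>j\<in>{1..2 * fib (4 + 2 * i) + 1}. (u j)^2) \<le> (\<Sum>j\<in>{1..N}. (u j)^2)"
    proof (rule sum_mono2)
      have "N = 2 * fib (4 + 2 * i) + fib (3 + 2 * i)" by (simp add: N_def k_def numeral_eq_Suc)
      moreover have "2 \<le> fib (3 + 2 * i)" using fib_mono[of 3 "3 + 2 * i"] by (simp add: numeral_eq_Suc)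
      ultimately show "{1..2 * fib (4 + 2 * i) + 1} \<subseteq> {1..N}" by auto
    qed auto
    then have "real (i + 1) * (a^2 + b^2) \<le> 52 * (B^2 * (2 * (a^2 + b^2)))"
      using solution_sum[OF E, of i a b] up unfolding u_def by linarith
    then have "real (i + 1) * (a^2 + b^2) \<le> (104 * B^2) * (a^2 + b^2)" by (simp add: algebra_simps)
    then have "real (i + 1) \<le> 104 * B^2" using ab(1) by (simp only: mult_le_cancel_right_pos)
    moreover have "104 * B^2 \<le> real i" unfolding i_def by linarith
    ultimately show False by simp
  qed
qed

theorem fibonacci_spectrum_eq: "fibonacci_spectrum V \<omega> = trapped V"
  using spectrum_subset_trapped trapped_subset_spectrum by blast

end

section \<open>Explicit constants at small coupling\<close>

theorem theorem1p2:
  shows "(\<forall>\<omega>. ((\<lambda>V. thickness (fibonacci_spectrum V \<omega>)) \<longlongrightarrow> \<infinity>) (at_right 0)) \<and>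
    (\<exists>C\<^sub>3>0. \<exists>C\<^sub>4>0. \<exists>V\<^sub>0>0. \<forall>V. 0 < V \<and> V < V\<^sub>0 \<longrightarrow> (\<forall>\<omega>.
        ereal (C\<^sub>3 * inverse V) \<le> thickness (fibonacci_spectrum V \<omega>) \<and>
        thickness (fibonacci_spectrum V \<omega>) \<le> denseness (fibonacci_spectrum V \<omega>) \<and>
        denseness (fibonacci_spectrum V \<omega>) \<le> ereal (C\<^sub>4 * inverse V)))"
proof
  have bounds: "ereal (1 / 10000 * inverse V) \<le> thickness (fibonacci_spectrum V \<omega>)"
    "thickness (fibonacci_spectrum V \<omega>) \<le> denseness (fibonacci_spectrum V \<omega>)"
    "denseness (fibonacci_spectrum V \<omega>) \<le> ereal (2 * 10^12 * inverse V)"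
    if V: "0 < V" "V < 1 / 10^7" for V \<omega>
  proof -
    interpret coupling V by standard (use V in auto)
    interpret balanced_gaps "trapped V" "10000 * V" "V / 10^12"
      by (rule balanced_gaps_trapped) (use V in simp)
    show "ereal (1 / 10000 * inverse V) \<le> thickness (fibonacci_spectrum V \<omega>)"
      using thickness_ge by (simp add: fibonacci_spectrum_eq field_simps)
    show "thickness (fibonacci_spectrum V \<omega>) \<le> denseness (fibonacci_spectrum V \<omega>)"
      using thickness_le_denseness by (simp add: fibonacci_spectrum_eq)
    show "denseness (fibonacci_spectrum V \<omega>) \<le> ereal (2 * 10^12 * inverse V)"
      using denseness_le by (simp add: fibonacci_spectrum_eq field_simps)
  qed
  show "\<forall>\<omega>. ((\<lambda>V. thickness (fibonacci_spectrum V \<omega>)) \<longlongrightarrow> \<infinity>) (at_right 0)"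
    unfolding tendsto_PInfty
  proof (intro allI)
    fix \<omega> r :: real
    \<comment> \<open>Below this coupling the lower bound \<open>1 / 10000 * inverse V\<close>
      already exceeds \<open>\<bar>r\<bar> + 1\<close>.\<close>
    define b where "b = min (1 / 10^7) (1 / (10000 * (\<bar>r\<bar> + 1)))"
    have b: "0 < b" by (simp add: b_def)
    have "ereal r < thickness (fibonacci_spectrum V \<omega>)" if V: "0 < V" "V < b" for V
    proof -
      have "V * (10000 * (\<bar>r\<bar> + 1)) < 1" using V by (simp add: b_def pos_less_divide_eq)
      then have "\<bar>r\<bar> + 1 < 1 / 10000 * inverse V" using V(1) by (simp add: field_simps)
      then have "ereal r < ereal (1 / 10000 * inverse V)" by simp
      also have "\<dots> \<le> thickness (fibonacci_spectrum V \<omega>)" using bounds(1)[of V \<omega>] V by (simp add: b_def)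
      finally show ?thesis .
    qed
    then show "\<forall>\<^sub>F V in at_right 0. ereal r < thickness (fibonacci_spectrum V \<omega>)"
      using b unfolding eventually_at_right_field by blast
  qed
  have "(0 :: real) < 1 / 10000" "(0 :: real) < 2 * 10^12" "(0 :: real) < 1 / 10^7" by auto
  then show "\<exists>C\<^sub>3>0. \<exists>C\<^sub>4>0. \<exists>V\<^sub>0>0. \<forall>V. 0 < V \<and> V < V\<^sub>0 \<longrightarrow> (\<forall>\<omega>.
        ereal (C\<^sub>3 * inverse V) \<le> thickness (fibonacci_spectrum V \<omega>) \<and>
        thickness (fibonacci_spectrum V \<omega>) \<le> denseness (fibonacci_spectrum V \<omega>) \<and>
        denseness (fibonacci_spectrum V \<omega>) \<le> ereal (C\<^sub>4 * inverse V))"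
    using bounds by blast
qed

end
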